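(* Let $\Omega\subset\mathbb{R}^N$ be open and bounded and let $p:\Omega\to(1,\infty)$ be Lipschitz continuous with $p^-:=\operatorname{ess\,inf}_\Omega p>1$. Let $u\in C^1(\Omega)$ be a weak solution to $-\Delta^S_{p(x)}u=0$ in $\Omega\setminus\{u=0\}$. Then $u$ is a weak solution to $-\Delta^S_{p(x)}u=0$ in the whole $\Omega$.
   Context: Variable exponent spaces: for an open set $U$, $L^{p(\cdot)}(U)$ is the space of measurable $u$ with $\int_U|u|^{p(x)}dx<\infty$; $W^{1,p(\cdot)}(U)$ consists of $u\in L^{p(\cdot)}(U)$ with weak gradient in $L^{p(\cdot)}(U)$; $W^{1,p(\cdot)}_{loc}(U)$ consists of functions in $W^{1,p(\cdot)}(U')$ for all $U'\Subset U$. For an open $U\subseteq\Omega$, $u\in W^{1,p(\cdot)}_{loc}(U)$ is a weak supersolution to $-\Delta^S_{p(x)}u\ge0$ in $U$ if $\int_U |Du|^{p(x)-2}Du\cdot D\varphi+|Du|^{p(x)-2}\log(|Du|)\,Du\cdot Dp\,\varphi\,dx\ge0$ for all non-negative $\varphi\in W^{1,p(\cdot)}(U)$ with compact support in $U$ (integrand terms taken to be $0$ where $Du=0$); a weak subsolution if $-u$ is a weak supersolution; a weak solution if both. *)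

theory Defs
  imports "HOL-Analysis.Analysis"
begin

primrec Ck :: "nat \<Rightarrow> 'a::euclidean_space set \<Rightarrow> ('a \<Rightarrow> real) \<Rightarrow> bool" where
  "Ck 0 U f = continuous_on U f"
| "Ck (Suc k) U f = (continuous_on U f \<and>
     (\<exists>Df. (\<forall>x\<in>U. (f has_derivative (\<lambda>h. Df x \<bullet> h)) (at x)) \<and>
           (\<forall>i\<in>Basis. Ck k U (\<lambda>x. Df x \<bullet> i))))"

definition smooth_on :: "'a::euclidean_space set \<Rightarrow> ('a \<Rightarrow> real) \<Rightarrow> bool" where
  "smooth_on U f \<longleftrightarrow> (\<forall>k. Ck k U f)"

definition C1_on :: "'a::euclidean_space set \<Rightarrow> ('a \<Rightarrow> real) \<Rightarrow> bool" where
  "C1_on U f \<longleftrightarrow> (\<exists>Df. (\<forall>x\<in>U. (f has_derivative (\<lambda>h. Df x \<bullet> h)) (at x)) \<and> continuous_on U Df)"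

definition compact_support_in :: "'a::euclidean_space set \<Rightarrow> ('a \<Rightarrow> real) \<Rightarrow> bool" where
  "compact_support_in U f \<longleftrightarrow>
     compact (closure {x\<in>U. f x \<noteq> 0}) \<and> closure {x\<in>U. f x \<noteq> 0} \<subseteq> U"

definition compactly_in :: "'a::euclidean_space set \<Rightarrow> 'a set \<Rightarrow> bool" where
  "compactly_in V U \<longleftrightarrow> compact (closure V) \<and> closure V \<subseteq> U"

definition locally_integrable_on :: "'a::euclidean_space set \<Rightarrow> ('a \<Rightarrow> 'b::euclidean_space) \<Rightarrow> bool" where
  "locally_integrable_on U f \<longleftrightarrow>
     (\<forall>K. compact K \<and> K \<subseteq> U \<longrightarrow> set_integrable lebesgue K f)"

definition weak_gradient :: "'a::euclidean_space set \<Rightarrow> ('a \<Rightarrow> real) \<Rightarrow> ('a \<Rightarrow> 'a) \<Rightarrow> bool" where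
  "weak_gradient U u G \<longleftrightarrow>
     locally_integrable_on U u \<and> locally_integrable_on U G \<and>
     (\<forall>\<phi>. smooth_on U \<phi> \<and> compact_support_in U \<phi> \<longrightarrow>
        (\<forall>i\<in>Basis. (LINT x:U|lebesgue. u x * frechet_derivative \<phi> (at x) i)
                 = - (LINT x:U|lebesgue. (G x \<bullet> i) * \<phi> x)))"

definition Lvar :: "('a::euclidean_space \<Rightarrow> real) \<Rightarrow> 'a set \<Rightarrow> ('a \<Rightarrow> 'b::euclidean_space) \<Rightarrow> bool" where
  "Lvar p U f \<longleftrightarrow> f \<in> borel_measurable (lebesgue_on U) \<and>
     (\<integral>\<^sup>+ x\<in>U. ennreal (norm (f x) powr p x) \<partial>lebesgue) < \<infinity>"

definition W1var_grad :: "('a::euclidean_space \<Rightarrow> real) \<Rightarrow> 'a set \<Rightarrow> ('a \<Rightarrow> real) \<Rightarrow> ('a \<Rightarrow> 'a) \<Rightarrow> bool" where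
  "W1var_grad p U u G \<longleftrightarrow> Lvar p U u \<and> weak_gradient U u G \<and> Lvar p U G"

definition W1var :: "('a::euclidean_space \<Rightarrow> real) \<Rightarrow> 'a set \<Rightarrow> ('a \<Rightarrow> real) \<Rightarrow> bool" where
  "W1var p U u \<longleftrightarrow> (\<exists>G. W1var_grad p U u G)"

definition W1var_loc :: "('a::euclidean_space \<Rightarrow> real) \<Rightarrow> 'a set \<Rightarrow> ('a \<Rightarrow> real) \<Rightarrow> bool" where
  "W1var_loc p U u \<longleftrightarrow> (\<forall>V. open V \<and> compactly_in V U \<longrightarrow> W1var p V u)"

definition strong_plap_integrand ::
  "('a::euclidean_space \<Rightarrow> real) \<Rightarrow> ('a \<Rightarrow> 'a) \<Rightarrow> ('a \<Rightarrow> 'a) \<Rightarrow> ('a \<Rightarrow> real) \<Rightarrow> ('a \<Rightarrow> 'a) \<Rightarrow> 'a \<Rightarrow> real" where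
  "strong_plap_integrand p Dp Du \<phi> D\<phi> x =
     (if Du x = 0 then 0 else
        norm (Du x) powr (p x - 2) * (Du x \<bullet> D\<phi> x)
        + norm (Du x) powr (p x - 2) * ln (norm (Du x)) * (Du x \<bullet> Dp x) * \<phi> x)"

definition weak_supersolution :: "('a::euclidean_space \<Rightarrow> real) \<Rightarrow> 'a set \<Rightarrow> ('a \<Rightarrow> real) \<Rightarrow> bool" where
  "weak_supersolution p U u \<longleftrightarrow>
     W1var_loc p U u \<and>
     (\<exists>Du Dp. weak_gradient U u Du \<and> weak_gradient U p Dp \<and>
        (\<forall>\<phi> D\<phi>. W1var_grad p U \<phi> D\<phi> \<and> (\<forall>x\<in>U. 0 \<le> \<phi> x) \<and> compact_support_in U \<phi> \<longrightarrow>
            set_integrable lebesgue U (strong_plap_integrand p Dp Du \<phi> D\<phi>) \<and>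
            0 \<le> (LINT x:U|lebesgue. strong_plap_integrand p Dp Du \<phi> D\<phi> x)))"

definition weak_subsolution :: "('a::euclidean_space \<Rightarrow> real) \<Rightarrow> 'a set \<Rightarrow> ('a \<Rightarrow> real) \<Rightarrow> bool" where
  "weak_subsolution p U u \<longleftrightarrow> weak_supersolution p U (\<lambda>x. - u x)"

definition weak_solution :: "('a::euclidean_space \<Rightarrow> real) \<Rightarrow> 'a set \<Rightarrow> ('a \<Rightarrow> real) \<Rightarrow> bool" where
  "weak_solution p U u \<longleftrightarrow> weak_supersolution p U u \<and> weak_subsolution p U u"

definition ess_inf :: "'a measure \<Rightarrow> ('a \<Rightarrow> real) \<Rightarrow> ereal" where
  "ess_inf M f = Sup {c::ereal. AE x in M. c \<le> ereal (f x)}"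

end

theory Submission
  imports Defs "HOL-Real_Asymp.Real_Asymp"
begin

text \<open>
  Write \<open>D\<close> for the gradient of \<open>u\<close>. Where \<open>D\<close> does not vanish, the level set \<open>{u = 0}\<close>
  is a null set and there is no flux jump across it, because \<open>D\<close> is continuous; hence the equation holds on \<open>{D \<noteq> 0}\<close>.
  To reach the critical set, differentiate the equation discretely and test it with the difference
  quotient \<open>d\<close> of \<open>u\<close> weighted by \<open>|d| powr (\<kappa> - 1)\<close> and cut off where \<open>|d| \<le> \<delta>\<close>. Since \<open>p > 1\<close>, a small
  \<open>\<kappa> > 0\<close> leaves enough ellipticity for a bound on \<open>\<integral> |d| powr (p - 3 + \<kappa>) |Dd|\<^sup>2\<close> over \<open>{|d| > \<delta>}\<close>, uniformly in \<open>\<delta>\<close>.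
  With it, the term produced by cutting a test function off near \<open>{D = 0}\<close> is \<open>O(\<delta> powr \<kappa>)\<close>, and since the flux and
  the drift vanish on the critical set, the equation holds for all test functions of class C1 with compact
  support. Mollification extends it to Sobolev test functions.
\<close>

section \<open>Differentiable functions with compact support\<close>

text \<open>\<open>u\<close> is only C1, so there is no Hessian to work with: \<open>dq\<close>
  replaces the gradient and the quotients \<open>dV\<close> of \<open>D\<close> replace the second
  derivatives. Differencing the flux leaves an error \<omega> |dV| which the degenerate ellipticity
  cannot absorb uniformly in \<delta>. Hence two energy bounds: a crude one on compact subsets of {D
  \<noteq> 0}, whose constant may depend on \<delta>, and the weighted one, where \<omega> is chosen
  after the crude constant so that the error costs a fixed amount. The drift contains the gradient
  of \<open>p\<close>, which is merely bounded and measurable; its difference quotient is thrown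
  back onto the test function. The exponents: the logarithm is paid for with a small power of |d|.
  The cutoff term is of size \<delta>^\<kappa> |d|^(p-2-\<kappa>) |dV|; by Cauchy-Schwarz against
  the energy weight |d|^(p-3+\<kappa>) there remains |d|^(p-1-3\<kappa>), which is bounded as soon
  as 3 \<kappa> \<le> p - 1.\<close>

abbreviation has_gradient :: "('a::euclidean_space \<Rightarrow> real) \<Rightarrow> 'a \<Rightarrow> 'a \<Rightarrow> bool" where
  "has_gradient f g x \<equiv> (f has_derivative (\<lambda>h. g \<bullet> h)) (at x)"

definition C1_grad :: "'a::euclidean_space set \<Rightarrow> ('a \<Rightarrow> real) \<Rightarrow> ('a \<Rightarrow> 'a) \<Rightarrow> bool" where
  "C1_grad W f Df \<longleftrightarrow> (\<forall>x\<in>W. has_gradient f (Df x) x) \<and> continuous_on W Df"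

text \<open>\<open>S\<close> is any compact set off which \<open>f\<close> vanishes, not the exact
  support, so sums can share one set and \<open>C1_supp_restrict\<close> can change it.
  \<open>f\<close> is C1 on the whole space, which lets all integrals run over the full Lebesgue
  measure without regard to a domain.\<close>

definition C1_supp :: "'a::euclidean_space set \<Rightarrow> ('a \<Rightarrow> real) \<Rightarrow> ('a \<Rightarrow> 'a) \<Rightarrow> bool" where
  "C1_supp S f Df \<longleftrightarrow> compact S \<and> C1_grad UNIV f Df \<and> (\<forall>x. x \<notin> S \<longrightarrow> f x = 0)"

lemma has_gradient_mult:
  assumes "has_gradient f a x" "has_gradient g b x"
  shows "has_gradient (\<lambda>x. f x * g x) (g x *\<^sub>R a + f x *\<^sub>R b) x"
  by (rule has_derivative_eq_rhs[OF has_derivative_mult[OF assms]])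
     (auto simp: inner_add_left algebra_simps)

lemma has_gradient_add:
  assumes "has_gradient f a x" "has_gradient g b x"
  shows "has_gradient (\<lambda>x. f x + g x) (a + b) x"
  by (rule has_derivative_eq_rhs[OF has_derivative_add[OF assms]])
     (auto simp: inner_add_left algebra_simps)

lemma has_gradient_chain:
  assumes "has_gradient f a x" "(g has_real_derivative g') (at (f x))"
  shows "has_gradient (\<lambda>x. g (f x)) (g' *\<^sub>R a) x"
  by (rule has_derivative_eq_rhs[OF has_derivative_compose[OF assms(1)
        assms(2)[unfolded has_field_derivative_def]]]) auto

lemma has_gradient_translate:
  assumes "has_gradient f a (x + c)"
  shows "has_gradient (\<lambda>x. f (x + c)) a x"
proof -
  have "((\<lambda>x. x + c) has_derivative (\<lambda>h. h)) (at x)"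
    by (auto intro!: derivative_eq_intros)
  from has_derivative_compose[OF this assms] show ?thesis .
qed

lemma has_gradient_unique:
  assumes "has_gradient f a x" "has_gradient f b x"
  shows "a = b"
proof -
  have "(\<lambda>h. a \<bullet> h) = (\<lambda>h. b \<bullet> h)"
    by (rule has_derivative_unique[OF assms])
  then show ?thesis by (metis vector_eq_rdot)
qed

lemma C1_gradD:
  assumes "C1_grad W f Df"
  shows "x \<in> W \<Longrightarrow> has_gradient f (Df x) x" "continuous_on W Df" "continuous_on W f"
proof -
  show "x \<in> W \<Longrightarrow> has_gradient f (Df x) x" "continuous_on W Df"
    using assms by (auto simp: C1_grad_def)
  show "continuous_on W f"
    using assms
    by (meson C1_grad_def continuous_at_imp_continuous_on has_derivative_continuous)
qed

lemma C1_grad_subset: "C1_grad W f Df \<Longrightarrow> V \<subseteq> W \<Longrightarrow> C1_grad V f Df"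
  unfolding C1_grad_def using continuous_on_subset by blast

lemma C1_grad_mult:
  assumes "C1_grad W f Df" "C1_grad W g Dg"
  shows "C1_grad W (\<lambda>x. f x * g x) (\<lambda>x. g x *\<^sub>R Df x + f x *\<^sub>R Dg x)"
  using assms C1_gradD(3)[OF assms(1)] C1_gradD(3)[OF assms(2)]
  unfolding C1_grad_def
  by (auto intro!: has_gradient_mult continuous_intros)

lemma C1_grad_add:
  assumes "C1_grad W f Df" "C1_grad W g Dg"
  shows "C1_grad W (\<lambda>x. f x + g x) (\<lambda>x. Df x + Dg x)"
  using assms unfolding C1_grad_def
  by (auto intro!: has_gradient_add continuous_intros)

lemma C1_grad_const: "C1_grad W (\<lambda>x. c) (\<lambda>x. 0)"
  unfolding C1_grad_def by (auto intro!: derivative_eq_intros)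

lemma C1_grad_cmult:
  assumes "C1_grad W f Df"
  shows "C1_grad W (\<lambda>x. c * f x) (\<lambda>x. c *\<^sub>R Df x)"
  using C1_grad_mult[OF C1_grad_const assms] by simp

lemma C1_grad_diff:
  assumes "C1_grad W f Df" "C1_grad W g Dg"
  shows "C1_grad W (\<lambda>x. f x - g x) (\<lambda>x. Df x - Dg x)"
  using C1_grad_add[OF assms(1) C1_grad_cmult[OF assms(2), of "-1"]] by simp

lemma C1_grad_sum:
  assumes "\<And>i. i \<in> I \<Longrightarrow> C1_grad W (f i) (Df i)"
  shows "C1_grad W (\<lambda>x. \<Sum>i\<in>I. f i x) (\<lambda>x. \<Sum>i\<in>I. Df i x)"
  using assms
  by (induction I rule: infinite_finite_induct) (auto intro: C1_grad_const C1_grad_add)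

lemma C1_grad_chain:
  assumes "C1_grad W f Df" "\<And>s. s \<in> f ` W \<Longrightarrow> (g has_real_derivative g' s) (at s)"
    "continuous_on (f ` W) g'"
  shows "C1_grad W (\<lambda>x. g (f x)) (\<lambda>x. g' (f x) *\<^sub>R Df x)"
proof -
  have "continuous_on W (\<lambda>x. g' (f x))"
    using continuous_on_compose[OF C1_gradD(3)[OF assms(1)] assms(3)] by (simp add: o_def)
  then show ?thesis
    using assms unfolding C1_grad_def
    by (auto intro!: has_gradient_chain[where g = g] continuous_intros)
qed

lemma C1_grad_translate:
  assumes "C1_grad W f Df" "\<And>x. x \<in> V \<Longrightarrow> x + c \<in> W"
  shows "C1_grad V (\<lambda>x. f (x + c)) (\<lambda>x. Df (x + c))"
proof -
  have "continuous_on V (\<lambda>x. Df (x + c))"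
    by (rule continuous_on_compose2[OF C1_gradD(2)[OF assms(1)]])
       (use assms in \<open>auto intro!: continuous_intros\<close>)
  then show ?thesis using assms by (auto simp: C1_grad_def intro!: has_gradient_translate)
qed

lemma C1_suppD:
  assumes "C1_supp S f Df"
  shows "compact S" "has_gradient f (Df x) x" "continuous_on UNIV Df" "continuous_on UNIV f"
    "x \<notin> S \<Longrightarrow> f x = 0" "x \<notin> S \<Longrightarrow> Df x = 0" "C1_grad W f Df"
proof -
  show 1: "compact S" "continuous_on UNIV Df" "x \<notin> S \<Longrightarrow> f x = 0" "has_gradient f (Df x) x"
    "C1_grad W f Df"
    using assms C1_grad_subset[of UNIV f Df W] by (auto simp: C1_supp_def C1_grad_def)
  show "continuous_on UNIV f"
    using assms by (auto simp: C1_supp_def dest: C1_gradD)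
  assume x: "x \<notin> S"
  have "has_gradient f 0 x"
  proof (rule has_derivative_transform_within_open[of "\<lambda>_. 0" _ _ _ "- S"])
    show "open (- S)" using 1(1) by (simp add: compact_imp_closed open_Compl)
  qed (use x assms in \<open>auto simp: C1_supp_def\<close>)
  with 1(4) show "Df x = 0" using has_gradient_unique by blast
qed

text \<open>\<open>W\<close> and the complement of \<open>S\<close> are open and cover the space,
  and on the latter the product is zero. The values of \<open>f\<close> outside \<open>W\<close> are
  therefore harmless.\<close>

lemma continuous_on_supp_scaleR:
  fixes f :: "'a::topological_space \<Rightarrow> 'b::real_normed_vector"
  assumes W: "open W" and S: "closed S" "S \<subseteq> W" and f: "continuous_on W f"
    and g: "continuous_on UNIV g" "\<And>x. x \<notin> S \<Longrightarrow> g x = (0::real)"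
  shows "continuous_on UNIV (\<lambda>x. g x *\<^sub>R f x)"
proof -
  have 1: "continuous_on W (\<lambda>x. g x *\<^sub>R f x)"
    by (intro continuous_intros f continuous_on_subset[OF g(1)]) auto
  have 2: "continuous_on (- S) (\<lambda>x. g x *\<^sub>R f x)"
    by (rule continuous_on_eq[of _ "\<lambda>_. 0"]) (use g in auto)
  have "continuous_on (W \<union> - S) (\<lambda>x. g x *\<^sub>R f x)"
    by (rule continuous_on_open_Un) (use 1 2 W S in auto)
  moreover have "W \<union> - S = UNIV" using S by auto
  ultimately show ?thesis by simp
qed

lemma continuous_on_supp_scaleR':
  fixes g :: "'a::topological_space \<Rightarrow> 'b::real_normed_vector"
  assumes W: "open W" and S: "closed S" "S \<subseteq> W" and f: "continuous_on W f"
    and g: "continuous_on UNIV g" "\<And>x. x \<notin> S \<Longrightarrow> g x = 0"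
  shows "continuous_on UNIV (\<lambda>x. (f x :: real) *\<^sub>R g x)"
proof -
  have 1: "continuous_on W (\<lambda>x. f x *\<^sub>R g x)"
    by (intro continuous_intros f continuous_on_subset[OF g(1)]) auto
  have 2: "continuous_on (- S) (\<lambda>x. f x *\<^sub>R g x)"
    by (rule continuous_on_eq[of _ "\<lambda>_. 0"]) (use g in auto)
  have "continuous_on (W \<union> - S) (\<lambda>x. f x *\<^sub>R g x)"
    by (rule continuous_on_open_Un) (use 1 2 W S in auto)
  moreover have "W \<union> - S = UNIV" using S by auto
  ultimately show ?thesis by simp
qed

text \<open>The source of nearly all test functions: \<open>f\<close> has to be differentiable only
  on the open set \<open>W\<close>, for instance a nonlinear function of \<open>u\<close> or of its
  difference quotients, and the product is still globally C1.\<close>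

lemma C1_supp_mult:
  assumes W: "open W" and f: "C1_grad W f Df" and g: "C1_supp S g Dg" and S: "S \<subseteq> W"
  shows "C1_supp S (\<lambda>x. f x * g x) (\<lambda>x. g x *\<^sub>R Df x + f x *\<^sub>R Dg x)"
proof -
  note gD = C1_suppD[OF g]
  have cl: "closed S" using gD(1) by (rule compact_imp_closed)
  have "has_gradient (\<lambda>x. f x * g x) (g x *\<^sub>R Df x + f x *\<^sub>R Dg x) x" for x
  proof (cases "x \<in> W")
    case True
    then show ?thesis using f gD(2) by (auto simp: C1_grad_def intro!: has_gradient_mult)
  next
    case False
    then have x: "x \<in> - S" using S by auto
    have "has_gradient (\<lambda>x. f x * g x) 0 x"
      by (rule has_derivative_transform_within_open[of "\<lambda>_. 0" _ _ _ "- S"])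
         (use x gD(5) cl in \<open>auto simp: open_Compl\<close>)
    then show ?thesis using x gD(5,6) by auto
  qed
  moreover have "continuous_on UNIV (\<lambda>x. g x *\<^sub>R Df x + f x *\<^sub>R Dg x)"
    by (intro continuous_on_add continuous_on_supp_scaleR[OF W cl S] continuous_on_supp_scaleR'[OF W cl S])
       (use C1_gradD[OF f] gD in auto)
  ultimately show ?thesis
    using gD by (auto simp: C1_supp_def C1_grad_def)
qed

lemma C1_supp_restrict:
  assumes "C1_supp S f Df" "compact S'" "\<And>x. x \<notin> S' \<Longrightarrow> f x = 0"
  shows "C1_supp S' f Df"
  using assms by (auto simp: C1_supp_def)

lemma C1_supp_sum:
  assumes "\<And>i. i \<in> I \<Longrightarrow> C1_supp S (f i) (Df i)" "compact S"
  shows "C1_supp S (\<lambda>x. \<Sum>i\<in>I. f i x) (\<lambda>x. \<Sum>i\<in>I. Df i x)"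
  using assms C1_grad_sum[of I UNIV f Df] by (auto simp: C1_supp_def intro!: sum.neutral)

lemma C1_supp_cmult:
  assumes "C1_supp S f Df"
  shows "C1_supp S (\<lambda>x. c * f x) (\<lambda>x. c *\<^sub>R Df x)"
  using assms C1_grad_cmult[of UNIV f Df c] by (auto simp: C1_supp_def)

lemma C1_supp_add:
  assumes "C1_supp S f Df" "C1_supp S g Dg"
  shows "C1_supp S (\<lambda>x. f x + g x) (\<lambda>x. Df x + Dg x)"
  using assms C1_grad_add[of UNIV f Df g Dg] by (auto simp: C1_supp_def)

section \<open>Translation, compact supports and integration by parts\<close>

lemma lborel_integrable_translate:
  fixes f :: "'a::euclidean_space \<Rightarrow> 'b::{banach, second_countable_topology}"
  assumes "integrable lborel f"
  shows "integrable lborel (\<lambda>x. f (x + c))"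
proof -
  have "integrable (distr lborel borel ((+) c)) f"
    using assms by (simp add: lborel_distr_plus)
  then have "integrable lborel (\<lambda>x. f (c + x))"
    by (subst (asm) integrable_distr_eq) (use assms in auto)
  then show ?thesis by (simp add: add.commute)
qed

lemma lborel_integral_translate:
  fixes f :: "'a::euclidean_space \<Rightarrow> 'b::{banach, second_countable_topology}"
  assumes "f \<in> borel_measurable borel"
  shows "(\<integral>x. f (x + c) \<partial>lborel) = (\<integral>x. f x \<partial>lborel)"
proof -
  have "(\<integral>x. f x \<partial>lborel) = (\<integral>x. f x \<partial>(distr lborel borel ((+) c)))"
    by (simp add: lborel_distr_plus)
  also have "\<dots> = (\<integral>x. f (c + x) \<partial>lborel)"
    by (subst integral_distr) (use assms in auto)
  finally show ?thesis by (simp add: add.commute)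
qed

lemma integrable_indicator_compact:
  fixes S :: "'a::euclidean_space set"
  assumes "compact S"
  shows "integrable lborel (indicator S :: 'a \<Rightarrow> real)"
  using assms emeasure_compact_finite[OF assms]
  by (intro integrable_real_indicator) (auto simp: borel_compact)

lemma integrable_compact_bounded:
  fixes f :: "'a::euclidean_space \<Rightarrow> 'b::{banach, second_countable_topology}"
  assumes "f \<in> borel_measurable borel" "compact S" "\<And>x. x \<in> S \<Longrightarrow> norm (f x) \<le> C"
    "\<And>x. x \<notin> S \<Longrightarrow> f x = 0"
  shows "integrable lborel f"
proof (rule Bochner_Integration.integrable_bound)
  show "integrable lborel (\<lambda>x. C * indicator S x :: real)"
    by (intro integrable_mult_right integrable_indicator_compact assms)
  show "AE x in lborel. norm (f x) \<le> norm (C * indicator S x :: real)"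
    using assms(3,4) by (intro AE_I2) (force simp: indicator_def)
qed (use assms in auto)

lemma integrable_continuous_compact_supp:
  fixes f :: "'a::euclidean_space \<Rightarrow> 'b::{banach, second_countable_topology}"
  assumes f: "continuous_on UNIV f" and S: "compact S" and 0: "\<And>x. x \<notin> S \<Longrightarrow> f x = 0"
  shows "integrable lborel f"
proof -
  have "bounded (f ` S)"
    using f S by (meson compact_continuous_image compact_imp_bounded continuous_on_subset subset_UNIV)
  then obtain C where "\<And>x. x \<in> S \<Longrightarrow> norm (f x) \<le> C"
    by (auto simp: bounded_iff)
  with assms show ?thesis
    by (intro integrable_compact_bounded[of f S C]) (auto intro: borel_measurable_continuous_onI)
qed

lemma C1_supp_bound:
  assumes "C1_supp S f Df"
  obtains C where "C \<ge> 0" "\<And>x. \<bar>f x\<bar> \<le> C" "\<And>x. norm (Df x) \<le> C"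
proof -
  note D = C1_suppD[OF assms]
  have "bounded (f ` S)" "bounded (Df ` S)"
    using D(1,3,4) by (meson compact_continuous_image compact_imp_bounded continuous_on_subset subset_UNIV)+
  then obtain a b where ab: "\<And>x. x \<in> S \<Longrightarrow> \<bar>f x\<bar> \<le> a" "\<And>x. x \<in> S \<Longrightarrow> norm (Df x) \<le> b"
    by (auto simp: bounded_iff)
  show ?thesis
  proof (rule that[of "\<bar>a\<bar> + \<bar>b\<bar>"])
    fix x
    show "\<bar>f x\<bar> \<le> \<bar>a\<bar> + \<bar>b\<bar>" using ab(1)[of x] D(5)[of x] by (cases "x \<in> S") auto
    show "norm (Df x) \<le> \<bar>a\<bar> + \<bar>b\<bar>" using ab(2)[of x] D(6)[of x] by (cases "x \<in> S") auto
  qed auto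
qed

lemma C1_supp_lipschitz:
  assumes "C1_supp S f Df" "\<And>x. norm (Df x) \<le> C"
  shows "\<bar>f x - f y\<bar> \<le> C * norm (x - y)"
proof -
  have "norm (f x - f y) \<le> C * norm (x - y)"
  proof (rule differentiable_bound[of UNIV f "\<lambda>x h. Df x \<bullet> h"])
    fix x :: 'a
    show "onorm ((\<bullet>) (Df x)) \<le> C"
    proof (rule onorm_le)
      fix h show "norm (Df x \<bullet> h) \<le> C * norm h"
        using Cauchy_Schwarz_ineq2[of "Df x" h] assms(2)[of x]
        by (smt (verit) mult_right_mono norm_ge_zero real_norm_def)
    qed
  qed (use C1_suppD(2)[OF assms(1)] in auto)
  then show ?thesis by simp
qed

lemma gradient_difference_quotient_LIMSEQ:
  assumes "has_gradient f a x"
  shows "(\<lambda>n. (f (x + (1 / real (Suc n)) *\<^sub>R i) - f x) * real (Suc n)) \<longlonglongrightarrow> a \<bullet> i"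
proof -
  have "((\<lambda>t::real. x + t *\<^sub>R i) has_derivative (\<lambda>t. t *\<^sub>R i)) (at 0)"
    by (auto intro!: derivative_eq_intros)
  moreover have "has_gradient f a (x + 0 *\<^sub>R i)" using assms by simp
  ultimately have "((\<lambda>t. f (x + t *\<^sub>R i)) has_derivative (\<lambda>t. a \<bullet> (t *\<^sub>R i))) (at 0)"
    by (rule has_derivative_compose)
  then have "((\<lambda>t. f (x + t *\<^sub>R i)) has_real_derivative a \<bullet> i) (at 0)"
    by (simp add: has_field_derivative_def mult.commute[of _ "a \<bullet> i"] mult_commute_abs)
  then have "((\<lambda>h. (f (x + h *\<^sub>R i) - f x) / h) \<longlongrightarrow> a \<bullet> i) (at 0)"
    by (simp add: DERIV_def)
  moreover have "filterlim (\<lambda>n. 1 / real (Suc n)) (at 0) sequentially"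
    unfolding filterlim_at using LIMSEQ_inverse_real_of_nat
    by (auto simp: field_simps inverse_eq_divide)
  ultimately have "(\<lambda>n. (f (x + (1 / real (Suc n)) *\<^sub>R i) - f x) / (1 / real (Suc n))) \<longlonglongrightarrow> a \<bullet> i"
    by (rule filterlim_compose)
  then show ?thesis by simp
qed

lemma compact_cball_sum:
  fixes S :: "'a::euclidean_space set"
  assumes "compact S"
  shows "compact {x + y |x y. x \<in> S \<and> y \<in> cball 0 r}"
  using compact_sums[OF assms compact_cball[of 0 r]] by simp

text \<open>By translation invariance every difference quotient of \<open>f\<close> has integral 0,
  and dominated convergence passes to the derivative; the Lipschitz bound supplies the
  majorant.\<close>

lemma integral_partial_zero:
  assumes f: "C1_supp S f Df"
  shows "(\<integral>x. Df x \<bullet> i \<partial>lborel) = 0"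
proof -
  note D = C1_suppD[OF f]
  obtain C where C: "C \<ge> 0" "\<And>x. \<bar>f x\<bar> \<le> C" "\<And>x. norm (Df x) \<le> C"
    using C1_supp_bound[OF f] by metis
  \<comment> \<open>The difference steps have length at most \<open>norm i\<close>, so all quotients
    vanish off this enlargement of \<open>S\<close>.\<close>
  define K where "K = {x + y |x y. x \<in> S \<and> y \<in> cball (0::'a) (norm i)}"
  have K: "compact K" unfolding K_def by (rule compact_cball_sum[OF D(1)])
  let ?q = "\<lambda>n x. (f (x + (1 / real (Suc n)) *\<^sub>R i) - f x) * real (Suc n)"
  have int: "integrable lborel f"
    by (rule integrable_continuous_compact_supp[OF D(4,1,5)])
  have fm: "f \<in> borel_measurable borel" using D(4) by (rule borel_measurable_continuous_onI)
  have z: "(\<integral>x. ?q n x \<partial>lborel) = 0" for n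
    using lborel_integral_translate[OF fm, of "(1 / real (Suc n)) *\<^sub>R i"]
      lborel_integrable_translate[OF int, of "(1 / real (Suc n)) *\<^sub>R i"] int
    by (simp add: Bochner_Integration.integral_diff)
  have "(\<lambda>n. \<integral>x. ?q n x \<partial>lborel) \<longlonglongrightarrow> (\<integral>x. Df x \<bullet> i \<partial>lborel)"
  proof (rule integral_dominated_convergence[where w = "\<lambda>x. (C * norm i) * indicator K x"])
    show "(\<lambda>x. Df x \<bullet> i) \<in> borel_measurable lborel"
      using D(3) by (auto intro!: borel_measurable_continuous_onI continuous_intros)
    show "?q n \<in> borel_measurable lborel" for n
      using D(4) by (auto intro!: borel_measurable_continuous_onI continuous_intros
          intro: continuous_on_compose2)
    show "integrable lborel (\<lambda>x. (C * norm i) * indicator K x)"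
      by (intro integrable_mult_right integrable_indicator_compact K)
    show "AE x in lborel. (\<lambda>n. ?q n x) \<longlonglongrightarrow> Df x \<bullet> i"
      using gradient_difference_quotient_LIMSEQ[OF D(2)] by auto
    show "AE x in lborel. norm (?q n x) \<le> C * norm i * indicator K x" for n
    proof (intro AE_I2)
      fix x :: 'a
      let ?h = "(1 / real (Suc n)) *\<^sub>R i"
      have nh: "norm ?h \<le> norm i" by (simp add: divide_le_eq mult_le_cancel_left1)
      show "norm (?q n x) \<le> C * norm i * indicator K x"
      proof (cases "x \<in> K")
        case True
        have "\<bar>f (x + ?h) - f x\<bar> \<le> C * norm ?h"
          using C1_supp_lipschitz[OF f C(3), of "x + ?h" x] by simp
        then have "\<bar>f (x + ?h) - f x\<bar> * real (Suc n) \<le> C * norm ?h * real (Suc n)"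
          by (rule mult_right_mono) simp
        also have "\<dots> = C * norm i" by simp
        finally show ?thesis using True by (simp add: abs_mult)
      next
        case False
        have "x \<notin> S"
        proof
          assume "x \<in> S" then have "x + 0 \<in> K" unfolding K_def by fastforce
          with False show False by simp
        qed
        moreover have "x + ?h \<notin> S"
        proof
          assume "x + ?h \<in> S"
          moreover have "- ?h \<in> cball 0 (norm i)" using nh by (simp add: dist_norm)
          ultimately have "(x + ?h) + - ?h \<in> K" unfolding K_def by blast
          with False show False by simp
        qed
        ultimately show ?thesis using False D(5) by simp
      qed
    qed
  qed
  then have "(\<lambda>n::nat. 0::real) \<longlonglongrightarrow> (\<integral>x. Df x \<bullet> i \<partial>lborel)" unfolding z .
  then show ?thesis by (simp add: LIMSEQ_const_iff)
qed

lemma integral_by_parts: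
  assumes W: "open W" and f: "C1_grad W f Df" and g: "C1_supp S g Dg" and S: "S \<subseteq> W"
  shows "(\<integral>x. f x * (Dg x \<bullet> i) \<partial>lborel) = - (\<integral>x. (Df x \<bullet> i) * g x \<partial>lborel)"
    "integrable lborel (\<lambda>x. f x * (Dg x \<bullet> i))" "integrable lborel (\<lambda>x. (Df x \<bullet> i) * g x)"
proof -
  note gD = C1_suppD[OF g]
  have cl: "closed S" using gD(1) by (rule compact_imp_closed)
  have "continuous_on UNIV (\<lambda>x. f x *\<^sub>R (Dg x \<bullet> i))"
    by (rule continuous_on_supp_scaleR'[OF W cl S])
       (use C1_gradD[OF f] gD in \<open>auto intro!: continuous_intros\<close>)
  then show 1: "integrable lborel (\<lambda>x. f x * (Dg x \<bullet> i))"
    by (intro integrable_continuous_compact_supp[OF _ gD(1)]) (auto simp: gD(6))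
  have "continuous_on UNIV (\<lambda>x. g x *\<^sub>R (Df x \<bullet> i))"
    by (rule continuous_on_supp_scaleR[OF W cl S])
       (use C1_gradD[OF f] gD in \<open>auto intro!: continuous_intros\<close>)
  then show 2: "integrable lborel (\<lambda>x. (Df x \<bullet> i) * g x)"
    by (intro integrable_continuous_compact_supp[OF _ gD(1)]) (auto simp: gD(5) mult.commute)
  have "(\<integral>x. (g x *\<^sub>R Df x + f x *\<^sub>R Dg x) \<bullet> i \<partial>lborel) = 0"
    by (rule integral_partial_zero[OF C1_supp_mult[OF W f g S]])
  then have "(\<integral>x. (Df x \<bullet> i) * g x + f x * (Dg x \<bullet> i) \<partial>lborel) = 0"
    by (simp add: inner_add_left mult.commute)
  then show "(\<integral>x. f x * (Dg x \<bullet> i) \<partial>lborel) = - (\<integral>x. (Df x \<bullet> i) * g x \<partial>lborel)"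
    using 1 2 by simp
qed

section \<open>Mollification\<close>

text \<open>A family in \<open>k\<close> instead of the single function exp(-1/s): differentiation
  turns \<open>flat_exp k\<close> into a combination of the members \<open>k + 1\<close> and
  \<open>k + 2\<close>, so derivatives of all orders stay in the family.\<close>

definition flat_exp :: "nat \<Rightarrow> real \<Rightarrow> real" where
  "flat_exp k s = (if s \<le> 0 then 0 else (1 / s) ^ k * exp (- (1 / s)))"

lemma flat_exp_tendsto_0: "(flat_exp k \<longlongrightarrow> 0) (at_right 0)"
proof -
  have "((\<lambda>s::real. (1 / s) ^ k / exp (1 / s)) \<longlongrightarrow> 0) (at_right 0)"
    using filterlim_compose[OF tendsto_power_div_exp_0[of k] filterlim_inverse_at_top_right]
    by (simp add: inverse_eq_divide)
  moreover have "eventually (\<lambda>s. flat_exp k s = (1 / s) ^ k / exp (1 / s)) (at_right 0)"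
    by (auto simp: eventually_at_filter flat_exp_def exp_minus divide_inverse)
  ultimately show ?thesis by (subst tendsto_cong) auto
qed

text \<open>At 0 the difference quotient is \<open>flat_exp (Suc k)\<close> from the right and 0
  from the left, and both tend to 0.\<close>

lemma flat_exp_deriv:
  "(flat_exp k has_real_derivative flat_exp (k + 2) s - real k * flat_exp (k + 1) s) (at s)"
proof (cases s "0::real" rule: linorder_cases)
  case less
  then show ?thesis
    by (intro has_field_derivative_transform_within_open[of "\<lambda>_. 0" _ _ "{..<0}" "flat_exp k", rotated])
       (auto simp: flat_exp_def)
next
  case greater
  have "((\<lambda>s. (1 / s) ^ k * exp (- (1 / s))) has_real_derivative
      flat_exp (k + 2) s - real k * flat_exp (k + 1) s) (at s)"
  proof -
    have d: "((\<lambda>s::real. 1 / s) has_real_derivative - ((1 / s)\<^sup>2)) (at s)"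
      using greater by (auto intro!: derivative_eq_intros simp: power2_eq_square divide_inverse)
    have e: "((\<lambda>s::real. exp (- (1 / s))) has_real_derivative exp (- (1 / s)) * (1 / s)\<^sup>2) (at s)"
      using DERIV_fun_exp[OF DERIV_minus[OF d]] by simp
    have "((\<lambda>s. (1 / s) ^ k * exp (- (1 / s))) has_real_derivative
        (real k * (1 / s) ^ (k - 1) * (- ((1 / s)\<^sup>2))) * exp (- (1 / s))
        + exp (- (1 / s)) * (1 / s)\<^sup>2 * (1 / s) ^ k) (at s)"
      using DERIV_mult[OF DERIV_power[OF d, of k] e] by (simp add: mult_ac)
    moreover have "(real k * (1 / s) ^ (k - 1) * (- ((1 / s)\<^sup>2))) * exp (- (1 / s))
        + exp (- (1 / s)) * (1 / s)\<^sup>2 * (1 / s) ^ k = flat_exp (k + 2) s - real k * flat_exp (k + 1) s"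
      using greater by (cases k) (simp_all add: flat_exp_def power2_eq_square algebra_simps add_divide_distrib)
    ultimately show ?thesis by simp
  qed
  then show ?thesis
    by (rule has_field_derivative_transform_within_open[of _ _ _ "{0<..}"])
       (use greater in \<open>auto simp: flat_exp_def\<close>)
next
  case equal
  have r: "((\<lambda>h. flat_exp k h / h) \<longlongrightarrow> 0) (at_right 0)"
  proof -
    have "eventually (\<lambda>h. flat_exp k h / h = flat_exp (Suc k) h) (at_right 0)"
      by (auto simp: eventually_at_filter flat_exp_def)
    then show ?thesis using flat_exp_tendsto_0[of "Suc k"] by (subst tendsto_cong) auto
  qed
  have l: "((\<lambda>h. flat_exp k h / h) \<longlongrightarrow> 0) (at_left 0)"
  proof -
    have "eventually (\<lambda>h. flat_exp k h / h = 0) (at_left 0)"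
      by (auto simp: eventually_at_filter flat_exp_def)
    then show ?thesis by (subst tendsto_cong) auto
  qed
  have "((\<lambda>h. flat_exp k h / h) \<longlongrightarrow> 0) (at 0)"
    using l r filterlim_split_at by blast
  then show ?thesis using equal by (simp add: DERIV_def flat_exp_def)
qed

lemma Ck_add: "Ck k U f \<Longrightarrow> Ck k U g \<Longrightarrow> Ck k U (\<lambda>x. f x + g x)"
proof (induction k arbitrary: f g)
  case 0
  then show ?case by (auto intro: continuous_intros)
next
  case (Suc k)
  obtain Df where Df: "\<forall>x\<in>U. has_gradient f (Df x) x" "\<forall>i\<in>Basis. Ck k U (\<lambda>x. Df x \<bullet> i)"
    using Suc.prems(1) by auto
  obtain Dg where Dg: "\<forall>x\<in>U. has_gradient g (Dg x) x" "\<forall>i\<in>Basis. Ck k U (\<lambda>x. Dg x \<bullet> i)"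
    using Suc.prems(2) by auto
  have "\<forall>x\<in>U. has_gradient (\<lambda>x. f x + g x) (Df x + Dg x) x"
    using Df(1) Dg(1) has_gradient_add by blast
  moreover have "\<forall>i\<in>Basis. Ck k U (\<lambda>x. (Df x + Dg x) \<bullet> i)"
    using Df(2) Dg(2) Suc.IH by (simp add: inner_add_left)
  ultimately show ?case
    using Suc.prems by (auto intro!: continuous_intros exI[of _ "\<lambda>x. Df x + Dg x"])
qed

lemma real_polynomial_function_gradient:
  fixes q :: "'a::euclidean_space \<Rightarrow> real"
  assumes "real_polynomial_function q"
  shows "\<exists>Dq. (\<forall>x. has_gradient q (Dq x) x) \<and> (\<forall>i. real_polynomial_function (\<lambda>x. Dq x \<bullet> i))"
  using assms
proof induction
  case (linear f)
  define a where "a = (\<Sum>b\<in>Basis. f b *\<^sub>R b)"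
  have "f = (\<lambda>h. a \<bullet> h)"
  proof
    fix h
    interpret bounded_linear f by fact
    have "f h = f (\<Sum>b\<in>Basis. (h \<bullet> b) *\<^sub>R b)" by (simp add: euclidean_representation)
    also have "\<dots> = a \<bullet> h"
      by (simp add: sum scaleR a_def inner_sum_left mult.commute) (simp add: inner_commute)
    finally show "f h = a \<bullet> h" .
  qed
  moreover have "has_gradient f a x" for x
    using bounded_linear_imp_has_derivative[OF linear] calculation by metis
  ultimately show ?case by (intro exI[of _ "\<lambda>_. a"]) auto
next
  case (const c)
  then show ?case by (intro exI[of _ "\<lambda>_. 0"]) (auto intro!: derivative_eq_intros)
next
  case (add f g)
  then obtain Df Dg where
    "\<forall>x. has_gradient f (Df x) x" "\<forall>i. real_polynomial_function (\<lambda>x. Df x \<bullet> i)"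
    "\<forall>x. has_gradient g (Dg x) x" "\<forall>i. real_polynomial_function (\<lambda>x. Dg x \<bullet> i)" by auto
  then have "\<forall>x. has_gradient (\<lambda>x. f x + g x) (Df x + Dg x) x"
    "\<forall>i. real_polynomial_function (\<lambda>x. Df x \<bullet> i + Dg x \<bullet> i)"
    by (simp add: has_gradient_add, intro allI real_polynomial_function.intros(3), simp_all)
  then have "\<forall>x. has_gradient (\<lambda>x. f x + g x) (Df x + Dg x) x"
    "\<forall>i. real_polynomial_function (\<lambda>x. (Df x + Dg x) \<bullet> i)"
    by (simp_all add: inner_add_left)
  then show ?case by (intro exI[of _ "\<lambda>x. Df x + Dg x"] conjI)
next
  case (mult f g)
  then obtain Df Dg where
    "\<forall>x. has_gradient f (Df x) x" "\<forall>i. real_polynomial_function (\<lambda>x. Df x \<bullet> i)"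
    "\<forall>x. has_gradient g (Dg x) x" "\<forall>i. real_polynomial_function (\<lambda>x. Dg x \<bullet> i)" by auto
  then have "\<forall>x. has_gradient (\<lambda>x. f x * g x) (g x *\<^sub>R Df x + f x *\<^sub>R Dg x) x"
    "\<forall>i. real_polynomial_function (\<lambda>x. g x * (Df x \<bullet> i) + f x * (Dg x \<bullet> i))"
    using mult.hyps by (simp add: has_gradient_mult, intro allI real_polynomial_function.intros(3,4), simp_all)
  then have "\<forall>x. has_gradient (\<lambda>x. f x * g x) (g x *\<^sub>R Df x + f x *\<^sub>R Dg x) x"
    "\<forall>i. real_polynomial_function (\<lambda>x. (g x *\<^sub>R Df x + f x *\<^sub>R Dg x) \<bullet> i)"
    by (simp_all add: inner_add_left)
  then show ?case by (intro exI[of _ "\<lambda>x. g x *\<^sub>R Df x + f x *\<^sub>R Dg x"] conjI)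
qed

lemma polynomial_function_C1_grad:
  fixes q :: "'a::euclidean_space \<Rightarrow> real"
  assumes "real_polynomial_function q"
  shows "\<exists>Dq. C1_grad W q Dq"
proof -
  obtain Dq where D: "\<forall>x. has_gradient q (Dq x) x" "\<forall>i. real_polynomial_function (\<lambda>x. Dq x \<bullet> i)"
    using real_polynomial_function_gradient[OF assms] by blast
  have "continuous_on W Dq"
    by (subst continuous_on_componentwise) (use D(2) in \<open> auto intro!: continuous_on_polymonial_function simp: real_polynomial_function_eq\<close>)
  then show ?thesis using D by (auto simp: C1_grad_def)
qed

lemma has_gradient_bump_arg:
  "has_gradient (\<lambda>x. r\<^sup>2 - (x - c) \<bullet> (x - c)) (- 2 *\<^sub>R (x - c)) x"
  by (auto intro!: derivative_eq_intros simp: inner_commute algebra_simps)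

text \<open>The polynomial factor and the index \<open>k\<close> are general because every partial
  derivative of such a product is a sum of products of the same kind; this closes the induction on
  \<open>m\<close>.\<close>

lemma Ck_polynomial_bump:
  fixes q :: "'a::euclidean_space \<Rightarrow> real"
  assumes "real_polynomial_function q"
  shows "Ck m U (\<lambda>x. q x * flat_exp k (r\<^sup>2 - (x - c) \<bullet> (x - c)))"
  using assms
proof (induction m arbitrary: q k)
  case 0
  have "continuous_on UNIV (flat_exp k)"
    using flat_exp_deriv by (meson DERIV_isCont continuous_at_imp_continuous_on)
  then have "continuous_on U (\<lambda>x. flat_exp k (r\<^sup>2 - (x - c) \<bullet> (x - c)))"
    by (rule continuous_on_compose2) (auto intro!: continuous_intros)
  moreover have "continuous_on U q"
    using 0 by (auto intro!: continuous_on_polymonial_function simp: real_polynomial_function_eq[symmetric])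
  ultimately show ?case by (auto intro!: continuous_intros)
next
  case (Suc m)
  let ?s = "\<lambda>x. r\<^sup>2 - (x - c) \<bullet> (x - c)"
  obtain Dq where D: "\<forall>x. has_gradient q (Dq x) x" "\<forall>i. real_polynomial_function (\<lambda>x. Dq x \<bullet> i)"
    using real_polynomial_function_gradient[OF Suc.prems] by blast
  define DF where "DF x = flat_exp k (?s x) *\<^sub>R Dq x
      + q x *\<^sub>R ((flat_exp (k + 2) (?s x) - real k * flat_exp (k + 1) (?s x)) *\<^sub>R (- 2 *\<^sub>R (x - c)))" for x
  have g: "has_gradient (\<lambda>x. q x * flat_exp k (?s x)) (DF x) x" for x
    unfolding DF_def
    by (intro has_gradient_mult has_gradient_chain[OF has_gradient_bump_arg] flat_exp_deriv D(1)[rule_format])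
  have "Ck m U (\<lambda>x. DF x \<bullet> i)" for i
  proof -
    have p: "real_polynomial_function (\<lambda>x. (x - c) \<bullet> i)"
      unfolding inner_diff_left
      by (intro real_polynomial_function_diff real_polynomial_function.intros) (simp add: bounded_linear_inner_left)
    have e: "DF x \<bullet> i = (Dq x \<bullet> i) * flat_exp k (?s x)
        + ((q x * ((- 2) * ((x - c) \<bullet> i))) * flat_exp (k + 2) (?s x)
        + (q x * ((2 * real k) * ((x - c) \<bullet> i))) * flat_exp (k + 1) (?s x))" for x
      by (simp add: DF_def inner_add_left algebra_simps)
    show ?thesis
      unfolding e
      by (intro Ck_add Suc.IH D(2)[rule_format] real_polynomial_function.intros(4)
          real_polynomial_function.intros(2) p Suc.prems)
  qed
  moreover have "continuous_on U (\<lambda>x. q x * flat_exp k (?s x))"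
    using g by (meson continuous_at_imp_continuous_on has_derivative_continuous)
  ultimately show ?case using g by auto
qed

definition bump :: "real \<Rightarrow> 'a::euclidean_space \<Rightarrow> real" where
  "bump r x = flat_exp 0 (r\<^sup>2 - x \<bullet> x)"

lemma bump_smooth: "smooth_on U (\<lambda>x. a * bump r (x - c))"
  using Ck_polynomial_bump[OF real_polynomial_function.intros(2)[of a], of _ U 0 r c]
  by (simp add: smooth_on_def bump_def)

lemma bump_pos_iff: "r > 0 \<Longrightarrow> bump r x > 0 \<longleftrightarrow> norm x < r"
  using power2_less_imp_less[of "norm x" r] power_strict_mono[of "norm x" r 2]
  by (auto simp: bump_def flat_exp_def not_le power2_norm_eq_inner[symmetric])

lemma bump_nonneg: "bump r x \<ge> 0"
  by (simp add: bump_def flat_exp_def)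

lemma smooth_on_imp_C1_grad:
  assumes "smooth_on U f"
  shows "\<exists>Df. C1_grad U f Df"
proof -
  have "Ck (Suc 0) U f" using assms by (auto simp: smooth_on_def)
  then obtain Df where "\<forall>x\<in>U. has_gradient f (Df x) x" "\<forall>i\<in>Basis. continuous_on U (\<lambda>x. Df x \<bullet> i)"
    by auto
  then show ?thesis using continuous_on_componentwise[of U Df] by (auto simp: C1_grad_def)
qed

definition mollifier :: "real \<Rightarrow> 'a::euclidean_space \<Rightarrow> real" where
  "mollifier r x = (1 / (\<integral>y. bump r (y::'a) \<partial>lborel)) * bump r x"

lemma bump_C1_supp:
  assumes "r > 0"
  shows "\<exists>D. C1_supp (cball 0 r) (bump r :: 'a::euclidean_space \<Rightarrow> real) D"
proof -
  obtain D where "C1_grad UNIV (bump r :: 'a \<Rightarrow> real) D"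
    using smooth_on_imp_C1_grad[OF bump_smooth[of UNIV 1 r 0]] by auto
  moreover have "bump r x = 0" if "x \<notin> cball 0 r" for x :: 'a
    using bump_pos_iff[OF assms, of x] bump_nonneg[of r x] that by auto
  ultimately show ?thesis by (auto simp: C1_supp_def)
qed

lemma integral_bump_pos:
  assumes "r > 0"
  shows "(\<integral>y. bump r (y::'a::euclidean_space) \<partial>lborel) > 0"
proof -
  obtain D where D: "C1_supp (cball 0 r) (bump r :: 'a \<Rightarrow> real) D" using bump_C1_supp[OF assms] by blast
  have int: "integrable lborel (bump r :: 'a \<Rightarrow> real)"
    by (rule integrable_continuous_compact_supp[OF C1_suppD(4,1,5)[OF D]])
  have "(\<integral>y. bump r (y::'a) \<partial>lborel) \<noteq> 0"
  proof
    assume "(\<integral>y. bump r (y::'a) \<partial>lborel) = 0"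
    then have "AE x in lborel. bump r (x::'a) = 0"
      using integral_nonneg_eq_0_iff_AE[OF int] bump_nonneg by auto
    then have "AE x in lborel. (x::'a) \<notin> ball 0 r"
      by eventually_elim (use bump_pos_iff[OF assms] in force)
    then have "emeasure lborel (ball (0::'a) r) = 0"
      by (subst (asm) AE_iff_measurable[of "ball 0 r"]) auto
    then have "negligible (ball (0::'a) r)"
      by (simp add: negligible_iff_null_sets null_sets_def)
    then show False using assms open_not_negligible[of "ball (0::'a) r"] by simp
  qed
  then show ?thesis
    using Bochner_Integration.integral_nonneg[of lborel "bump r :: 'a \<Rightarrow> real", OF bump_nonneg] by linarith
qed

lemma mollifier_props:
  assumes "r > 0"
  shows "mollifier r (x::'a::euclidean_space) \<ge> 0" "(\<integral>y. mollifier r (y::'a) \<partial>lborel) = 1"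
    "\<exists>D. C1_supp (cball 0 r) (mollifier r :: 'a \<Rightarrow> real) D"
    "smooth_on U (\<lambda>y. mollifier r (y - x))"
    "mollifier r (- x) = mollifier r x"
proof -
  show "mollifier r x \<ge> 0"
    using integral_bump_pos[OF assms] bump_nonneg[of r x]
    by (simp add: mollifier_def bump_nonneg less_imp_le)
  show "(\<integral>y. mollifier r (y::'a) \<partial>lborel) = 1"
    using integral_bump_pos[OF assms, where ?'a = 'a] by (simp add: mollifier_def)
  show "\<exists>D. C1_supp (cball 0 r) (mollifier r :: 'a \<Rightarrow> real) D"
    using bump_C1_supp[OF assms, where ?'a = 'a] C1_supp_cmult[where ?'a = 'a]
    unfolding mollifier_def by blast
  show "smooth_on U (\<lambda>y. mollifier r (y - x))"
    unfolding mollifier_def by (rule bump_smooth)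
  show "mollifier r (- x) = mollifier r x" by (simp add: mollifier_def bump_def)
qed

lemma mollifier_cont: "r > 0 \<Longrightarrow> continuous_on UNIV (mollifier r)"
  using mollifier_props(3) C1_suppD(4) by blast

lemma mollifier_measurable [measurable]:
  "mollifier r \<in> borel_measurable borel"
proof (cases "r > 0")
  case False
  have "continuous_on UNIV (\<lambda>x::'a. bump r x)"
    using C1_gradD(3) smooth_on_imp_C1_grad[OF bump_smooth[of UNIV 1 r 0]] by fastforce
  then show ?thesis
    unfolding mollifier_def by (intro borel_measurable_continuous_onI continuous_intros) auto
qed (use mollifier_cont in \<open>blast intro: borel_measurable_continuous_onI\<close>)

lemma mollifier_zero: "r > 0 \<Longrightarrow> norm x > r \<Longrightarrow> mollifier r x = 0"
  using mollifier_props(3)[of r] C1_suppD(5)[of "cball 0 r" "mollifier r" _ x] by (auto simp: dist_norm)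

lemma mollifier_integrable: "r > 0 \<Longrightarrow> integrable lborel (mollifier r)"
  using mollifier_props(3)[of r] integrable_continuous_compact_supp C1_suppD(4,1,5) by metis

lemma mollifier_translate:
  assumes "r > 0"
  shows "integrable lborel (\<lambda>x::'a::euclidean_space. mollifier r (x - y))"
    "(\<integral>x. mollifier r (x - y :: 'a) \<partial>lborel) = 1"
    "integrable lborel (\<lambda>x::'a. mollifier r (y - x))"
    "(\<integral>x. mollifier r (y - x :: 'a) \<partial>lborel) = 1"
proof -
  show 1: "integrable lborel (\<lambda>x::'a. mollifier r (x - y))"
    using lborel_integrable_translate[OF mollifier_integrable[OF assms], of "- y"] by simp
  show 2: "(\<integral>x. mollifier r (x - y :: 'a) \<partial>lborel) = 1"
    using lborel_integral_translate[OF mollifier_measurable[where ?'a = 'a], of r "- y"] mollifier_props(2)[OF assms, where ?'a = 'a]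
    by simp
  have "mollifier r (y - x) = mollifier r (x - y)" for x :: 'a
    using mollifier_props(5)[OF assms, of "x - y"] by simp
  then show "integrable lborel (\<lambda>x::'a. mollifier r (y - x))"
    "(\<integral>x. mollifier r (y - x :: 'a) \<partial>lborel) = 1"
    using 1 2 by auto
qed

section \<open>Approximation in L1 by continuous functions and by convolution\<close>

lemma AE_lebesgue_iff: "(AE x in lebesgue. P x) \<longleftrightarrow> (AE x in lborel. P x)"
  by (rule AE_completion_iff)

text \<open>Two approximations by dominated convergence: \<open>f\<close> by its truncations
  \<open>F k\<close> in height and in space, then a truncation by continuous functions that converge
  to it almost everywhere.\<close>

lemma L1_approx_continuous:
  fixes f :: "'a::euclidean_space \<Rightarrow> real"
  assumes f: "integrable lborel f" and e: "e > 0"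
  obtains g S where "continuous_on UNIV g" "compact S" "\<And>x. x \<notin> S \<Longrightarrow> g x = 0"
    "(\<integral>x. \<bar>f x - g x\<bar> \<partial>lborel) < e"
proof -
  have fm [measurable]: "f \<in> borel_measurable borel" using f by auto
  define F where "F k x = max (- real k) (min (real k) (f x)) * indicator (cball 0 (real k)) x" for k x
  have Fm [measurable]: "F k \<in> borel_measurable borel" for k
    unfolding F_def by (intro borel_measurable_times borel_measurable_indicator) auto
  have "(\<lambda>k. \<integral>x. \<bar>f x - F k x\<bar> \<partial>lborel) \<longlonglongrightarrow> (\<integral>x. 0 \<partial>(lborel :: 'a measure))"
  proof (rule integral_dominated_convergence[where w = "\<lambda>x. 2 * \<bar>f x\<bar>"])
    show "AE x in lborel. (\<lambda>k. \<bar>f x - F k x\<bar>) \<longlonglongrightarrow> 0"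
    proof (intro AE_I2 tendsto_eventually)
      fix x :: 'a
      obtain N where N: "real N \<ge> \<bar>f x\<bar> + norm x" using real_arch_simple by blast
      show "eventually (\<lambda>k. \<bar>f x - F k x\<bar> = 0) sequentially"
        using eventually_ge_at_top[of N]
      proof eventually_elim
        case (elim k)
        then have "real k \<ge> real N" by simp
        with N have "norm x \<le> real k" "\<bar>f x\<bar> \<le> real k" using norm_ge_zero[of x] by linarith+
        then show ?case by (auto simp: F_def max_def min_def indicator_def)
      qed
    qed
    show "AE x in lborel. norm \<bar>f x - F k x\<bar> \<le> 2 * \<bar>f x\<bar>" for k
      by (intro AE_I2) (auto simp: F_def max_def min_def indicator_def)
  qed (use f Fm in auto)
  then have "(\<lambda>k. \<integral>x. \<bar>f x - F k x\<bar> \<partial>lborel) \<longlonglongrightarrow> 0" by simp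
  from order_tendstoD(2)[OF this, of "e / 2"] e obtain k where
    k: "(\<integral>x. \<bar>f x - F k x\<bar> \<partial>lborel) < e / 2"
    by (auto simp: eventually_sequentially)
  have "F k \<in> borel_measurable lebesgue" using Fm by (simp add: borel_measurable_if_I measurable_completion)
  then have "F k measurable_on UNIV"
    by (intro lebesgue_measurable_imp_measurable_on_real) auto
  then obtain N g where N: "negligible N" and gc: "\<And>n. continuous_on UNIV (g n)"
    and gl: "\<And>x. x \<notin> N \<Longrightarrow> (\<lambda>n. g n x) \<longlonglongrightarrow> F k x"
    unfolding measurable_on_def by auto
  \<comment> \<open>The continuous functions \<open>g n\<close> converge almost everywhere but
    without a majorant. Clipping them at height \<open>k\<close> and multiplying by \<open>c\<close>
    makes them dominated and compactly supported, and leaves the limit alone because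
    \<open>F k\<close> is bounded by \<open>k\<close> and vanishes where \<open>c\<close> differs
    from 1.\<close>
  define c where "c x = max 0 (min 1 (real k + 1 - norm x))" for x :: 'a
  define h where "h n x = max (- real k) (min (real k) (g n x)) * c x" for n x
  have hc: "continuous_on UNIV (h n)" for n
    unfolding h_def c_def by (intro continuous_intros gc)
  have h0: "h n x = 0" if "x \<notin> cball 0 (real k + 1)" for n x
    using that by (auto simp: h_def c_def)
  have Fb: "\<bar>F k x\<bar> \<le> real k" for x by (auto simp: F_def max_def min_def indicator_def)
  have Fz: "F k x = 0" if "x \<notin> cball 0 (real k)" for x
    using that by (auto simp: F_def)
  have "(\<lambda>n. \<integral>x. \<bar>F k x - h n x\<bar> \<partial>lborel) \<longlonglongrightarrow> (\<integral>x. 0 \<partial>(lborel :: 'a measure))"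
  proof (rule integral_dominated_convergence[where w = "\<lambda>x. (2 * real k) * indicator (cball 0 (real k + 1)) x"])
    have "AE x in lborel. x \<notin> N"
      using N unfolding AE_lebesgue_iff[symmetric]
      by (simp add: negligible_iff_null_sets AE_not_in)
    then show "AE x in lborel. (\<lambda>n. \<bar>F k x - h n x\<bar>) \<longlonglongrightarrow> 0"
    proof eventually_elim
      case (elim x)
      have "(\<lambda>n. \<bar>F k x - h n x\<bar>) \<longlonglongrightarrow> \<bar>F k x - max (- real k) (min (real k) (F k x)) * c x\<bar>"
        unfolding h_def by (intro tendsto_intros gl elim)
      moreover have "max (- real k) (min (real k) (F k x)) * c x = F k x"
        using Fb[of x] Fz[of x] by (cases "x \<in> cball 0 (real k)") (auto simp: c_def max_def min_def)
      ultimately show ?case by simp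
    qed
    show "AE x in lborel. norm \<bar>F k x - h n x\<bar> \<le> 2 * real k * indicator (cball 0 (real k + 1)) x" for n
    proof (intro AE_I2)
      fix x :: 'a
      have "0 \<le> c x" "c x \<le> 1" by (auto simp: c_def)
      then have "\<bar>h n x\<bar> \<le> real k * 1"
        unfolding h_def abs_mult by (intro mult_mono) auto
      then show "norm \<bar>F k x - h n x\<bar> \<le> 2 * real k * indicator (cball 0 (real k + 1)) x"
        using Fb[of x] Fz[of x] h0[of x n] by (auto simp: indicator_def)
    qed
    show "integrable lborel (\<lambda>x. (2 * real k) * indicator (cball 0 (real k + 1)) x)"
      by (intro integrable_mult_right integrable_indicator_compact) auto
    show "(\<lambda>x. \<bar>F k x - h n x\<bar>) \<in> borel_measurable lborel" for n
      using borel_measurable_continuous_onI[OF hc[of n]] by auto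
  qed auto
  then have "(\<lambda>n. \<integral>x. \<bar>F k x - h n x\<bar> \<partial>lborel) \<longlonglongrightarrow> 0" by simp
  from order_tendstoD(2)[OF this, of "e / 2"] e obtain n where
    n: "(\<integral>x. \<bar>F k x - h n x\<bar> \<partial>lborel) < e / 2"
    by (auto simp: eventually_sequentially)
  have iF: "integrable lborel (F k)"
    by (rule integrable_compact_bounded[of _ "cball 0 (real k)" "real k"]) (use Fb Fz in auto)
  have ih: "integrable lborel (h n)"
    by (rule integrable_continuous_compact_supp[OF hc compact_cball h0])
  have "(\<integral>x. \<bar>f x - h n x\<bar> \<partial>lborel) \<le> (\<integral>x. \<bar>f x - F k x\<bar> + \<bar>F k x - h n x\<bar> \<partial>lborel)"
    by (rule integral_mono) (use f iF ih in auto)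
  also have "\<dots> = (\<integral>x. \<bar>f x - F k x\<bar> \<partial>lborel) + (\<integral>x. \<bar>F k x - h n x\<bar> \<partial>lborel)"
    by (rule Bochner_Integration.integral_add) (use f iF ih in auto)
  also have "\<dots> < e" using k n by simp
  finally show ?thesis
    by (intro that[of "h n" "cball 0 (real k + 1)"] hc h0) auto
qed

definition mollify :: "real \<Rightarrow> ('a::euclidean_space \<Rightarrow> real) \<Rightarrow> 'a \<Rightarrow> real" where
  "mollify r f x = (\<integral>y. f y * mollifier r (x - y) \<partial>lborel)"

lemma mollify_integrand_integrable:
  fixes f :: "'a::euclidean_space \<Rightarrow> real"
  assumes r: "r > 0" and f: "integrable lborel f"
  shows "integrable lborel (\<lambda>y. f y * mollifier r (x - y))"
proof -
  obtain D where D: "C1_supp (cball 0 r) (mollifier r :: 'a \<Rightarrow> real) D" using mollifier_props(3)[OF r] by blast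
  obtain C where C: "C \<ge> 0" "\<And>x::'a. \<bar>mollifier r x\<bar> \<le> C" using C1_supp_bound[OF D] by metis
  have [measurable]: "f \<in> borel_measurable borel" using f by auto
  show ?thesis
  proof (rule Bochner_Integration.integrable_bound)
    show "integrable lborel (\<lambda>y. C * f y)" using f by auto
    show "AE y in lborel. norm (f y * mollifier r (x - y)) \<le> norm (C * f y)"
      using mult_left_mono[OF C(2)[of "x - _"], of "\<bar>f _\<bar>"] C(1) by (intro AE_I2) (simp add: abs_mult mult.commute)
  qed measurable
qed

text \<open>Fubini: for each fixed \<open>y\<close> the kernel is nonnegative with unit mass in
  \<open>x\<close>, so convolution is a contraction of L1.\<close>

lemma mollify_L1:
  fixes f :: "'a::euclidean_space \<Rightarrow> real"
  assumes r: "r > 0" and f: "integrable lborel f"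
  shows "integrable lborel (mollify r f)" "(\<integral>x. \<bar>mollify r f x\<bar> \<partial>lborel) \<le> (\<integral>x. \<bar>f x\<bar> \<partial>lborel)"
proof -
  have [measurable]: "f \<in> borel_measurable borel" using f by auto
  interpret lborel_pair: pair_sigma_finite "lborel :: 'a measure" "lborel :: 'a measure" ..
  let ?h = "\<lambda>(y, x). f y * mollifier r (x - y)"
  have nn: "(\<integral>x. norm (?h (y, x)) \<partial>lborel) = \<bar>f y\<bar>" for y
    using mollifier_translate(2)[OF r, of y] by (simp add: abs_mult abs_of_nonneg[OF mollifier_props(1)[OF r]])
  have ih: "integrable (lborel \<Otimes>\<^sub>M lborel) ?h"
  proof (rule lborel_pair.Fubini_integrable)
    show "integrable lborel (\<lambda>y. \<integral>x. norm (?h (y, x)) \<partial>lborel)" unfolding nn using f by simp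
    show "AE y in lborel. integrable lborel (\<lambda>x. ?h (y, x))"
      using mollifier_translate(1)[OF r] by auto
  qed measurable
  have ihn: "integrable (lborel \<Otimes>\<^sub>M lborel) (\<lambda>(y, x). \<bar>f y * mollifier r (x - y)\<bar>)"
    using integrable_norm[OF ih] by (simp add: case_prod_beta')
  show 1: "integrable lborel (mollify r f)"
    using lborel_pair.integrable_snd[OF ih] unfolding mollify_def by simp
  have "(\<integral>x. \<bar>mollify r f x\<bar> \<partial>lborel) \<le> (\<integral>x. (\<integral>y. \<bar>f y * mollifier r (x - y)\<bar> \<partial>lborel) \<partial>lborel)"
  proof (rule integral_mono)
    show "integrable lborel (\<lambda>x. \<integral>y. \<bar>f y * mollifier r (x - y)\<bar> \<partial>lborel)"
      using lborel_pair.integrable_snd[OF ihn] by simp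
    show "\<bar>mollify r f x\<bar> \<le> (\<integral>y. \<bar>f y * mollifier r (x - y)\<bar> \<partial>lborel)" for x
      unfolding mollify_def by (rule integral_abs_bound)
  qed (use 1 in auto)
  also have "\<dots> = (\<integral>y. (\<integral>x. \<bar>f y * mollifier r (x - y)\<bar> \<partial>lborel) \<partial>lborel)"
    using lborel_pair.Fubini_integral[OF ihn] by simp
  also have "\<dots> = (\<integral>y. \<bar>f y\<bar> \<partial>lborel)" using nn by simp
  finally show "(\<integral>x. \<bar>mollify r f x\<bar> \<partial>lborel) \<le> (\<integral>x. \<bar>f x\<bar> \<partial>lborel)" .
qed

lemma mollify_diff_pointwise:
  fixes f :: "'a::euclidean_space \<Rightarrow> real"
  assumes r: "r > 0" and f: "integrable lborel f"
    and e: "\<And>y. norm (x - y) \<le> r \<Longrightarrow> \<bar>f y - f x\<bar> \<le> e"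
  shows "\<bar>mollify r f x - f x\<bar> \<le> e"
proof -
  have "mollify r f x - f x = (\<integral>y. f y * mollifier r (x - y) \<partial>lborel) - (\<integral>y. f x * mollifier r (x - y) \<partial>lborel)"
    using mollifier_translate(4)[OF r, of x] by (simp add: mollify_def)
  also have "\<dots> = (\<integral>y. (f y - f x) * mollifier r (x - y) \<partial>lborel)"
    using mollify_integrand_integrable[OF r f, of x] mollifier_translate(3)[OF r, of x]
    by (subst Bochner_Integration.integral_diff[symmetric]) (auto simp: algebra_simps)
  finally have eq: "mollify r f x - f x = (\<integral>y. (f y - f x) * mollifier r (x - y) \<partial>lborel)" .
  have int: "integrable lborel (\<lambda>y. (f y - f x) * mollifier r (x - y))"
    using mollify_integrand_integrable[OF r f, of x] mollifier_translate(3)[OF r, of x]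
    by (simp add: left_diff_distrib)
  have "\<bar>mollify r f x - f x\<bar> \<le> (\<integral>y. \<bar>(f y - f x) * mollifier r (x - y)\<bar> \<partial>lborel)"
    unfolding eq by (rule integral_abs_bound)
  also have "\<dots> \<le> (\<integral>y. e * mollifier r (x - y) \<partial>lborel)"
  proof (rule integral_mono)
    show "\<bar>(f y - f x) * mollifier r (x - y)\<bar> \<le> e * mollifier r (x - y)" for y
      using e[of y] mollifier_zero[OF r, of "x - y"] mollifier_props(1)[OF r, of "x - y"]
      by (cases "norm (x - y) \<le> r") (auto simp: abs_mult intro!: mult_right_mono)
  qed (use int mollifier_translate(3)[OF r, of x] in auto)
  also have "\<dots> = e" using mollifier_translate(4)[OF r, of x] by simp
  finally show ?thesis .
qed

text \<open>For a continuous function of compact support the convergence is uniform; the contraction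
  property carries it to all of L1 with an error split in three.\<close>

lemma mollify_tendsto_L1:
  fixes f :: "'a::euclidean_space \<Rightarrow> real"
  assumes f: "integrable lborel f" and e: "e > 0"
  shows "\<exists>r0>0. \<forall>r. 0 < r \<and> r < r0 \<longrightarrow> (\<integral>x. \<bar>mollify r f x - f x\<bar> \<partial>lborel) < e"
proof -
  obtain g S where g: "continuous_on UNIV g" "compact S" "\<And>x. x \<notin> S \<Longrightarrow> g x = 0"
    "(\<integral>x. \<bar>f x - g x\<bar> \<partial>lborel) < e / 3"
    using L1_approx_continuous[OF f, of "e / 3"] e by auto
  have ig: "integrable lborel g" by (rule integrable_continuous_compact_supp[OF g(1-3)])
  define K where "K = {x + y |x y. x \<in> S \<and> y \<in> cball (0::'a) 1}"
  have K: "compact K" unfolding K_def by (rule compact_cball_sum[OF g(2)])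
  \<comment> \<open>\<open>K\<close> contains all points where \<open>g\<close> or its mollification
    can be nonzero, \<open>K2\<close> all points that are compared with those; uniform continuity is
    used on \<open>K2\<close>.\<close>
  define K2 where "K2 = {x + y |x y. x \<in> K \<and> y \<in> cball (0::'a) 1}"
  have K2: "compact K2" unfolding K2_def by (rule compact_cball_sum[OF K])
  define m where "m = measure lborel K + 1"
  have m: "m > 0" by (simp add: m_def add_nonneg_pos)
  have "uniformly_continuous_on K2 g"
    using g(1) K2 compact_uniformly_continuous continuous_on_subset by blast
  then obtain d where d: "d > 0" "\<And>x y. x \<in> K2 \<Longrightarrow> y \<in> K2 \<Longrightarrow> dist y x < d \<Longrightarrow> dist (g y) (g x) < e / (3 * m)"
    unfolding uniformly_continuous_on_def using e m by (metis divide_pos_pos mult_pos_pos zero_less_numeral)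
  have KK2: "x \<in> K2" if "x \<in> K" for x
    using that unfolding K2_def by (intro CollectI exI[of _ x] exI[of _ 0]) auto
  show ?thesis
  proof (intro exI[of _ "min d 1"] conjI allI impI)
    fix r :: real assume "0 < r \<and> r < min d 1"
    then have r: "r > 0" "r < d" "r < 1" by auto
    have out: "mollify r g x = 0 \<and> g x = 0" if x: "x \<notin> K" for x
    proof
      have xs: "y \<notin> S" if "norm (x - y) \<le> 1" for y
      proof
        assume "y \<in> S"
        moreover have "x - y \<in> cball 0 1" using that by simp
        ultimately have "y + (x - y) \<in> K" unfolding K_def by blast
        then show False using x by simp
      qed
      have "g y * mollifier r (x - y) = 0" for y
        using xs[of y] g(3)[of y] mollifier_zero[OF r(1), of "x - y"] r(3) by (cases "norm (x - y) \<le> 1") auto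
      then show "mollify r g x = 0" unfolding mollify_def by (simp only: integral_zero)
      show "g x = 0" using xs[of x] g(3) by auto
    qed
    have "\<bar>mollify r g x - g x\<bar> \<le> e / (3 * m)" if x: "x \<in> K" for x
    proof (rule mollify_diff_pointwise[OF r(1) ig])
      fix y assume y: "norm (x - y) \<le> r"
      have "y - x \<in> cball 0 1" using y r by (simp add: norm_minus_commute)
      then have "x + (y - x) \<in> K2" using x unfolding K2_def by blast
      then have "y \<in> K2" by simp
      with d(2)[OF KK2[OF x] this] y r show "\<bar>g y - g x\<bar> \<le> e / (3 * m)"
        by (simp add: dist_norm norm_minus_commute)
    qed
    then have b: "\<bar>mollify r g x - g x\<bar> \<le> e / (3 * m) * indicator K x" for x
      using out[of x] by (cases "x \<in> K") auto
    have "(\<integral>x. \<bar>mollify r g x - g x\<bar> \<partial>lborel) \<le> (\<integral>x. e / (3 * m) * indicator K x \<partial>lborel)"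
      by (rule integral_mono) (use b mollify_L1[OF r(1) ig] ig integrable_indicator_compact[OF K] in auto)
    also have "\<dots> = e / (3 * m) * measure lborel K"
      using K by (simp add: borel_compact)
    also have "\<dots> < e / 3"
    proof -
      have "measure lborel K < m" by (simp add: m_def)
      then show ?thesis using e m by (simp add: field_simps)
    qed
    finally have 2: "(\<integral>x. \<bar>mollify r g x - g x\<bar> \<partial>lborel) < e / 3" .
    have ifg: "integrable lborel (\<lambda>x. f x - g x)" using f ig by auto
    have 1: "(\<integral>x. \<bar>mollify r (\<lambda>x. f x - g x) x\<bar> \<partial>lborel) < e / 3"
      using mollify_L1(2)[OF r(1) ifg] g(4) by simp
    have eq: "mollify r (\<lambda>x. f x - g x) x = mollify r f x - mollify r g x" for x
      unfolding mollify_def left_diff_distrib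
      by (rule Bochner_Integration.integral_diff) (use mollify_integrand_integrable[OF r(1)] f ig in auto)
    note I = mollify_L1(1)[OF r(1) f] mollify_L1(1)[OF r(1) ig] f ig
    have "(\<integral>x. \<bar>mollify r f x - f x\<bar> \<partial>lborel) \<le>
      (\<integral>x. \<bar>mollify r (\<lambda>x. f x - g x) x\<bar> + (\<bar>mollify r g x - g x\<bar> + \<bar>f x - g x\<bar>) \<partial>lborel)"
      by (rule integral_mono) (use I in \<open>auto simp: eq\<close>)
    also have "\<dots> = (\<integral>x. \<bar>mollify r (\<lambda>x. f x - g x) x\<bar> \<partial>lborel) + ((\<integral>x. \<bar>mollify r g x - g x\<bar> \<partial>lborel)
        + (\<integral>x. \<bar>f x - g x\<bar> \<partial>lborel))"
      using I by (simp add: eq)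
    also have "\<dots> < e" using 1 2 g(4) by simp
    finally show "(\<integral>x. \<bar>mollify r f x - f x\<bar> \<partial>lborel) < e" .
  qed (use d in auto)
qed

text \<open>The gradient is prescribed from outside by its integral formula, because in
  \<open>weak_gradient_approx\<close> it is the mollified weak gradient. Uniform continuity of
  \<open>Dm\<close> yields both the continuity of \<open>Df\<close> and the differentiation under
  the integral sign.\<close>

lemma mollify_C1:
  fixes f :: "'a::euclidean_space \<Rightarrow> real"
  assumes r: "r > 0" and f: "integrable lborel f" and D: "C1_supp (cball 0 r) (mollifier r) Dm"
    and Df: "\<And>x i. i \<in> Basis \<Longrightarrow> Df x \<bullet> i = (\<integral>y. f y * (Dm (x - y) \<bullet> i) \<partial>lborel)"
  shows "C1_grad UNIV (mollify r f) Df"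
proof -
  have [measurable]: "f \<in> borel_measurable borel" using f by auto
  note DD = C1_suppD[OF D]
  obtain C where C: "C \<ge> 0" "\<And>x. norm (Dm x) \<le> C" using C1_supp_bound[OF D] by metis
  have Dmm [measurable]: "Dm \<in> borel_measurable borel" using DD(3) by (rule borel_measurable_continuous_onI)
  define I where "I = (\<integral>y. \<bar>f y\<bar> \<partial>lborel) + 1"
  have I: "I > 0" by (simp add: I_def add_nonneg_pos)
  have uc: "uniformly_continuous_on UNIV Dm"
  proof -
    have 1: "uniformly_continuous_on (cball 0 (r + 1)) Dm"
      by (rule compact_uniformly_continuous[OF continuous_on_subset[OF DD(3)]]) auto
    show ?thesis unfolding uniformly_continuous_on_def
    proof (intro allI impI)
      fix e :: real assume e: "e > 0"
      obtain d where d: "d > 0" "\<And>x y. x \<in> cball 0 (r+1) \<Longrightarrow> y \<in> cball 0 (r+1) \<Longrightarrow> dist y x < d \<Longrightarrow> dist (Dm y) (Dm x) < e"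
        using 1 e unfolding uniformly_continuous_on_def by metis
      have "dist (Dm y) (Dm x) < e" if xy: "dist y x < min d 1" for x y
      proof (cases "x \<in> cball 0 (r+1) \<and> y \<in> cball 0 (r+1)")
        case True then show ?thesis using d(2) xy by auto
      next
        case False
        have "x \<notin> cball 0 r" "y \<notin> cball 0 r"
          using False xy norm_triangle_ineq2[of x y] norm_triangle_ineq2[of y x]
          by (auto simp: dist_norm norm_minus_commute)
        then show ?thesis using DD(6) e by simp
      qed
      then show "\<exists>d>0. \<forall>x\<in>UNIV. \<forall>x'\<in>UNIV. dist x' x < d \<longrightarrow> dist (Dm x') (Dm x) < e"
        using d(1) by (intro exI[of _ "min d 1"]) auto
    qed
  qed
  have int: "integrable lborel (\<lambda>y. f y * (Dm (x - y) \<bullet> h))" for x h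
  proof (rule Bochner_Integration.integrable_bound)
    show "integrable lborel (\<lambda>y. (C * norm h) * f y)" using f by auto
    show "AE y in lborel. norm (f y * (Dm (x - y) \<bullet> h)) \<le> norm ((C * norm h) * f y)"
    proof (intro AE_I2)
      fix y
      have "\<bar>Dm (x - y) \<bullet> h\<bar> \<le> C * norm h"
        using Cauchy_Schwarz_ineq2[of "Dm (x-y)" h] C(2)[of "x - y"] by (smt (verit) mult_right_mono norm_ge_zero)
      then have "\<bar>f y\<bar> * \<bar>Dm (x - y) \<bullet> h\<bar> \<le> \<bar>f y\<bar> * (C * norm h)" by (rule mult_left_mono) simp
      then show "norm (f y * (Dm (x - y) \<bullet> h)) \<le> norm ((C * norm h) * f y)"
        using C(1) by (simp add: abs_mult mult_ac)
    qed
  qed measurable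
  have Dfh: "Df x \<bullet> h = (\<integral>y. f y * (Dm (x - y) \<bullet> h) \<partial>lborel)" for x h
  proof -
    have "Df x \<bullet> h = (\<Sum>i\<in>Basis. (Df x \<bullet> i) * (h \<bullet> i))" by (rule euclidean_inner)
    also have "\<dots> = (\<Sum>i\<in>Basis. (\<integral>y. f y * (Dm (x - y) \<bullet> i) * (h \<bullet> i) \<partial>lborel))"
      using Df by (simp add: int)
    also have "\<dots> = (\<integral>y. (\<Sum>i\<in>Basis. f y * (Dm (x - y) \<bullet> i) * (h \<bullet> i)) \<partial>lborel)"
      by (rule Bochner_Integration.integral_sum[symmetric]) (use int in auto)
    also have "\<dots> = (\<integral>y. f y * (Dm (x - y) \<bullet> h) \<partial>lborel)"
      by (subst (2) euclidean_inner) (simp add: sum_distrib_left mult.assoc)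
    finally show ?thesis .
  qed
  have bnd: "\<bar>(\<integral>y. f y * g y \<partial>lborel)\<bar> \<le> b * I"
    if "b \<ge> 0" "\<And>y. \<bar>g y\<bar> \<le> b" "integrable lborel (\<lambda>y. f y * g y)" for g b
  proof -
    have "\<bar>(\<integral>y. f y * g y \<partial>lborel)\<bar> \<le> (\<integral>y. \<bar>f y * g y\<bar> \<partial>lborel)" by (rule integral_abs_bound)
    also have "\<dots> \<le> (\<integral>y. b * \<bar>f y\<bar> \<partial>lborel)"
    proof (rule integral_mono)
      show "\<bar>f y * g y\<bar> \<le> b * \<bar>f y\<bar>" for y
        using mult_right_mono[OF that(2)[of y], of "\<bar>f y\<bar>"] by (simp add: abs_mult mult.commute)
    qed (use f that(3) in auto)
    also have "\<dots> \<le> b * I" using that(1) by (auto simp: I_def intro!: mult_left_mono)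
    finally show ?thesis .
  qed
  have cont: "continuous_on UNIV Df"
  proof (subst continuous_on_componentwise, intro ballI, unfold continuous_on_iff, intro ballI allI impI)
    fix i :: 'a and x :: 'a and e :: real assume i: "i \<in> Basis" and e: "e > 0"
    obtain d where d: "d > 0" "\<And>x y. dist y x < d \<Longrightarrow> dist (Dm y) (Dm x) < e / (2 * I)"
      using uc e I unfolding uniformly_continuous_on_def by (metis UNIV_I divide_pos_pos mult_pos_pos zero_less_numeral)
    show "\<exists>d>0. \<forall>x'\<in>UNIV. dist x' x < d \<longrightarrow> dist (Df x' \<bullet> i) (Df x \<bullet> i) < e"
    proof (intro exI[of _ d] conjI ballI impI d(1))
      fix x' assume x': "dist x' x < d"
      have "Df x' \<bullet> i - Df x \<bullet> i = (\<integral>y. f y * (Dm (x' - y) \<bullet> i - Dm (x - y) \<bullet> i) \<partial>lborel)"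
        unfolding Dfh right_diff_distrib by (rule Bochner_Integration.integral_diff[symmetric]) (use int in auto)
      moreover have "\<bar>\<dots>\<bar> \<le> e / (2 * I) * I"
      proof (rule bnd)
        show "\<bar>Dm (x' - y) \<bullet> i - Dm (x - y) \<bullet> i\<bar> \<le> e / (2 * I)" for y
          using d(2)[of "x' - y" "x - y"] x' Basis_le_norm[OF i, of "Dm (x' - y) - Dm (x - y)"]
          by (simp add: dist_norm inner_diff_left)
        show "integrable lborel (\<lambda>y. f y * (Dm (x' - y) \<bullet> i - Dm (x - y) \<bullet> i))"
          unfolding right_diff_distrib using int by auto
      qed (use e I in auto)
      ultimately show "dist (Df x' \<bullet> i) (Df x \<bullet> i) < e" using e I by (simp add: dist_real_def)
    qed
  qed
  have "has_gradient (mollify r f) (Df x) x" for x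
    unfolding has_derivative_at_alt
  proof (intro conjI allI impI bounded_linear_inner_right)
    fix e :: real assume e: "e > 0"
    obtain d where d: "d > 0" "\<And>x y. dist y x < d \<Longrightarrow> dist (Dm y) (Dm x) < e / I"
      using uc e I unfolding uniformly_continuous_on_def by (metis UNIV_I divide_pos_pos)
    show "\<exists>d>0. \<forall>y. norm (y - x) < d \<longrightarrow>
        norm (mollify r f y - mollify r f x - Df x \<bullet> (y - x)) \<le> e * norm (y - x)"
    proof (intro exI[of _ d] conjI allI impI d(1))
      fix x' assume x': "norm (x' - x) < d"
      \<comment> \<open>The first-order Taylor remainder of the mollifier; by the mean value
        inequality it is at most \<open>e / I * norm (x' - x)\<close> uniformly in
        \<open>y\<close>.\<close>
      define g where "g y = mollifier r (x' - y) - mollifier r (x - y) - Dm (x - y) \<bullet> (x' - x)" for y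
      have gb: "\<bar>g y\<bar> \<le> e / I * norm (x' - x)" for y
      proof -
        let ?F = "\<lambda>z. mollifier r z - Dm (x - y) \<bullet> z"
        have "norm (?F (x' - y) - ?F (x - y)) \<le> e / I * norm ((x' - y) - (x - y))"
        proof (rule differentiable_bound[of "ball (x - y) d" ?F "\<lambda>z h. (Dm z - Dm (x - y)) \<bullet> h"])
          fix z assume z: "z \<in> ball (x - y) d"
          show "(?F has_derivative (\<lambda>h. (Dm z - Dm (x - y)) \<bullet> h)) (at z within ball (x - y) d)"
            unfolding inner_diff_left
            by (intro derivative_intros has_derivative_at_withinI[OF DD(2)])
          show "onorm (\<lambda>h. (Dm z - Dm (x - y)) \<bullet> h) \<le> e / I"
          proof (rule onorm_le)
            fix h
            have "norm (Dm z - Dm (x - y)) \<le> e / I" using d(2)[of z "x - y"] z by (simp add: dist_norm norm_minus_commute)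
            then show "norm ((Dm z - Dm (x - y)) \<bullet> h) \<le> e / I * norm h"
              using Cauchy_Schwarz_ineq2[of "Dm z - Dm (x-y)" h] mult_right_mono[of "norm (Dm z - Dm (x - y))" "e / I" "norm h"] by simp
          qed
        qed (use x' d in \<open>auto simp: dist_norm norm_minus_commute\<close>)
        then show ?thesis by (simp add: g_def inner_diff_right algebra_simps)
      qed
      have ig: "integrable lborel (\<lambda>y. f y * g y)"
        unfolding g_def right_diff_distrib using int mollify_integrand_integrable[OF r f] by auto
      have "mollify r f x' - mollify r f x - Df x \<bullet> (x' - x) = (\<integral>y. f y * g y \<partial>lborel)"
        unfolding g_def right_diff_distrib mollify_def Dfh
        using int mollify_integrand_integrable[OF r f] by simp
      moreover have "\<bar>(\<integral>y. f y * g y \<partial>lborel)\<bar> \<le> e / I * norm (x' - x) * I"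
        by (rule bnd[OF _ gb ig]) (use e I in auto)
      ultimately show "norm (mollify r f x' - mollify r f x - Df x \<bullet> (x' - x)) \<le> e * norm (x' - x)"
        using I by simp
    qed
  qed
  with cont show ?thesis by (auto simp: C1_grad_def)
qed

section \<open>Weak gradients\<close>

text \<open>The weak formulations integrate against the completed measure, while Fubini and
  translation are used for Borel functions; replacing \<open>f\<close> on \<open>S\<close> by a
  Borel function equal almost everywhere connects the two.\<close>

lemma lebesgue_borel_version:
  fixes f :: "'a::euclidean_space \<Rightarrow> real"
  assumes S: "S \<in> sets borel" and f: "set_integrable lebesgue S f"
  obtains g where "integrable lborel g" "\<And>x. x \<notin> S \<Longrightarrow> g x = 0" "AE x in lebesgue. g x = indicator S x * f x"
proof -
  have m: "(\<lambda>x. indicator S x * f x) \<in> borel_measurable (completion lborel)"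
    using f by (auto simp: set_integrable_def)
  obtain g where g: "g \<in> borel_measurable lborel" "AE x in lborel. indicator S x * f x = g x"
    using completion_ex_borel_measurable_real[OF m] by blast
  have S': "indicator S \<in> borel_measurable lborel" using S by auto
  define h where "h x = indicator S x * g x" for x
  have hm: "h \<in> borel_measurable lborel" unfolding h_def using g(1) S' by (intro borel_measurable_times) auto
  have ae: "AE x in lebesgue. h x = indicator S x * f x"
    unfolding AE_lebesgue_iff using g(2) by eventually_elim (auto simp: h_def indicator_def)
  have "integrable lebesgue h"
    by (rule integrable_cong_AE_imp[of _ "\<lambda>x. indicator S x * f x"])
       (use f ae hm in \<open>auto simp: set_integrable_def intro: measurable_completion\<close>)
  then have "integrable lborel h" using integrable_completion[OF hm] by simp
  then show ?thesis using that[of h] ae by (simp add: h_def)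
qed

text \<open>Only the product has to vanish off \<open>S\<close>: sometimes the function and
  sometimes the test factor carries the support.\<close>

lemma set_integral_test_eq:
  fixes f g h :: "'a::euclidean_space \<Rightarrow> real"
  assumes g: "integrable lborel g" "AE x in lebesgue. g x = indicator S x * f x"
    and SU: "S \<subseteq> U" and h: "h \<in> borel_measurable borel"
    and z: "\<And>x. x \<in> U \<Longrightarrow> x \<notin> S \<Longrightarrow> f x * h x = 0"
  shows "(LINT x:U|lebesgue. f x * h x) = (\<integral>x. g x * h x \<partial>lborel)"
proof -
  have gm: "g \<in> borel_measurable lborel" using g by auto
  have m: "(\<lambda>x. g x * h x) \<in> borel_measurable lborel" using gm h by auto
  have "(\<integral>x. g x * h x \<partial>lborel) = (\<integral>x. g x * h x \<partial>lebesgue)"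
    using integral_completion[OF m] by simp
  also have "\<dots> = (\<integral>x. indicator U x *\<^sub>R (f x * h x) \<partial>lebesgue)"
  proof (rule integral_cong_AE)
    show mm: "(\<lambda>x. g x * h x) \<in> borel_measurable lebesgue" using m by (rule measurable_completion)
    show ae: "AE x in lebesgue. g x * h x = indicator U x *\<^sub>R (f x * h x)"
      using g(2) by eventually_elim (use SU z in \<open>auto simp: indicator_def\<close>)
    show "(\<lambda>x. indicator U x *\<^sub>R (f x * h x)) \<in> borel_measurable lebesgue"
      by (rule borel_measurable_AE[OF mm ae])
  qed
  finally show ?thesis by (simp add: set_lebesgue_integral_def)
qed

text \<open>The fundamental lemma of the calculus of variations. A translated mollifier is a test
  function, so the mollifications of \<open>f\<close> vanish on a ball, while they converge to
  \<open>f\<close> in L1; countably many balls suffice.\<close>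

lemma locally_integrable_zero_AE:
  fixes f :: "'a::euclidean_space \<Rightarrow> real"
  assumes U: "open U" and f: "locally_integrable_on U f"
    and test: "\<And>\<phi> S. (\<And>W. smooth_on W \<phi>) \<Longrightarrow> compact S \<Longrightarrow> S \<subseteq> U \<Longrightarrow> (\<And>x. x \<notin> S \<Longrightarrow> \<phi> x = 0)
      \<Longrightarrow> (LINT x:U|lebesgue. f x * \<phi> x) = 0"
  shows "AE x in lebesgue. x \<in> U \<longrightarrow> f x = 0"
proof -
  have loc: "AE x in lborel. x \<in> ball c R \<longrightarrow> f x = 0" if R: "R > 0" and cR: "cball c (2 * R) \<subseteq> U" for c R
  proof -
    \<comment> \<open>The radius is doubled so that a mollifier of radius below \<open>R\<close>,
      centred in the ball of radius \<open>R\<close>, sees only points of \<open>?K\<close>, where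
      \<open>f\<close> agrees with its integrable Borel version.\<close>
    let ?K = "cball c (2 * R)"
    obtain g where g: "integrable lborel g" "\<And>x. x \<notin> ?K \<Longrightarrow> g x = 0" "AE x in lebesgue. g x = indicator ?K x * f x"
      using lebesgue_borel_version[of ?K f] f cR by (auto simp: locally_integrable_on_def)
    have zero: "mollify r g x = 0" if r: "0 < r" "r < R" and x: "x \<in> ball c R" for r x
    proof -
      have K: "cball x r \<subseteq> ?K"
      proof
        fix y assume "y \<in> cball x r"
        then show "y \<in> ?K" using x r dist_triangle[of c y x] by (simp add: dist_commute)
      qed
      have "(LINT y:U|lebesgue. f y * mollifier r (y - x)) = 0"
      proof (rule test[of _ "cball x r"])
        show "mollifier r (y - x) = 0" if "y \<notin> cball x r" for y
          using that mollifier_zero[OF r(1), of "y - x"] by (simp add: dist_norm norm_minus_commute)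
      qed (use mollifier_props(4)[OF r(1)] K cR in auto)
      moreover have "(LINT y:U|lebesgue. f y * mollifier r (y - x)) = (\<integral>y. g y * mollifier r (y - x) \<partial>lborel)"
      proof (rule set_integral_test_eq[OF g(1,3) cR])
        show "f y * mollifier r (y - x) = 0" if "y \<notin> ?K" for y
        proof -
          have "y \<notin> cball x r" using that K by auto
          then show ?thesis using mollifier_zero[OF r(1), of "y - x"] by (simp add: dist_norm norm_minus_commute)
        qed
        show "(\<lambda>y. mollifier r (y - x)) \<in> borel_measurable borel" by measurable
      qed
      moreover have "mollifier r (y - x) = mollifier r (x - y)" for y
        using mollifier_props(5)[OF r(1), of "x - y"] by simp
      ultimately show ?thesis by (simp add: mollify_def)
    qed
    have ib: "integrable lborel (\<lambda>x. indicator (ball c R) x * \<bar>g x\<bar>)"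
      using integrable_mult_indicator[of "ball c R" lborel "\<lambda>x. \<bar>g x\<bar>"] g(1) by simp
    have "(\<integral>x. indicator (ball c R) x * \<bar>g x\<bar> \<partial>lborel) \<le> 0"
    proof (rule field_le_epsilon)
      fix e :: real assume "e > 0"
      then obtain r0 where r0: "r0 > 0" "\<And>r. 0 < r \<Longrightarrow> r < r0 \<Longrightarrow> (\<integral>x. \<bar>mollify r g x - g x\<bar> \<partial>lborel) < e"
        using mollify_tendsto_L1[OF g(1)] by blast
      define r where "r = min r0 R / 2"
      have r: "0 < r" "r < r0" "r < R" using r0 R by (auto simp: r_def)
      have "(\<integral>x. indicator (ball c R) x * \<bar>g x\<bar> \<partial>lborel) \<le> (\<integral>x. \<bar>mollify r g x - g x\<bar> \<partial>lborel)"
      proof (rule integral_mono[OF ib])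
        show "indicator (ball c R) x * \<bar>g x\<bar> \<le> \<bar>mollify r g x - g x\<bar>" for x
          using zero[OF r(1,3), of x] by (cases "x \<in> ball c R") auto
      qed (use g(1) mollify_L1[OF r(1) g(1)] in auto)
      then show "(\<integral>x. indicator (ball c R) x * \<bar>g x\<bar> \<partial>lborel) \<le> 0 + e" using r0(2)[OF r(1,2)] by simp
    qed
    moreover have "(\<integral>x. indicator (ball c R) x * \<bar>g x\<bar> \<partial>lborel) \<ge> 0"
      by (rule Bochner_Integration.integral_nonneg) auto
    ultimately have "AE x in lborel. indicator (ball c R) x * \<bar>g x\<bar> = 0"
      using integral_nonneg_eq_0_iff_AE[OF ib] by auto
    with g(3) show ?thesis unfolding AE_lebesgue_iff
    proof eventually_elim
      case (elim x)
      show ?case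
      proof
        assume x: "x \<in> ball c R"
        then have "x \<in> ?K" using R by auto
        with elim x show "f x = 0" by (auto simp: indicator_def)
      qed
    qed
  qed
  define F where "F = {ball c R |c R. R > 0 \<and> cball c (2 * R) \<subseteq> U}"
  obtain F' where F': "F' \<subseteq> F" "countable F'" "\<Union>F' = \<Union>F"
    using Lindelof[of F] unfolding F_def by auto
  have UF: "U \<subseteq> \<Union>F"
  proof
    fix x assume "x \<in> U"
    then obtain e where "e > 0" "cball x e \<subseteq> U" using U open_contains_cball by blast
    then show "x \<in> \<Union>F" unfolding F_def by (intro UnionI[of "ball x (e/2)"] CollectI exI[of _ x] exI[of _ "e/2"]) auto
  qed
  have "AE x in lborel. \<forall>B\<in>F'. x \<in> B \<longrightarrow> f x = 0"
    using F' loc by (intro AE_ball_countable[THEN iffD2]) (auto simp: F_def)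
  then show ?thesis unfolding AE_lebesgue_iff
    by eventually_elim (use UF F' in auto)
qed

lemma C1_supp_of_smooth:
  assumes "\<And>W. smooth_on W \<phi>" "compact S" "\<And>x. x \<notin> S \<Longrightarrow> \<phi> x = 0"
  obtains D where "C1_supp S \<phi> D" "\<And>x i. frechet_derivative \<phi> (at x) i = D x \<bullet> i"
proof -
  obtain D where "C1_grad UNIV \<phi> D" using smooth_on_imp_C1_grad[OF assms(1)] by blast
  moreover from this have "frechet_derivative \<phi> (at x) = (\<lambda>i. D x \<bullet> i)" for x
    using frechet_derivative_at[of \<phi> _ x] by (metis C1_gradD(1) UNIV_I)
  ultimately show ?thesis using that[of D] assms by (auto simp: C1_supp_def)
qed

lemma locally_integrable_on_subset:
  "locally_integrable_on V f \<Longrightarrow> U \<subseteq> V \<Longrightarrow> locally_integrable_on U f"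
  unfolding locally_integrable_on_def by blast

lemma locally_integrable_on_inner:
  "locally_integrable_on U G \<Longrightarrow> locally_integrable_on U (\<lambda>x. G x \<bullet> i)"
  unfolding locally_integrable_on_def set_integrable_def
proof (intro allI impI)
  fix K assume "\<forall>K. compact K \<and> K \<subseteq> U \<longrightarrow> integrable lebesgue (\<lambda>x. indicat_real K x *\<^sub>R G x)"
    "compact K \<and> K \<subseteq> U"
  then have "integrable lebesgue (\<lambda>x. (indicat_real K x *\<^sub>R G x) \<bullet> i)"
    using integrable_inner_left[of i lebesgue "\<lambda>x. indicat_real K x *\<^sub>R G x"] by blast
  then show "integrable lebesgue (\<lambda>x. indicat_real K x *\<^sub>R (G x \<bullet> i))" by simp
qed

lemma compact_support_in_subset:
  assumes "compact S" "S \<subseteq> U" "\<And>x. x \<in> U \<Longrightarrow> x \<notin> S \<Longrightarrow> f x = 0"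
  shows "compact_support_in U f"
proof -
  have 1: "closure {x \<in> U. f x \<noteq> 0} \<subseteq> S"
    using assms by (intro closure_minimal compact_imp_closed) auto
  then have "compact (closure {x \<in> U. f x \<noteq> 0})"
    using compact_Int_closed[OF assms(1) closed_closure[of "{x \<in> U. f x \<noteq> 0}"]] by (simp add: Int_absorb1)
  with 1 assms(2) show ?thesis unfolding compact_support_in_def by blast
qed

lemma set_lebesgue_integral_restrict:
  assumes "U \<subseteq> V" "\<And>x. x \<in> V \<Longrightarrow> x \<notin> U \<Longrightarrow> f x = 0" "\<And>x. x \<in> U \<Longrightarrow> f x = g x"
  shows "(LINT x:V|M. f x) = (LINT x:U|M. g x)"
  unfolding set_lebesgue_integral_def
  by (rule Bochner_Integration.integral_cong) (use assms in \<open>auto simp: indicator_def\<close>)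

lemma weak_gradientD:
  assumes "weak_gradient U u G" "smooth_on U \<phi>" "compact_support_in U \<phi>" "i \<in> Basis"
  shows "(LINT x:U|lebesgue. u x * frechet_derivative \<phi> (at x) i) = - (LINT x:U|lebesgue. (G x \<bullet> i) * \<phi> x)"
  using assms unfolding weak_gradient_def by blast

text \<open>A test function on \<open>U\<close> is, after extension by zero, one on
  \<open>V\<close>, so the difference of the gradients is orthogonal to all of them. The form with
  two nested sets is what identifies the gradients postulated on the set where \<open>u\<close> is
  nonzero with those known on all of the domain.\<close>

lemma weak_gradient_unique:
  fixes f f' :: "'a::euclidean_space \<Rightarrow> real"
  assumes U: "open U" and UV: "U \<subseteq> V" and G: "weak_gradient U f G" and G': "weak_gradient V f' G'"
    and ff: "\<And>x. x \<in> U \<Longrightarrow> f x = f' x"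
  shows "AE x in lebesgue. x \<in> U \<longrightarrow> G x = G' x"
proof -
  have "AE x in lebesgue. x \<in> U \<longrightarrow> G x \<bullet> i - G' x \<bullet> i = 0" if i: "i \<in> Basis" for i
  proof (rule locally_integrable_zero_AE[OF U])
    have l: "locally_integrable_on U (\<lambda>x. G x \<bullet> i)" "locally_integrable_on U (\<lambda>x. G' x \<bullet> i)"
      using G G' UV by (auto simp: weak_gradient_def intro!: locally_integrable_on_inner intro: locally_integrable_on_subset)
    then show "locally_integrable_on U (\<lambda>x. G x \<bullet> i - G' x \<bullet> i)"
      by (auto simp: locally_integrable_on_def)
    fix \<phi> :: "'a \<Rightarrow> real" and S assume sm: "\<And>W. smooth_on W \<phi>" and S: "compact S" "S \<subseteq> U" and z: "\<And>x. x \<notin> S \<Longrightarrow> \<phi> x = 0"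
    obtain D where D: "C1_supp S \<phi> D" "\<And>x i. frechet_derivative \<phi> (at x) i = D x \<bullet> i"
      using C1_supp_of_smooth[OF sm S(1) z] by blast
    have c: "compact_support_in U \<phi>" "compact_support_in V \<phi>"
      using compact_support_in_subset[of S _ \<phi>] S z UV by auto
    have 1: "(LINT x:U|lebesgue. f x * (D x \<bullet> i)) = - (LINT x:U|lebesgue. (G x \<bullet> i) * \<phi> x)"
      using weak_gradientD[OF G sm c(1) i] by (simp add: D(2))
    have 2: "(LINT x:V|lebesgue. f' x * (D x \<bullet> i)) = - (LINT x:V|lebesgue. (G' x \<bullet> i) * \<phi> x)"
      using weak_gradientD[OF G' sm c(2) i] by (simp add: D(2))
    have Dz: "D x = 0" if "x \<notin> U" for x using C1_suppD(6)[OF D(1)] S that by blast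
    have 3: "(LINT x:V|lebesgue. f' x * (D x \<bullet> i)) = (LINT x:U|lebesgue. f x * (D x \<bullet> i))"
      by (rule set_lebesgue_integral_restrict[OF UV]) (use Dz ff in auto)
    have 4: "(LINT x:V|lebesgue. (G' x \<bullet> i) * \<phi> x) = (LINT x:U|lebesgue. (G' x \<bullet> i) * \<phi> x)"
      by (rule set_lebesgue_integral_restrict[OF UV]) (use z S in auto)
    have I: "set_integrable lebesgue U (\<lambda>x. h x * \<phi> x)" if h: "locally_integrable_on U h" for h :: "'a \<Rightarrow> real"
    proof -
      obtain C where C: "\<And>x. \<bar>\<phi> x\<bar> \<le> C" using C1_supp_bound[OF D(1)] by metis
      have hi: "integrable lebesgue (\<lambda>x. indicator S x * h x)"
        using h S by (auto simp: locally_integrable_on_def set_integrable_def)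
      have pm: "\<phi> \<in> borel_measurable lebesgue"
        using borel_measurable_continuous_onI[OF C1_suppD(4)[OF D(1)]] by (simp add: measurable_completion)
      have "integrable lebesgue (\<lambda>x. (indicator S x * h x) * \<phi> x)"
      proof (rule Bochner_Integration.integrable_bound)
        show "integrable lebesgue (\<lambda>x. C * (indicator S x * h x))" using hi by auto
        show "AE x in lebesgue. norm (indicator S x * h x * \<phi> x) \<le> norm (C * (indicator S x * h x))"
        proof (intro AE_I2)
          fix x
          have "\<bar>\<phi> x\<bar> \<le> \<bar>C\<bar>" using C[of x] by linarith
          then show "norm (indicator S x * h x * \<phi> x) \<le> norm (C * (indicator S x * h x))"
            using mult_right_mono[of "\<bar>\<phi> x\<bar>" "\<bar>C\<bar>" "\<bar>indicator S x * h x\<bar>"]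
            by (simp add: abs_mult mult_ac)
        qed
      qed (use hi pm in auto)
      moreover have "(indicator S x * h x) * \<phi> x = indicator U x *\<^sub>R (h x * \<phi> x)" for x
        using z[of x] S by (auto simp: indicator_def)
      ultimately show ?thesis unfolding set_integrable_def by simp
    qed
    have "(LINT x:U|lebesgue. (G x \<bullet> i - G' x \<bullet> i) * \<phi> x) = (LINT x:U|lebesgue. (G x \<bullet> i) * \<phi> x - (G' x \<bullet> i) * \<phi> x)"
      by (simp add: left_diff_distrib)
    also have "\<dots> = (LINT x:U|lebesgue. (G x \<bullet> i) * \<phi> x) - (LINT x:U|lebesgue. (G' x \<bullet> i) * \<phi> x)"
      by (rule set_integral_diff) (use I l in auto)
    finally show "(LINT x:U|lebesgue. (G x \<bullet> i - G' x \<bullet> i) * \<phi> x) = 0" using 1 2 3 4 by simp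
  qed
  then have "AE x in lebesgue. \<forall>i\<in>Basis. x \<in> U \<longrightarrow> G x \<bullet> i - G' x \<bullet> i = 0"
    by (subst AE_finite_all) auto
  then show ?thesis by eventually_elim (auto intro: euclidean_eqI)
qed

lemma weak_gradient_zero: "open U \<Longrightarrow> weak_gradient U (\<lambda>_. 0) (\<lambda>_. 0)"
  by (auto simp: weak_gradient_def locally_integrable_on_def set_integrable_def set_lebesgue_integral_def)

text \<open>Locality: on the open set \<open>U - S\<close> the function coincides with 0, and weak
  gradients are unique there.\<close>

lemma weak_gradient_supp_zero:
  assumes "open U" "weak_gradient U \<phi> G" "compact S" "\<And>x. x \<in> U \<Longrightarrow> x \<notin> S \<Longrightarrow> \<phi> x = 0"
  shows "AE x in lebesgue. x \<in> U \<longrightarrow> x \<notin> S \<longrightarrow> G x = 0"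
proof -
  have o: "open (U - S)" using assms by (simp add: compact_imp_closed open_Diff)
  have "AE x in lebesgue. x \<in> U - S \<longrightarrow> 0 = G x"
    by (rule weak_gradient_unique[OF o _ weak_gradient_zero[OF o] assms(2)]) (use assms in auto)
  then show ?thesis by eventually_elim auto
qed

text \<open>Mollification commutes with the weak gradient at points whose mollifier ball lies in
  \<open>U\<close>, and a compact support keeps all relevant points away from the boundary. The
  Borel versions are returned along with the approximation because the later estimates are over
  \<open>lborel\<close>.\<close>

lemma weak_gradient_approx:
  fixes \<phi> :: "'a::euclidean_space \<Rightarrow> real"
  assumes U: "open U" and G: "weak_gradient U \<phi> G" and S: "compact S" "S \<subseteq> U"
    and z: "\<And>x. x \<in> U \<Longrightarrow> x \<notin> S \<Longrightarrow> \<phi> x = 0"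
  obtains S' \<phi>' G' where "compact S'" "S' \<subseteq> U" "integrable lborel \<phi>'" "\<And>i. i \<in> Basis \<Longrightarrow> integrable lborel (\<lambda>x. G' x \<bullet> i)"
    "AE x in lebesgue. \<phi>' x = indicator U x * \<phi> x" "AE x in lebesgue. G' x = indicator U x *\<^sub>R G x"
    "\<And>x. x \<notin> S' \<Longrightarrow> \<phi>' x = 0"  "\<And>x. x \<notin> S' \<Longrightarrow> G' x = 0"
    "\<And>e. e > 0 \<Longrightarrow> \<exists>\<psi> D\<psi>. C1_supp S' \<psi> D\<psi> \<and> (\<integral>x. \<bar>\<psi> x - \<phi>' x\<bar> \<partial>lborel) < e \<and>
       (\<forall>i\<in>Basis. (\<integral>x. \<bar>D\<psi> x \<bullet> i - G' x \<bullet> i\<bar> \<partial>lborel) < e)"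
proof -
  have Sb: "S \<in> sets borel" using S by (simp add: borel_compact)
  have li: "locally_integrable_on U \<phi>" "\<And>i. locally_integrable_on U (\<lambda>x. G x \<bullet> i)"
    using G by (auto simp: weak_gradient_def intro: locally_integrable_on_inner)
  obtain f where f: "integrable lborel f" "\<And>x. x \<notin> S \<Longrightarrow> f x = 0" "AE x in lebesgue. f x = indicator S x * \<phi> x"
    using lebesgue_borel_version[OF Sb, of \<phi>] li S by (auto simp: locally_integrable_on_def)
  have "\<exists>g. integrable lborel g \<and> (\<forall>x. x \<notin> S \<longrightarrow> g x = 0) \<and> (AE x in lebesgue. g x = indicator S x * (G x \<bullet> i))" for i
    using lebesgue_borel_version[OF Sb, of "\<lambda>x. G x \<bullet> i"] li(2)[of i] S unfolding locally_integrable_on_def by metis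
  then obtain g where g: "\<And>i. integrable lborel (g i)" "\<And>i x. x \<notin> S \<Longrightarrow> g i x = 0"
    "\<And>i. AE x in lebesgue. g i x = indicator S x * (G x \<bullet> i)" by metis
  define G' where "G' x = (\<Sum>i\<in>Basis. g i x *\<^sub>R i)" for x
  have G'i: "G' x \<bullet> i = g i x" if "i \<in> Basis" for x i
    using that by (simp add: G'_def inner_sum_left inner_Basis if_distrib cong: if_cong)
  obtain d where d: "d > 0" "(\<Union>x\<in>S. cball x d) \<subseteq> U"
    using compact_subset_open_imp_cball_epsilon_subset[OF S(1) U S(2)] by blast
  \<comment> \<open>The closed \<open>d\<close>-neighbourhood of \<open>S\<close>. With
    \<open>2 * r < d\<close>, any ball of radius \<open>r\<close> that meets \<open>S\<close> lies
    inside it, and hence in \<open>U\<close>.\<close>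
  define S' where "S' = {x + y |x y. x \<in> S \<and> y \<in> cball (0::'a) d}"
  have S': "compact S'" unfolding S'_def by (rule compact_cball_sum[OF S(1)])
  have S'I: "x \<in> S'" if "y \<in> S" "norm (x - y) \<le> d" for x y
    unfolding S'_def using that by (intro CollectI exI[of _ y] exI[of _ "x - y"]) auto
  have S'U: "S' \<subseteq> U"
  proof
    fix x assume "x \<in> S'"
    then obtain a b where "x = a + b" "a \<in> S" "norm b \<le> d" unfolding S'_def by auto
    then have "x \<in> cball a d" by (simp add: dist_norm)
    then show "x \<in> U" using d(2) \<open>a \<in> S\<close> by blast
  qed
  have SS': "S \<subseteq> S'" using S'I[of _ ] d by force
  have Gz: "AE x in lebesgue. x \<in> U \<longrightarrow> x \<notin> S \<longrightarrow> G x = 0"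
    by (rule weak_gradient_supp_zero[OF U G S(1) z])
  have a1: "AE x in lebesgue. f x = indicator U x * \<phi> x"
    using f(3) by eventually_elim (use z S in \<open>auto simp: indicator_def\<close>)
  have "AE x in lebesgue. \<forall>i\<in>Basis. g i x = indicator S x * (G x \<bullet> i)"
    using g(3) by (subst AE_finite_all) auto
  with Gz have a2: "AE x in lebesgue. G' x = indicator U x *\<^sub>R G x"
  proof eventually_elim
    case (elim x)
    show ?case by (rule euclidean_eqI) (use elim S in \<open>auto simp: G'i indicator_def\<close>)
  qed
  have ap: "\<exists>\<psi> D\<psi>. C1_supp S' \<psi> D\<psi> \<and> (\<integral>x. \<bar>\<psi> x - f x\<bar> \<partial>lborel) < e \<and>
       (\<forall>i\<in>Basis. (\<integral>x. \<bar>D\<psi> x \<bullet> i - G' x \<bullet> i\<bar> \<partial>lborel) < e)" if e: "e > 0" for e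
  proof -
    obtain r1 where r1: "r1 > 0" "\<And>r. 0 < r \<Longrightarrow> r < r1 \<Longrightarrow> (\<integral>x. \<bar>mollify r f x - f x\<bar> \<partial>lborel) < e"
      using mollify_tendsto_L1[OF f(1) e] by blast
    have "\<forall>i. \<exists>r0>0. \<forall>r. 0 < r \<and> r < r0 \<longrightarrow> (\<integral>x. \<bar>mollify r (g i) x - g i x\<bar> \<partial>lborel) < e"
      using mollify_tendsto_L1[OF g(1) e] by blast
    then obtain R where R: "\<And>i. R i > 0" "\<And>i r. 0 < r \<Longrightarrow> r < R i \<Longrightarrow> (\<integral>x. \<bar>mollify r (g i) x - g i x\<bar> \<partial>lborel) < e"
      by metis
    define m where "m = Min (insert (d/2) (insert r1 (R ` Basis)))"
    define r where "r = m / 2"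
    have m: "0 < m" unfolding m_def using d r1 R by (subst Min_gr_iff) auto
    have mm: "m \<le> a" if "a \<in> insert (d/2) (insert r1 (R ` Basis))" for a
      unfolding m_def by (rule Min_le) (use that in auto)
    have "m \<le> d/2" "m \<le> r1" "\<And>i. i \<in> Basis \<Longrightarrow> m \<le> R i"
      using mm by blast+
    with m have r: "0 < r" "2 * r < d" "r < r1" "\<And>i. i \<in> Basis \<Longrightarrow> r < R i"
      unfolding r_def by (auto simp: field_simps) fastforce+
    obtain Dm where Dm: "C1_supp (cball 0 r) (mollifier r :: 'a \<Rightarrow> real) Dm" using mollifier_props(3)[OF r(1)] by blast
    \<comment> \<open>The mollifier is even. Oddness of its gradient converts derivatives in
      \<open>y\<close> of the translate centred at \<open>x\<close> into the kernel
      \<open>Dm (x - y)\<close> of the convolution.\<close>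
    have odd: "Dm (- x) = - Dm x" for x
    proof -
      have "((\<lambda>y::'a. - y) has_derivative (\<lambda>h. - h)) (at x)" by (auto intro!: derivative_eq_intros)
      from has_derivative_compose[OF this C1_suppD(2)[OF Dm, of "- x"]]
      have "has_gradient (\<lambda>y. mollifier r (- y)) (- Dm (- x)) x" by simp
      then have "has_gradient (mollifier r) (- Dm (- x)) x"
        using mollifier_props(5)[OF r(1), where ?'a = 'a] by simp
      then have "- Dm (- x) = Dm x" using C1_suppD(2)[OF Dm] has_gradient_unique by blast
      then show ?thesis by (metis minus_minus)
    qed
    have Dmb: "Dm \<in> borel_measurable borel" using C1_suppD(3)[OF Dm] by (rule borel_measurable_continuous_onI)
    define DF where "DF x = (\<Sum>i\<in>Basis. mollify r (g i) x *\<^sub>R i)" for x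
    have DFi: "DF x \<bullet> i = mollify r (g i) x" if "i \<in> Basis" for x i
      using that by (simp add: DF_def inner_sum_left inner_Basis if_distrib cong: if_cong)
    \<comment> \<open>If the ball of radius \<open>r\<close> about \<open>x\<close> misses
      \<open>S\<close>, both integrands vanish. Otherwise the ball is contained in \<open>U\<close>,
      and the translated mollifier is an admissible test function in the definition of the weak
      gradient.\<close>
    have key: "DF x \<bullet> i = (\<integral>y. f y * (Dm (x - y) \<bullet> i) \<partial>lborel)" if i: "i \<in> Basis" for x i
    proof (cases "\<exists>y\<in>S. norm (x - y) \<le> r")
      case False
      have "f y * (Dm (x - y) \<bullet> i) = 0 \<and> g i y * mollifier r (x - y) = 0" for y
      proof (cases "y \<in> S")
        case True
        then have "norm (x - y) > r" using False by force
        then show ?thesis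
          using C1_suppD(6)[OF Dm, of "x - y"] mollifier_zero[OF r(1), of "x - y"] by simp
      qed (use f(2) g(2) in auto)
      then show ?thesis unfolding DFi[OF i] mollify_def by (simp only: integral_zero simp_thms)
    next
      case True
      then obtain y0 where y0: "y0 \<in> S" "norm (x - y0) \<le> r" by auto
      have K: "cball x r \<subseteq> U"
      proof
        fix y assume "y \<in> cball x r"
        then have "norm (y - y0) \<le> d"
          using y0 r norm_triangle_ineq[of "y - x" "x - y0"] by (simp add: dist_norm norm_minus_commute)
        then show "y \<in> U" using S'I[OF y0(1)] S'U by auto
      qed
      let ?t = "\<lambda>y. mollifier r (y - x)"
      have ht: "has_gradient ?t (Dm (y - x)) y" for y
        using has_gradient_translate[of "mollifier r" "Dm (y - x)" y "- x"] C1_suppD(2)[OF Dm] by simp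
      then have fr: "frechet_derivative ?t (at y) i = Dm (y - x) \<bullet> i" for y
        using frechet_derivative_at[OF ht] by metis
      have tz: "?t y = 0" if "y \<notin> cball x r" for y
        using that mollifier_zero[OF r(1), of "y - x"] by (simp add: dist_norm norm_minus_commute)
      have "(LINT y:U|lebesgue. \<phi> y * (Dm (y - x) \<bullet> i)) = - (LINT y:U|lebesgue. (G y \<bullet> i) * ?t y)"
        using weak_gradientD[OF G mollifier_props(4)[OF r(1), of U x] compact_support_in_subset[OF _ K, of ?t] i] tz
        by (simp add: fr)
      moreover have "(LINT y:U|lebesgue. \<phi> y * (Dm (y - x) \<bullet> i)) = (\<integral>y. f y * (Dm (y - x) \<bullet> i) \<partial>lborel)"
        by (rule set_integral_test_eq[OF f(1,3) S(2)]) (use z Dmb in auto)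
      moreover have "(LINT y:U|lebesgue. (G y \<bullet> i) * ?t y) = (\<integral>y. g i y * ?t y \<partial>lborel)"
      proof (rule set_integral_test_eq[where S = S'])
        show "AE y in lebesgue. g i y = indicator S' y * (G y \<bullet> i)"
          using g(3)[of i] Gz by eventually_elim (use SS' S'U in \<open>auto simp: indicator_def\<close>)
        fix y assume y: "y \<in> U" "y \<notin> S'"
        have "norm (y - x) > r"
        proof (rule ccontr)
          assume "\<not> norm (y - x) > r"
          then have "norm (y - y0) \<le> d"
            using y0 r norm_triangle_ineq[of "y - x" "x - y0"] by simp
          then show False using S'I[OF y0(1)] y by auto
        qed
        then show "(G y \<bullet> i) * ?t y = 0" using mollifier_zero[OF r(1), of "y - x"] by simp
      qed (use g S'U in auto)
      moreover have "Dm (y - x) = - Dm (x - y)" "?t y = mollifier r (x - y)" for y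
        using odd[of "x - y"] mollifier_props(5)[OF r(1), of "x - y"] by auto
      ultimately show ?thesis unfolding DFi[OF i] mollify_def by simp
    qed
    have "C1_grad UNIV (mollify r f) DF"
      by (rule mollify_C1[OF r(1) f(1) Dm key])
    moreover have "mollify r f x = 0" if "x \<notin> S'" for x
    proof -
      have "f y * mollifier r (x - y) = 0" for y
        using f(2)[of y] S'I[of y x] that r mollifier_zero[OF r(1), of "x - y"] by (cases "y \<in> S"; force)
      then show ?thesis unfolding mollify_def by (simp only: integral_zero)
    qed
    ultimately have "C1_supp S' (mollify r f) DF" using S' by (auto simp: C1_supp_def)
    then show ?thesis using r r1(2) R(2)[OF r(1)] by (intro exI[of _ "mollify r f"] exI[of _ DF]) (auto simp: DFi G'i)
  qed
  have "f x = 0" "G' x = 0" if "x \<notin> S'" for x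
  proof -
    have "x \<notin> S" using that SS' by blast
    then show "f x = 0" "G' x = 0" using f(2) g(2) by (auto simp: G'_def)
  qed
  then show ?thesis
    by (intro that[OF S' S'U f(1) _ a1 a2 _ _ ap]) (use g in \<open>auto simp: G'i\<close>)
qed

section \<open>Weak limits of bounded sequences\<close>

text \<open>Midpoints are the only convex combinations that the parallelogram law calls for;
  \<open>n\<close> marks the tail from which the sequence elements are taken.\<close>

inductive_set midpoint_hull :: "(nat \<Rightarrow> 'a \<Rightarrow> real) \<Rightarrow> nat \<Rightarrow> ('a \<Rightarrow> real) set" for d n where
  base: "m \<ge> n \<Longrightarrow> d m \<in> midpoint_hull d n"
| mid: "f \<in> midpoint_hull d n \<Longrightarrow> g \<in> midpoint_hull d n \<Longrightarrow> (\<lambda>x. (f x + g x) / 2) \<in> midpoint_hull d n"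

lemma midpoint_hull_mono:
  assumes "f \<in> midpoint_hull d m" "n \<le> m"
  shows "f \<in> midpoint_hull d n"
  using assms by induction (auto intro: midpoint_hull.intros)

text \<open>A bounded sequence has a weak limit: elements of almost minimal L2-norm in the convex hulls
  of its tails are Cauchy in L2 by the parallelogram law.\<close>

lemma bounded_weak_limit:
  fixes d :: "nat \<Rightarrow> 'a::euclidean_space \<Rightarrow> real"
  assumes K: "compact K" and dm: "\<And>n. d n \<in> borel_measurable borel" and L: "L \<ge> 0"
    and db: "\<And>n x. \<bar>d n x\<bar> \<le> L * indicator K x"
  obtains g where "g \<in> borel_measurable borel" "\<And>x. \<bar>g x\<bar> \<le> L * indicator K x"
    "\<And>\<phi> B l. \<phi> \<in> borel_measurable borel \<Longrightarrow> (\<And>x. \<bar>\<phi> x\<bar> \<le> B) \<Longrightarrow>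
       (\<lambda>n. \<integral>x. d n x * \<phi> x \<partial>lborel) \<longlonglongrightarrow> l \<Longrightarrow> (\<integral>x. g x * \<phi> x \<partial>lborel) = l"
proof -
  let ?C = "midpoint_hull d"
  have Cm: "f \<in> borel_measurable borel" "\<bar>f x\<bar> \<le> L * indicator K x" if "f \<in> ?C n" for f n x
    using that
  proof (induction arbitrary: x)
    case (base m) { case 1 show ?case by (rule dm) next case 2 show ?case by (rule db) }
  next
    case (mid f g)
    { case 1 show ?case using mid by auto
    next case 2 show ?case using mid.IH(2)[of x] mid.IH(4)[of x] by (simp add: abs_le_iff) }
  qed
  have Kf: "integrable lborel (\<lambda>x. c * indicator K x :: real)" for c
    using integrable_indicator_compact[OF K] by auto
  have bi: "integrable lborel f" if "f \<in> borel_measurable borel" "\<And>x. \<bar>f x\<bar> \<le> c * indicator K x" for f :: "'a \<Rightarrow> real" and c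
  proof (rule Bochner_Integration.integrable_bound[OF Kf[of c]])
    show "AE x in lborel. norm (f x) \<le> norm (c * indicator K x :: real)"
      using that(2) by (intro AE_I2) (metis abs_ge_self order_trans real_norm_def)
  qed (use that in auto)
  define N where "N f = (\<integral>x. (f x)\<^sup>2 \<partial>lborel)" for f :: "'a \<Rightarrow> real"
  have sqb: "(f x)\<^sup>2 \<le> L\<^sup>2 * indicator K x" if "\<bar>f x\<bar> \<le> L * indicator K x" for f :: "'a \<Rightarrow> real" and x
    using power_mono[OF that, of 2] by (auto simp: power_mult_distrib indicator_def)
  have Ci2: "integrable lborel (\<lambda>x. (f x)\<^sup>2)" if "f \<in> ?C n" for f n
  proof (rule bi[of _ "L\<^sup>2"])
    show "\<bar>(f x)\<^sup>2\<bar> \<le> L\<^sup>2 * indicator K x" for x using sqb[of f x] Cm(2)[OF that, of x] by simp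
  qed (use Cm(1)[OF that] in auto)
  have Cif: "integrable lborel (\<lambda>x. f x * g x)" if "f \<in> ?C n" "g \<in> ?C m" for f g n m
  proof (rule bi[of _ "L\<^sup>2"])
    fix x
    have "\<bar>f x * g x\<bar> \<le> (L * indicator K x) * (L * indicator K x)"
      unfolding abs_mult by (rule mult_mono) (use Cm[OF that(1)] Cm[OF that(2)] L in auto)
    then show "\<bar>f x * g x\<bar> \<le> L\<^sup>2 * indicator K x" by (auto simp: indicator_def power2_eq_square)
  qed (use Cm[OF that(1)] Cm[OF that(2)] in auto)
  define J where "J = L\<^sup>2 * measure lborel K"
  have NJ: "0 \<le> N f" "N f \<le> J" if "f \<in> ?C n" for f n
  proof -
    show "0 \<le> N f" unfolding N_def by (rule Bochner_Integration.integral_nonneg) auto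
    have "N f \<le> (\<integral>x. L\<^sup>2 * indicator K x \<partial>lborel)"
      unfolding N_def by (rule integral_mono) (use Ci2[OF that] Kf sqb Cm(2)[OF that] in auto)
    also have "\<dots> = J" using K by (simp add: J_def borel_compact)
    finally show "N f \<le> J" .
  qed
  define I where "I n = Inf (N ` ?C n)" for n
  have ne: "N ` ?C n \<noteq> {}" for n using midpoint_hull.base[of n n d] by auto
  have bb: "bdd_below (N ` ?C n)" for n using NJ by (auto intro!: bdd_belowI[of _ 0])
  have Ile: "I n \<le> N f" if "f \<in> ?C n" for f n
    unfolding I_def by (rule cInf_lower) (use that bb in auto)
  have Imono: "I n \<le> I m" if "n \<le> m" for n m
    unfolding I_def
  proof (rule cInf_superset_mono[OF ne bb])
    show "N ` ?C m \<subseteq> N ` ?C n" using that midpoint_hull_mono by (intro image_mono) blast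
  qed
  have IJ: "I n \<le> J" for n
    using Ile[of "d n" n] NJ(2)[of "d n" n] midpoint_hull.base[of n n d] by auto
  have "\<exists>f. f \<in> ?C n \<and> N f < I n + 1 / real (Suc n)" for n
  proof -
    have "\<exists>y\<in>N ` ?C n. y < I n + 1 / real (Suc n)"
      unfolding I_def by (rule cInf_lessD[of _ "Inf (N ` ?C n) + 1 / real (Suc n)"]) (use ne in auto)
    then show ?thesis by auto
  qed
  then obtain f where f: "\<And>n. f n \<in> ?C n" "\<And>n. N (f n) < I n + 1 / real (Suc n)" by metis
  have "Bseq I"
  proof (rule BseqI')
    show "norm (I n) \<le> \<bar>J\<bar> + \<bar>I 0\<bar>" for n using IJ[of n] Imono[of 0 n] by auto
  qed
  then have "convergent I" using Bseq_monoseq_convergent Imono by (auto simp: monoseq_def)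
  then have CI: "Cauchy I" by (simp add: Cauchy_convergent_iff)
  \<comment> \<open>The midpoint of \<open>f m\<close> and \<open>f n\<close> lies in the
    \<open>n\<close>-th hull, so its squared norm is at least \<open>I n\<close>; the parallelogram
    identity turns this into a bound for the difference.\<close>
  have par: "N (\<lambda>x. f m x - f n x) \<le> 2 * (I m - I n) + 2 / real (Suc n) + 2 / real (Suc m)" if mn: "n \<le> m" for n m
  proof -
    have fm: "f m \<in> ?C n" using f(1) midpoint_hull_mono mn by blast
    have a: "I n \<le> N (\<lambda>x. (f m x + f n x) / 2)" by (rule Ile[OF midpoint_hull.mid[OF fm f(1)]])
    note ints = Ci2[OF f(1)[of n]] Ci2[OF f(1)[of m]] Cif[OF f(1)[of m] f(1)[of n]]
    have e1: "N (\<lambda>x. f m x - f n x) = N (f m) - 2 * (\<integral>x. f m x * f n x \<partial>lborel) + N (f n)"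
      unfolding N_def power2_diff using ints by (simp add: mult.assoc)
    have e2: "N (\<lambda>x. (f m x + f n x) / 2) = (N (f m) + 2 * (\<integral>x. f m x * f n x \<partial>lborel) + N (f n)) / 4"
      unfolding N_def power_divide power2_sum using ints by (simp add: mult.assoc)
    have q: "2 / real (Suc n) = 2 * (1 / real (Suc n))" "2 / real (Suc m) = 2 * (1 / real (Suc m))" by auto
    show ?thesis using a e1 e2 f(2)[of n] f(2)[of m] unfolding q by argo
  qed
  have "\<exists>M. \<forall>m\<ge>M. \<forall>n\<ge>M. N (\<lambda>x. f m x - f n x) \<le> (1/4)^k" for k :: nat
  proof -
    obtain M1 where M1: "\<And>m n. m \<ge> M1 \<Longrightarrow> n \<ge> M1 \<Longrightarrow> \<bar>I m - I n\<bar> < (1/4)^k / 8"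
      using CI unfolding Cauchy_def dist_real_def by (metis divide_pos_pos zero_less_numeral zero_less_power zero_less_one)
    obtain M2 :: nat where M2: "1 / real (Suc M2) < (1/4)^k / 8"
      using reals_Archimedean[of "(1/4)^k / 8"] by (auto simp: inverse_eq_divide)
    have *: "N (\<lambda>x. f m x - f n x) \<le> (1/4)^k" if "n \<le> m" "n \<ge> max M1 M2" for m n
    proof -
      have "1 / real (Suc n) \<le> 1 / real (Suc M2)" "1 / real (Suc m) \<le> 1 / real (Suc M2)" using that by (auto intro!: divide_left_mono)
      then have "2 / real (Suc n) \<le> (1/4)^k / 4" "2 / real (Suc m) \<le> (1/4)^k / 4" using M2 by auto
      moreover have "\<bar>I m - I n\<bar> < (1/4)^k / 8" using M1[of m n] that by auto
      moreover have "(1/4::real)^k > 0" by simp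
      moreover have "P \<le> X" if "P \<le> 2 * (a - b) + c + d" "c \<le> X/4" "d \<le> X/4" "\<bar>a - b\<bar> < X/8" "0 < X"
        for P a b c d X :: real using that abs_ge_self[of "a - b"] by argo
      ultimately show ?thesis using par[OF that(1)] by blast
    qed
    have sym: "N (\<lambda>x. f m x - f n x) = N (\<lambda>x. f n x - f m x)" for m n
      by (simp add: N_def power2_commute)
    show ?thesis
    proof (intro exI[of _ "max M1 M2"] allI impI)
      fix m n assume "max M1 M2 \<le> m" "max M1 M2 \<le> n"
      then show "N (\<lambda>x. f m x - f n x) \<le> (1/4)^k" using *[of n m] *[of m n] sym[of m n] by (cases "n \<le> m") auto
    qed
  qed
  then obtain M where M: "\<And>k m n. m \<ge> M k \<Longrightarrow> n \<ge> M k \<Longrightarrow> N (\<lambda>x. f m x - f n x) \<le> (1/4)^k" by metis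
  \<comment> \<open>The partial sums make \<open>s\<close> monotone and at least \<open>M k\<close>;
    adding \<open>k\<close> gives \<open>k \<le> s k\<close>, so that \<open>h k\<close> lies in the
    hull of the tail from \<open>k\<close> on.\<close>
  define s where "s k = (\<Sum>j\<le>k. M j) + k" for k
  have sM: "M k \<le> s k" for k
    unfolding s_def by (rule trans_le_add1) (use member_le_sum[of k "{..k}" M] in auto)
  have s1: "s k \<le> s (Suc k)" for k by (simp add: s_def)
  have sk: "k \<le> s k" for k by (simp add: s_def)
  define h where "h k = f (s k)" for k
  have hm: "h k \<in> borel_measurable borel" "\<bar>h k x\<bar> \<le> L * indicator K x" for k x
    using Cm[OF f(1)] by (auto simp: h_def)
  have hN: "N (\<lambda>x. h (Suc k) x - h k x) \<le> (1/4)^k" for k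
    unfolding h_def by (rule M) (use sM[of k] s1[of k] in auto)
  have hi: "integrable lborel (\<lambda>x. \<bar>h (Suc k) x - h k x\<bar>)" for k
    using bi[OF hm] by auto
  have hi2: "integrable lborel (\<lambda>x. (h (Suc k) x - h k x)\<^sup>2)" for k
    unfolding power2_diff h_def using Ci2[OF f(1)] Cif[OF f(1) f(1)] by (auto simp: mult.assoc)
  define mK where "mK = measure lborel K"
  have h1: "(\<integral>x. \<bar>h (Suc k) x - h k x\<bar> \<partial>lborel) \<le> (1 + mK) * (1/2)^k" for k
  proof -
    \<comment> \<open>Weighting the square with \<open>2^k\<close> trades a squared L2 bound of
      order (1/4)^k on the set \<open>K\<close> of finite measure for an L1 bound of order (1/2)^k,
      which is summable.\<close>
    have pw: "\<bar>h (Suc k) x - h k x\<bar> \<le> 2^k * (h (Suc k) x - h k x)\<^sup>2 + (1/2)^k * indicator K x" for x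
    proof (cases "x \<in> K")
      case True
      have gen: "\<bar>a\<bar> \<le> b * a\<^sup>2 + 1 / b" if "b > 0" for a b :: real
      proof -
        have "0 \<le> (b * \<bar>a\<bar> - 1/2)\<^sup>2" by simp
        also have "\<dots> = b * (b * a\<^sup>2) - b * \<bar>a\<bar> + 1/4"
          by (simp add: power2_diff power_mult_distrib power2_eq_square[of b] power_divide)
        finally have "b * \<bar>a\<bar> \<le> b * (b * a\<^sup>2 + 1 / b)" using that by (simp add: distrib_left)
        then show ?thesis using that by simp
      qed
      have "\<bar>h (Suc k) x - h k x\<bar> \<le> 2^k * (h (Suc k) x - h k x)\<^sup>2 + 1 / 2^k" by (rule gen) simp
      then show ?thesis using True by (simp add: power_one_over)
    next
      case False
      then have "h (Suc k) x = 0" "h k x = 0" using hm(2)[of "Suc k" x] hm(2)[of k x] by auto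
      then show ?thesis using False by simp
    qed
    have "(\<integral>x. \<bar>h (Suc k) x - h k x\<bar> \<partial>lborel) \<le> (\<integral>x. 2^k * (h (Suc k) x - h k x)\<^sup>2 + (1/2)^k * indicator K x \<partial>lborel)"
      by (rule integral_mono[OF _ _ pw]) (use hi hi2 integrable_indicator_compact[OF K] in auto)
    also have "\<dots> = 2^k * N (\<lambda>x. h (Suc k) x - h k x) + (1/2)^k * mK"
      using hi2[of k] integrable_indicator_compact[OF K] K by (simp add: N_def mK_def borel_compact)
    also have "\<dots> \<le> 2^k * (1/4)^k + (1/2)^k * mK" using hN[of k] by simp
    also have "2^k * (1/4::real)^k = (1/2)^k" by (simp add: power_mult_distrib[symmetric])
    finally show ?thesis by (simp add: algebra_simps)
  qed
  have "AE x in lborel. summable (\<lambda>k. h (Suc k) x - h k x)"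
  proof -
    have "(\<integral>\<^sup>+x. (\<Sum>k. ennreal \<bar>h (Suc k) x - h k x\<bar>) \<partial>lborel) = (\<Sum>k. \<integral>\<^sup>+x. ennreal \<bar>h (Suc k) x - h k x\<bar> \<partial>lborel)"
      by (rule nn_integral_suminf) (use hm(1) in auto)
    also have "\<dots> \<le> (\<Sum>k. ennreal ((1 + mK) * (1/2)^k))"
      using h1 by (intro suminf_le summableI) (subst nn_integral_eq_integral[OF hi], auto intro!: ennreal_leI)
    also have "\<dots> < \<infinity>"
    proof -
      have "summable (\<lambda>k. (1 + mK) * (1/2::real)^k)" by (intro summable_mult summable_geometric) simp
      moreover have "0 \<le> (1 + mK) * (1/2::real)^k" for k by (simp add: mK_def)
      ultimately show ?thesis by (subst suminf_ennreal2) auto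
    qed
    finally have "AE x in lborel. (\<Sum>k. ennreal \<bar>h (Suc k) x - h k x\<bar>) \<noteq> \<infinity>"
      by (intro nn_integral_PInf_AE) (use hm(1) in auto)
    then show ?thesis
    proof eventually_elim
      case (elim x)
      have "summable (\<lambda>k. \<bar>h (Suc k) x - h k x\<bar>)" by (rule summable_suminf_not_top) (use elim in auto)
      then show ?case by (rule summable_rabs_cancel)
    qed
  qed
  then have conv: "AE x in lborel. convergent (\<lambda>k. h k x)"
  proof eventually_elim
    case (elim x)
    have "(\<lambda>n. \<Sum>k<n. h (Suc k) x - h k x) = (\<lambda>n. h n x - h 0 x)"
      by (rule ext) (rule sum_lessThan_telescope[of "\<lambda>k. h k x"])
    with elim have "convergent (\<lambda>n. h n x - h 0 x)" by (simp add: summable_iff_convergent)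
    then have "convergent (\<lambda>n. (h n x - h 0 x) + h 0 x)" by (intro convergent_add convergent_const)
    then show ?case by simp
  qed
  \<comment> \<open>The pointwise limit exists only almost everywhere; clipping makes the bound by
    \<open>L\<close> hold at every point.\<close>
  define g where "g x = max (- (L * indicator K x)) (min (L * indicator K x) (lim (\<lambda>k. h k x)))" for x
  have Kb: "indicat_real K \<in> borel_measurable borel"
    using K by (intro borel_measurable_indicator) (simp add: borel_compact)
  have gm: "g \<in> borel_measurable borel"
    unfolding g_def using hm(1) Kb by (intro borel_measurable_max borel_measurable_min borel_measurable_lim_metric borel_measurable_uminus borel_measurable_times) auto
  have gb: "\<bar>g x\<bar> \<le> L * indicator K x" for x
    unfolding g_def using L by (auto simp: max_def min_def indicator_def)
  have gl: "AE x in lborel. (\<lambda>k. h k x) \<longlonglongrightarrow> g x"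
    using conv
  proof eventually_elim
    case (elim x)
    then have l: "(\<lambda>k. h k x) \<longlonglongrightarrow> lim (\<lambda>k. h k x)" by (simp add: convergent_LIMSEQ_iff)
    then have "(\<lambda>k. \<bar>h k x\<bar>) \<longlonglongrightarrow> \<bar>lim (\<lambda>k. h k x)\<bar>" by (rule tendsto_rabs)
    then have "\<bar>lim (\<lambda>k. h k x)\<bar> \<le> L * indicator K x"
      by (rule LIMSEQ_le_const2) (use hm(2) in auto)
    then have "g x = lim (\<lambda>k. h k x)" by (auto simp: g_def)
    with l show ?case by simp
  qed
  show ?thesis
  proof (rule that[OF gm gb])
    fix \<phi> :: "'a \<Rightarrow> real" and B l assume pm: "\<phi> \<in> borel_measurable borel" and pb: "\<And>x. \<bar>\<phi> x\<bar> \<le> B"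
      and lim: "(\<lambda>n. \<integral>x. d n x * \<phi> x \<partial>lborel) \<longlonglongrightarrow> l"
    have B: "B \<ge> 0" using pb[of 0] by linarith
    have pi: "integrable lborel (\<lambda>x. f x * \<phi> x)" if "f \<in> borel_measurable borel" "\<And>x. \<bar>f x\<bar> \<le> L * indicator K x" for f
    proof (rule bi[of _ "L * B"])
      fix x
      have "\<bar>f x * \<phi> x\<bar> \<le> (L * indicator K x) * B"
        unfolding abs_mult by (rule mult_mono[OF that(2) pb]) (use L in auto)
      then show "\<bar>f x * \<phi> x\<bar> \<le> L * B * indicator K x" by (simp add: mult_ac)
    qed (use that pm in auto)
    \<comment> \<open>Closeness of the pairing to \<open>l\<close> is inherited by midpoints, hence
      by the whole hull of a tail.\<close>
    have hull: "\<bar>(\<integral>x. f x * \<phi> x \<partial>lborel) - l\<bar> \<le> e"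
      if "f \<in> ?C n" "\<And>m. m \<ge> n \<Longrightarrow> \<bar>(\<integral>x. d m x * \<phi> x \<partial>lborel) - l\<bar> \<le> e" for f n e
      using that(1)
    proof induction
      case (base m) then show ?case using that(2) by auto
    next
      case (mid f g)
      have "(\<integral>x. (f x + g x) / 2 * \<phi> x \<partial>lborel) = ((\<integral>x. f x * \<phi> x \<partial>lborel) + (\<integral>x. g x * \<phi> x \<partial>lborel)) / 2"
        using pi[OF Cm[OF mid.hyps(1)]] pi[OF Cm[OF mid.hyps(2)]] by (simp add: distrib_right)
      then show ?case using mid.IH by argo
    qed
    have "(\<lambda>k. \<integral>x. h k x * \<phi> x \<partial>lborel) \<longlonglongrightarrow> l"
    proof (rule LIMSEQ_I)
      fix e :: real assume e: "e > 0"
      then obtain n0 where n0: "\<And>m. m \<ge> n0 \<Longrightarrow> \<bar>(\<integral>x. d m x * \<phi> x \<partial>lborel) - l\<bar> < e / 2"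
        using LIMSEQ_D[OF lim, of "e/2"] by auto
      have "\<bar>(\<integral>x. h k x * \<phi> x \<partial>lborel) - l\<bar> \<le> e / 2" if "k \<ge> n0" for k
        unfolding h_def
        by (rule hull[OF f(1)]) (use n0 sk[of k] that in \<open>auto intro: less_imp_le\<close>)
      then show "\<exists>no. \<forall>n\<ge>no. norm ((\<integral>x. h n x * \<phi> x \<partial>lborel) - l) < e"
        using e by (intro exI[of _ n0]) force
    qed
    moreover have "(\<lambda>k. \<integral>x. h k x * \<phi> x \<partial>lborel) \<longlonglongrightarrow> (\<integral>x. g x * \<phi> x \<partial>lborel)"
    proof (rule integral_dominated_convergence[where w = "\<lambda>x. L * B * indicator K x"])
      show "AE x in lborel. (\<lambda>k. h k x * \<phi> x) \<longlonglongrightarrow> g x * \<phi> x"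
        using gl by eventually_elim (intro tendsto_intros)
      show "AE x in lborel. norm (h k x * \<phi> x) \<le> L * B * indicator K x" for k
      proof (intro AE_I2)
        fix x
        have "\<bar>h k x * \<phi> x\<bar> \<le> (L * indicator K x) * B"
          unfolding abs_mult by (rule mult_mono[OF hm(2) pb]) (use L in auto)
        then show "norm (h k x * \<phi> x) \<le> L * B * indicator K x" by (simp add: mult_ac)
      qed
    qed (use gm hm(1) pm integrable_indicator_compact[OF K] in auto)
    ultimately show "(\<integral>x. g x * \<phi> x \<partial>lborel) = l" using LIMSEQ_unique by blast
  qed
qed

section \<open>Classical gradients and the weak gradient of a Lipschitz function\<close>

lemma set_integral_lebesgue_eq_lborel:
  fixes f :: "'a::euclidean_space \<Rightarrow> real"
  assumes "g \<in> borel_measurable borel" "\<And>x. indicator U x * f x = g x"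
  shows "(LINT x:U|lebesgue. f x) = (\<integral>x. g x \<partial>lborel)"
  using integral_completion[of g lborel] assms by (simp add: set_lebesgue_integral_def)

text \<open>Test functions of the weak formulation are controlled only on \<open>U\<close> and may
  take any value outside. Redefined as zero there they become C1 on the whole space, since near the
  boundary of \<open>U\<close> they already vanish.\<close>

lemma C1_supp_extend:
  assumes U: "open U" and D: "C1_grad U \<phi> D" and c: "compact_support_in U \<phi>"
  shows "C1_supp (closure {x \<in> U. \<phi> x \<noteq> 0}) (\<lambda>x. if x \<in> U then \<phi> x else 0) (\<lambda>x. if x \<in> U then D x else 0)"
proof -
  let ?S = "closure {x \<in> U. \<phi> x \<noteq> 0}" and ?f = "\<lambda>x. if x \<in> U then \<phi> x else 0" and ?D = "\<lambda>x. if x \<in> U then D x else 0"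
  have S: "compact ?S" "?S \<subseteq> U" using c by (auto simp: compact_support_in_def)
  have z: "?f x = 0" if "x \<notin> ?S" for x
    using that closure_subset[of "{x \<in> U. \<phi> x \<noteq> 0}"] by auto
  have gU: "has_gradient ?f (?D x) x" if "x \<in> U" for x
    by (rule has_derivative_transform_within_open[of \<phi> _ _ _ U]) (use that U C1_gradD(1)[OF D] in auto)
  have gS: "has_gradient ?f 0 x" if "x \<notin> ?S" for x
    by (rule has_derivative_transform_within_open[of "\<lambda>_. 0" _ _ _ "- ?S"]) (use that z in \<open>auto simp: open_Compl\<close>)
  have DS: "?D x = 0" if "x \<notin> ?S" for x
    using has_gradient_unique[OF gU[of x] gS[OF that]] by (cases "x \<in> U") auto
  have "has_gradient ?f (?D x) x" for x
    using gU[of x] gS[of x] DS[of x] S(2) by (cases "x \<in> U") auto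
  moreover have "continuous_on UNIV ?D"
  proof -
    have 1: "continuous_on U ?D" by (rule continuous_on_eq[OF C1_gradD(2)[OF D]]) auto
    have 2: "continuous_on (- ?S) ?D" by (rule continuous_on_eq[of _ "\<lambda>_. 0"]) (use DS in auto)
    have "continuous_on (U \<union> - ?S) ?D" by (rule continuous_on_open_Un) (use 1 2 U in auto)
    moreover have "U \<union> - ?S = UNIV" using S by auto
    ultimately show ?thesis by simp
  qed
  ultimately show ?thesis using S z by (auto simp: C1_supp_def C1_grad_def)
qed

lemma continuous_locally_integrable:
  assumes "continuous_on U f"
  shows "locally_integrable_on U f"
  unfolding locally_integrable_on_def set_integrable_def
proof (intro allI impI)
  fix K assume K: "compact K \<and> K \<subseteq> U"
  have "integrable lborel (\<lambda>x. indicator K x *\<^sub>R f x)"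
    by (rule borel_integrable_compact) (use K assms continuous_on_subset in auto)
  then show "integrable lebesgue (\<lambda>x. indicator K x *\<^sub>R f x)"
    by (subst integrable_completion) auto
qed

lemma C1_weak_gradient:
  assumes U: "open U" and u: "C1_grad U u D"
  shows "weak_gradient U u D"
  unfolding weak_gradient_def
proof (intro conjI allI impI ballI)
  show "locally_integrable_on U u" "locally_integrable_on U D"
    using C1_gradD[OF u] by (auto intro: continuous_locally_integrable)
  fix \<phi> i assume \<phi>: "smooth_on U \<phi> \<and> compact_support_in U \<phi>" and i: "i \<in> (Basis :: 'a set)"
  obtain D\<phi> where D\<phi>: "C1_grad U \<phi> D\<phi>" using smooth_on_imp_C1_grad \<phi> by blast
  have fr: "frechet_derivative \<phi> (at x) i = D\<phi> x \<bullet> i" if "x \<in> U" for x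
    using frechet_derivative_at[OF C1_gradD(1)[OF D\<phi> that]] by metis
  have c: "compact_support_in U \<phi>" using \<phi> by auto
  note E = C1_supp_extend[OF U D\<phi> c]
  have S: "closure {x \<in> U. \<phi> x \<noteq> 0} \<subseteq> U" using c by (auto simp: compact_support_in_def)
  note P = integral_by_parts[OF U u E S, of i]
  have "(LINT x:U|lebesgue. u x * frechet_derivative \<phi> (at x) i) = (\<integral>x. u x * ((if x \<in> U then D\<phi> x else 0) \<bullet> i) \<partial>lborel)"
    by (rule set_integral_lebesgue_eq_lborel) (use P(2) fr in \<open>auto simp: indicator_def\<close>)
  moreover have "(LINT x:U|lebesgue. (D x \<bullet> i) * \<phi> x) = (\<integral>x. (D x \<bullet> i) * (if x \<in> U then \<phi> x else 0) \<partial>lborel)"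
    by (rule set_integral_lebesgue_eq_lborel) (use P(3) in \<open>auto simp: indicator_def\<close>)
  ultimately show "(LINT x:U|lebesgue. u x * frechet_derivative \<phi> (at x) i) = - (LINT x:U|lebesgue. (D x \<bullet> i) * \<phi> x)"
    using P(1) by simp
qed

lemma Lvar_bounded:
  fixes f :: "'a::euclidean_space \<Rightarrow> 'b::euclidean_space"
  assumes m: "f \<in> borel_measurable (lebesgue_on V)" and S: "compact S"
    and C: "\<And>x. x \<in> V \<Longrightarrow> x \<in> S \<Longrightarrow> norm (f x) \<le> C" and p: "\<And>x. x \<in> V \<Longrightarrow> x \<in> S \<Longrightarrow> 0 \<le> p x \<and> p x \<le> c"
    and z: "\<And>x. x \<in> V \<Longrightarrow> x \<notin> S \<Longrightarrow> f x = 0"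
  shows "Lvar p V f"
proof -
  let ?M = "(1 + \<bar>C\<bar>) powr c"
  have "(\<integral>\<^sup>+ x\<in>V. ennreal (norm (f x) powr p x) \<partial>lebesgue) \<le> (\<integral>\<^sup>+ x. ennreal ?M * indicator S x \<partial>lebesgue)"
  proof (rule nn_integral_mono)
    fix x
    show "ennreal (norm (f x) powr p x) * indicator V x \<le> ennreal ?M * indicator S x"
    proof (cases "x \<in> V \<and> x \<in> S")
      case True
      have "norm (f x) powr p x \<le> (1 + \<bar>C\<bar>) powr p x"
        by (rule powr_mono2) (use True C[of x] p[of x] in auto)
      also have "\<dots> \<le> ?M" by (rule powr_mono) (use True p[of x] in auto)
      finally show ?thesis using True by (simp add: ennreal_leI)
    next
      case False
      then show ?thesis using z[of x] by (auto simp: indicator_def)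
    qed
  qed
  also have "\<dots> = ennreal ?M * emeasure lebesgue S"
    using S by (simp add: nn_integral_cmult_indicator lmeasurable_compact fmeasurableD)
  also have "\<dots> < \<infinity>"
    using emeasure_compact_finite[OF S] S by (simp add: ennreal_mult_less_top borel_compact)
  finally show ?thesis using m by (simp add: Lvar_def)
qed

lemma C1_supp_W1var_grad:
  assumes U: "open U" and f: "C1_supp S f D" and S: "S \<subseteq> U" and p: "continuous_on U p" "\<And>x. x \<in> U \<Longrightarrow> 0 \<le> p x"
  shows "W1var_grad p U f D"
proof -
  obtain C where C: "\<And>x. \<bar>f x\<bar> \<le> C" "\<And>x. norm (D x) \<le> C" using C1_supp_bound[OF f] by metis
  have cS: "compact S" using f C1_suppD by blast
  have "compact (p ` S)" using compact_continuous_image continuous_on_subset p(1) S cS by blast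
  then have "bounded (p ` S)" by (rule compact_imp_bounded)
  then obtain c where c: "\<And>x. x \<in> S \<Longrightarrow> p x \<le> c"
    by (auto simp: bounded_iff abs_le_iff)
  have Ul: "U \<in> sets lebesgue" using U by auto
  have "f \<in> borel_measurable (lebesgue_on U)" "D \<in> borel_measurable (lebesgue_on U)"
    using C1_suppD(3,4)[OF f] continuous_imp_measurable_on_sets_lebesgue[OF _ Ul] continuous_on_subset by blast+
  then have "Lvar p U f" "Lvar p U D"
    using Lvar_bounded[OF _ cS, of f U C p c] Lvar_bounded[OF _ cS, of D U C p c] C c p(2) C1_suppD(5,6)[OF f] S by auto
  then show ?thesis using C1_weak_gradient[OF U] C1_suppD(7)[OF f] by (auto simp: W1var_grad_def)
qed

text \<open>No pointwise differentiability is used: the difference quotients of \<open>p\<close> are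
  bounded by \<open>L\<close>, a weak limit of them exists, and moving the quotient onto the test
  function identifies it as the weak derivative. Summing the components gives the factor
  \<open>DIM('a)\<close> in the bound.\<close>

lemma lipschitz_weak_gradient:
  fixes p :: "'a::euclidean_space \<Rightarrow> real"
  assumes U: "open U" "bounded U" and p: "L-lipschitz_on U p"
  obtains P where "P \<in> borel_measurable borel" "\<And>x. norm (P x) \<le> real DIM('a) * L" "weak_gradient U p P"
proof -
  have L: "L \<ge> 0" using p by (rule lipschitz_on_nonneg)
  define K where "K = closure U"
  have K: "compact K" using U by (simp add: K_def compact_closure)
  have UK: "U \<subseteq> K" unfolding K_def by (rule closure_subset)
  have pc: "continuous_on U p" using p by (rule lipschitz_on_continuous_on)
  define q where "q x = indicator U x *\<^sub>R p x" for x
  have qm: "q \<in> borel_measurable borel" unfolding q_def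
    by (rule borel_measurable_continuous_on_indicator) (use U pc in auto)
  have "bounded (p ` U)" using lipschitz_on_uniformly_continuous[OF p] bounded_uniformly_continuous_image U by blast
  then obtain C where C: "\<And>x. x \<in> U \<Longrightarrow> \<bar>p x\<bar> \<le> C" by (auto simp: bounded_iff)
  have qb: "\<bar>q x\<bar> \<le> \<bar>C\<bar>" for x using C[of x] by (auto simp: q_def indicator_def)
  have qz: "q x = 0" if "x \<notin> K" for x using that UK by (auto simp: q_def indicator_def)
  define Phi where "Phi i g \<longleftrightarrow> g \<in> borel_measurable borel \<and> (\<forall>x. \<bar>g x\<bar> \<le> L * indicator K x) \<and>
     (\<forall>S \<phi> D. C1_supp S \<phi> D \<longrightarrow> S \<subseteq> U \<longrightarrow> (\<integral>x. g x * \<phi> x \<partial>lborel) = - (\<integral>x. q x * (D x \<bullet> i) \<partial>lborel))"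
    for i :: 'a and g
  have "\<exists>g. Phi i g" if i: "i \<in> Basis" for i :: 'a
  proof -
    let ?h = "\<lambda>n. (1 / real (Suc n)) *\<^sub>R i"
    define A where "A n = {x \<in> U. x + ?h n \<in> U}" for n
    have A: "open (A n)" for n
    proof -
      have "A n = U \<inter> (\<lambda>x. x + ?h n) -` U" by (auto simp: A_def)
      then show ?thesis using U by (auto intro!: open_Int open_vimage continuous_intros)
    qed
    define d where "d n x = indicator (A n) x *\<^sub>R ((p (x + ?h n) - p x) * real (Suc n))" for n x
    have dm: "d n \<in> borel_measurable borel" for n
      unfolding d_def
    proof (rule borel_measurable_continuous_on_indicator)
      show "A n \<in> sets borel" using A by auto
      have "continuous_on (A n) (\<lambda>x. p (x + ?h n))"
        by (rule continuous_on_compose2[OF pc]) (auto simp: A_def intro!: continuous_intros)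
      moreover have "continuous_on (A n) p" using pc by (rule continuous_on_subset) (auto simp: A_def)
      ultimately show "continuous_on (A n) (\<lambda>x. (p (x + ?h n) - p x) * real (Suc n))" by (intro continuous_intros)
    qed
    have db: "\<bar>d n x\<bar> \<le> L * indicator K x" for n x
    proof (cases "x \<in> A n")
      case True
      then have "dist (p (x + ?h n)) (p x) \<le> L * dist (x + ?h n) x"
        using lipschitz_onD[OF p] by (auto simp: A_def)
      then have "\<bar>p (x + ?h n) - p x\<bar> * real (Suc n) \<le> L * norm (?h n) * real (Suc n)"
        by (intro mult_right_mono) (auto simp: dist_norm)
      also have "\<dots> = L" using i by simp
      finally show ?thesis using True UK by (auto simp: d_def abs_mult A_def)
    qed (use L in \<open>auto simp: d_def\<close>)
    obtain g where g: "g \<in> borel_measurable borel" "\<And>x. \<bar>g x\<bar> \<le> L * indicator K x"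
      "\<And>\<phi> B l. \<phi> \<in> borel_measurable borel \<Longrightarrow> (\<And>x. \<bar>\<phi> x\<bar> \<le> B) \<Longrightarrow>
       (\<lambda>n. \<integral>x. d n x * \<phi> x \<partial>lborel) \<longlonglongrightarrow> l \<Longrightarrow> (\<integral>x. g x * \<phi> x \<partial>lborel) = l"
    proof (rule bounded_weak_limit[where d = d, OF K dm L db])
      fix g assume a: "g \<in> borel_measurable borel" "\<And>x. \<bar>g x\<bar> \<le> L * indicator K x"
        "\<And>\<phi> B l. \<phi> \<in> borel_measurable borel \<Longrightarrow> (\<And>x. \<bar>\<phi> x\<bar> \<le> B) \<Longrightarrow>
         (\<lambda>n. \<integral>x. d n x * \<phi> x \<partial>lborel) \<longlonglongrightarrow> l \<Longrightarrow> (\<integral>x. g x * \<phi> x \<partial>lborel) = l"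
      show thesis by (rule that[OF a])
    qed
    show ?thesis unfolding Phi_def
    proof (intro exI[of _ g] conjI allI impI g(1,2))
      fix S and \<phi> :: "'a \<Rightarrow> real" and D assume \<phi>: "C1_supp S \<phi> D" and S: "S \<subseteq> U"
      note D = C1_suppD[OF \<phi>]
      obtain B where B: "B \<ge> 0" "\<And>x. \<bar>\<phi> x\<bar> \<le> B" "\<And>x. norm (D x) \<le> B" using C1_supp_bound[OF \<phi>] by metis
      have \<phi>m: "\<phi> \<in> borel_measurable borel" using D(4) by (rule borel_measurable_continuous_onI)
      obtain e where e: "e > 0" "(\<Union>x\<in>S. cball x e) \<subseteq> U"
        using compact_subset_open_imp_cball_epsilon_subset[OF D(1) U(1) S] by blast
      obtain n0 :: nat where n0: "1 / real (Suc n0) < e" using reals_Archimedean[OF e(1)] by (auto simp: inverse_eq_divide)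
      let ?Q = "\<lambda>n x. (\<phi> (x + (1 / real (Suc n)) *\<^sub>R (- i)) - \<phi> x) * real (Suc n)"
      \<comment> \<open>Translation moves the quotient from \<open>p\<close> to
        \<open>\<phi>\<close>. This needs steps shorter than the distance \<open>e\<close> of
        \<open>S\<close> to the boundary, so that the cutoff set \<open>A n\<close> contains
        \<open>S\<close>; hence only \<open>n \<ge> n0\<close>.\<close>
      have shift: "(\<integral>x. d n x * \<phi> x \<partial>lborel) = (\<integral>x. q x * ?Q n x \<partial>lborel)" if n: "n \<ge> n0" for n
      proof -
        have xU: "x + ?h n \<in> U" if "x \<in> S" for x
        proof -
          have "1 / real (Suc n) \<le> 1 / real (Suc n0)" using n by (auto intro!: divide_left_mono)
          then have "norm (?h n) \<le> e" using n0 i by simp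
          then have "x + ?h n \<in> cball x e" by (simp add: dist_norm)
          then show ?thesis using e(2) that by blast
        qed
        have 1: "d n x * \<phi> x = (q (x + ?h n) * \<phi> x - q x * \<phi> x) * real (Suc n)" for x
          using xU[of x] S D(5)[of x] by (cases "x \<in> S") (auto simp: d_def A_def q_def algebra_simps)
        have i1: "integrable lborel (\<lambda>x. q (x + ?h n) * \<phi> x)"
          by (rule integrable_compact_bounded[OF _ D(1), of _ "\<bar>C\<bar> * B"])
             (use qb B D(5) qm \<phi>m in \<open>auto simp: abs_mult intro!: mult_mono\<close>)
        have i2: "integrable lborel (\<lambda>x. q x * \<phi> x)"
          by (rule integrable_compact_bounded[OF _ D(1), of _ "\<bar>C\<bar> * B"])
             (use qb B D(5) qm \<phi>m in \<open>auto simp: abs_mult intro!: mult_mono\<close>)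
        have i3: "integrable lborel (\<lambda>x. q x * \<phi> (x - ?h n))"
          using lborel_integrable_translate[OF i1, of "- ?h n"] by simp
        have "(\<integral>x. q (x + ?h n) * \<phi> x \<partial>lborel) = (\<integral>x. q (x + ?h n) * \<phi> ((x + ?h n) - ?h n) \<partial>lborel)" by simp
        also have "\<dots> = (\<integral>x. q x * \<phi> (x - ?h n) \<partial>lborel)"
          by (rule lborel_integral_translate) (use qm \<phi>m in auto)
        finally have 2: "(\<integral>x. q (x + ?h n) * \<phi> x \<partial>lborel) = (\<integral>x. q x * \<phi> (x - ?h n) \<partial>lborel)" .
        have "(\<integral>x. d n x * \<phi> x \<partial>lborel) = ((\<integral>x. q x * \<phi> (x - ?h n) \<partial>lborel) - (\<integral>x. q x * \<phi> x \<partial>lborel)) * real (Suc n)"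
          unfolding 1 using i1 i2 2 by simp
        also have "\<dots> = (\<integral>x. (q x * \<phi> (x - ?h n) - q x * \<phi> x) * real (Suc n) \<partial>lborel)"
          using i2 i3 by simp
        also have "\<dots> = (\<integral>x. q x * ?Q n x \<partial>lborel)" by (simp add: algebra_simps)
        finally show ?thesis .
      qed
      \<comment> \<open>After the translation the quotient of \<open>\<phi>\<close> steps in
        direction \<open>- i\<close>, which is the origin of the minus sign in the weak
        derivative.\<close>
      have "(\<lambda>n. \<integral>x. q x * ?Q n x \<partial>lborel) \<longlonglongrightarrow> (\<integral>x. q x * (D x \<bullet> (- i)) \<partial>lborel)"
      proof (rule integral_dominated_convergence[where w = "\<lambda>x. (\<bar>C\<bar> * B) * indicator K x"])
        show "integrable lborel (\<lambda>x. (\<bar>C\<bar> * B) * indicator K x)" using integrable_indicator_compact[OF K] by auto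
        show "AE x in lborel. (\<lambda>n. q x * ?Q n x) \<longlonglongrightarrow> q x * (D x \<bullet> (- i))"
          by (intro AE_I2 tendsto_mult tendsto_const gradient_difference_quotient_LIMSEQ[OF D(2)])
        show "AE x in lborel. norm (q x * ?Q n x) \<le> \<bar>C\<bar> * B * indicator K x" for n
        proof (intro AE_I2)
          fix x
          have "\<bar>\<phi> (x + (1 / real (Suc n)) *\<^sub>R (- i)) - \<phi> x\<bar> \<le> B * norm (?h n)"
            using C1_supp_lipschitz[OF \<phi> B(3), of "x + (1 / real (Suc n)) *\<^sub>R (- i)" x] by simp
          then have "\<bar>?Q n x\<bar> \<le> B * norm (?h n) * real (Suc n)" unfolding abs_mult by (intro mult_mono) auto
          also have "\<dots> = B" using i by simp
          finally have "\<bar>q x * ?Q n x\<bar> \<le> \<bar>C\<bar> * B" unfolding abs_mult[of "q x"] by (intro mult_mono qb) auto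
          then show "norm (q x * ?Q n x) \<le> \<bar>C\<bar> * B * indicator K x" using qz[of x] by (cases "x \<in> K") auto
        qed
        have Dm: "D \<in> borel_measurable borel" using D(3) by (rule borel_measurable_continuous_onI)
        show "(\<lambda>x. q x * (D x \<bullet> (- i))) \<in> borel_measurable lborel" using qm Dm by auto
        show "(\<lambda>x. q x * ?Q n x) \<in> borel_measurable lborel" for n using qm \<phi>m by auto
      qed
      then have "(\<lambda>n. \<integral>x. d n x * \<phi> x \<partial>lborel) \<longlonglongrightarrow> (\<integral>x. q x * (D x \<bullet> (- i)) \<partial>lborel)"
        by (rule Lim_transform_eventually) (use shift in \<open>auto simp: eventually_sequentially intro!: exI[of _ n0]\<close>)
      from g(3)[OF \<phi>m B(2) this] show "(\<integral>x. g x * \<phi> x \<partial>lborel) = - (\<integral>x. q x * (D x \<bullet> i) \<partial>lborel)" by simp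
    qed
  qed
  then obtain g where "\<And>i. i \<in> Basis \<Longrightarrow> Phi i (g i)" by metis
  then have g: "\<And>i. i \<in> Basis \<Longrightarrow> g i \<in> borel_measurable borel"
    "\<And>i x. i \<in> Basis \<Longrightarrow> \<bar>g i x\<bar> \<le> L * indicator K x"
    "\<And>i S \<phi> D. i \<in> Basis \<Longrightarrow> C1_supp S \<phi> D \<Longrightarrow> S \<subseteq> U \<Longrightarrow> (\<integral>x. g i x * \<phi> x \<partial>lborel) = - (\<integral>x. q x * (D x \<bullet> i) \<partial>lborel)"
    unfolding Phi_def by blast+
  define P where "P x = (\<Sum>i\<in>Basis. g i x *\<^sub>R i)" for x
  have Pi: "P x \<bullet> i = g i x" if "i \<in> Basis" for x i
    using that by (simp add: P_def inner_sum_left inner_Basis if_distrib cong: if_cong)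
  have Pm: "P \<in> borel_measurable borel" unfolding P_def using g(1) by (intro borel_measurable_sum borel_measurable_scaleR) auto
  have Pb: "norm (P x) \<le> real DIM('a) * L" for x
  proof -
    have "norm (P x) \<le> (\<Sum>i\<in>Basis. norm (g i x *\<^sub>R i))" unfolding P_def by (rule norm_sum)
    also have "\<dots> \<le> (\<Sum>i\<in>(Basis::'a set). L)"
    proof (rule sum_mono)
      fix i :: 'a assume i: "i \<in> Basis"
      show "norm (g i x *\<^sub>R i) \<le> L" using g(2)[OF i, of x] i L by (cases "x \<in> K") auto
    qed
    finally show ?thesis by simp
  qed
  have "weak_gradient U p P" unfolding weak_gradient_def
  proof (intro conjI allI impI ballI)
    show "locally_integrable_on U p" using pc by (rule continuous_locally_integrable)
    show "locally_integrable_on U P" unfolding locally_integrable_on_def set_integrable_def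
    proof (intro allI impI)
      fix A assume A: "compact A \<and> A \<subseteq> U"
      have Ab: "A \<in> sets borel" using A by (auto simp: borel_compact)
      have "integrable lborel (\<lambda>x. indicator A x *\<^sub>R P x)"
        by (rule integrable_compact_bounded[of _ A "real DIM('a) * L"]) (use A Ab Pm Pb in auto)
      then show "integrable lebesgue (\<lambda>x. indicator A x *\<^sub>R P x)" by (subst integrable_completion) auto
    qed
    fix \<phi> i assume \<phi>: "smooth_on U \<phi> \<and> compact_support_in U \<phi>" and i: "i \<in> (Basis :: 'a set)"
    obtain D\<phi> where D\<phi>: "C1_grad U \<phi> D\<phi>" using smooth_on_imp_C1_grad \<phi> by blast
    have fr: "frechet_derivative \<phi> (at x) i = D\<phi> x \<bullet> i" if "x \<in> U" for x
      using frechet_derivative_at[OF C1_gradD(1)[OF D\<phi> that]] by metis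
    have c: "compact_support_in U \<phi>" using \<phi> by auto
    note E = C1_supp_extend[OF U(1) D\<phi> c]
    have S: "closure {x \<in> U. \<phi> x \<noteq> 0} \<subseteq> U" using c by (auto simp: compact_support_in_def)
    have bm: "(\<lambda>x. if x \<in> U then \<phi> x else 0) \<in> borel_measurable borel" "(\<lambda>x. if x \<in> U then D\<phi> x else 0) \<in> borel_measurable borel"
      using C1_suppD(3,4)[OF E] by (auto intro: borel_measurable_continuous_onI)
    have "(LINT x:U|lebesgue. p x * frechet_derivative \<phi> (at x) i) = (\<integral>x. q x * ((if x \<in> U then D\<phi> x else 0) \<bullet> i) \<partial>lborel)"
    proof (rule set_integral_lebesgue_eq_lborel)
      show "(\<lambda>x. q x * ((if x \<in> U then D\<phi> x else 0) \<bullet> i)) \<in> borel_measurable borel"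
        by (intro borel_measurable_times borel_measurable_inner qm bm borel_measurable_const)
    qed (use fr in \<open>auto simp: q_def indicator_def\<close>)
    moreover have "(LINT x:U|lebesgue. (P x \<bullet> i) * \<phi> x) = (\<integral>x. g i x * (if x \<in> U then \<phi> x else 0) \<partial>lborel)"
      by (rule set_integral_lebesgue_eq_lborel)
         (use Pi[OF i] g(1)[OF i] bm in \<open>auto simp: indicator_def intro!: borel_measurable_times\<close>)
    ultimately show "(LINT x:U|lebesgue. p x * frechet_derivative \<phi> (at x) i) = - (LINT x:U|lebesgue. (P x \<bullet> i) * \<phi> x)"
      using g(3)[OF i E S] by simp
  qed
  with Pm Pb show ?thesis by (rule that)
qed

section \<open>The equation away from the critical set\<close>

text \<open>A finite sum of bumps whose half-radius balls cover \<open>S\<close>, normalised by the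
  least value of a bump on such a ball. The function is at least 1 on \<open>S\<close> rather than
  equal to 1, which is all that a majorant requires.\<close>

lemma C1_cutoff:
  fixes S :: "'a::euclidean_space set"
  assumes S: "compact S" and U: "open U" "S \<subseteq> U"
  obtains S1 \<zeta> D\<zeta> where "C1_supp S1 \<zeta> D\<zeta>" "S1 \<subseteq> U" "\<And>x. \<zeta> x \<ge> 0" "\<And>x. x \<in> S \<Longrightarrow> \<zeta> x \<ge> 1"
proof -
  obtain d where d: "d > 0" "(\<Union>x\<in>S. cball x d) \<subseteq> U"
    using compact_subset_open_imp_cball_epsilon_subset[OF S U] by blast
  obtain F where F: "finite F" "F \<subseteq> S" "S \<subseteq> (\<Union>x\<in>F. ball x (d/2))"
    using compactE_image[OF S, of S "\<lambda>x. ball x (d/2)"] d(1) by (metis (no_types, lifting) UN_iff centre_in_ball half_gt_zero open_ball subsetI)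
  \<comment> \<open>The value of \<open>bump d\<close> at distance \<open>d / 2\<close>, a lower
    bound for it on the half-radius ball.\<close>
  define b where "b = exp (- (1 / (d\<^sup>2 - (d/2)\<^sup>2)))"
  have b: "b > 0" by (simp add: b_def)
  have bb: "bump d z \<ge> b" if "norm z < d / 2" for z :: 'a
  proof -
    have 1: "z \<bullet> z \<le> (d/2)\<^sup>2" using that d by (metis less_imp_le norm_ge_zero power2_norm_eq_inner power_mono)
    have "d\<^sup>2 - (d/2)\<^sup>2 > 0" using d by (simp add: power_divide)
    with 1 show ?thesis by (simp add: bump_def flat_exp_def b_def frac_le)
  qed
  obtain D where D: "C1_supp (cball 0 d) (bump d :: 'a \<Rightarrow> real) D" using bump_C1_supp[OF d(1)] by blast
  define S1 where "S1 = (\<Union>x\<in>F. cball x d)"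
  have S1: "compact S1" "S1 \<subseteq> U" unfolding S1_def using F d by (auto intro!: compact_UN)
  have "C1_supp S1 (\<lambda>x. bump d (x + - y)) (\<lambda>x. D (x + - y))" if "y \<in> F" for y
  proof -
    have "C1_grad UNIV (\<lambda>x. bump d (x + - y)) (\<lambda>x. D (x + - y))"
      by (rule C1_grad_translate[OF C1_suppD(7)[OF D, of UNIV]]) auto
    moreover have "bump d (x + - y) = 0" if "x \<notin> S1" for x
      using that \<open>y \<in> F\<close> C1_suppD(5)[OF D, of "x + - y"] by (auto simp: S1_def dist_norm norm_minus_commute)
    ultimately show ?thesis using S1 by (simp add: C1_supp_def)
  qed
  from C1_supp_cmult[OF C1_supp_sum[OF this S1(1)], where c = "1/b"]
  have 1: "C1_supp S1 (\<lambda>x. 1 / b * (\<Sum>y\<in>F. bump d (x + - y))) (\<lambda>x. (1 / b) *\<^sub>R (\<Sum>y\<in>F. D (x + - y)))" by auto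
  show ?thesis
  proof (rule that[OF 1 S1(2)])
    show "1 / b * (\<Sum>y\<in>F. bump d (x + - y)) \<ge> 0" for x
      using b by (intro mult_nonneg_nonneg sum_nonneg bump_nonneg) auto
    fix x assume "x \<in> S"
    then obtain y where y: "y \<in> F" "norm (x - y) < d/2" using F(3) by (auto simp: dist_norm norm_minus_commute)
    have "b \<le> bump d (x + - y)" using bb[of "x - y"] y by simp
    also have "\<dots> \<le> (\<Sum>y\<in>F. bump d (x + - y))"
      by (rule member_le_sum[OF y(1), of "\<lambda>y. bump d (x + - y)"]) (use F bump_nonneg in auto)
    finally show "1 / b * (\<Sum>y\<in>F. bump d (x + - y)) \<ge> 1" using b by (simp add: field_simps)
  qed
qed

lemma field_by_parts:
  fixes Z :: "'a::euclidean_space \<Rightarrow> 'a \<Rightarrow> real"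
  assumes W: "open W" and f: "C1_grad W f Df" and Z: "\<And>i. i \<in> Basis \<Longrightarrow> C1_supp S (Z i) (DZ i)" and S: "S \<subseteq> W"
  shows "(\<integral>x. (\<Sum>i\<in>Basis. Z i x * (Df x \<bullet> i)) \<partial>lborel) = - (\<integral>x. f x * (\<Sum>i\<in>Basis. DZ i x \<bullet> i) \<partial>lborel)"
    "integrable lborel (\<lambda>x. (\<Sum>i\<in>Basis. Z i x * (Df x \<bullet> i)))"
    "integrable lborel (\<lambda>x. f x * (\<Sum>i\<in>Basis. DZ i x \<bullet> i))"
proof -
  note P = integral_by_parts[OF W f Z S]
  show "integrable lborel (\<lambda>x. (\<Sum>i\<in>Basis. Z i x * (Df x \<bullet> i)))"
    using P(3) by (intro Bochner_Integration.integrable_sum) (simp add: mult.commute)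
  show "integrable lborel (\<lambda>x. f x * (\<Sum>i\<in>Basis. DZ i x \<bullet> i))"
    unfolding sum_distrib_left using P(2) by (intro Bochner_Integration.integrable_sum)
  have "(\<integral>x. (\<Sum>i\<in>Basis. Z i x * (Df x \<bullet> i)) \<partial>lborel) = (\<Sum>i\<in>Basis. (\<integral>x. (Df x \<bullet> i) * Z i x \<partial>lborel))"
    using P(3) by (subst Bochner_Integration.integral_sum[symmetric]) (auto simp: mult.commute)
  also have "\<dots> = (\<Sum>i\<in>Basis. - (\<integral>x. f x * (DZ i x \<bullet> i) \<partial>lborel))"
    using P(1) by (intro sum.cong) auto
  also have "\<dots> = - (\<integral>x. (\<Sum>i\<in>Basis. f x * (DZ i x \<bullet> i)) \<partial>lborel)"
    using P(2) by (subst Bochner_Integration.integral_sum) (auto simp: sum_negf)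
  finally show "(\<integral>x. (\<Sum>i\<in>Basis. Z i x * (Df x \<bullet> i)) \<partial>lborel) = - (\<integral>x. f x * (\<Sum>i\<in>Basis. DZ i x \<bullet> i) \<partial>lborel)"
    by (simp add: sum_distrib_left)
qed

lemma polynomial_field_approx:
  fixes F :: "'a::euclidean_space \<Rightarrow> 'a"
  assumes S: "compact S" and F: "continuous_on S F" and e: "e > 0"
  obtains g Dg where "\<And>i. i \<in> Basis \<Longrightarrow> C1_grad UNIV (\<lambda>x. g x \<bullet> i) (Dg i)" "\<And>x. x \<in> S \<Longrightarrow> norm (F x - g x) < e"
proof -
  obtain g where g: "polynomial_function g" "\<forall>x\<in>S. norm (F x - g x) < e"
    using Stone_Weierstrass_polynomial_function[OF S F e] by blast
  have "\<exists>Dg. C1_grad UNIV (\<lambda>x. g x \<bullet> i) Dg" if "i \<in> Basis" for i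
    using g(1) that polynomial_function_C1_grad[of "\<lambda>x. g x \<bullet> i"] polynomial_function_iff_Basis_inner[of g] by blast
  then obtain Dg where "\<And>i. i \<in> Basis \<Longrightarrow> C1_grad UNIV (\<lambda>x. g x \<bullet> i) (Dg i)" by metis
  then show ?thesis using that g(2) by blast
qed

text \<open>A smooth stand-in for the merely continuous field \<open>D\<close>, along which one can integrate by parts;
  it bounds the mass of \<open>D\<close> near a level set.\<close>

lemma transversal_field:
  fixes D :: "'a::euclidean_space \<Rightarrow> 'a"
  assumes U: "open U" and D: "continuous_on U D" "\<And>x. x \<in> U \<Longrightarrow> D x \<noteq> 0" and S: "compact S" "S \<subseteq> U"
  obtains S1 Z DZ where "compact S1" "S1 \<subseteq> U" "\<And>i. i \<in> Basis \<Longrightarrow> C1_supp S1 (Z i) (DZ i)"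
    "\<And>x. (\<Sum>i\<in>Basis. Z i x * (D x \<bullet> i)) \<ge> 0" "\<And>x. x \<in> S \<Longrightarrow> (\<Sum>i\<in>Basis. Z i x * (D x \<bullet> i)) \<ge> norm (D x)"
proof -
  obtain S1 \<zeta> D\<zeta> where \<zeta>: "C1_supp S1 \<zeta> D\<zeta>" "S1 \<subseteq> U" "\<And>x. \<zeta> x \<ge> 0" "\<And>x. x \<in> S \<Longrightarrow> \<zeta> x \<ge> 1"
    using C1_cutoff[OF S(1) U S(2)] by blast
  have S1: "compact S1" using \<zeta>(1) C1_suppD(1) by blast
  obtain c where c: "c > 0" "\<And>x. x \<in> S1 \<Longrightarrow> norm (D x) \<ge> c"
  proof (cases "S1 = {}")
    case True then show ?thesis using that[of 1] by auto
  next
    case False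
    have "continuous_on S1 (\<lambda>x. norm (D x))" using D(1) \<zeta>(2) by (intro continuous_intros) (rule continuous_on_subset)
    from continuous_attains_inf[OF S1 False this] obtain x0 where "x0 \<in> S1" "\<And>y. y \<in> S1 \<Longrightarrow> norm (D x0) \<le> norm (D y)" by blast
    then show ?thesis using that[of "norm (D x0)"] D(2) \<zeta>(2) by auto
  qed
  obtain g Dg where g: "\<And>i. i \<in> Basis \<Longrightarrow> C1_grad UNIV (\<lambda>x. g x \<bullet> i) (Dg i)" "\<And>x. x \<in> S1 \<Longrightarrow> norm (D x - g x) < c / 2"
    using polynomial_field_approx[OF S1 continuous_on_subset[OF D(1) \<zeta>(2)], of "c/2"] c(1) by auto
  \<comment> \<open>With |D| \<ge> c and an error below c/2, the product of \<open>g\<close> and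
    \<open>D\<close> is at least |D|^2 - (c/2) |D|, hence at least (c/2) |D|; the factor
    \<open>2 / c\<close> normalises this.\<close>
  have gd: "2 / c * (g x \<bullet> D x) \<ge> norm (D x)" if x: "x \<in> S1" for x
  proof -
    have "norm (D x) * c \<le> norm (D x) * norm (D x)" using c(2)[OF x] by (intro mult_left_mono) auto
    also have "\<dots> = D x \<bullet> D x" by (simp add: power2_norm_eq_inner[symmetric] power2_eq_square)
    also have "\<dots> = g x \<bullet> D x + (D x - g x) \<bullet> D x" by (simp add: inner_diff_left)
    also have "(D x - g x) \<bullet> D x \<le> norm (D x - g x) * norm (D x)" by (rule norm_cauchy_schwarz)
    also have "\<dots> \<le> c / 2 * norm (D x)" using g(2)[OF x] by (intro mult_right_mono) auto
    finally show ?thesis using c(1) by (simp add: field_simps)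
  qed
  define Z where "Z i x = 2 / c * ((g x \<bullet> i) * \<zeta> x)" for i x
  have Z: "\<exists>DZ. C1_supp S1 (Z i) DZ" if "i \<in> Basis" for i
    unfolding Z_def using C1_supp_cmult[OF C1_supp_mult[OF open_UNIV g(1)[OF that] \<zeta>(1)], of "2 / c"] by auto
  then obtain DZ where DZ: "\<And>i. i \<in> Basis \<Longrightarrow> C1_supp S1 (Z i) (DZ i)" by metis
  have Zs: "(\<Sum>i\<in>Basis. Z i x * (D x \<bullet> i)) = \<zeta> x * (2 / c * (g x \<bullet> D x))" for x
    by (subst euclidean_inner[of "g x"]) (simp add: Z_def sum_distrib_left mult_ac)
  show ?thesis
  proof (rule that[OF S1 \<zeta>(2) DZ])
    show "(\<Sum>i\<in>Basis. Z i x * (D x \<bullet> i)) \<ge> 0" for x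
    proof (cases "x \<in> S1")
      case True
      have "0 \<le> norm (D x)" by simp
      with gd[OF True] have "0 \<le> 2 / c * (g x \<bullet> D x)" by linarith
      then show ?thesis unfolding Zs using \<zeta>(3)[of x] by (rule mult_nonneg_nonneg[rotated])
    qed (use C1_suppD(5)[OF \<zeta>(1)] in \<open>simp add: Zs\<close>)
    fix x assume x: "x \<in> S"
    have "x \<in> S1" using \<zeta>(4)[OF x] C1_suppD(5)[OF \<zeta>(1), of x] by force
    from gd[OF this] have a: "norm (D x) \<le> 2 / c * (g x \<bullet> D x)" .
    have "1 * norm (D x) \<le> \<zeta> x * (2 / c * (g x \<bullet> D x))" by (rule mult_mono[OF \<zeta>(4)[OF x] a]) (use \<zeta>(3)[of x] in auto)
    then show "(\<Sum>i\<in>Basis. Z i x * (D x \<bullet> i)) \<ge> norm (D x)" unfolding Zs by simp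
  qed
qed

section \<open>One-dimensional cutoffs and elementary bounds\<close>

lemma DERIV_max_0_power2: "((\<lambda>s::real. (max 0 s)\<^sup>2) has_real_derivative 2 * max 0 s) (at s)"
proof (cases s "0::real" rule: linorder_cases)
  case less
  then show ?thesis
    by (intro has_field_derivative_transform_within_open[of "\<lambda>_. 0" _ _ "{..<0}" "\<lambda>s. (max 0 s)\<^sup>2", rotated]) auto
next
  case greater
  have "((\<lambda>s::real. s\<^sup>2) has_real_derivative 2 * max 0 s) (at s)"
    using greater by (auto intro!: derivative_eq_intros)
  then show ?thesis
    by (rule has_field_derivative_transform_within_open[of _ _ _ "{0<..}"]) (use greater in auto)
next
  case equal
  have "((\<lambda>h::real. (max 0 h)\<^sup>2 / h) \<longlongrightarrow> 0) (at 0)"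
  proof (rule Lim_null_comparison)
    show "\<forall>\<^sub>F h in at 0. norm ((max 0 h)\<^sup>2 / h) \<le> \<bar>h\<bar>" for h :: real
      by (rule always_eventually) (auto simp: max_def power2_eq_square)
    show "((\<lambda>h::real. \<bar>h\<bar>) \<longlongrightarrow> 0) (at 0)" using tendsto_rabs_zero[OF tendsto_ident_at] by simp
  qed
  then show ?thesis using equal by (simp add: DERIV_def)
qed

text \<open>A nondecreasing C1 step that is 0 up to \<open>s = 1\<close> and tends to 1 at infinity.
  The square of the positive part makes the derivative continuous at 1.\<close>

definition sstep :: "real \<Rightarrow> real" where "sstep s = (max 0 (s - 1))\<^sup>2 / ((max 0 (s - 1))\<^sup>2 + 1)"
definition sstep' :: "real \<Rightarrow> real" where "sstep' s = 2 * max 0 (s - 1) / ((max 0 (s - 1))\<^sup>2 + 1)\<^sup>2"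

lemma sstep_deriv: "(sstep has_real_derivative sstep' s) (at s)"
proof -
  have 1: "((\<lambda>s::real. (max 0 (s - 1))\<^sup>2) has_real_derivative 2 * max 0 (s - 1)) (at s)"
  proof -
    have "((\<lambda>s::real. s - 1) has_real_derivative 1) (at s)" by (auto intro!: derivative_eq_intros)
    from DERIV_chain2[OF DERIV_max_0_power2 this] show ?thesis by simp
  qed
  have ne: "(max 0 (s - 1))\<^sup>2 + 1 \<noteq> (0::real)" by (smt (verit) zero_le_power2)
  have "((\<lambda>s::real. (max 0 (s - 1))\<^sup>2 / ((max 0 (s - 1))\<^sup>2 + 1)) has_real_derivative
     (2 * max 0 (s - 1) * ((max 0 (s - 1))\<^sup>2 + 1) - (max 0 (s - 1))\<^sup>2 * (2 * max 0 (s - 1))) / (((max 0 (s - 1))\<^sup>2 + 1) * ((max 0 (s - 1))\<^sup>2 + 1))) (at s)"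
    by (rule DERIV_divide[OF 1]) (use DERIV_add[OF 1 DERIV_const[of 1]] ne in simp_all)
  then show ?thesis unfolding sstep_def sstep'_def by (simp add: power2_eq_square algebra_simps)
qed

lemma sstep_props:
  "0 \<le> sstep s" "sstep s \<le> 1" "0 \<le> sstep' s" "s \<le> 1 \<Longrightarrow> sstep s = 0" "s \<le> 1 \<Longrightarrow> sstep' s = 0"
  "continuous_on X sstep'"
proof -
  have ne: "(max 0 (s - 1))\<^sup>2 + 1 > (0::real)" for s by (smt (verit) zero_le_power2)
  show "0 \<le> sstep s" "sstep s \<le> 1" "0 \<le> sstep' s" "s \<le> 1 \<Longrightarrow> sstep s = 0" "s \<le> 1 \<Longrightarrow> sstep' s = 0"
    using ne[of s] by (auto simp: sstep_def sstep'_def)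
  show "continuous_on X sstep'"
    unfolding sstep'_def using ne by (intro continuous_intros) (auto, metis less_irrefl)
qed

lemma sstep_tendsto: "s > 0 \<Longrightarrow> (\<lambda>n. sstep (real (Suc n) * s)) \<longlonglongrightarrow> 1"
proof -
  assume s: "s > 0"
  have "((\<lambda>t. sstep t) \<longlongrightarrow> 1) at_top"
  proof -
    have "((\<lambda>t::real. (t - 1)\<^sup>2 / ((t - 1)\<^sup>2 + 1)) \<longlongrightarrow> 1) at_top" by real_asymp
    moreover have "eventually (\<lambda>t::real. (t - 1)\<^sup>2 / ((t - 1)\<^sup>2 + 1) = sstep t) at_top"
      using eventually_ge_at_top[of 1] by eventually_elim (simp add: sstep_def)
    ultimately show ?thesis by (rule Lim_transform_eventually)
  qed
  moreover have "filterlim (\<lambda>n. real (Suc n) * s) at_top sequentially"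
    using s by real_asymp
  ultimately show ?thesis by (rule filterlim_compose)
qed

lemma powr_le_bound:
  fixes h M e E :: real
  assumes "0 \<le> h" "h \<le> M" "1 \<le> M" "0 \<le> e" "e \<le> E"
  shows "h powr e \<le> M powr E"
proof -
  have "h powr e \<le> M powr e" using assms by (intro powr_mono2) auto
  also have "\<dots> \<le> M powr E" using assms by (intro powr_mono) auto
  finally show ?thesis .
qed

text \<open>Trades the logarithm for an arbitrarily small loss in the exponent. For h \<le> 1 it is
  ln y \<le> y - 1 at y = h^(-k); for h > 1 it is ln h \<le> h, and the power of \<open>M\<close>
  compensates the factor h^(-k).\<close>

lemma abs_ln_le_powr:
  fixes h M k :: real
  assumes h: "0 < h" "h \<le> M" and M: "1 \<le> M" and k: "k > 0"
  shows "\<bar>ln h\<bar> \<le> (1 / k + M powr (k + 1)) * h powr (- k)"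
proof (cases "h \<le> 1")
  case True
  have "ln (1 / h powr k) \<le> 1 / h powr k - 1" by (rule ln_le_minus_one) (use h in auto)
  then have "k * (- ln h) \<le> h powr (- k)" using h by (simp add: ln_div ln_powr powr_minus_divide)
  then have "- ln h \<le> (1 / k) * h powr (- k)" using k by (simp add: field_simps)
  moreover have "\<bar>ln h\<bar> = - ln h" using True h by simp
  moreover have "0 \<le> M powr (k + 1) * h powr (- k)" by simp
  ultimately show ?thesis unfolding distrib_right by linarith
next
  case False
  have "\<bar>ln h\<bar> = ln h" using False by simp
  also have "\<dots> \<le> h" using ln_le_minus_one[of h] h by simp
  also have "\<dots> = h powr (k + 1) * h powr (- k)" using h by (simp add: powr_add[symmetric])
  also have "\<dots> \<le> M powr (k + 1) * h powr (- k)" using h k by (intro mult_right_mono powr_mono2) auto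
  also have "\<dots> \<le> (1 / k + M powr (k + 1)) * h powr (- k)" using k by (intro mult_right_mono) auto
  finally show ?thesis .
qed

section \<open>Flux, drift and the weak form\<close>

definition plap_flux :: "real \<Rightarrow> 'a::euclidean_space \<Rightarrow> 'a" where
  "plap_flux q \<xi> = norm \<xi> powr (q - 2) *\<^sub>R \<xi>"

lemma norm_plap_flux: "norm (plap_flux q \<xi>) = norm \<xi> powr (q - 1)"
proof (cases "\<xi> = 0")
  case False
  have "norm (plap_flux q \<xi>) = norm \<xi> powr (q - 2) * norm \<xi> powr 1" using False by (simp add: plap_flux_def)
  also have "\<dots> = norm \<xi> powr (q - 1)" by (subst powr_add[symmetric]) simp
  finally show ?thesis .
qed (simp add: plap_flux_def)

text \<open>All functions are Borel on the whole space and \<open>D\<close> vanishes off the domain,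
  so flux and drift can be integrated over the full space. Of \<open>P\<close>, which stands for the
  weak gradient of \<open>p\<close>, only boundedness and measurability are recorded.\<close>

locale plap_setting =
  fixes \<Omega> :: "'a::euclidean_space set" and p u :: "'a \<Rightarrow> real" and D P :: "'a \<Rightarrow> 'a" and L L' :: real
  assumes open_\<Omega>: "open \<Omega>" and u_C1: "C1_grad \<Omega> u D" and D_out: "\<And>x. x \<notin> \<Omega> \<Longrightarrow> D x = 0"
    and u_borel: "u \<in> borel_measurable borel" and p_borel: "p \<in> borel_measurable borel"
    and P_borel: "P \<in> borel_measurable borel" and P_bound: "\<And>x. norm (P x) \<le> L'"
    and p_lip: "L-lipschitz_on \<Omega> p" and p_gt1: "\<And>x. x \<in> \<Omega> \<Longrightarrow> 1 < p x"
begin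

definition "flux x = plap_flux (p x) (D x)"
definition "drift x = norm (D x) powr (p x - 2) * ln (norm (D x)) * (D x \<bullet> P x)"
definition "wform \<phi> D\<phi> = (\<integral>x. flux x \<bullet> D\<phi> x + drift x * \<phi> x \<partial>lborel)"
definition "regular = {x \<in> \<Omega>. D x \<noteq> 0}"

lemma D_cont: "continuous_on \<Omega> D" and u_cont: "continuous_on \<Omega> u" and p_cont: "continuous_on \<Omega> p"
  using C1_gradD[OF u_C1] lipschitz_on_continuous_on[OF p_lip] by auto

lemma L_nonneg: "0 \<le> L" and L'_nonneg: "0 \<le> L'"
  using lipschitz_on_nonneg[OF p_lip] order_trans[OF norm_ge_zero P_bound] by auto

lemma D_borel: "D \<in> borel_measurable borel"
proof -
  have "(\<lambda>x. indicator \<Omega> x *\<^sub>R D x) \<in> borel_measurable borel"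
    by (rule borel_measurable_continuous_on_indicator) (use open_\<Omega> D_cont in auto)
  moreover have "(\<lambda>x. indicator \<Omega> x *\<^sub>R D x) = D" using D_out by (auto simp: indicator_def fun_eq_iff)
  ultimately show ?thesis by simp
qed

lemma flux_borel: "flux \<in> borel_measurable borel" and drift_borel: "drift \<in> borel_measurable borel"
proof -
  note [measurable] = D_borel p_borel P_borel
  show "flux \<in> borel_measurable borel" unfolding flux_def plap_flux_def by measurable
  show "drift \<in> borel_measurable borel" unfolding drift_def by measurable
qed

lemma open_regular: "open regular"
proof -
  have "open (\<Omega> \<inter> D -` (- {0}))"
    by (rule continuous_open_preimage[OF D_cont open_\<Omega>]) auto
  moreover have "regular = \<Omega> \<inter> D -` (- {0})" by (auto simp: regular_def)
  ultimately show ?thesis by simp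
qed

lemma regular_sub: "regular \<subseteq> \<Omega>" by (auto simp: regular_def)

lemma compact_bounds:
  assumes S: "compact S" "S \<subseteq> \<Omega>"
  obtains M p1 p2 where "M \<ge> 1" "1 < p1" "p1 \<le> p2"
    "\<And>x. x \<in> S \<Longrightarrow> norm (D x) \<le> M" "\<And>x. x \<in> S \<Longrightarrow> p1 \<le> p x \<and> p x \<le> p2"
proof (cases "S = {}")
  case True
  then show ?thesis using that[of 1 2 2] by auto
next
  case False
  have "bounded (D ` S)" using S D_cont by (meson compact_continuous_image compact_imp_bounded continuous_on_subset)
  then obtain M where M: "\<And>x. x \<in> S \<Longrightarrow> norm (D x) \<le> M" by (auto simp: bounded_iff)
  have pc: "continuous_on S p" using p_cont S(2) by (rule continuous_on_subset)
  obtain a where a: "a \<in> S" "\<And>x. x \<in> S \<Longrightarrow> p a \<le> p x" using continuous_attains_inf[OF S(1) False pc] by blast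
  obtain b where b: "b \<in> S" "\<And>x. x \<in> S \<Longrightarrow> p x \<le> p b" using continuous_attains_sup[OF S(1) False pc] by blast
  show ?thesis
    by (rule that[of "max 1 M" "p a" "p b"]) (use M a b p_gt1 S(2) in \<open>auto simp: le_max_iff_disj\<close>)
qed

lemma flux_drift_bounded:
  assumes S: "compact S" "S \<subseteq> \<Omega>"
  obtains C where "C \<ge> 0" "\<And>x. x \<in> S \<Longrightarrow> norm (flux x) \<le> C" "\<And>x. x \<in> S \<Longrightarrow> \<bar>drift x\<bar> \<le> C"
proof -
  obtain M p1 p2 where M: "M \<ge> 1" and p: "1 < p1" "p1 \<le> p2"
    and b: "\<And>x. x \<in> S \<Longrightarrow> norm (D x) \<le> M" "\<And>x. x \<in> S \<Longrightarrow> p1 \<le> p x \<and> p x \<le> p2"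
    using compact_bounds[OF S] by blast
  \<comment> \<open>The drift is of size h^(p-1) |ln h|; giving up the exponent
    \<open>p1 - 1\<close> to the logarithm leaves h^(p - p1), which is still bounded at h =
    0.\<close>
  define k where "k = p1 - 1"
  define c where "c = 1 / k + M powr (k + 1)"
  have k: "k > 0" using p by (simp add: k_def)
  have c: "c \<ge> 0" using k by (simp add: c_def)
  show ?thesis
  proof (rule that[of "M powr p2 + M powr p2 * c * L'"])
    show "0 \<le> M powr p2 + M powr p2 * c * L'" using c L'_nonneg by auto
    fix x assume x: "x \<in> S"
    have "norm (flux x) \<le> M powr p2"
      unfolding flux_def norm_plap_flux by (rule powr_le_bound) (use b[OF x] M p in auto)
    moreover have "0 \<le> M powr p2 * c * L'" using c L'_nonneg by auto
    ultimately show "norm (flux x) \<le> M powr p2 + M powr p2 * c * L'" by linarith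
    show "\<bar>drift x\<bar> \<le> M powr p2 + M powr p2 * c * L'"
    proof (cases "D x = 0")
      case False
      let ?h = "norm (D x)"
      have h: "?h > 0" using False by simp
      have "\<bar>drift x\<bar> \<le> ?h powr (p x - 2) * \<bar>ln ?h\<bar> * (?h * L')"
        unfolding drift_def abs_mult
        using Cauchy_Schwarz_ineq2[of "D x" "P x"] P_bound[of x] mult_left_mono[of "norm (P x)" L' ?h]
        by (intro mult_mono) auto
      also have "\<dots> \<le> ?h powr (p x - 2) * (c * ?h powr (- k)) * (?h * L')"
        using abs_ln_le_powr[OF h b(1)[OF x] M k] L'_nonneg h by (intro mult_mono) (auto simp: c_def)
      also have "\<dots> = (?h powr (p x - 2) * ?h powr (- k) * ?h powr 1) * c * L'" using h by simp
      also have "?h powr (p x - 2) * ?h powr (- k) * ?h powr 1 = ?h powr (p x - p1)"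
        unfolding powr_add[symmetric] by (simp add: k_def)
      also have "?h powr (p x - p1) * c * L' \<le> M powr p2 * c * L'"
        by (intro mult_right_mono powr_le_bound) (use b[OF x] M p c L'_nonneg in auto)
      finally show ?thesis by (smt (verit) powr_ge_zero)
    qed (use c L'_nonneg in \<open>simp add: drift_def\<close>)
  qed
qed

lemma wform_integrable:
  assumes f: "C1_supp S \<phi> D\<phi>" and S: "S \<subseteq> \<Omega>"
  shows "integrable lborel (\<lambda>x. flux x \<bullet> D\<phi> x)" "integrable lborel (\<lambda>x. drift x * \<phi> x)"
    "integrable lborel (\<lambda>x. flux x \<bullet> D\<phi> x + drift x * \<phi> x)"
proof -
  note F = C1_suppD[OF f]
  obtain C where C: "C \<ge> 0" "\<And>x. x \<in> S \<Longrightarrow> norm (flux x) \<le> C" "\<And>x. x \<in> S \<Longrightarrow> \<bar>drift x\<bar> \<le> C"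
    using flux_drift_bounded[OF F(1) S] by blast
  obtain B where B: "B \<ge> 0" "\<And>x. \<bar>\<phi> x\<bar> \<le> B" "\<And>x. norm (D\<phi> x) \<le> B" using C1_supp_bound[OF f] by metis
  have bm: "\<phi> \<in> borel_measurable borel" "D\<phi> \<in> borel_measurable borel"
    using F(3,4) by (auto intro: borel_measurable_continuous_onI)
  show 1: "integrable lborel (\<lambda>x. flux x \<bullet> D\<phi> x)"
  proof (rule integrable_compact_bounded[OF _ F(1)])
    show "norm (flux x \<bullet> D\<phi> x) \<le> C * B" if "x \<in> S" for x
      using Cauchy_Schwarz_ineq2[of "flux x" "D\<phi> x"] mult_mono[OF C(2)[OF that] B(3)[of x]] C by auto
  qed (use F(6) flux_borel bm in auto)
  show 2: "integrable lborel (\<lambda>x. drift x * \<phi> x)"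
  proof (rule integrable_compact_bounded[OF _ F(1)])
    show "norm (drift x * \<phi> x) \<le> C * B" if "x \<in> S" for x
      using mult_mono[OF C(3)[OF that] B(2)[of x]] C by (auto simp: abs_mult)
  qed (use F(5) drift_borel bm in auto)
  show "integrable lborel (\<lambda>x. flux x \<bullet> D\<phi> x + drift x * \<phi> x)" using 1 2 by auto
qed

lemma flux_cont_regular: "continuous_on regular flux"
  unfolding flux_def plap_flux_def
  by (intro continuous_intros continuous_on_subset[OF D_cont regular_sub] continuous_on_subset[OF p_cont regular_sub])
     (auto simp: regular_def)

text \<open>Integrating arctan((n+1) u) by parts along a transversal field bounds the mass of (n+1)
  / (1 + (n+1)^2 u^2) times the transversal component of \<open>D\<close> uniformly in
  \<open>n\<close>. On the zero set the first factor is n+1, so the transversal component vanishes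
  almost everywhere there, whereas on \<open>S\<close> it is at least |D| > 0.\<close>

lemma level_set_null:
  assumes S: "compact S" "S \<subseteq> regular"
  shows "AE x in lborel. x \<in> S \<longrightarrow> u x \<noteq> 0"
proof -
  have Dr: "continuous_on regular D" using D_cont regular_sub by (rule continuous_on_subset)
  obtain S1 Z DZ where Z: "compact S1" "S1 \<subseteq> regular" "\<And>i. i \<in> Basis \<Longrightarrow> C1_supp S1 (Z i) (DZ i)"
    "\<And>x. (\<Sum>i\<in>Basis. Z i x * (D x \<bullet> i)) \<ge> 0" "\<And>x. x \<in> S \<Longrightarrow> (\<Sum>i\<in>Basis. Z i x * (D x \<bullet> i)) \<ge> norm (D x)"
    using transversal_field[OF open_regular Dr _ S] by (auto simp: regular_def)
  let ?ZD = "\<lambda>x. (\<Sum>i\<in>Basis. Z i x * (D x \<bullet> i))"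
  let ?div = "\<lambda>x. (\<Sum>i\<in>Basis. DZ i x \<bullet> i)"
  have S1: "S1 \<subseteq> \<Omega>" using Z(2) regular_sub by auto
  have idiv: "integrable lborel ?div"
    by (rule integrable_continuous_compact_supp[OF _ Z(1)])
       (use C1_suppD(3,6)[OF Z(3)] in \<open>auto intro!: continuous_intros sum.neutral\<close>)
  have iZ: "integrable lborel ?ZD" by (rule field_by_parts(2)[OF open_\<Omega> u_C1 Z(3) S1])
  define N where "N = {x \<in> space borel. u x = 0} \<inter> S"
  have Nb: "N \<in> sets borel" unfolding N_def using u_borel S by (auto simp: borel_compact)
  have iN: "integrable lborel (\<lambda>x. indicator N x * ?ZD x)"
    using integrable_mult_indicator[of N lborel ?ZD] Nb iZ by simp
  define C where "C = (\<integral>x. 2 * \<bar>?div x\<bar> \<partial>lborel)"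
  have key: "real (Suc n) * (\<integral>x. indicator N x * ?ZD x \<partial>lborel) \<le> C" for n
  proof -
    let ?a = "\<lambda>s. arctan (real (Suc n) * s)" and ?a' = "\<lambda>s. real (Suc n) / (1 + (real (Suc n) * s)\<^sup>2)"
    have g: "C1_grad \<Omega> (\<lambda>x. ?a (u x)) (\<lambda>x. ?a' (u x) *\<^sub>R D x)"
    proof (rule C1_grad_chain[OF u_C1])
      show "(?a has_real_derivative ?a' s) (at s)" for s
        by (auto intro!: derivative_eq_intros simp: inverse_eq_divide)
      have "1 + (real (Suc n) * s)\<^sup>2 \<noteq> 0" for s by (smt (verit) zero_le_power2)
      then show "continuous_on (u ` \<Omega>) ?a'" by (intro continuous_intros) auto
    qed
    note P = field_by_parts[where Z = Z and DZ = DZ, OF open_\<Omega> g Z(3) S1]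
    have e: "(\<Sum>i\<in>Basis. Z i x * ((?a' (u x) *\<^sub>R D x) \<bullet> i)) = ?a' (u x) * ?ZD x" for x
      by (simp add: sum_distrib_left sum_divide_distrib mult_ac)
    have "real (Suc n) * (\<integral>x. indicator N x * ?ZD x \<partial>lborel) = (\<integral>x. real (Suc n) * (indicator N x * ?ZD x) \<partial>lborel)" by simp
    also have "\<dots> \<le> (\<integral>x. ?a' (u x) * ?ZD x \<partial>lborel)"
    proof (rule integral_mono)
      show "integrable lborel (\<lambda>x. ?a' (u x) * ?ZD x)" using P(2) unfolding e .
      fix x
      show "real (Suc n) * (indicator N x * ?ZD x) \<le> ?a' (u x) * ?ZD x"
      proof (cases "x \<in> N")
        case True then show ?thesis by (simp add: N_def)
      next
        case False
        have "0 \<le> ?a' (u x)" by simp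
        with Z(4)[of x] have "0 \<le> ?a' (u x) * ?ZD x" by (intro mult_nonneg_nonneg)
        with False show ?thesis by simp
      qed
    qed (use iN in auto)
    also have "\<dots> = - (\<integral>x. ?a (u x) * ?div x \<partial>lborel)" using P(1) unfolding e .
    also have "\<dots> \<le> \<bar>(\<integral>x. ?a (u x) * ?div x \<partial>lborel)\<bar>" by simp
    also have "\<dots> \<le> (\<integral>x. \<bar>?a (u x) * ?div x\<bar> \<partial>lborel)" by (rule integral_abs_bound)
    also have "\<dots> \<le> C" unfolding C_def
    proof (rule integral_mono)
      fix x
      have "\<bar>?a (u x)\<bar> \<le> 2"
        using arctan_lbound[of "real (Suc n) * u x"] arctan_ubound[of "real (Suc n) * u x"] pi_less_4 by (auto simp: abs_le_iff)
      then show "\<bar>?a (u x) * ?div x\<bar> \<le> 2 * \<bar>?div x\<bar>" unfolding abs_mult by (intro mult_right_mono) auto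
    qed (use P(3) idiv in auto)
    finally show ?thesis .
  qed
  have "(\<integral>x. indicator N x * ?ZD x \<partial>lborel) \<le> 0"
  proof (rule ccontr)
    assume "\<not> ?thesis"
    then have pos: "(\<integral>x. indicator N x * ?ZD x \<partial>lborel) > 0" by simp
    obtain n :: nat where "C < real n * (\<integral>x. indicator N x * ?ZD x \<partial>lborel)" using reals_Archimedean3[OF pos] by blast
    also have "\<dots> \<le> real (Suc n) * (\<integral>x. indicator N x * ?ZD x \<partial>lborel)" using pos by (intro mult_right_mono) auto
    finally show False using key[of n] by simp
  qed
  moreover have nn: "indicator N x * ?ZD x \<ge> 0" for x using Z(4) by simp
  ultimately have "(\<integral>x. indicator N x * ?ZD x \<partial>lborel) = 0"
    by (intro antisym Bochner_Integration.integral_nonneg) auto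
  then have "AE x in lborel. indicator N x * ?ZD x = 0"
    using integral_nonneg_eq_0_iff_AE[OF iN] nn by auto
  then show ?thesis
  proof eventually_elim
    case (elim x)
    show ?case
    proof (intro impI notI)
      assume x: "x \<in> S" "u x = 0"
      then have "x \<in> N" by (auto simp: N_def)
      then have "?ZD x = 0" using elim by simp
      then have "norm (D x) \<le> 0" using Z(5)[OF x(1)] by simp
      then show False using x S(2) by (auto simp: regular_def)
    qed
  qed
qed

end

lemma integral_factor_tendsto:
  fixes f :: "'a::euclidean_space \<Rightarrow> real"
  assumes f: "integrable lborel f" and c: "\<And>n. c n \<in> borel_measurable borel" "\<And>n x. \<bar>c n x\<bar> \<le> K"
    and l: "AE x in lborel. f x \<noteq> 0 \<longrightarrow> (\<lambda>n. c n x) \<longlonglongrightarrow> 1"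
  shows "(\<lambda>n. \<integral>x. c n x * f x \<partial>lborel) \<longlonglongrightarrow> (\<integral>x. f x \<partial>lborel)"
proof (rule integral_dominated_convergence[where w = "\<lambda>x. K * \<bar>f x\<bar>"])
  have fm: "f \<in> borel_measurable borel" using f by auto
  show "AE x in lborel. (\<lambda>n. c n x * f x) \<longlonglongrightarrow> f x"
    using l
  proof eventually_elim
    case (elim x)
    show ?case
    proof (cases "f x = 0")
      case False
      then have "(\<lambda>n. c n x * f x) \<longlonglongrightarrow> 1 * f x" using elim by (intro tendsto_intros) auto
      then show ?thesis by simp
    qed simp
  qed
  show "AE x in lborel. norm (c n x * f x) \<le> K * \<bar>f x\<bar>" for n
    using c(2) by (intro AE_I2) (auto simp: abs_mult intro: mult_right_mono)
qed (use f c(1) in auto)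

text \<open>The equation enters as an identity for test functions of either sign; passing to it from
  the two one-sided inequalities is left to the interpretation of the locale.\<close>

locale plap_solution = plap_setting +
  assumes eqn: "\<And>S \<phi> D\<phi>. C1_supp S \<phi> D\<phi> \<Longrightarrow> S \<subseteq> {x \<in> \<Omega>. u x \<noteq> 0} \<Longrightarrow> wform \<phi> D\<phi> = 0"
begin

text \<open>Test with \<open>\<eta>\<^sub>n(u) \<phi>\<close>, where \<open>\<eta>\<^sub>n\<close> vanishes near 0 and tends to 1 elsewhere. If \<open>flux\<close> were a smooth field \<open>G\<close>,
  the extra term would be \<open>\<integral> \<eta>\<^sub>n'(u) \<phi> G \<bullet> D = - \<integral> \<eta>\<^sub>n(u) div (\<phi> G)\<close>, which tends to \<open>- \<integral> div (\<phi> G) = 0\<close>. The error of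
  replacing \<open>flux\<close> by a polynomial field is controlled by \<open>|\<eta>\<^sub>n'| \<le> \<mu>\<^sub>n'\<close> and a transversal field, along which
  \<open>\<mu>\<^sub>n'(u)\<close> has bounded mass.\<close>

lemma wform_eq_0_on_regular:
  assumes \<phi>: "C1_supp S \<phi> D\<phi>" and S: "S \<subseteq> regular"
  shows "wform \<phi> D\<phi> = 0"
proof -
  note F = C1_suppD[OF \<phi>]
  have S\<Omega>: "S \<subseteq> \<Omega>" using S regular_sub by auto
  define \<eta> where "\<eta> n s = sstep (real (Suc n) * s) + sstep (real (Suc n) * (- s))" for n s
  define \<eta>' where "\<eta>' n s = real (Suc n) * (sstep' (real (Suc n) * s) - sstep' (real (Suc n) * (- s)))" for n s
  \<comment> \<open>The odd companion of the even function \<open>\<eta>\<close>: its derivative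
    adds the two pieces that the derivative of \<open>\<eta>\<close> subtracts, so it dominates the
    modulus of the latter, and it is itself the derivative of a function bounded uniformly in
    \<open>n\<close>.\<close>
  define \<mu> where "\<mu> n s = sstep (real (Suc n) * s) - sstep (real (Suc n) * (- s))" for n s
  define \<mu>' where "\<mu>' n s = real (Suc n) * (sstep' (real (Suc n) * s) + sstep' (real (Suc n) * (- s)))" for n s
  have d1: "((\<lambda>s. sstep (c * s)) has_real_derivative sstep' (c * s) * c) (at s)" for c s
    using DERIV_chain2[OF sstep_deriv, of "\<lambda>s. c * s" c s UNIV] by (auto intro!: derivative_eq_intros)
  have d2: "((\<lambda>s. sstep (c * - s)) has_real_derivative sstep' (c * - s) * - c) (at s)" for c s
    using d1[of "- c" s] by simp
  have \<eta>d: "(\<eta> n has_real_derivative \<eta>' n s) (at s)" for n s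
    using DERIV_add[OF d1[of "real (Suc n)" s] d2[of "real (Suc n)" s]] unfolding \<eta>_def \<eta>'_def by (simp add: algebra_simps)
  have \<mu>d: "(\<mu> n has_real_derivative \<mu>' n s) (at s)" for n s
    using DERIV_diff[OF d1[of "real (Suc n)" s] d2[of "real (Suc n)" s]] unfolding \<mu>_def \<mu>'_def by (simp add: algebra_simps)
  have sc: "continuous_on X (\<lambda>s. sstep' (c * s))" for c X
    by (rule continuous_on_compose2[OF sstep_props(6)[of UNIV]]) (auto intro!: continuous_intros)
  have sc2: "continuous_on X (\<lambda>s. sstep' (c * - s))" for c X
    using sc[of X "- c"] by simp
  have \<eta>c: "continuous_on X (\<eta>' n)" and \<mu>c: "continuous_on X (\<mu>' n)" for n X
    unfolding \<eta>'_def \<mu>'_def by (intro continuous_intros sc sc2)+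
  have \<eta>b: "\<bar>\<eta> n s\<bar> \<le> 2" and \<mu>b: "\<bar>\<mu> n s\<bar> \<le> 2" for n s
    using sstep_props(1,2)[of "real (Suc n) * s"] sstep_props(1,2)[of "real (Suc n) * (- s)"] unfolding \<eta>_def \<mu>_def by linarith+
  have \<eta>\<mu>: "\<bar>\<eta>' n s\<bar> \<le> \<mu>' n s" and \<mu>0: "0 \<le> \<mu>' n s" for n s
  proof -
    have "\<bar>sstep' (real (Suc n) * s) - sstep' (real (Suc n) * (- s))\<bar> \<le> sstep' (real (Suc n) * s) + sstep' (real (Suc n) * (- s))"
      using sstep_props(3)[of "real (Suc n) * s"] sstep_props(3)[of "real (Suc n) * (- s)"] by linarith
    then show "\<bar>\<eta>' n s\<bar> \<le> \<mu>' n s" unfolding \<eta>'_def \<mu>'_def abs_mult by (simp add: mult_left_mono)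
    then show "0 \<le> \<mu>' n s" by linarith
  qed
  have \<eta>m: "(\<lambda>x. \<eta> n (u x)) \<in> borel_measurable borel" for n
  proof -
    have "continuous_on UNIV (\<eta> n)" using \<eta>d by (meson DERIV_isCont continuous_at_imp_continuous_on)
    then show ?thesis using u_borel borel_measurable_continuous_onI measurable_compose by blast
  qed
  have \<eta>lim: "(\<lambda>n. \<eta> n s) \<longlonglongrightarrow> 1" if "s \<noteq> 0" for s
  proof -
    have z: "sstep (real (Suc n) * t) = 0" if "t < 0" for n t
      by (rule sstep_props(4)) (use that in \<open>smt (verit) mult_nonneg_nonpos of_nat_0_le_iff\<close>)
    show ?thesis
    proof (cases "s > 0")
      case True
      then show ?thesis using sstep_tendsto[OF True] z[of "- s"] unfolding \<eta>_def by simp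
    next
      case False
      then show ?thesis using sstep_tendsto[of "- s"] z[of s] that unfolding \<eta>_def by simp
    qed
  qed
  have lim1: "AE x in lborel. x \<in> S \<longrightarrow> (\<lambda>n. \<eta> n (u x)) \<longlonglongrightarrow> 1"
    using level_set_null[OF F(1) S] by eventually_elim (use \<eta>lim in auto)
  have g\<eta>: "C1_grad \<Omega> (\<lambda>x. \<eta> n (u x)) (\<lambda>x. \<eta>' n (u x) *\<^sub>R D x)" and g\<mu>: "C1_grad \<Omega> (\<lambda>x. \<mu> n (u x)) (\<lambda>x. \<mu>' n (u x) *\<^sub>R D x)" for n
    using C1_grad_chain[OF u_C1, of "\<eta> n" "\<eta>' n"] C1_grad_chain[OF u_C1, of "\<mu> n" "\<mu>' n"] \<eta>d \<mu>d \<eta>c \<mu>c by auto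
  define R where "R n = (\<integral>x. \<phi> x * \<eta>' n (u x) * (flux x \<bullet> D x) \<partial>lborel)" for n
  note wi = wform_integrable[OF \<phi> S\<Omega>]
  have cR: "continuous_on UNIV (\<lambda>x. \<phi> x *\<^sub>R (\<eta>' n (u x) * (G x \<bullet> D x)))" if G: "continuous_on regular G" for n G
  proof (rule continuous_on_supp_scaleR[OF open_regular compact_imp_closed[OF F(1)] S _ F(4)])
    have "continuous_on regular (\<lambda>x. \<eta>' n (u x))"
      by (rule continuous_on_compose2[OF \<eta>c[of UNIV]]) (use u_cont regular_sub continuous_on_subset in auto)
    then show "continuous_on regular (\<lambda>x. \<eta>' n (u x) * (G x \<bullet> D x))"
      by (intro continuous_intros G continuous_on_subset[OF D_cont regular_sub])
  qed (use F(5) in auto)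
  have iR: "integrable lborel (\<lambda>x. \<phi> x * \<eta>' n (u x) * (G x \<bullet> D x))" if G: "continuous_on regular G" for n G
    using integrable_continuous_compact_supp[OF cR[OF G, of n] F(1)] F(5) by (auto simp: mult.assoc)
  have eqR: "(\<integral>x. \<eta> n (u x) * (flux x \<bullet> D\<phi> x + drift x * \<phi> x) \<partial>lborel) = - R n" for n
  proof -
    let ?f = "\<lambda>x. \<eta> n (u x) * \<phi> x" and ?D = "\<lambda>x. \<phi> x *\<^sub>R (\<eta>' n (u x) *\<^sub>R D x) + \<eta> n (u x) *\<^sub>R D\<phi> x"
    have f: "C1_supp S ?f ?D" by (rule C1_supp_mult[OF open_\<Omega> g\<eta> \<phi> S\<Omega>])
    \<comment> \<open>\<open>sstep\<close> vanishes up to argument 1, so the test function lives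
      where |u| \<ge> 1/(n+1), a compact subset of the set where the equation is given.\<close>
    define S' where "S' = S \<inter> (\<lambda>x. \<bar>u x\<bar>) -` {1 / real (Suc n)..}"
    have "closed S'" unfolding S'_def
      by (rule continuous_closed_preimage[OF _ compact_imp_closed[OF F(1)]]) (use continuous_on_subset[OF u_cont S\<Omega>] in \<open>auto intro!: continuous_intros\<close>)
    then have S': "compact S'" using compact_Int_closed[OF F(1)] by (metis Int_absorb1 S'_def inf_le1)
    have z: "?f x = 0" if "x \<notin> S'" for x
    proof (cases "x \<in> S")
      case True
      then have "\<bar>u x\<bar> < 1 / real (Suc n)" using that by (auto simp: S'_def)
      then have "real (Suc n) * u x \<le> 1" "real (Suc n) * (- u x) \<le> 1" by (auto simp: field_simps abs_less_iff)
      then show ?thesis using sstep_props(4) by (simp add: \<eta>_def)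
    qed (use F(5) in auto)
    have "wform ?f ?D = 0"
    proof (rule eqn[OF C1_supp_restrict[OF f S' z]])
      have "u x \<noteq> 0" if "x \<in> S'" for x
      proof
        assume "u x = 0"
        then have "1 / real (Suc n) \<le> 0" using that by (auto simp: S'_def)
        then show False by (simp add: divide_le_0_iff)
      qed
      then show "S' \<subseteq> {x \<in> \<Omega>. u x \<noteq> 0}" using S\<Omega> by (auto simp: S'_def)
    qed
    moreover have "flux x \<bullet> ?D x + drift x * ?f x = \<phi> x * \<eta>' n (u x) * (flux x \<bullet> D x) + \<eta> n (u x) * (flux x \<bullet> D\<phi> x + drift x * \<phi> x)" for x
      by (simp add: inner_add_right algebra_simps)
    ultimately have "(\<integral>x. \<phi> x * \<eta>' n (u x) * (flux x \<bullet> D x) + \<eta> n (u x) * (flux x \<bullet> D\<phi> x + drift x * \<phi> x) \<partial>lborel) = 0"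
      by (simp add: wform_def)
    moreover have "integrable lborel (\<lambda>x. \<eta> n (u x) * (flux x \<bullet> D\<phi> x + drift x * \<phi> x))"
    proof (rule Bochner_Integration.integrable_bound)
      show "integrable lborel (\<lambda>x. 2 * (flux x \<bullet> D\<phi> x + drift x * \<phi> x))" using wi by auto
      show "(\<lambda>x. \<eta> n (u x) * (flux x \<bullet> D\<phi> x + drift x * \<phi> x)) \<in> borel_measurable lborel" using \<eta>m wi(3) by auto
      show "AE x in lborel. norm (\<eta> n (u x) * (flux x \<bullet> D\<phi> x + drift x * \<phi> x)) \<le> norm (2 * (flux x \<bullet> D\<phi> x + drift x * \<phi> x))"
        by (intro AE_I2, unfold real_norm_def abs_mult abs_numeral, intro mult_right_mono \<eta>b abs_ge_zero)
    qed
    ultimately show ?thesis unfolding R_def using iR[OF flux_cont_regular, of n] by simp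
  qed
  have "(\<lambda>n. \<integral>x. \<eta> n (u x) * (flux x \<bullet> D\<phi> x + drift x * \<phi> x) \<partial>lborel) \<longlonglongrightarrow> (\<integral>x. flux x \<bullet> D\<phi> x + drift x * \<phi> x \<partial>lborel)"
  proof (rule integral_factor_tendsto[OF wi(3) \<eta>m \<eta>b])
    show "AE x in lborel. flux x \<bullet> D\<phi> x + drift x * \<phi> x \<noteq> 0 \<longrightarrow> (\<lambda>n. \<eta> n (u x)) \<longlonglongrightarrow> 1"
      using lim1 by eventually_elim (use F(5,6) in force)
  qed
  then have T: "(\<lambda>n. - R n) \<longlonglongrightarrow> wform \<phi> D\<phi>" unfolding eqR wform_def .
  have Dr: "continuous_on regular D" using D_cont regular_sub by (rule continuous_on_subset)
  obtain S1 Z DZ where Z: "compact S1" "S1 \<subseteq> regular" "\<And>i. i \<in> Basis \<Longrightarrow> C1_supp S1 (Z i) (DZ i)"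
    "\<And>x. (\<Sum>i\<in>Basis. Z i x * (D x \<bullet> i)) \<ge> 0" "\<And>x. x \<in> S \<Longrightarrow> (\<Sum>i\<in>Basis. Z i x * (D x \<bullet> i)) \<ge> norm (D x)"
    using transversal_field[OF open_regular Dr _ F(1) S] by (auto simp: regular_def)
  have S1: "S1 \<subseteq> \<Omega>" using Z(2) regular_sub by auto
  let ?ZD = "\<lambda>x. (\<Sum>i\<in>Basis. Z i x * (D x \<bullet> i))" and ?div = "\<lambda>x. (\<Sum>i\<in>Basis. DZ i x \<bullet> i)"
  have idiv: "integrable lborel ?div"
    by (rule integrable_continuous_compact_supp[OF _ Z(1)])
       (use C1_suppD(3,6)[OF Z(3)] in \<open>auto intro!: continuous_intros sum.neutral\<close>)
  define C where "C = (\<integral>x. 2 * \<bar>?div x\<bar> \<partial>lborel)"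
  have sum\<mu>: "(\<Sum>i\<in>Basis. Z i x * ((\<mu>' n (u x) *\<^sub>R D x) \<bullet> i)) = \<mu>' n (u x) * ?ZD x" for x n
    by (simp add: sum_distrib_left mult_ac)
  note P\<mu> = field_by_parts[where Z = Z and DZ = DZ, OF open_\<Omega> g\<mu> Z(3) S1, unfolded sum\<mu>]
  have Cb: "(\<integral>x. \<mu>' n (u x) * ?ZD x \<partial>lborel) \<le> C" for n
  proof -
    have "(\<integral>x. \<mu>' n (u x) * ?ZD x \<partial>lborel) \<le> \<bar>(\<integral>x. \<mu> n (u x) * ?div x \<partial>lborel)\<bar>" using P\<mu>(1)[of n] by simp
    also have "\<dots> \<le> (\<integral>x. \<bar>\<mu> n (u x) * ?div x\<bar> \<partial>lborel)" by (rule integral_abs_bound)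
    also have "\<dots> \<le> C" unfolding C_def
    proof (rule integral_mono)
      fix x show "\<bar>\<mu> n (u x) * ?div x\<bar> \<le> 2 * \<bar>?div x\<bar>" unfolding abs_mult by (intro mult_right_mono \<mu>b) auto
    qed (use P\<mu>(3) idiv in auto)
    finally show ?thesis .
  qed
  obtain B where B: "B \<ge> 0" "\<And>x. \<bar>\<phi> x\<bar> \<le> B" "\<And>x. norm (D\<phi> x) \<le> B" using C1_supp_bound[OF \<phi>] by metis
  \<comment> \<open>The constants \<open>B\<close> and \<open>C\<close> are fixed before the
    polynomial field, so the approximation error \<open>e\<close> can be sent to 0
    afterwards.\<close>
  have "\<bar>wform \<phi> D\<phi>\<bar> \<le> e * (B * C)" if e: "e > 0" for e
  proof -
    obtain g Dg where g: "\<And>i. i \<in> Basis \<Longrightarrow> C1_grad UNIV (\<lambda>x. g x \<bullet> i) (Dg i)" "\<And>x. x \<in> S \<Longrightarrow> norm (flux x - g x) < e"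
      using polynomial_field_approx[OF F(1) continuous_on_subset[OF flux_cont_regular S] e] by blast
    have gc: "continuous_on X g" for X
      by (subst continuous_on_componentwise) (use C1_gradD(3)[OF g(1)] continuous_on_subset in blast)
    define Y where "Y i x = (g x \<bullet> i) * \<phi> x" for i x
    define DY where "DY i x = \<phi> x *\<^sub>R Dg i x + (g x \<bullet> i) *\<^sub>R D\<phi> x" for i x
    have Y: "C1_supp S (Y i) (DY i)" if "i \<in> Basis" for i
      unfolding Y_def DY_def by (rule C1_supp_mult[OF open_UNIV g(1)[OF that] \<phi>]) auto
    let ?dY = "\<lambda>x. \<Sum>i\<in>Basis. DY i x \<bullet> i"
    have sumY: "(\<Sum>i\<in>Basis. Y i x * ((\<eta>' n (u x) *\<^sub>R D x) \<bullet> i)) = \<phi> x * \<eta>' n (u x) * (g x \<bullet> D x)" for x n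
      by (subst euclidean_inner[of "g x"]) (simp add: Y_def sum_distrib_left mult_ac)
    note PY = field_by_parts[where Z = Y and DZ = DY, OF open_\<Omega> g\<eta> Y S\<Omega>, unfolded sumY]
    have idY: "integrable lborel ?dY"
      by (rule integrable_continuous_compact_supp[OF _ F(1)])
         (use C1_suppD(3,6)[OF Y] in \<open>auto intro!: continuous_intros sum.neutral\<close>)
    have "(\<lambda>n. \<integral>x. \<eta> n (u x) * ?dY x \<partial>lborel) \<longlonglongrightarrow> (\<integral>x. ?dY x \<partial>lborel)"
    proof (rule integral_factor_tendsto[OF idY \<eta>m \<eta>b])
      have z: "?dY x = 0" if "x \<notin> S" for x using C1_suppD(6)[OF Y that] by (auto intro!: sum.neutral)
      show "AE x in lborel. ?dY x \<noteq> 0 \<longrightarrow> (\<lambda>n. \<eta> n (u x)) \<longlonglongrightarrow> 1"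
        using lim1 by eventually_elim (use z in blast)
    qed
    moreover have "(\<integral>x. ?dY x \<partial>lborel) = 0"
    proof -
      have "(\<integral>x. ?dY x \<partial>lborel) = (\<Sum>i\<in>Basis. \<integral>x. DY i x \<bullet> i \<partial>lborel)"
        by (rule Bochner_Integration.integral_sum)
           (rule integrable_continuous_compact_supp[OF _ F(1)], use C1_suppD(3,6)[OF Y] in \<open>auto intro!: continuous_intros\<close>)
      also have "\<dots> = 0" using integral_partial_zero[OF Y] by (intro sum.neutral) auto
      finally show ?thesis .
    qed
    ultimately have "(\<lambda>n. - (\<integral>x. \<eta> n (u x) * ?dY x \<partial>lborel)) \<longlonglongrightarrow> - 0"
      by (intro tendsto_minus) simp
    then have l0: "(\<lambda>n. \<integral>x. \<phi> x * \<eta>' n (u x) * (g x \<bullet> D x) \<partial>lborel) \<longlonglongrightarrow> 0"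
      using PY(1) by simp
    have est: "\<bar>R n - (\<integral>x. \<phi> x * \<eta>' n (u x) * (g x \<bullet> D x) \<partial>lborel)\<bar> \<le> e * (B * C)" for n
    proof -
      note i1 = iR[OF flux_cont_regular, of n] and i2 = iR[OF gc, of n]
      have e0: "R n - (\<integral>x. \<phi> x * \<eta>' n (u x) * (g x \<bullet> D x) \<partial>lborel) =
          (\<integral>x. \<phi> x * \<eta>' n (u x) * (flux x \<bullet> D x) - \<phi> x * \<eta>' n (u x) * (g x \<bullet> D x) \<partial>lborel)"
        unfolding R_def by (rule Bochner_Integration.integral_diff[symmetric, OF i1 i2])
      have "\<bar>R n - (\<integral>x. \<phi> x * \<eta>' n (u x) * (g x \<bullet> D x) \<partial>lborel)\<bar> \<le>
          (\<integral>x. \<bar>\<phi> x * \<eta>' n (u x) * (flux x \<bullet> D x) - \<phi> x * \<eta>' n (u x) * (g x \<bullet> D x)\<bar> \<partial>lborel)"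
        unfolding e0 by (rule integral_abs_bound)
      also have "\<dots> \<le> (\<integral>x. e * B * (\<mu>' n (u x) * ?ZD x) \<partial>lborel)"
      proof (rule integral_mono)
        fix x
        show "\<bar>\<phi> x * \<eta>' n (u x) * (flux x \<bullet> D x) - \<phi> x * \<eta>' n (u x) * (g x \<bullet> D x)\<bar> \<le> e * B * (\<mu>' n (u x) * ?ZD x)"
        proof (cases "x \<in> S")
          case True
          have "\<bar>\<phi> x * \<eta>' n (u x) * (flux x \<bullet> D x) - \<phi> x * \<eta>' n (u x) * (g x \<bullet> D x)\<bar>
            = \<bar>\<phi> x\<bar> * \<bar>\<eta>' n (u x)\<bar> * \<bar>(flux x - g x) \<bullet> D x\<bar>"
            by (simp add: abs_mult[symmetric] inner_diff_left right_diff_distrib)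
          also have "\<dots> \<le> B * \<mu>' n (u x) * (e * ?ZD x)"
          proof (intro mult_mono B(2) \<eta>\<mu>)
            have "\<bar>(flux x - g x) \<bullet> D x\<bar> \<le> norm (flux x - g x) * norm (D x)" by (rule Cauchy_Schwarz_ineq2)
            also have "\<dots> \<le> e * ?ZD x" by (intro mult_mono Z(5)[OF True]) (use g(2)[OF True] e in auto)
            finally show "\<bar>(flux x - g x) \<bullet> D x\<bar> \<le> e * ?ZD x" .
          qed (use B(1) \<mu>0 in auto)
          finally show ?thesis by (simp add: mult_ac)
        next
          case False
          then show ?thesis using F(5)[of x] e B(1) \<mu>0[of n "u x"] Z(4)[of x] by simp
        qed
      qed (use i1 i2 P\<mu>(2)[of n] in auto)
      also have "\<dots> = e * B * (\<integral>x. \<mu>' n (u x) * ?ZD x \<partial>lborel)" by simp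
      also have "\<dots> \<le> e * B * C" using Cb[of n] e B(1) by (intro mult_left_mono) auto
      finally show ?thesis by (simp add: mult.assoc)
    qed
    have "(\<lambda>n. \<bar>R n - (\<integral>x. \<phi> x * \<eta>' n (u x) * (g x \<bullet> D x) \<partial>lborel)\<bar>) \<longlonglongrightarrow> \<bar>- wform \<phi> D\<phi> - 0\<bar>"
      using tendsto_minus[OF T] l0 by (intro tendsto_intros) simp_all
    then have "\<bar>- wform \<phi> D\<phi> - 0\<bar> \<le> e * (B * C)"
      by (rule LIMSEQ_le_const2) (use est in auto)
    then show ?thesis by simp
  qed
  moreover have "e * (B * C) \<le> e * (B * \<bar>C\<bar> + 1)" if "e > 0" for e using that B(1) by (intro mult_left_mono add_increasing2 mult_left_mono) auto
  ultimately have le: "\<bar>wform \<phi> D\<phi>\<bar> \<le> e * (B * \<bar>C\<bar> + 1)" if "e > 0" for e using that by (meson order_trans)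
  have pos: "B * \<bar>C\<bar> + 1 > 0" using B(1) by (simp add: add_nonneg_pos)
  have "\<bar>wform \<phi> D\<phi>\<bar> \<le> 0"
  proof (rule field_le_epsilon)
    fix e :: real assume "e > 0"
    then show "\<bar>wform \<phi> D\<phi>\<bar> \<le> 0 + e" using le[of "e / (B * \<bar>C\<bar> + 1)"] pos by simp
  qed
  then show ?thesis by simp
qed

end

section \<open>Energy estimate for difference quotients\<close>

text \<open>The derivative of \<open>plap_flux q\<close> at \<open>d\<close> in direction
  \<open>v\<close>. For nonzero \<open>d\<close> its matrix is |d|^(q-2) times one with eigenvalue q
  - 1 along \<open>d\<close> and 1 orthogonal to it; this is where q > 1 gives ellipticity.\<close>

definition plap_lin :: "real \<Rightarrow> 'a::euclidean_space \<Rightarrow> 'a \<Rightarrow> 'a" where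
  "plap_lin q d v = norm d powr (q - 2) *\<^sub>R v + ((q - 2) * norm d powr (q - 4) * (d \<bullet> v)) *\<^sub>R d"

lemma has_gradient_norm_powr:
  fixes \<xi> :: "'a::euclidean_space"
  assumes "\<xi> \<noteq> 0"
  shows "has_gradient (\<lambda>\<xi>. norm \<xi> powr a) ((a * norm \<xi> powr (a - 2)) *\<^sub>R \<xi>) \<xi>"
proof -
  have e: "norm x powr b = (x \<bullet> x) powr (b / 2)" for x :: 'a and b
    by (cases "x = 0") (simp_all add: power2_norm_eq_inner[symmetric] powr_powr flip: powr_numeral)
  have g: "has_gradient (\<lambda>x::'a. x \<bullet> x) (2 *\<^sub>R \<xi>) \<xi>"
    by (auto intro!: derivative_eq_intros simp: inner_commute)
  have "((\<lambda>s. s powr (a / 2)) has_real_derivative (a / 2) * (\<xi> \<bullet> \<xi>) powr (a / 2 - 1)) (at (\<xi> \<bullet> \<xi>))"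
    using assms by (auto intro!: derivative_eq_intros)
  from has_gradient_chain[OF g this] show ?thesis
    unfolding e by (simp add: diff_divide_distrib)
qed

lemma plap_flux_has_derivative:
  fixes \<xi> :: "'a::euclidean_space"
  assumes "\<xi> \<noteq> 0"
  shows "(plap_flux q has_derivative plap_lin q \<xi>) (at \<xi>)"
proof -
  have "((\<lambda>\<xi>. norm \<xi> powr (q - 2) *\<^sub>R \<xi>) has_derivative
     (\<lambda>h. norm \<xi> powr (q - 2) *\<^sub>R h + (((q - 2) * norm \<xi> powr (q - 2 - 2)) *\<^sub>R \<xi> \<bullet> h) *\<^sub>R \<xi>)) (at \<xi>)"
    by (rule has_derivative_scaleR[OF has_gradient_norm_powr[OF assms] has_derivative_ident])
  then show ?thesis unfolding plap_flux_def plap_lin_def by (simp add: mult.assoc)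
qed

lemma plap_lin_bounded_linear: "bounded_linear (plap_lin q d)"
  unfolding plap_lin_def
  by (intro bounded_linear_add bounded_linear_scaleR_right bounded_linear_scaleR_left
      bounded_linear_compose[OF bounded_linear_scaleR_left]
      bounded_linear_const_mult bounded_linear_inner_right)

text \<open>The mean value inequality for the flux minus its linearisation at \<open>d\<close>. The
  radius is uniform in \<open>q\<close> and \<open>d\<close> because the coefficients are uniformly
  continuous on a compact set of exponents times an annulus; the lower bound \<open>\<delta>\<close>
  keeps the annulus away from 0.\<close>

lemma flux_linearization:
  fixes \<delta> M p1 p2 \<omega> :: real
  assumes \<delta>: "\<delta> > 0" and \<omega>: "\<omega> > 0"
  shows "\<exists>r>0. \<forall>q (d::'a::euclidean_space) \<xi> \<xi>'. p1 \<le> q \<longrightarrow> q \<le> p2 \<longrightarrow> \<delta> \<le> norm d \<longrightarrow> norm d \<le> M \<longrightarrow>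
     norm (\<xi> - d) \<le> r \<longrightarrow> norm (\<xi>' - d) \<le> r \<longrightarrow>
     norm (plap_flux q \<xi>' - plap_flux q \<xi> - plap_lin q d (\<xi>' - \<xi>)) \<le> \<omega> * norm (\<xi>' - \<xi>)"
proof -
  define R where "R = \<bar>M\<bar> + \<delta>"
  have R: "R > 0" using \<delta> by (simp add: R_def)
  define K where "K = {p1..p2} \<times> (cball (0::'a) R - ball 0 (\<delta>/2))"
  have cK: "compact K" unfolding K_def by (intro compact_Times compact_diff) auto
  have inK: "(q, z) \<in> K" if "p1 \<le> q" "q \<le> p2" "\<delta>/2 \<le> norm z" "norm z \<le> R" for q z
    using that by (auto simp: K_def)
  define f1 where "f1 = (\<lambda>y::real \<times> 'a. norm (snd y) powr (fst y - 2))"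
  define f2 where "f2 = (\<lambda>y::real \<times> 'a. (fst y - 2) * norm (snd y) powr (fst y - 4))"
  have nz: "norm (snd y) \<noteq> 0" if "y \<in> K" for y
    using that \<delta> by (auto simp: K_def)
  have c1: "continuous_on K f1" unfolding f1_def using nz by (intro continuous_intros) auto
  have c2: "continuous_on K f2" unfolding f2_def using nz by (intro continuous_intros) auto
  have "bounded (f2 ` K)" using compact_continuous_image[OF c2 cK] by (rule compact_imp_bounded)
  then obtain b where b: "\<And>y. y \<in> K \<Longrightarrow> \<bar>f2 y\<bar> \<le> b" by (auto simp: bounded_iff)
  \<comment> \<open>\<open>\<epsilon>\<close> bounds the change of the two scalar coefficients, and
    \<open>r3\<close> below the change of the rank-one part from \<open>d\<close> to
    \<open>z\<close>; each contributes at most \<open>\<omega> / 3\<close>.\<close>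
  define \<epsilon> where "\<epsilon> = \<omega> / (3 * (1 + R\<^sup>2))"
  have R2: "1 + R\<^sup>2 > 0" by (smt (verit) zero_le_power2)
  have \<epsilon>: "\<epsilon> > 0" unfolding \<epsilon>_def using \<omega> R2 by auto
  obtain r1 where r1: "r1 > 0" "\<And>x y. x \<in> K \<Longrightarrow> y \<in> K \<Longrightarrow> dist y x < r1 \<Longrightarrow> dist (f1 y) (f1 x) < \<epsilon>"
    using compact_uniformly_continuous[OF c1 cK] \<epsilon> unfolding uniformly_continuous_on_def by metis
  obtain r2 where r2: "r2 > 0" "\<And>x y. x \<in> K \<Longrightarrow> y \<in> K \<Longrightarrow> dist y x < r2 \<Longrightarrow> dist (f2 y) (f2 x) < \<epsilon>"
    using compact_uniformly_continuous[OF c2 cK] \<epsilon> unfolding uniformly_continuous_on_def by metis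
  define r3 where "r3 = \<omega> / (6 * R * (\<bar>b\<bar> + 1))"
  have r3: "r3 > 0" unfolding r3_def using \<omega> R by (intro divide_pos_pos mult_pos_pos) auto
  define r where "r = min (min (r1/2) (r2/2)) (min r3 (\<delta>/2))"
  have r: "r > 0" "r < r1" "r < r2" "r \<le> r3" "r \<le> \<delta>/2" using r1 r2 r3 \<delta> by (auto simp: r_def)
  show ?thesis
  proof (intro exI[of _ r] conjI allI impI r(1))
    fix q and d \<xi> \<xi>' :: 'a
    assume q: "p1 \<le> q" "q \<le> p2" and d: "\<delta> \<le> norm d" "norm d \<le> M" and \<xi>: "norm (\<xi> - d) \<le> r" "norm (\<xi>' - d) \<le> r"
    let ?F = "\<lambda>z. plap_flux q z - plap_lin q d z"
    have dK: "(q, d) \<in> K" using inK q d \<delta> by (auto simp: R_def)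
    have "norm (?F \<xi>' - ?F \<xi>) \<le> \<omega> * norm (\<xi>' - \<xi>)"
    proof (rule differentiable_bound[of "cball d r" ?F "\<lambda>z v. plap_lin q z v - plap_lin q d v"])
      fix z assume z: "z \<in> cball d r"
      have zd: "norm (z - d) \<le> r" using z by (simp add: dist_norm norm_minus_commute)
      have zn: "\<delta>/2 \<le> norm z" "norm z \<le> R"
        using zd d r(5) norm_triangle_ineq2[of d z] norm_triangle_ineq2[of z d] \<delta>
        by (auto simp: R_def norm_minus_commute)
      have z0: "z \<noteq> 0" using zn \<delta> by auto
      have zK: "(q, z) \<in> K" using inK q zn by auto
      show "(?F has_derivative (\<lambda>v. plap_lin q z v - plap_lin q d v)) (at z within cball d r)"
        by (intro has_derivative_diff has_derivative_at_withinI[OF plap_flux_has_derivative[OF z0]]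
            bounded_linear_imp_has_derivative plap_lin_bounded_linear)
      show "onorm (\<lambda>v. plap_lin q z v - plap_lin q d v) \<le> \<omega>"
      proof (rule onorm_le)
        fix v
        have dzd: "dist (q, z) (q, d) = norm (z - d)" by (simp add: dist_Pair_Pair dist_norm)
        have a1: "\<bar>f1 (q, z) - f1 (q, d)\<bar> \<le> \<epsilon>" using r1(2)[OF dK zK] zd r dzd by (auto simp: dist_real_def)
        have a2: "\<bar>f2 (q, z) - f2 (q, d)\<bar> \<le> \<epsilon>" using r2(2)[OF dK zK] zd r dzd by (auto simp: dist_real_def)
        have e: "plap_lin q z v - plap_lin q d v = (f1 (q, z) - f1 (q, d)) *\<^sub>R v
            + ((f2 (q, z) - f2 (q, d)) * (z \<bullet> v)) *\<^sub>R z
            + f2 (q, d) *\<^sub>R (((z - d) \<bullet> v) *\<^sub>R z + (d \<bullet> v) *\<^sub>R (z - d))"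
          by (simp add: plap_lin_def f1_def f2_def inner_diff_left scaleR_diff_left scaleR_diff_right algebra_simps)
        have dR: "norm d \<le> R" using d \<delta> by (auto simp: R_def)
        have n1: "norm ((f1 (q, z) - f1 (q, d)) *\<^sub>R v) \<le> \<epsilon> * norm v"
          using a1 by (simp add: mult_right_mono)
        have n2: "norm (((f2 (q, z) - f2 (q, d)) * (z \<bullet> v)) *\<^sub>R z) \<le> \<epsilon> * (R * norm v) * R"
          unfolding norm_scaleR abs_mult
        proof (intro mult_mono a2 zn(2))
          show "\<bar>z \<bullet> v\<bar> \<le> R * norm v"
            using Cauchy_Schwarz_ineq2[of z v] mult_right_mono[OF zn(2), of "norm v"] by simp
        qed (use \<epsilon> R in auto)
        have n3: "norm (f2 (q, d) *\<^sub>R (((z - d) \<bullet> v) *\<^sub>R z + (d \<bullet> v) *\<^sub>R (z - d))) \<le> \<bar>b\<bar> * (2 * R * r * norm v)"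
          unfolding norm_scaleR
        proof (intro mult_mono)
          show "\<bar>f2 (q, d)\<bar> \<le> \<bar>b\<bar>" using b[OF dK] by linarith
          have "norm (((z - d) \<bullet> v) *\<^sub>R z) \<le> (r * norm v) * R" unfolding norm_scaleR
          proof (intro mult_mono zn(2))
            show "\<bar>(z - d) \<bullet> v\<bar> \<le> r * norm v"
              using Cauchy_Schwarz_ineq2[of "z - d" v] mult_right_mono[OF zd, of "norm v"] by simp
          qed (use r in auto)
          moreover have "norm ((d \<bullet> v) *\<^sub>R (z - d)) \<le> (R * norm v) * r" unfolding norm_scaleR
          proof (intro mult_mono zd)
            show "\<bar>d \<bullet> v\<bar> \<le> R * norm v"
              using Cauchy_Schwarz_ineq2[of d v] mult_right_mono[OF dR, of "norm v"] by simp
          qed (use R in auto)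
          ultimately show "norm (((z - d) \<bullet> v) *\<^sub>R z + (d \<bullet> v) *\<^sub>R (z - d)) \<le> 2 * R * r * norm v"
            using norm_triangle_ineq[of "((z - d) \<bullet> v) *\<^sub>R z" "(d \<bullet> v) *\<^sub>R (z - d)"] by (simp add: mult_ac)
        qed auto
        have "norm (plap_lin q z v - plap_lin q d v) \<le> \<epsilon> * norm v + \<epsilon> * (R * norm v) * R + \<bar>b\<bar> * (2 * R * r * norm v)"
          unfolding e by (intro norm_triangle_mono n1 n2 n3)
        also have "\<dots> = (\<epsilon> * (1 + R\<^sup>2) + \<bar>b\<bar> * (2 * R * r)) * norm v" by (simp add: algebra_simps power2_eq_square)
        also have "\<dots> \<le> \<omega> * norm v"
        proof (rule mult_right_mono)
          have "\<omega> / (3 * X) * X = \<omega> / 3" if "X > 0" for X :: real using that by simp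
          from this[OF R2] have s1: "\<epsilon> * (1 + R\<^sup>2) = \<omega> / 3" unfolding \<epsilon>_def .
          have s2: "\<bar>b\<bar> * (2 * R * r) \<le> (\<bar>b\<bar> + 1) * (2 * R * r3)"
            using r R by (intro mult_mono) auto
          have "Y * (2 * R * (\<omega> / (6 * R * Y))) = \<omega> / 3" if "Y > 0" for Y :: real using that R by simp
          from this[of "\<bar>b\<bar> + 1"] have t: "(\<bar>b\<bar> + 1) * (2 * R * r3) = \<omega> / 3" unfolding r3_def by simp
          show "\<epsilon> * (1 + R\<^sup>2) + \<bar>b\<bar> * (2 * R * r) \<le> \<omega>" using \<omega> s1 s2 t by linarith
        qed simp
        finally show "norm (plap_lin q z v - plap_lin q d v) \<le> \<omega> * norm v" .
      qed
    qed (use \<xi> in \<open>auto simp: dist_norm norm_minus_commute\<close>)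
    moreover have "?F \<xi>' - ?F \<xi> = plap_flux q \<xi>' - plap_flux q \<xi> - plap_lin q d (\<xi>' - \<xi>)"
      using linear_diff[OF bounded_linear.linear[OF plap_lin_bounded_linear[of q d]], of \<xi>' \<xi>] by simp
    ultimately show "norm (plap_flux q \<xi>' - plap_flux q \<xi> - plap_lin q d (\<xi>' - \<xi>)) \<le> \<omega> * norm (\<xi>' - \<xi>)" by simp
  qed
qed

lemma plap_lin_quadratic:
  fixes d :: "'a::euclidean_space"
  assumes d: "d \<noteq> 0"
  shows "plap_lin q d v \<bullet> w = norm d powr (q - 2) * (v \<bullet> w + (q - 2) * (d \<bullet> v) * (d \<bullet> w) / (norm d)\<^sup>2)"
proof -
  have "norm d powr (q - 4) = norm d powr (q - 2) * norm d powr (- 2)" unfolding powr_add[symmetric] by simp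
  also have "norm d powr (- 2) = 1 / (norm d)\<^sup>2" using d by (simp add: powr_minus_divide)
  finally have "norm d powr (q - 4) = norm d powr (q - 2) / (norm d)\<^sup>2" by simp
  then show ?thesis by (simp add: plap_lin_def inner_add_left algebra_simps)
qed

lemma weighted_sum_square_le:
  fixes V :: "'a::euclidean_space \<Rightarrow> 'a"
  shows "(norm (\<Sum>k\<in>Basis. (d \<bullet> k) *\<^sub>R V k))\<^sup>2 \<le> (norm d)\<^sup>2 * (\<Sum>k\<in>Basis. (norm (V k))\<^sup>2)"
proof -
  have "norm (\<Sum>k\<in>Basis. (d \<bullet> k) *\<^sub>R V k) \<le> (\<Sum>k\<in>Basis. \<bar>d \<bullet> k\<bar> * norm (V k))"
    using norm_sum[of "\<lambda>k. (d \<bullet> k) *\<^sub>R V k" Basis] by simp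
  then have "(norm (\<Sum>k\<in>Basis. (d \<bullet> k) *\<^sub>R V k))\<^sup>2 \<le> (\<Sum>k\<in>Basis. \<bar>d \<bullet> k\<bar> * norm (V k))\<^sup>2"
    by (rule power_mono) simp
  also have "\<dots> \<le> (\<Sum>k\<in>Basis. \<bar>d \<bullet> k\<bar>\<^sup>2) * (\<Sum>k\<in>Basis. (norm (V k))\<^sup>2)"
    by (rule Cauchy_Schwarz_ineq_sum)
  also have "(\<Sum>k\<in>Basis. \<bar>d \<bullet> k\<bar>\<^sup>2) = (norm d)\<^sup>2"
    by (simp add: norm_eq_sqrt_inner euclidean_inner[of d d] power2_eq_square sum_nonneg)
  finally show ?thesis .
qed

text \<open>Split into the parts orthogonal to \<open>d\<close> and along \<open>d\<close>, the form
  is a sum of squares, the second with weight q - 1 \<ge> 0, and Cauchy-Schwarz applies to each.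
  With \<open>V k\<close> the rows of a Hessian the left side is the form at Hessian times
  \<open>d\<close>: this lets the negative term produced by a weight that decreases in |d| be
  absorbed with the sharp constant 1.\<close>

lemma quadratic_form_sum_le:
  fixes V :: "'a::euclidean_space \<Rightarrow> 'a" and d :: 'a
  assumes d: "d \<noteq> 0" and q: "q \<ge> 1"
  defines "Qf \<equiv> \<lambda>v. v \<bullet> v + (q - 2) * (d \<bullet> v) * (d \<bullet> v) / (norm d)\<^sup>2"
  shows "Qf (\<Sum>k\<in>Basis. (d \<bullet> k) *\<^sub>R V k) \<le> (norm d)\<^sup>2 * (\<Sum>k\<in>Basis. Qf (V k))"
proof -
  let ?h = "norm d"
  have h: "?h > 0" using d by simp
  have dd: "d \<bullet> d = ?h\<^sup>2" by (simp add: power2_norm_eq_inner)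
  let ?P = "\<lambda>v. v - ((d \<bullet> v) / ?h\<^sup>2) *\<^sub>R d"
  have dec: "Qf v = (norm (?P v))\<^sup>2 + (q - 1) * (d \<bullet> v)\<^sup>2 / ?h\<^sup>2" for v
  proof -
    have "(norm (?P v))\<^sup>2 = v \<bullet> v - 2 * ((d \<bullet> v) / ?h\<^sup>2 * (d \<bullet> v)) + ((d \<bullet> v) / ?h\<^sup>2)\<^sup>2 * (d \<bullet> d)"
      unfolding power2_norm_eq_inner by (simp add: inner_diff_left inner_diff_right inner_commute power2_eq_square)
    also have "\<dots> = v \<bullet> v - (d \<bullet> v)\<^sup>2 / ?h\<^sup>2"
      unfolding dd using h by (simp add: power2_eq_square field_simps)
    finally show ?thesis using h by (simp add: Qf_def power2_eq_square field_simps)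
  qed
  let ?W = "\<Sum>k\<in>Basis. (d \<bullet> k) *\<^sub>R V k"
  have PW: "?P ?W = (\<Sum>k\<in>Basis. (d \<bullet> k) *\<^sub>R ?P (V k))"
    by (simp add: scaleR_diff_right sum_subtractf inner_sum_right sum_divide_distrib scaleR_left.sum)
  have 1: "(norm (?P ?W))\<^sup>2 \<le> ?h\<^sup>2 * (\<Sum>k\<in>Basis. (norm (?P (V k)))\<^sup>2)"
    unfolding PW by (rule weighted_sum_square_le)
  have "(d \<bullet> ?W)\<^sup>2 = (\<Sum>k\<in>Basis. (d \<bullet> k) * (d \<bullet> V k))\<^sup>2" by (simp add: inner_sum_right)
  also have "\<dots> \<le> (\<Sum>k\<in>Basis. (d \<bullet> k)\<^sup>2) * (\<Sum>k\<in>Basis. (d \<bullet> V k)\<^sup>2)" by (rule Cauchy_Schwarz_ineq_sum)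
  also have "(\<Sum>k\<in>Basis. (d \<bullet> k)\<^sup>2) = ?h\<^sup>2"
    by (simp add: norm_eq_sqrt_inner euclidean_inner[of d d] power2_eq_square sum_nonneg)
  finally have 2: "(q - 1) * (d \<bullet> ?W)\<^sup>2 / ?h\<^sup>2 \<le> (q - 1) * (?h\<^sup>2 * (\<Sum>k\<in>Basis. (d \<bullet> V k)\<^sup>2)) / ?h\<^sup>2"
    using q by (intro divide_right_mono mult_left_mono) auto
  have "Qf ?W \<le> ?h\<^sup>2 * (\<Sum>k\<in>Basis. (norm (?P (V k)))\<^sup>2) + (q - 1) * (?h\<^sup>2 * (\<Sum>k\<in>Basis. (d \<bullet> V k)\<^sup>2)) / ?h\<^sup>2"
    unfolding dec[of ?W] using 1 2 by linarith
  also have "\<dots> = ?h\<^sup>2 * (\<Sum>k\<in>Basis. Qf (V k))"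
    unfolding dec by (simp add: sum.distrib distrib_left sum_distrib_left sum_divide_distrib mult_ac)
  finally show ?thesis .
qed

lemma young_ineq: "\<epsilon> > 0 \<Longrightarrow> a * b \<le> \<epsilon> * a\<^sup>2 + b\<^sup>2 / (4 * \<epsilon>)" for a b \<epsilon> :: real
proof -
  assume e: "\<epsilon> > 0"
  have "0 \<le> (2 * \<epsilon> * a - b)\<^sup>2" by simp
  then have "4 * \<epsilon> * (a * b) \<le> 4 * \<epsilon> * (\<epsilon> * a\<^sup>2) + b\<^sup>2" by (simp add: power2_eq_square algebra_simps)
  then have "4 * \<epsilon> * (a * b) \<le> 4 * \<epsilon> * (\<epsilon> * a\<^sup>2 + b\<^sup>2 / (4 * \<epsilon>))" using e by (simp add: distrib_left)
  then show ?thesis using e by (metis mult_le_cancel_left_pos mult_pos_pos zero_less_numeral)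
qed

text \<open>The algebra of the energy estimate at one point. \<open>V k\<close> is the gradient of
  the component d_k, \<open>R k\<close> the linearisation error, \<open>\<beta>\<close> the size of
  the drift, and \<open>Y k\<close> the gradient of the test function G(|d|^2) d_k s^2, where
  \<open>z\<close> is the gradient of the cutoff \<open>s\<close>. The derivative of the weight is
  encoded by E = 2 |d|^2 G' + (1 - \<kappa>) G; that E is nonnegative says that G falls no faster
  than |d|^(\<kappa>-1), and the E term is kept because it absorbs errors of its own.\<close>

lemma energy_pointwise:
  fixes V R :: "'a::euclidean_space \<Rightarrow> 'a" and d z :: 'a
  assumes d: "d \<noteq> 0" and c0: "0 < c0" "c0 \<le> 1" "c0 \<le> q - 1" and c2: "1 + \<bar>q - 2\<bar> \<le> c2"
    and \<kappa>: "0 < \<kappa>" "\<kappa> \<le> 1" and GE: "0 \<le> G" "0 \<le> E" and \<beta>: "0 \<le> \<beta>" and \<omega>: "0 \<le> \<omega>" and s: "0 \<le> s"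
    and R: "\<And>k. k \<in> Basis \<Longrightarrow> norm (R k) \<le> \<omega> * norm (V k) + \<beta>"
  defines "H \<equiv> norm d" and "c \<equiv> norm d powr (q - 2)" and "n \<equiv> real DIM('a)"
    and "W \<equiv> \<Sum>k\<in>Basis. (d \<bullet> k) *\<^sub>R V k" and "v \<equiv> sqrt (\<Sum>k\<in>Basis. (norm (V k))\<^sup>2)"
    and "g \<equiv> (E - (1 - \<kappa>) * G) / (norm d)\<^sup>2"
  defines "Y \<equiv> \<lambda>k. s\<^sup>2 *\<^sub>R (G *\<^sub>R V k + (g * (d \<bullet> k)) *\<^sub>R W) + (2 * s * G * (d \<bullet> k)) *\<^sub>R z"
  shows "c * c0 * \<kappa> / 2 * s\<^sup>2 * G * v\<^sup>2
      - (4 * c * c2\<^sup>2 * G * H\<^sup>2 * (norm z)\<^sup>2 / (c0 * \<kappa>) + 16 * n\<^sup>2 * s\<^sup>2 * G * \<beta>\<^sup>2 / (c * c0 * \<kappa>)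
         + n\<^sup>2 * s\<^sup>2 * E * \<beta>\<^sup>2 / (c * c0) + 4 * n * \<beta> * s * G * H * norm z)
      - n * \<omega> * v * (s\<^sup>2 * (2 * G + E) * v + 2 * s * G * H * norm z)
    \<le> (\<Sum>k\<in>Basis. (plap_lin q d (V k) + R k) \<bullet> Y k) - \<beta> * (\<Sum>k\<in>Basis. norm (Y k))"
proof -
  let ?zn = "norm z" and ?w = "norm W"
  have H: "H > 0" and c: "c > 0" using d by (auto simp: H_def c_def)
  have n: "n > 0" by (simp add: n_def)
  have sumV: "0 \<le> (\<Sum>k\<in>Basis. (norm (V k))\<^sup>2)" by (intro sum_nonneg) auto
  have v: "v \<ge> 0" "v\<^sup>2 = (\<Sum>k\<in>Basis. (norm (V k))\<^sup>2)" using sumV by (auto simp: v_def)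
  have Vk: "norm (V k) \<le> v" if "k \<in> Basis" for k
    unfolding v_def using member_le_sum[OF that, of "\<lambda>k. (norm (V k))\<^sup>2"] by (intro real_le_rsqrt) auto
  have dk: "\<bar>d \<bullet> k\<bar> \<le> H" if "k \<in> Basis" for k using Basis_le_norm[OF that] by (simp add: H_def)
  have "?w\<^sup>2 \<le> (H * v)\<^sup>2" unfolding W_def power_mult_distrib v(2) H_def by (rule weighted_sum_square_le)
  then have w: "?w \<le> H * v" using H v(1) by (intro power2_le_imp_le[of ?w]) auto
  then have wH: "?w / H \<le> v" using H by (simp add: field_simps)
  have ag: "\<bar>g\<bar> * H * ?w \<le> G * v + E * ?w / H"
  proof -
    have "\<bar>E - (1 - \<kappa>) * G\<bar> \<le> E + G"
    proof -
      have "0 \<le> (1 - \<kappa>) * G" "(1 - \<kappa>) * G \<le> G" using \<kappa> GE(1) mult_right_mono[of "1 - \<kappa>" 1 G] by auto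
      then show ?thesis using GE by linarith
    qed
    then have "\<bar>g\<bar> \<le> (E + G) / H\<^sup>2" unfolding g_def H_def by (simp add: abs_divide divide_right_mono)
    then have "\<bar>g\<bar> * (H * ?w) \<le> (E + G) / H\<^sup>2 * (H * ?w)" using H by (intro mult_right_mono) auto
    also have "\<dots> = G * (?w / H) + E * ?w / H" using H by (simp add: power2_eq_square field_simps)
    also have "\<dots> \<le> G * v + E * ?w / H" using mult_left_mono[OF wH GE(1)] by simp
    finally show ?thesis by (simp add: mult.assoc)
  qed
  define y where "y = s\<^sup>2 * (2 * G * v + E * ?w / H) + 2 * s * G * H * ?zn"
  have Yk: "norm (Y k) \<le> y" if k: "k \<in> Basis" for k
  proof -
    have "norm (Y k) \<le> norm (s\<^sup>2 *\<^sub>R (G *\<^sub>R V k + (g * (d \<bullet> k)) *\<^sub>R W)) + norm ((2 * s * G * (d \<bullet> k)) *\<^sub>R z)"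
      unfolding Y_def by (rule norm_triangle_ineq)
    also have "\<dots> \<le> s\<^sup>2 * (2 * G * v + E * ?w / H) + 2 * s * G * H * ?zn"
    proof (rule add_mono)
      have "norm (G *\<^sub>R V k + (g * (d \<bullet> k)) *\<^sub>R W) \<le> G * norm (V k) + \<bar>g\<bar> * \<bar>d \<bullet> k\<bar> * ?w"
        using norm_triangle_ineq[of "G *\<^sub>R V k" "(g * (d \<bullet> k)) *\<^sub>R W"] GE by (simp add: abs_mult)
      also have "\<dots> \<le> G * v + \<bar>g\<bar> * H * ?w"
        by (intro add_mono mult_left_mono mult_right_mono Vk dk k GE) auto
      finally have "norm (G *\<^sub>R V k + (g * (d \<bullet> k)) *\<^sub>R W) \<le> 2 * G * v + E * ?w / H" using ag by simp
      then show "norm (s\<^sup>2 *\<^sub>R (G *\<^sub>R V k + (g * (d \<bullet> k)) *\<^sub>R W)) \<le> s\<^sup>2 * (2 * G * v + E * ?w / H)"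
        by (simp add: mult_left_mono)
      have "\<bar>2 * s * G * (d \<bullet> k)\<bar> \<le> 2 * s * G * H" using s GE(1) dk[OF k] by (simp add: abs_mult mult_left_mono)
      then show "norm ((2 * s * G * (d \<bullet> k)) *\<^sub>R z) \<le> 2 * s * G * H * ?zn" unfolding norm_scaleR by (rule mult_right_mono) simp
    qed
    finally show ?thesis by (simp add: y_def)
  qed
  have y0: "0 \<le> y" using Yk SOME_Basis norm_ge_zero order_trans by blast
  have RY: "- (n * ((\<omega> * v + \<beta>) * y)) \<le> (\<Sum>k\<in>Basis. R k \<bullet> Y k)"
  proof -
    have "- ((\<omega> * v + \<beta>) * y) \<le> R k \<bullet> Y k" if k: "k \<in> Basis" for k
    proof -
      have "norm (R k) \<le> \<omega> * v + \<beta>" using R[OF k] mult_left_mono[OF Vk[OF k] \<omega>] by linarith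
      then have "norm (R k) * norm (Y k) \<le> (\<omega> * v + \<beta>) * y" using Yk[OF k] \<omega> v \<beta> by (intro mult_mono) auto
      then show ?thesis using Cauchy_Schwarz_ineq2[of "R k" "Y k"] by linarith
    qed
    then have "(\<Sum>k\<in>(Basis::'a set). - ((\<omega> * v + \<beta>) * y)) \<le> (\<Sum>k\<in>Basis. R k \<bullet> Y k)" by (rule sum_mono)
    then show ?thesis by (simp add: n_def)
  qed
  have bY: "\<beta> * (\<Sum>k\<in>Basis. norm (Y k)) \<le> n * (\<beta> * y)"
  proof -
    have "(\<Sum>k\<in>Basis. norm (Y k)) \<le> (\<Sum>k\<in>(Basis::'a set). y)" by (rule sum_mono) (rule Yk)
    then have "\<beta> * (\<Sum>k\<in>Basis. norm (Y k)) \<le> \<beta> * (n * y)" using \<beta> by (intro mult_left_mono) (simp_all add: n_def)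
    then show ?thesis by (simp add: mult_ac)
  qed
  let ?L = "plap_lin q d"
  have linL: "linear ?L" using plap_lin_bounded_linear bounded_linear.linear by blast
  have LW: "(\<Sum>k\<in>Basis. (d \<bullet> k) *\<^sub>R ?L (V k)) = ?L W"
    unfolding W_def by (simp add: linear_sum[OF linL] linear_scale[OF linL])
  have "(\<Sum>k\<in>Basis. ?L (V k) \<bullet> Y k) = (\<Sum>k\<in>Basis. s\<^sup>2 * G * (?L (V k) \<bullet> V k) + s\<^sup>2 * g * (((d \<bullet> k) *\<^sub>R ?L (V k)) \<bullet> W)
      + 2 * s * G * (((d \<bullet> k) *\<^sub>R ?L (V k)) \<bullet> z))"
    by (rule sum.cong[OF refl]) (simp add: Y_def inner_add_right algebra_simps)
  also have "\<dots> = s\<^sup>2 * G * (\<Sum>k\<in>Basis. ?L (V k) \<bullet> V k) + s\<^sup>2 * g * (?L W \<bullet> W) + 2 * s * G * (?L W \<bullet> z)"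
    unfolding sum.distrib by (simp only: sum_distrib_left[symmetric] inner_sum_left[symmetric] LW)
  finally have LY: "(\<Sum>k\<in>Basis. ?L (V k) \<bullet> Y k) = s\<^sup>2 * G * (\<Sum>k\<in>Basis. ?L (V k) \<bullet> V k) + s\<^sup>2 * g * (?L W \<bullet> W) + 2 * s * G * (?L W \<bullet> z)" .
  define Qf where "Qf v = v \<bullet> v + (q - 2) * (d \<bullet> v) * (d \<bullet> v) / (norm d)\<^sup>2" for v
  have Lq: "?L v \<bullet> v = c * Qf v" for v unfolding c_def Qf_def by (rule plap_lin_quadratic[OF d])
  have QW: "Qf W \<le> H\<^sup>2 * (\<Sum>k\<in>Basis. Qf (V k))"
    unfolding W_def H_def Qf_def by (rule quadratic_form_sum_le[OF d]) (use c0 in auto)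
  have Q0: "c0 * (norm v)\<^sup>2 \<le> Qf v" for v
  proof -
    have cs: "(d \<bullet> v) * (d \<bullet> v) / H\<^sup>2 \<le> (norm v)\<^sup>2"
    proof -
      have "(d \<bullet> v)\<^sup>2 \<le> (H * norm v)\<^sup>2" using Cauchy_Schwarz_ineq2[of d v] unfolding H_def by (metis abs_ge_zero power2_abs power_mono)
      then show ?thesis using H by (simp add: power_mult_distrib power2_eq_square divide_le_eq mult_ac)
    qed
    have nn: "0 \<le> (d \<bullet> v) * (d \<bullet> v) / H\<^sup>2" by simp
    have e: "Qf v = (norm v)\<^sup>2 + (q - 2) * ((d \<bullet> v) * (d \<bullet> v) / H\<^sup>2)" by (simp add: Qf_def H_def power2_norm_eq_inner mult.assoc)
    show ?thesis
    proof (cases "q \<ge> 2")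
      case True
      have "c0 * (norm v)\<^sup>2 \<le> 1 * (norm v)\<^sup>2" using c0 by (intro mult_right_mono) auto
      then show ?thesis unfolding e using True nn by (simp add: add_increasing2)
    next
      case False
      have "(q - 2) * (norm v)\<^sup>2 \<le> (q - 2) * ((d \<bullet> v) * (d \<bullet> v) / H\<^sup>2)" using False cs by (intro mult_left_mono_neg) auto
      moreover have "c0 * (norm v)\<^sup>2 \<le> (q - 1) * (norm v)\<^sup>2" using c0 by (intro mult_right_mono) auto
      moreover have "(q - 1) * (norm v)\<^sup>2 = (norm v)\<^sup>2 + (q - 2) * (norm v)\<^sup>2" by (simp add: algebra_simps)
      ultimately show ?thesis unfolding e by linarith
    qed
  qed
  define A where "A = (\<Sum>k\<in>Basis. Qf (V k))"
  have A: "c0 * v\<^sup>2 \<le> A" unfolding A_def v(2) sum_distrib_left by (rule sum_mono) (rule Q0)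
  \<comment> \<open>The dangerous part of \<open>g\<close> is - (1 - \<kappa>) G / H^2. By
    \<open>quadratic_form_sum_le\<close> it consumes at most the share 1 - \<kappa> of G A, so the
    share \<kappa> survives, together with the E term in full.\<close>
  have main: "c0 * (\<kappa> * G * v\<^sup>2 + E * (?w / H)\<^sup>2) \<le> G * A + g * Qf W"
  proof -
    have "g * Qf W = E * (Qf W / H\<^sup>2) - (1 - \<kappa>) * G * (Qf W / H\<^sup>2)" unfolding g_def H_def by (simp add: left_diff_distrib diff_divide_distrib)
    moreover have "(1 - \<kappa>) * G * (Qf W / H\<^sup>2) \<le> (1 - \<kappa>) * G * A"
    proof (rule mult_left_mono)
      show "Qf W / H\<^sup>2 \<le> A" using QW H by (simp add: A_def divide_le_eq mult.commute)
    qed (use \<kappa> GE in auto)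
    moreover have "E * (c0 * (?w / H)\<^sup>2) \<le> E * (Qf W / H\<^sup>2)"
      using Q0[of W] H GE by (intro mult_left_mono) (auto simp: power_divide divide_right_mono)
    moreover have "\<kappa> * G * (c0 * v\<^sup>2) \<le> \<kappa> * G * A" using A \<kappa> GE by (intro mult_left_mono) auto
    moreover have "G * A - (1 - \<kappa>) * G * A = \<kappa> * G * A" by (simp add: algebra_simps)
    ultimately show ?thesis by (simp add: algebra_simps)
  qed
  have LWz: "- (c * c2 * (H * v) * ?zn) \<le> ?L W \<bullet> z"
  proof -
    have "\<bar>?L W \<bullet> z\<bar> = c * \<bar>W \<bullet> z + (q - 2) * ((d \<bullet> W) * (d \<bullet> z) / H\<^sup>2)\<bar>"
      unfolding plap_lin_quadratic[OF d] using c by (simp add: c_def H_def abs_mult mult.assoc)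
    also have "\<dots> \<le> c * (?w * ?zn + \<bar>q - 2\<bar> * (?w * ?zn))"
    proof (rule mult_left_mono)
      have "\<bar>(d \<bullet> W) * (d \<bullet> z)\<bar> \<le> (H * ?w) * (H * ?zn)"
        unfolding abs_mult H_def by (intro mult_mono Cauchy_Schwarz_ineq2) auto
      then have "\<bar>(d \<bullet> W) * (d \<bullet> z) / H\<^sup>2\<bar> \<le> ?w * ?zn" using H by (simp add: divide_le_eq power2_eq_square mult_ac)
      then have "\<bar>(q - 2) * ((d \<bullet> W) * (d \<bullet> z) / H\<^sup>2)\<bar> \<le> \<bar>q - 2\<bar> * (?w * ?zn)" unfolding abs_mult[of "q - 2"] by (rule mult_left_mono) simp
      then show "\<bar>W \<bullet> z + (q - 2) * ((d \<bullet> W) * (d \<bullet> z) / H\<^sup>2)\<bar> \<le> ?w * ?zn + \<bar>q - 2\<bar> * (?w * ?zn)"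
        using Cauchy_Schwarz_ineq2[of W z] by linarith
    qed (use c in auto)
    also have "\<dots> = c * ((1 + \<bar>q - 2\<bar>) * (?w * ?zn))" by (simp add: algebra_simps)
    also have "\<dots> \<le> c * (c2 * ((H * v) * ?zn))"
      using c2 w c H v(1) by (intro mult_left_mono mult_mono) auto
    finally show ?thesis by (simp add: mult.assoc)
  qed
  have LYge: "s\<^sup>2 * (c * (c0 * (\<kappa> * G * v\<^sup>2 + E * (?w / H)\<^sup>2))) - 2 * s * G * (c * c2 * (H * v) * ?zn) \<le> (\<Sum>k\<in>Basis. ?L (V k) \<bullet> Y k)"
  proof -
    have "s\<^sup>2 * (c * (c0 * (\<kappa> * G * v\<^sup>2 + E * (?w / H)\<^sup>2))) \<le> s\<^sup>2 * (c * (G * A + g * Qf W))"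
      using main c by (intro mult_left_mono) auto
    also have "\<dots> = s\<^sup>2 * G * (\<Sum>k\<in>Basis. ?L (V k) \<bullet> V k) + s\<^sup>2 * g * (?L W \<bullet> W)"
      unfolding Lq A_def by (simp add: sum_distrib_left algebra_simps)
    finally have 1: "s\<^sup>2 * (c * (c0 * (\<kappa> * G * v\<^sup>2 + E * (?w / H)\<^sup>2))) \<le> \<dots>" .
    have "2 * s * G * - (c * c2 * (H * v) * ?zn) \<le> 2 * s * G * (?L W \<bullet> z)"
      using LWz s GE by (intro mult_left_mono) auto
    with 1 show ?thesis unfolding LY mult_minus_right by linarith
  qed
  have tot: "s\<^sup>2 * (c * (c0 * (\<kappa> * G * v\<^sup>2 + E * (?w / H)\<^sup>2))) - 2 * s * G * (c * c2 * (H * v) * ?zn)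
      - n * (\<omega> * v + 2 * \<beta>) * y \<le> (\<Sum>k\<in>Basis. (?L (V k) + R k) \<bullet> Y k) - \<beta> * (\<Sum>k\<in>Basis. norm (Y k))"
    using LYge RY bY by (simp add: inner_add_left sum.distrib algebra_simps)
  \<comment> \<open>Young's inequality three times: a quarter of the good term \<open>X\<close> pays
    for the cutoff gradient, another quarter for the drift against G, and the whole E term for the
    drift against E. Half of \<open>X\<close> is left.\<close>
  have t1: "2 * s * G * (c * c2 * (H * v) * ?zn) \<le> c * G * ((c0 * \<kappa> / 4) * (s * v)\<^sup>2 + (2 * c2 * H * ?zn)\<^sup>2 / (4 * (c0 * \<kappa> / 4)))"
  proof -
    have "(s * v) * (2 * c2 * H * ?zn) \<le> (c0 * \<kappa> / 4) * (s * v)\<^sup>2 + (2 * c2 * H * ?zn)\<^sup>2 / (4 * (c0 * \<kappa> / 4))"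
      by (rule young_ineq) (use c0 \<kappa> in auto)
    from mult_left_mono[OF this, of "c * G"] c GE show ?thesis by (simp add: mult_ac)
  qed
  have t2: "4 * n * \<beta> * s\<^sup>2 * G * v \<le> s\<^sup>2 * G * ((c * c0 * \<kappa> / 4) * v\<^sup>2 + (4 * n * \<beta>)\<^sup>2 / (4 * (c * c0 * \<kappa> / 4)))"
  proof -
    have "v * (4 * n * \<beta>) \<le> (c * c0 * \<kappa> / 4) * v\<^sup>2 + (4 * n * \<beta>)\<^sup>2 / (4 * (c * c0 * \<kappa> / 4))"
      by (rule young_ineq) (use c c0 \<kappa> in auto)
    from mult_left_mono[OF this, of "s\<^sup>2 * G"] GE show ?thesis by (simp add: mult_ac)
  qed
  have t3: "2 * n * \<beta> * s\<^sup>2 * (E * ?w / H) \<le> s\<^sup>2 * E * ((c * c0) * (?w / H)\<^sup>2 + (2 * n * \<beta>)\<^sup>2 / (4 * (c * c0)))"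
  proof -
    have "(?w / H) * (2 * n * \<beta>) \<le> (c * c0) * (?w / H)\<^sup>2 + (2 * n * \<beta>)\<^sup>2 / (4 * (c * c0))"
      by (rule young_ineq) (use c c0 in auto)
    from mult_left_mono[OF this, of "s\<^sup>2 * E"] GE show ?thesis by (simp add: mult_ac)
  qed
  have t5: "n * \<omega> * v * y \<le> n * \<omega> * v * (s\<^sup>2 * (2 * G + E) * v + 2 * s * G * H * ?zn)"
  proof (rule mult_left_mono)
    have "E * ?w / H \<le> E * v" using mult_left_mono[OF wH GE(2)] by simp
    then have "s\<^sup>2 * (2 * G * v + E * ?w / H) \<le> s\<^sup>2 * ((2 * G + E) * v)" by (intro mult_left_mono) (auto simp: distrib_right)
    then show "y \<le> s\<^sup>2 * (2 * G + E) * v + 2 * s * G * H * ?zn" by (simp add: y_def mult.assoc)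
  qed (use n \<omega> v in auto)
  define T1 where "T1 = 4 * c * c2\<^sup>2 * G * H\<^sup>2 * ?zn\<^sup>2 / (c0 * \<kappa>)"
  define T2 where "T2 = 16 * n\<^sup>2 * s\<^sup>2 * G * \<beta>\<^sup>2 / (c * c0 * \<kappa>)"
  define T3 where "T3 = n\<^sup>2 * s\<^sup>2 * E * \<beta>\<^sup>2 / (c * c0)"
  define X where "X = c * c0 * \<kappa> * s\<^sup>2 * G * v\<^sup>2"
  define X2 where "X2 = c * c0 * s\<^sup>2 * E * (?w / H)\<^sup>2"
  have e1: "c * G * ((c0 * \<kappa> / 4) * (s * v)\<^sup>2 + (2 * c2 * H * ?zn)\<^sup>2 / (4 * (c0 * \<kappa> / 4))) = X / 4 + T1"
    by (simp add: X_def T1_def power_mult_distrib distrib_left mult_ac)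
  have e2: "s\<^sup>2 * G * ((c * c0 * \<kappa> / 4) * v\<^sup>2 + (4 * n * \<beta>)\<^sup>2 / (4 * (c * c0 * \<kappa> / 4))) = X / 4 + T2"
    by (simp add: X_def T2_def power_mult_distrib distrib_left mult_ac)
  have e3: "s\<^sup>2 * E * ((c * c0) * (?w / H)\<^sup>2 + (2 * n * \<beta>)\<^sup>2 / (4 * (c * c0))) = X2 + T3"
    by (simp add: X2_def T3_def power_mult_distrib distrib_left mult_ac)
  have e4: "s\<^sup>2 * (c * (c0 * (\<kappa> * G * v\<^sup>2 + E * (?w / H)\<^sup>2))) = X + X2"
    by (simp add: X_def X2_def algebra_simps)
  have e5: "n * (\<omega> * v + 2 * \<beta>) * y = n * \<omega> * v * y + (4 * n * \<beta> * s\<^sup>2 * G * v + 2 * n * \<beta> * s\<^sup>2 * (E * ?w / H) + 4 * n * \<beta> * s * G * H * ?zn)"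
    by (simp add: y_def algebra_simps)
  have "X / 2 - (T1 + T2 + T3 + 4 * n * \<beta> * s * G * H * ?zn) - n * \<omega> * v * (s\<^sup>2 * (2 * G + E) * v + 2 * s * G * H * ?zn)
     \<le> (\<Sum>k\<in>Basis. (?L (V k) + R k) \<bullet> Y k) - \<beta> * (\<Sum>k\<in>Basis. norm (Y k))"
    using tot t1 t2 t3 t5 unfolding e1 e2 e3 e4 e5 by linarith
  moreover have "X / 2 = c * c0 * \<kappa> / 2 * s\<^sup>2 * G * v\<^sup>2" by (simp add: X_def)
  ultimately show ?thesis unfolding T1_def T2_def T3_def by simp
qed

section \<open>The cutoff near the critical set\<close>

text \<open>In terms of Q = |d|^2 this is the squared positive part of 1 - (\<delta>/|d|)^\<kappa>.
  The power \<kappa> yields the factor \<delta>^\<kappa> in the derivative, and the square makes the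
  function C1 and leaves a factor sqrt(cut) in the derivative.\<close>

definition cut :: "real \<Rightarrow> real \<Rightarrow> real \<Rightarrow> real" where
  "cut \<delta> \<kappa> Q = (if Q \<le> 0 then 0 else (max 0 (1 - (\<delta>\<^sup>2 / Q) powr (\<kappa> / 2)))\<^sup>2)"

definition cut' :: "real \<Rightarrow> real \<Rightarrow> real \<Rightarrow> real" where
  "cut' \<delta> \<kappa> Q = (if Q \<le> 0 then 0 else \<kappa> * max 0 (1 - (\<delta>\<^sup>2 / Q) powr (\<kappa> / 2)) * (\<delta>\<^sup>2 / Q) powr (\<kappa> / 2) / Q)"

lemma cut_zero:
  assumes "\<delta> > 0" "\<kappa> > 0" "Q \<le> \<delta>\<^sup>2"
  shows "cut \<delta> \<kappa> Q = 0" "cut' \<delta> \<kappa> Q = 0"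
proof -
  have "max 0 (1 - (\<delta>\<^sup>2 / Q) powr (\<kappa> / 2)) = 0" if "Q > 0"
  proof -
    have "1 \<le> \<delta>\<^sup>2 / Q" using that assms by simp
    then have "1 powr (\<kappa> / 2) \<le> (\<delta>\<^sup>2 / Q) powr (\<kappa> / 2)" using assms by (intro powr_mono2) auto
    then show ?thesis by simp
  qed
  then show "cut \<delta> \<kappa> Q = 0" "cut' \<delta> \<kappa> Q = 0" by (auto simp: cut_def cut'_def)
qed

lemma cut_deriv:
  assumes \<delta>: "\<delta> > 0" and \<kappa>: "\<kappa> > 0"
  shows "(cut \<delta> \<kappa> has_real_derivative cut' \<delta> \<kappa> Q) (at Q)"
proof (cases "Q < \<delta>\<^sup>2")
  case True
  have "(cut \<delta> \<kappa> has_real_derivative 0) (at Q)"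
    by (rule has_field_derivative_transform_within_open[of "\<lambda>_. 0" _ _ "{..<\<delta>\<^sup>2}"])
       (use True cut_zero[OF \<delta> \<kappa>] in auto)
  then show ?thesis using cut_zero(2)[OF \<delta> \<kappa>] True by simp
next
  case False
  have Q: "Q > 0" using False \<delta> by (meson less_le_trans not_less zero_less_power)
  let ?l = "\<kappa> / 2"
  have "((\<lambda>Q. \<delta>\<^sup>2 / Q) has_real_derivative - (\<delta>\<^sup>2 / Q\<^sup>2)) (at Q)"
    using Q by (auto intro!: derivative_eq_intros simp: power2_eq_square)
  from DERIV_fun_powr[OF this, of ?l]
  have "((\<lambda>Q. (\<delta>\<^sup>2 / Q) powr ?l) has_real_derivative ?l * (\<delta>\<^sup>2 / Q) powr (?l - 1) * - (\<delta>\<^sup>2 / Q\<^sup>2)) (at Q)"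
    using Q \<delta> by simp
  moreover have "(\<delta>\<^sup>2 / Q) powr (?l - 1) * (\<delta>\<^sup>2 / Q\<^sup>2) = (\<delta>\<^sup>2 / Q) powr ?l / Q"
  proof -
    have "(\<delta>\<^sup>2 / Q) powr (?l - 1) = (\<delta>\<^sup>2 / Q) powr ?l / (\<delta>\<^sup>2 / Q)" using Q \<delta> by (simp add: powr_diff)
    then show ?thesis using Q \<delta> by (simp add: power2_eq_square field_simps)
  qed
  ultimately have a0: "((\<lambda>Q. (\<delta>\<^sup>2 / Q) powr ?l) has_real_derivative - (?l * ((\<delta>\<^sup>2 / Q) powr ?l / Q))) (at Q)"
    by (simp only: mult_minus_right mult.assoc)
  have 1: "((\<lambda>Q. 1 - (\<delta>\<^sup>2 / Q) powr ?l) has_real_derivative ?l * ((\<delta>\<^sup>2 / Q) powr ?l / Q)) (at Q)"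
  proof -
    have "((\<lambda>Q. 1 - (\<delta>\<^sup>2 / Q) powr ?l) has_real_derivative 0 - (- (?l * ((\<delta>\<^sup>2 / Q) powr ?l / Q)))) (at Q)"
      by (rule DERIV_diff[OF DERIV_const a0])
    then show ?thesis by (simp only: diff_minus_eq_add add_0_left)
  qed
  have "((\<lambda>Q. (max 0 (1 - (\<delta>\<^sup>2 / Q) powr ?l))\<^sup>2) has_real_derivative
     2 * max 0 (1 - (\<delta>\<^sup>2 / Q) powr ?l) * (?l * ((\<delta>\<^sup>2 / Q) powr ?l / Q))) (at Q)"
    by (rule DERIV_chain2[OF DERIV_max_0_power2 1])
  then have "((\<lambda>Q. (max 0 (1 - (\<delta>\<^sup>2 / Q) powr ?l))\<^sup>2) has_real_derivative cut' \<delta> \<kappa> Q) (at Q)"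
    using Q by (simp add: cut'_def mult_ac)
  then show ?thesis
    by (rule has_field_derivative_transform_within_open[of _ _ _ "{0<..}"]) (use Q in \<open>auto simp: cut_def\<close>)
qed

lemma cut'_cont:
  assumes \<delta>: "\<delta> > 0" and \<kappa>: "\<kappa> > 0"
  shows "continuous_on X (cut' \<delta> \<kappa>)"
proof -
  have 1: "continuous_on {..<\<delta>\<^sup>2} (cut' \<delta> \<kappa>)"
    by (rule continuous_on_eq[of _ "\<lambda>_. 0"]) (use cut_zero(2)[OF \<delta> \<kappa>] in auto)
  have 2: "continuous_on {0<..} (cut' \<delta> \<kappa>)"
    by (rule continuous_on_eq[of _ "\<lambda>Q. \<kappa> * max 0 (1 - (\<delta>\<^sup>2 / Q) powr (\<kappa> / 2)) * (\<delta>\<^sup>2 / Q) powr (\<kappa> / 2) / Q"])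
       (use \<delta> in \<open>auto intro!: continuous_intros simp: cut'_def\<close>)
  have "continuous_on ({..<\<delta>\<^sup>2} \<union> {0<..}) (cut' \<delta> \<kappa>)" by (rule continuous_on_open_Un) (use 1 2 in auto)
  moreover have "{..<\<delta>\<^sup>2} \<union> {0<..} = UNIV" 
  proof -
    have "\<delta>\<^sup>2 > 0" using \<delta> by simp
    then have "x < \<delta>\<^sup>2 \<or> 0 < x" for x by linarith
    then show ?thesis by blast
  qed
  ultimately show ?thesis using continuous_on_subset[of UNIV _ X] by simp
qed

text \<open>The fourth bound controls the weight uniformly in \<open>\<delta>\<close>. The last one
  retains sqrt(cut) and \<delta>^\<kappa>: the former is paired with the energy density in
  \<open>cutoff_estimate\<close>, the latter is the smallness.\<close>

lemma cut_bounds: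
  assumes "\<delta> > 0" "\<kappa> > 0"
  shows "0 \<le> cut \<delta> \<kappa> Q" "cut \<delta> \<kappa> Q \<le> 1" "0 \<le> cut' \<delta> \<kappa> Q" "Q > 0 \<Longrightarrow> cut' \<delta> \<kappa> Q \<le> \<kappa> / Q"
    "Q > 0 \<Longrightarrow> cut' \<delta> \<kappa> Q \<le> \<kappa> * (sqrt (cut \<delta> \<kappa> Q) * (\<delta>\<^sup>2 / Q) powr (\<kappa> / 2)) / Q"
proof -
  let ?a = "(\<delta>\<^sup>2 / Q) powr (\<kappa> / 2)"
  show "0 \<le> cut \<delta> \<kappa> Q" "0 \<le> cut' \<delta> \<kappa> Q" using assms by (auto simp: cut_def cut'_def)
  have m: "0 \<le> max 0 (1 - ?a)" "max 0 (1 - ?a) \<le> 1" by auto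
  show "cut \<delta> \<kappa> Q \<le> 1" using power_mono[OF m(2) m(1), of 2] by (simp add: cut_def)
  show "Q > 0 \<Longrightarrow> cut' \<delta> \<kappa> Q \<le> \<kappa> * (sqrt (cut \<delta> \<kappa> Q) * (\<delta>\<^sup>2 / Q) powr (\<kappa> / 2)) / Q"
    by (simp add: cut_def cut'_def mult.assoc)
  assume Q: "Q > 0"
  have "max 0 (1 - ?a) * ?a \<le> 1"
  proof (cases "?a \<le> 1")
    case True
    then show ?thesis using mult_mono[OF m(2) True] by simp
  next
    case False then show ?thesis by simp
  qed
  then have "\<kappa> * (max 0 (1 - ?a) * ?a) / Q \<le> \<kappa> * 1 / Q" using assms Q by (intro divide_right_mono mult_left_mono) auto
  then show "cut' \<delta> \<kappa> Q \<le> \<kappa> / Q" using Q by (simp add: cut'_def mult.assoc)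
qed

text \<open>The quotient of \<open>F\<close> is the mean of its derivative over a segment. After
  Fubini and a translation the shift sits on \<open>B\<close>, so a bounded measurable
  \<open>B\<close> needs only a pointwise bound along segments starting in \<open>S\<close>. This is
  how the drift is differenced.\<close>

lemma difference_quotient_estimate:
  fixes F B \<beta> :: "'a::euclidean_space \<Rightarrow> real"
  assumes F: "C1_supp S F DF" and B: "B \<in> borel_measurable borel" "\<And>x. \<bar>B x\<bar> \<le> C" and t: "t > 0"
    and \<beta>: "\<And>x \<tau>. x \<in> S \<Longrightarrow> 0 \<le> \<tau> \<Longrightarrow> \<tau> \<le> 1 \<Longrightarrow> \<bar>B (x + (\<tau> * t) *\<^sub>R i)\<bar> \<le> \<beta> x"
    and i\<beta>: "integrable lborel (\<lambda>x. \<beta> x * \<bar>DF x \<bullet> i\<bar>)"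
  shows "\<bar>\<integral>x. B x * ((F x - F (x - t *\<^sub>R i)) / t) \<partial>lborel\<bar> \<le> (\<integral>x. \<beta> x * \<bar>DF x \<bullet> i\<bar> \<partial>lborel)"
proof -
  note D = C1_suppD[OF F]
  have DFm [measurable]: "DF \<in> borel_measurable borel" using D(3) by (rule borel_measurable_continuous_onI)
  note [measurable] = B(1)
  have C: "C \<ge> 0" using B(2)[of 0] by linarith
  let ?f = "\<lambda>\<tau> x. indicator {0..1} \<tau> * (B x * (DF (x - (\<tau> * t) *\<^sub>R i) \<bullet> i))"
  have iDF: "integrable lborel (\<lambda>x. DF x \<bullet> i)"
    by (rule integrable_continuous_compact_supp[OF _ D(1)]) (use D(3,6) in \<open>auto intro!: continuous_intros\<close>)
  define J where "J = (\<integral>x. \<bar>DF x \<bullet> i\<bar> \<partial>lborel)"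
  have ix: "integrable lborel (\<lambda>x. B x * (DF (x - a) \<bullet> i))" and nx: "(\<integral>x. \<bar>B x * (DF (x - a) \<bullet> i)\<bar> \<partial>lborel) \<le> C * J" for a
  proof -
    have i1: "integrable lborel (\<lambda>x. DF (x - a) \<bullet> i)" using lborel_integrable_translate[OF iDF, of "- a"] by simp
    show 2: "integrable lborel (\<lambda>x. B x * (DF (x - a) \<bullet> i))"
    proof (rule Bochner_Integration.integrable_bound)
      show "integrable lborel (\<lambda>x. C * (DF (x - a) \<bullet> i))" using i1 by auto
      show "AE x in lborel. norm (B x * (DF (x - a) \<bullet> i)) \<le> norm (C * (DF (x - a) \<bullet> i))"
        using B(2) C by (intro AE_I2) (auto simp: abs_mult intro!: mult_right_mono)
    qed measurable
    have "(\<integral>x. \<bar>B x * (DF (x - a) \<bullet> i)\<bar> \<partial>lborel) \<le> (\<integral>x. C * \<bar>DF (x - a) \<bullet> i\<bar> \<partial>lborel)"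
    proof (rule integral_mono)
      show "\<bar>B x * (DF (x - a) \<bullet> i)\<bar> \<le> C * \<bar>DF (x - a) \<bullet> i\<bar>" for x
        unfolding abs_mult by (intro mult_right_mono B(2)) auto
    qed (use 2 i1 in auto)
    also have "(\<integral>x. C * \<bar>DF (x - a) \<bullet> i\<bar> \<partial>lborel) = C * J"
      using lborel_integral_translate[of "\<lambda>x. \<bar>DF x \<bullet> i\<bar>" "- a"] by (simp add: J_def)
    finally show "(\<integral>x. \<bar>B x * (DF (x - a) \<bullet> i)\<bar> \<partial>lborel) \<le> C * J" .
  qed
  have im: "integrable (lborel \<Otimes>\<^sub>M lborel) (\<lambda>(\<tau>, x). ?f \<tau> x)"
  proof (rule lborel_pair.Fubini_integrable)
    show "(\<lambda>(\<tau>, x). ?f \<tau> x) \<in> borel_measurable (lborel \<Otimes>\<^sub>M lborel)" by measurable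
    show "AE \<tau> in lborel. integrable lborel (\<lambda>x. (case (\<tau>, x) of (\<tau>, x) \<Rightarrow> ?f \<tau> x))"
      using ix by (intro AE_I2) auto
    show "integrable lborel (\<lambda>\<tau>. \<integral>x. norm (case (\<tau>, x) of (\<tau>, x) \<Rightarrow> ?f \<tau> x) \<partial>lborel)"
    proof (rule integrable_compact_bounded[of _ "{0..1}" "C * J"])
      show "(\<lambda>\<tau>. \<integral>x. norm (case (\<tau>, x) of (\<tau>, x) \<Rightarrow> ?f \<tau> x) \<partial>lborel) \<in> borel_measurable borel" by measurable
      fix \<tau> :: real assume "\<tau> \<in> {0..1}"
      then show "norm (\<integral>x. norm (case (\<tau>, x) of (\<tau>, x) \<Rightarrow> ?f \<tau> x) \<partial>lborel) \<le> C * J"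
        using nx[of "(\<tau> * t) *\<^sub>R i"] by simp
    qed auto
  qed
  have ftc: "(\<integral>\<tau>. indicator {0..1} \<tau> * (DF (x - (\<tau> * t) *\<^sub>R i) \<bullet> i) \<partial>lborel) = (F x - F (x - t *\<^sub>R i)) / t" for x
  proof -
    let ?g = "\<lambda>\<tau>. - F (x - (\<tau> * t) *\<^sub>R i) / t"
    have "(\<integral>\<tau>. (DF (x - (\<tau> * t) *\<^sub>R i) \<bullet> i) * indicator {0..1} \<tau> \<partial>lborel) = ?g 1 - ?g 0"
    proof (rule integral_FTC_Icc_real)
      fix \<tau> :: real
      have "((\<lambda>\<tau>. x - (\<tau> * t) *\<^sub>R i) has_derivative (\<lambda>h. - ((h * t) *\<^sub>R i))) (at \<tau>)" by (auto intro!: derivative_eq_intros)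
      from has_derivative_compose[OF this D(2)]
      have "((\<lambda>\<tau>. F (x - (\<tau> * t) *\<^sub>R i)) has_derivative (\<lambda>h. DF (x - (\<tau> * t) *\<^sub>R i) \<bullet> - ((h * t) *\<^sub>R i))) (at \<tau>)" .
      then have "((\<lambda>\<tau>. F (x - (\<tau> * t) *\<^sub>R i)) has_real_derivative - t * (DF (x - (\<tau> * t) *\<^sub>R i) \<bullet> i)) (at \<tau>)"
        by (rule has_derivative_imp_has_field_derivative) (simp add: algebra_simps)
      from DERIV_cdivide[OF DERIV_minus[OF this], of t]
      show "(?g has_real_derivative DF (x - (\<tau> * t) *\<^sub>R i) \<bullet> i) (at \<tau>)" using t by simp
      have "continuous_on UNIV (\<lambda>\<tau>. DF (x - (\<tau> * t) *\<^sub>R i) \<bullet> i)"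
        by (intro continuous_intros continuous_on_compose2[OF D(3)]) auto
      then show "isCont (\<lambda>\<tau>. DF (x - (\<tau> * t) *\<^sub>R i) \<bullet> i) \<tau>" by (simp add: continuous_on_eq_continuous_at)
    qed simp
    then show ?thesis by (simp add: mult.commute diff_divide_distrib)
  qed
  have "(\<integral>x. B x * ((F x - F (x - t *\<^sub>R i)) / t) \<partial>lborel) = (\<integral>x. (\<integral>\<tau>. ?f \<tau> x \<partial>lborel) \<partial>lborel)"
  proof (rule Bochner_Integration.integral_cong[OF refl])
    fix x
    have "(\<integral>\<tau>. ?f \<tau> x \<partial>lborel) = (\<integral>\<tau>. B x * (indicator {0..1} \<tau> * (DF (x - (\<tau> * t) *\<^sub>R i) \<bullet> i)) \<partial>lborel)" by (simp add: mult_ac)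
    also have "\<dots> = B x * ((F x - F (x - t *\<^sub>R i)) / t)" unfolding integral_mult_right_zero ftc ..
    finally show "B x * ((F x - F (x - t *\<^sub>R i)) / t) = (\<integral>\<tau>. ?f \<tau> x \<partial>lborel)" by simp
  qed
  also have "\<dots> = (\<integral>\<tau>. (\<integral>x. ?f \<tau> x \<partial>lborel) \<partial>lborel)" using lborel_pair.Fubini_integral[OF im] by simp
  finally have eq: "(\<integral>x. B x * ((F x - F (x - t *\<^sub>R i)) / t) \<partial>lborel) = (\<integral>\<tau>. (\<integral>x. ?f \<tau> x \<partial>lborel) \<partial>lborel)" .
  define Kb where "Kb = (\<integral>x. \<beta> x * \<bar>DF x \<bullet> i\<bar> \<partial>lborel)"
  have in\<tau>: "\<bar>\<integral>x. ?f \<tau> x \<partial>lborel\<bar> \<le> Kb * indicator {0..1} \<tau>" for \<tau>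
  proof (cases "\<tau> \<in> {0..1}")
    case True
    let ?a = "(\<tau> * t) *\<^sub>R i"
    have m: "(\<lambda>x. B (x + ?a) * (DF x \<bullet> i)) \<in> borel_measurable borel" by measurable
    have "(\<integral>x. ?f \<tau> x \<partial>lborel) = (\<integral>x. B x * (DF (x - ?a) \<bullet> i) \<partial>lborel)" using True by simp
    also have "\<dots> = (\<integral>x. B (x + ?a) * (DF (x + ?a - ?a) \<bullet> i) \<partial>lborel)"
      by (rule lborel_integral_translate[symmetric]) measurable
    finally have "\<bar>\<integral>x. ?f \<tau> x \<partial>lborel\<bar> = \<bar>\<integral>x. B (x + ?a) * (DF x \<bullet> i) \<partial>lborel\<bar>" by simp
    also have "\<dots> \<le> (\<integral>x. \<bar>B (x + ?a) * (DF x \<bullet> i)\<bar> \<partial>lborel)" by (rule integral_abs_bound)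
    also have "\<dots> \<le> Kb" unfolding Kb_def
    proof (rule integral_mono)
      have "integrable lborel (\<lambda>x. B (x + ?a) * (DF (x + ?a - ?a) \<bullet> i))" by (rule lborel_integrable_translate[OF ix])
      then show "integrable lborel (\<lambda>x. \<bar>B (x + ?a) * (DF x \<bullet> i)\<bar>)" by simp
      fix x
      show "\<bar>B (x + ?a) * (DF x \<bullet> i)\<bar> \<le> \<beta> x * \<bar>DF x \<bullet> i\<bar>"
      proof (cases "x \<in> S")
        case True
        then show ?thesis using \<beta>[of x \<tau>] \<open>\<tau> \<in> {0..1}\<close> unfolding abs_mult by (intro mult_right_mono) auto
      qed (use D(6) in auto)
    qed (rule i\<beta>)
    finally show ?thesis using True by simp
  qed simp
  define h where "h \<tau> = (\<integral>x. ?f \<tau> x \<partial>lborel)" for \<tau>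
  have hi: "integrable lborel h" unfolding h_def using lborel_pair.integrable_fst[OF im] by simp
  have hb: "\<bar>h \<tau>\<bar> \<le> Kb * indicator {0..1} \<tau>" for \<tau> unfolding h_def by (rule in\<tau>)
  have ki: "integrable lborel (\<lambda>\<tau>::real. Kb * indicator {0..1} \<tau>)"
    by (intro integrable_mult_right integrable_indicator_compact) auto
  have "\<bar>\<integral>\<tau>. h \<tau> \<partial>lborel\<bar> \<le> (\<integral>\<tau>. \<bar>h \<tau>\<bar> \<partial>lborel)" by (rule integral_abs_bound)
  also have "\<dots> \<le> (\<integral>\<tau>. Kb * indicator {0..1::real} \<tau> \<partial>lborel)"
    using hi ki hb by (intro integral_mono) auto
  also have "\<dots> = Kb" by simp
  finally show ?thesis unfolding eq Kb_def h_def .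
qed

section \<open>Difference quotients of the solution\<close>

context plap_setting
begin

text \<open>\<open>dq\<close> is the discrete gradient, \<open>dV t k\<close> the gradient of its
  \<open>k\<close>-th component and thus a row of the discrete Hessian, written as a quotient of
  \<open>D\<close> since \<open>u\<close> has no second derivatives. \<open>dsq\<close> is the
  squared length of \<open>dq\<close>, which is differentiable also where \<open>dq\<close>
  vanishes.\<close>

definition "dq t x = (\<Sum>k\<in>Basis. ((u (x + t *\<^sub>R k) - u x) / t) *\<^sub>R k)"
definition "dV t k x = (1 / t) *\<^sub>R (D (x + t *\<^sub>R k) - D x)"
definition "dsq t x = dq t x \<bullet> dq t x"
definition "shiftdom t = {x \<in> \<Omega>. \<forall>k\<in>Basis. x + t *\<^sub>R k \<in> \<Omega>}"

lemma open_shiftdom: "open (shiftdom t)"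
proof -
  have "shiftdom t = \<Omega> \<inter> (\<Inter>k\<in>Basis. (\<lambda>x. x + t *\<^sub>R k) -` \<Omega>)" by (auto simp: shiftdom_def)
  moreover have "open ((\<lambda>x. x + t *\<^sub>R k) -` \<Omega>)" for k
    using open_\<Omega> by (intro open_vimage continuous_intros)
  ultimately show ?thesis using open_\<Omega> by (auto intro!: open_Int open_INT)
qed

lemma dq_inner: "k \<in> Basis \<Longrightarrow> dq t x \<bullet> k = (u (x + t *\<^sub>R k) - u x) / t"
  by (simp add: dq_def inner_sum_left inner_Basis if_distrib cong: if_cong)

lemma dq_C1:
  assumes "k \<in> Basis"
  shows "C1_grad (shiftdom t) (\<lambda>x. dq t x \<bullet> k) (dV t k)"
proof -
  have 1: "C1_grad (shiftdom t) (\<lambda>x. u (x + t *\<^sub>R k)) (\<lambda>x. D (x + t *\<^sub>R k))"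
    by (rule C1_grad_translate[OF u_C1]) (use assms in \<open>auto simp: shiftdom_def\<close>)
  have 2: "C1_grad (shiftdom t) u D" by (rule C1_grad_subset[OF u_C1]) (auto simp: shiftdom_def)
  from C1_grad_cmult[OF C1_grad_diff[OF 1 2], of "1 / t"] show ?thesis
    unfolding dq_inner[OF assms] dV_def by simp
qed

lemma dsq_sum: "dsq t x = (\<Sum>k\<in>Basis. (dq t x \<bullet> k) * (dq t x \<bullet> k))"
  unfolding dsq_def by (rule euclidean_inner)

lemma dsq_norm: "dsq t x = (norm (dq t x))\<^sup>2"
  by (simp add: dsq_def power2_norm_eq_inner)

lemma dsq_C1: "C1_grad (shiftdom t) (dsq t) (\<lambda>x. 2 *\<^sub>R (\<Sum>k\<in>Basis. (dq t x \<bullet> k) *\<^sub>R dV t k x))"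
proof -
  have "C1_grad (shiftdom t) (\<lambda>x. \<Sum>k\<in>Basis. (dq t x \<bullet> k) * (dq t x \<bullet> k))
     (\<lambda>x. \<Sum>k\<in>Basis. (dq t x \<bullet> k) *\<^sub>R dV t k x + (dq t x \<bullet> k) *\<^sub>R dV t k x)"
    by (intro C1_grad_sum C1_grad_mult dq_C1)
  then show ?thesis unfolding dsq_sum[symmetric] by (simp add: sum.distrib scaleR_2)
qed

lemma dq_borel: "dq t \<in> borel_measurable borel" and dV_borel: "dV t k \<in> borel_measurable borel"
  and dsq_borel: "dsq t \<in> borel_measurable borel"
proof -
  note [measurable] = u_borel D_borel
  show 1: "dq t \<in> borel_measurable borel" unfolding dq_def by measurable
  show "dV t k \<in> borel_measurable borel" unfolding dV_def by measurable
  show "dsq t \<in> borel_measurable borel" unfolding dsq_def using 1 by auto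
qed

text \<open>The mean value inequality for \<open>u\<close> minus its linear part at
  \<open>x\<close>, with the oscillation of \<open>D\<close> controlled by uniform continuity on
  \<open>N\<close>. The parameter \<tau> covers the segments needed for the drift.\<close>

lemma dq_uniform:
  assumes S: "S \<subseteq> \<Omega>" and N: "compact N" "N \<subseteq> \<Omega>" and e: "e > 0" "\<And>x. x \<in> S \<Longrightarrow> cball x e \<subseteq> N" and r: "r > 0"
  shows "\<exists>t0>0. t0 \<le> e \<and> (\<forall>t. 0 < t \<and> t < t0 \<longrightarrow> (\<forall>x\<in>S. x \<in> shiftdom t \<and> norm (dq t x - D x) \<le> r \<and>
     (\<forall>k\<in>Basis. \<forall>\<tau>. 0 \<le> \<tau> \<and> \<tau> \<le> 1 \<longrightarrow> x + (\<tau> * t) *\<^sub>R k \<in> N \<and> norm (D (x + (\<tau> * t) *\<^sub>R k) - D x) \<le> r)))"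
proof -
  \<comment> \<open>Division by the dimension allows for summing the errors of all components; the
    summand 1 also gives \<open>r' \<le> r\<close>.\<close>
  define r' where "r' = r / (real DIM('a) + 1)"
  have r': "r' > 0" "r' \<le> r" using r by (auto simp: r'_def field_simps)
  have "uniformly_continuous_on N D" using N D_cont compact_uniformly_continuous continuous_on_subset by blast
  then obtain d where d: "d > 0" "\<And>x y. x \<in> N \<Longrightarrow> y \<in> N \<Longrightarrow> dist y x < d \<Longrightarrow> dist (D y) (D x) < r'"
    unfolding uniformly_continuous_on_def using r' by metis
  show ?thesis
  proof (intro exI[of _ "min d e"] conjI allI impI ballI)
    fix t assume t: "0 < t \<and> t < min d e"
    fix x assume x: "x \<in> S"
    have xN: "x \<in> N" using e x by force
    have near: "y \<in> N \<and> norm (D y - D x) \<le> r'" if "norm (y - x) \<le> t" for y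
    proof
      have "y \<in> cball x e" using that t by (simp add: dist_norm norm_minus_commute)
      then show yN: "y \<in> N" using e(2)[OF x] by auto
      show "norm (D y - D x) \<le> r'" using d(2)[OF xN yN] that t by (auto simp: dist_norm)
    qed
    show "x \<in> shiftdom t"
      using near[of "x + t *\<^sub>R _"] t S x N(2) by (auto simp: shiftdom_def)
    show "x + (\<tau> * t) *\<^sub>R k \<in> N" "norm (D (x + (\<tau> * t) *\<^sub>R k) - D x) \<le> r"
      if "k \<in> Basis" "0 \<le> \<tau> \<and> \<tau> \<le> 1" for k \<tau>
    proof -
      have "norm ((x + (\<tau> * t) *\<^sub>R k) - x) \<le> t" using that t by (simp add: abs_mult mult_left_le_one_le)
      from near[OF this] show "x + (\<tau> * t) *\<^sub>R k \<in> N" "norm (D (x + (\<tau> * t) *\<^sub>R k) - D x) \<le> r" using r' by auto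
    qed
    have comp: "\<bar>(dq t x - D x) \<bullet> k\<bar> \<le> r'" if k: "k \<in> Basis" for k
    proof -
      let ?F = "\<lambda>y. u y - D x \<bullet> y"
      have "norm (?F (x + t *\<^sub>R k) - ?F x) \<le> r' * norm ((x + t *\<^sub>R k) - x)"
      proof (rule differentiable_bound[of "cball x t" ?F "\<lambda>y h. (D y - D x) \<bullet> h"])
        fix y assume "y \<in> cball x t"
        then have y: "norm (y - x) \<le> t" by (simp add: dist_norm norm_minus_commute)
        have y\<Omega>: "y \<in> \<Omega>" using near[OF y] N(2) by auto
        show "(?F has_derivative (\<lambda>h. (D y - D x) \<bullet> h)) (at y within cball x t)"
          unfolding inner_diff_left
          by (intro derivative_intros has_derivative_at_withinI[OF C1_gradD(1)[OF u_C1 y\<Omega>]])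
        show "onorm (\<lambda>h. (D y - D x) \<bullet> h) \<le> r'"
        proof (rule onorm_le)
          fix h show "norm ((D y - D x) \<bullet> h) \<le> r' * norm h"
            using near[OF y] Cauchy_Schwarz_ineq2[of "D y - D x" h] mult_right_mono[of "norm (D y - D x)" r' "norm h"] by simp
        qed
      qed (use t k in \<open>auto simp: dist_norm\<close>)
      then have "\<bar>(u (x + t *\<^sub>R k) - u x) - t * (D x \<bullet> k)\<bar> \<le> r' * t"
        using t k by (simp add: inner_add_right algebra_simps)
      then have "\<bar>(u (x + t *\<^sub>R k) - u x) - t * (D x \<bullet> k)\<bar> / t \<le> r'" using t by (simp add: divide_le_eq)
      moreover have "(dq t x - D x) \<bullet> k = ((u (x + t *\<^sub>R k) - u x) - t * (D x \<bullet> k)) / t"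
        unfolding inner_diff_left dq_inner[OF k] using t by (simp add: diff_divide_distrib)
      ultimately show ?thesis using t by (simp add: abs_divide)
    qed
    have "norm (dq t x - D x) \<le> (\<Sum>k\<in>Basis. \<bar>(dq t x - D x) \<bullet> k\<bar>)" by (rule norm_le_l1)
    also have "\<dots> \<le> (\<Sum>k\<in>(Basis::'a set). r')" by (rule sum_mono) (rule comp)
    also have "\<dots> \<le> r" using r by (simp add: r'_def field_simps)
    finally show "norm (dq t x - D x) \<le> r" .
  qed (use d e in auto)
qed

end

context plap_solution
begin

text \<open>The equation tested with the sum of the backward quotients of \<open>F k\<close>.
  Translation turns these into forward quotients of the flux, and the drift is estimated by
  \<open>difference_quotient_estimate\<close>, which makes an inequality of the equation.\<close>

lemma energy_le:
  assumes t: "t > 0" and F: "\<And>k. k \<in> Basis \<Longrightarrow> C1_supp S (F k) (DF k)" and S: "compact S" "S \<subseteq> regular"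
    and St: "\<And>x k. x \<in> S \<Longrightarrow> k \<in> Basis \<Longrightarrow> x + t *\<^sub>R k \<in> regular"
    and N: "compact N" "N \<subseteq> \<Omega>" "\<And>x k \<tau>. x \<in> S \<Longrightarrow> k \<in> Basis \<Longrightarrow> 0 \<le> \<tau> \<Longrightarrow> \<tau> \<le> 1 \<Longrightarrow> x + (\<tau> * t) *\<^sub>R k \<in> N"
    and \<beta>: "\<And>x k \<tau>. x \<in> S \<Longrightarrow> k \<in> Basis \<Longrightarrow> 0 \<le> \<tau> \<Longrightarrow> \<tau> \<le> 1 \<Longrightarrow> \<bar>drift (x + (\<tau> * t) *\<^sub>R k)\<bar> \<le> \<beta> x"
    and \<beta>m: "\<beta> \<in> borel_measurable borel" "\<And>x. x \<in> S \<Longrightarrow> \<bar>\<beta> x\<bar> \<le> C\<beta>"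
  defines "X \<equiv> \<lambda>x. (\<Sum>k\<in>Basis. ((1 / t) *\<^sub>R (flux (x + t *\<^sub>R k) - flux x)) \<bullet> DF k x) - \<beta> x * (\<Sum>k\<in>Basis. norm (DF k x))"
  shows "integrable lborel X" "(\<integral>x. X x \<partial>lborel) \<le> 0"
proof -
  have S\<Omega>: "S \<subseteq> \<Omega>" using S regular_sub by auto
  have NS: "S \<subseteq> N"
  proof
    fix x assume x: "x \<in> S"
    obtain k :: 'a where "k \<in> Basis" using nonempty_Basis by blast
    from N(3)[OF x this, of 0] show "x \<in> N" by simp
  qed
  have Nt: "x + t *\<^sub>R k \<in> N" if "x \<in> S" "k \<in> Basis" for x k using N(3)[OF that, of 1] by simp
  obtain C where C: "C \<ge> 0" "\<And>x. x \<in> N \<Longrightarrow> norm (flux x) \<le> C" "\<And>x. x \<in> N \<Longrightarrow> \<bar>drift x\<bar> \<le> C"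
    using flux_drift_bounded[OF N(1,2)] by blast
  note Fk = C1_suppD[OF F]
  have DFm: "DF k \<in> borel_measurable borel" "F k \<in> borel_measurable borel" if "k \<in> Basis" for k
    using Fk(3,4)[OF that] by (auto intro: borel_measurable_continuous_onI)
  have "\<forall>k\<in>Basis. \<exists>b. b \<ge> 0 \<and> (\<forall>x. norm (DF k x) \<le> b)" using C1_supp_bound[OF F] by metis
  then obtain b where b: "\<And>k. k \<in> Basis \<Longrightarrow> b k \<ge> 0" "\<And>k x. k \<in> Basis \<Longrightarrow> norm (DF k x) \<le> b k" by metis
  have if1: "integrable lborel (\<lambda>x. flux x \<bullet> DF k x)" if k: "k \<in> Basis" for k
    by (rule wform_integrable(1)[OF F[OF k] S\<Omega>])
  have if2: "integrable lborel (\<lambda>x. flux (x + t *\<^sub>R k) \<bullet> DF k x)" if k: "k \<in> Basis" for k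
  proof (rule integrable_compact_bounded[OF _ S(1)])
    show "(\<lambda>x. flux (x + t *\<^sub>R k) \<bullet> DF k x) \<in> borel_measurable borel" using flux_borel DFm(1)[OF k] by auto
    show "norm (flux (x + t *\<^sub>R k) \<bullet> DF k x) \<le> C * b k" if "x \<in> S" for x
      using Cauchy_Schwarz_ineq2[of "flux (x + t *\<^sub>R k)" "DF k x"] mult_mono[OF C(2)[OF Nt[OF that k]] b(2)[OF k, of x]] C(1) by auto
  qed (use Fk(6)[OF k] in auto)
  have if3: "integrable lborel (\<lambda>x. flux x \<bullet> DF k (x - t *\<^sub>R k))" if k: "k \<in> Basis" for k
    using lborel_integrable_translate[OF if2[OF k], of "- t *\<^sub>R k"] by simp
  have sh: "(\<integral>x. flux x \<bullet> DF k (x - t *\<^sub>R k) \<partial>lborel) = (\<integral>x. flux (x + t *\<^sub>R k) \<bullet> DF k x \<partial>lborel)" if k: "k \<in> Basis" for k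
    using lborel_integral_translate[of "\<lambda>x. flux x \<bullet> DF k (x - t *\<^sub>R k)" "t *\<^sub>R k"] flux_borel DFm(1)[OF k] by simp
  have i\<beta>: "integrable lborel (\<lambda>x. \<beta> x * norm (DF k x))" if k: "k \<in> Basis" for k
  proof (rule integrable_compact_bounded[OF _ S(1)])
    show "norm (\<beta> x * norm (DF k x)) \<le> C\<beta> * b k" if "x \<in> S" for x
      using mult_mono[OF \<beta>m(2)[OF that] b(2)[OF k, of x]] \<beta>m(2)[OF that] by (simp add: abs_mult)
  qed (use Fk(6)[OF k] DFm[OF k] \<beta>m in auto)
  have i\<beta>2: "integrable lborel (\<lambda>x. \<beta> x * \<bar>DF k x \<bullet> k\<bar>)" if k: "k \<in> Basis" for k
  proof (rule integrable_compact_bounded[OF _ S(1)])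
    show "norm (\<beta> x * \<bar>DF k x \<bullet> k\<bar>) \<le> C\<beta> * b k" if "x \<in> S" for x
    proof -
      have "\<bar>DF k x \<bullet> k\<bar> \<le> b k" using Basis_le_norm[OF k, of "DF k x"] b(2)[OF k, of x] by simp
      then show ?thesis using mult_mono[OF \<beta>m(2)[OF that], of "\<bar>DF k x \<bullet> k\<bar>" "b k"] \<beta>m(2)[OF that] by (simp add: abs_mult)
    qed
  qed (use Fk(6)[OF k] DFm[OF k] \<beta>m in auto)
  define \<psi> where "\<psi> x = (\<Sum>k\<in>Basis. (1 / t) * (F k x - F k (x - t *\<^sub>R k)))" for x
  define D\<psi> where "D\<psi> x = (\<Sum>k\<in>Basis. (1 / t) *\<^sub>R (DF k x - DF k (x - t *\<^sub>R k)))" for x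
  \<comment> \<open>The supports together with their translates: the backward quotient sees both,
    and both must stay off the critical set for the equation to apply.\<close>
  define S2 where "S2 = S \<union> (\<Union>k\<in>Basis. (\<lambda>x. x + t *\<^sub>R k) ` S)"
  have S2: "compact S2" unfolding S2_def
    by (intro compact_Un S compact_UN compact_continuous_image continuous_intros) auto
  have S2r: "S2 \<subseteq> regular" unfolding S2_def using S St by auto
  have each: "C1_supp S2 (\<lambda>x. (1 / t) * (F k x - F k (x - t *\<^sub>R k))) (\<lambda>x. (1 / t) *\<^sub>R (DF k x - DF k (x - t *\<^sub>R k)))" if k: "k \<in> Basis" for k
  proof -
    have g1: "C1_grad UNIV (F k) (DF k)" by (rule Fk(7)[OF k])
    have g2: "C1_grad UNIV (\<lambda>x. F k (x + - (t *\<^sub>R k))) (\<lambda>x. DF k (x + - (t *\<^sub>R k)))" by (rule C1_grad_translate[OF g1]) auto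
    have "C1_grad UNIV (\<lambda>x. (1 / t) * (F k x - F k (x - t *\<^sub>R k))) (\<lambda>x. (1 / t) *\<^sub>R (DF k x - DF k (x - t *\<^sub>R k)))"
      using C1_grad_cmult[OF C1_grad_diff[OF g1 g2], of "1 / t"] by simp
    moreover have "(1 / t) * (F k x - F k (x - t *\<^sub>R k)) = 0" if "x \<notin> S2" for x
    proof -
      have "x \<notin> S" using that by (auto simp: S2_def)
      moreover have "x - t *\<^sub>R k \<notin> S"
      proof
        assume "x - t *\<^sub>R k \<in> S"
        then have "(x - t *\<^sub>R k) + t *\<^sub>R k \<in> S2" unfolding S2_def using k by blast
        then show False using that by simp
      qed
      ultimately show ?thesis using Fk(5)[OF k] by simp
    qed
    ultimately show ?thesis using S2 by (simp add: C1_supp_def)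
  qed
  have \<psi>: "C1_supp S2 \<psi> D\<psi>" unfolding \<psi>_def D\<psi>_def by (rule C1_supp_sum[OF each S2])
  have S2\<Omega>: "S2 \<subseteq> \<Omega>" using S2r regular_sub by auto
  note wi = wform_integrable[OF \<psi> S2\<Omega>]
  have "wform \<psi> D\<psi> = 0" by (rule wform_eq_0_on_regular[OF \<psi> S2r])
  then have eq: "(\<integral>x. flux x \<bullet> D\<psi> x \<partial>lborel) = - (\<integral>x. drift x * \<psi> x \<partial>lborel)"
    unfolding wform_def using wi by simp
  have e1: "(\<integral>x. flux x \<bullet> D\<psi> x \<partial>lborel) = - (\<integral>x. (\<Sum>k\<in>Basis. ((1 / t) *\<^sub>R (flux (x + t *\<^sub>R k) - flux x)) \<bullet> DF k x) \<partial>lborel)"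
  proof -
    have "(\<integral>x. flux x \<bullet> D\<psi> x \<partial>lborel) = (\<integral>x. (\<Sum>k\<in>Basis. (1 / t) * (flux x \<bullet> DF k x - flux x \<bullet> DF k (x - t *\<^sub>R k))) \<partial>lborel)"
      unfolding D\<psi>_def by (simp add: inner_sum_right inner_diff_right)
    also have "\<dots> = (\<Sum>k\<in>Basis. (1 / t) * ((\<integral>x. flux x \<bullet> DF k x \<partial>lborel) - (\<integral>x. flux x \<bullet> DF k (x - t *\<^sub>R k) \<partial>lborel)))"
      by (subst Bochner_Integration.integral_sum) (use if1 if3 in auto)
    also have "\<dots> = (\<Sum>k\<in>Basis. - (\<integral>x. ((1 / t) *\<^sub>R (flux (x + t *\<^sub>R k) - flux x)) \<bullet> DF k x \<partial>lborel))"
    proof (rule sum.cong[OF refl])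
      fix k :: 'a assume k: "k \<in> Basis"
      have "(\<integral>x. ((1 / t) *\<^sub>R (flux (x + t *\<^sub>R k) - flux x)) \<bullet> DF k x \<partial>lborel)
         = (1 / t) * ((\<integral>x. flux (x + t *\<^sub>R k) \<bullet> DF k x \<partial>lborel) - (\<integral>x. flux x \<bullet> DF k x \<partial>lborel))"
        using if1[OF k] if2[OF k] by (simp add: inner_diff_left)
      then show "(1 / t) * ((\<integral>x. flux x \<bullet> DF k x \<partial>lborel) - (\<integral>x. flux x \<bullet> DF k (x - t *\<^sub>R k) \<partial>lborel))
         = - (\<integral>x. ((1 / t) *\<^sub>R (flux (x + t *\<^sub>R k) - flux x)) \<bullet> DF k x \<partial>lborel)"
        unfolding sh[OF k] by (simp add: right_diff_distrib)
    qed
    also have "\<dots> = - (\<integral>x. (\<Sum>k\<in>Basis. ((1 / t) *\<^sub>R (flux (x + t *\<^sub>R k) - flux x)) \<bullet> DF k x) \<partial>lborel)"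
      by (subst Bochner_Integration.integral_sum) (use if1 if2 in \<open>auto simp: inner_diff_left sum_negf\<close>)
    finally show ?thesis .
  qed
  \<comment> \<open>The drift is bounded only on compact subsets of the domain. Truncating it to
    \<open>N\<close> changes nothing where the test function lives and gives the global bound that
    Fubini asks for.\<close>
  define B where "B x = indicator N x * drift x" for x
  have Nb: "N \<in> sets borel" using N(1) by (simp add: borel_compact)
  have Bm: "B \<in> borel_measurable borel" unfolding B_def using Nb drift_borel by auto
  have Bb: "\<bar>B x\<bar> \<le> C" for x using C(1,3) by (auto simp: B_def indicator_def)
  have Bq: "drift x * ((1 / t) * (F k x - F k (x - t *\<^sub>R k))) = B x * ((F k x - F k (x - t *\<^sub>R k)) / t)" if k: "k \<in> Basis" for k x
  proof (cases "x \<in> N")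
    case True then show ?thesis by (simp add: B_def)
  next
    case False
    have "x \<notin> S" using NS False by auto
    moreover have "x - t *\<^sub>R k \<notin> S" using Nt[of "x - t *\<^sub>R k" k] k False by auto
    ultimately show ?thesis using Fk(5)[OF k] by simp
  qed
  have dint: "integrable lborel (\<lambda>x. B x * ((F k x - F k (x - t *\<^sub>R k)) / t))" if k: "k \<in> Basis" for k
    using wform_integrable(2)[OF each[OF k] S2\<Omega>] unfolding Bq[OF k] .
  have "(\<integral>x. drift x * \<psi> x \<partial>lborel) = (\<integral>x. (\<Sum>k\<in>Basis. B x * ((F k x - F k (x - t *\<^sub>R k)) / t)) \<partial>lborel)"
    unfolding \<psi>_def sum_distrib_left using Bq by (intro Bochner_Integration.integral_cong refl sum.cong) auto
  also have "\<dots> = (\<Sum>k\<in>Basis. \<integral>x. B x * ((F k x - F k (x - t *\<^sub>R k)) / t) \<partial>lborel)"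
    by (rule Bochner_Integration.integral_sum) (rule dint)
  also have "\<dots> \<le> (\<Sum>k\<in>Basis. \<integral>x. \<beta> x * norm (DF k x) \<partial>lborel)"
  proof (rule sum_mono)
    fix k :: 'a assume k: "k \<in> Basis"
    have "(\<integral>x. B x * ((F k x - F k (x - t *\<^sub>R k)) / t) \<partial>lborel) \<le> \<bar>\<integral>x. B x * ((F k x - F k (x - t *\<^sub>R k)) / t) \<partial>lborel\<bar>" by (rule abs_ge_self)
    also have "\<dots> \<le> (\<integral>x. \<beta> x * \<bar>DF k x \<bullet> k\<bar> \<partial>lborel)"
    proof (rule difference_quotient_estimate[OF F[OF k] Bm Bb t _ i\<beta>2[OF k]])
      fix x \<tau> assume "x \<in> S" "0 \<le> \<tau>" "\<tau> \<le> (1::real)"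
      then show "\<bar>B (x + (\<tau> * t) *\<^sub>R k)\<bar> \<le> \<beta> x" using \<beta>[of x k \<tau>] N(3)[of x k \<tau>] k by (simp add: B_def)
    qed
    also have "\<dots> \<le> (\<integral>x. \<beta> x * norm (DF k x) \<partial>lborel)"
    proof (rule integral_mono[OF i\<beta>2[OF k] i\<beta>[OF k]])
      fix x
      show "\<beta> x * \<bar>DF k x \<bullet> k\<bar> \<le> \<beta> x * norm (DF k x)"
      proof (cases "x \<in> S")
        case True
        have "0 \<le> \<beta> x" using \<beta>[OF True k, of 0] by simp
        then show ?thesis using Basis_le_norm[OF k, of "DF k x"] by (intro mult_left_mono) auto
      qed (use Fk(6)[OF k] in auto)
    qed
    finally show "(\<integral>x. B x * ((F k x - F k (x - t *\<^sub>R k)) / t) \<partial>lborel) \<le> (\<integral>x. \<beta> x * norm (DF k x) \<partial>lborel)" .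
  qed
  also have "\<dots> = (\<integral>x. \<beta> x * (\<Sum>k\<in>Basis. norm (DF k x)) \<partial>lborel)"
    unfolding sum_distrib_left by (rule Bochner_Integration.integral_sum[symmetric]) (rule i\<beta>)
  finally have le: "(\<integral>x. drift x * \<psi> x \<partial>lborel) \<le> (\<integral>x. \<beta> x * (\<Sum>k\<in>Basis. norm (DF k x)) \<partial>lborel)" .
  have I1: "integrable lborel (\<lambda>x. \<Sum>k\<in>Basis. ((1 / t) *\<^sub>R (flux (x + t *\<^sub>R k) - flux x)) \<bullet> DF k x)"
    by (rule Bochner_Integration.integrable_sum) (use if1 if2 in \<open>auto simp: inner_diff_left\<close>)
  have I2: "integrable lborel (\<lambda>x. \<beta> x * (\<Sum>k\<in>Basis. norm (DF k x)))"
    unfolding sum_distrib_left by (rule Bochner_Integration.integrable_sum) (rule i\<beta>)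
  show "integrable lborel X" unfolding X_def using I1 I2 by auto
  have "(\<integral>x. X x \<partial>lborel) = (\<integral>x. (\<Sum>k\<in>Basis. ((1 / t) *\<^sub>R (flux (x + t *\<^sub>R k) - flux x)) \<bullet> DF k x) \<partial>lborel) - (\<integral>x. \<beta> x * (\<Sum>k\<in>Basis. norm (DF k x)) \<partial>lborel)"
    unfolding X_def by (rule Bochner_Integration.integral_diff[OF I1 I2])
  then show "(\<integral>x. X x \<partial>lborel) \<le> 0" using e1 eq le by simp
qed

text \<open>Joins \<open>energy_le\<close> for the test functions G(|d|^2) d_k \<zeta>^2 with the
  pointwise inequality. The result is stated through a minorant \<open>low\<close>, so that each use
  can estimate the error terms in its own way. \<open>S'\<close> carries the weight, and
  nondegeneracy is required only there.\<close>

lemma energy_estimate: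
  fixes \<kappa> c0 c2 \<omega> t C\<beta> :: real and Gf Gf' :: "real \<Rightarrow> real"
  assumes t: "t > 0" and \<zeta>: "C1_supp S \<zeta> D\<zeta>" "\<And>x. 0 \<le> \<zeta> x" and Sd: "S \<subseteq> shiftdom t"
    and S': "compact S'" "S' \<subseteq> S" "S' \<subseteq> regular" "\<And>x. x \<in> S \<Longrightarrow> x \<notin> S' \<Longrightarrow> Gf (dsq t x) = 0"
    and St: "\<And>x k. x \<in> S' \<Longrightarrow> k \<in> Basis \<Longrightarrow> x + t *\<^sub>R k \<in> regular"
    and N: "compact N" "N \<subseteq> \<Omega>" "\<And>x k \<tau>. x \<in> S' \<Longrightarrow> k \<in> Basis \<Longrightarrow> 0 \<le> \<tau> \<Longrightarrow> \<tau> \<le> 1 \<Longrightarrow> x + (\<tau> * t) *\<^sub>R k \<in> N"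
    and \<beta>: "\<And>x k \<tau>. x \<in> S' \<Longrightarrow> k \<in> Basis \<Longrightarrow> 0 \<le> \<tau> \<Longrightarrow> \<tau> \<le> 1 \<Longrightarrow> \<bar>drift (x + (\<tau> * t) *\<^sub>R k)\<bar> \<le> \<beta> x"
    and \<beta>m: "\<beta> \<in> borel_measurable borel" "\<And>x. x \<in> S' \<Longrightarrow> \<bar>\<beta> x\<bar> \<le> C\<beta>"
    and G: "\<And>Q. (Gf has_real_derivative Gf' Q) (at Q)" "continuous_on UNIV Gf'" "\<And>Q. 0 \<le> Gf Q"
      "\<And>Q. 0 < Q \<Longrightarrow> 0 \<le> 2 * Q * Gf' Q + (1 - \<kappa>) * Gf Q"
    and dq0: "\<And>x. x \<in> S' \<Longrightarrow> dq t x \<noteq> 0"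
    and c0: "0 < c0" "c0 \<le> 1" "\<And>x. x \<in> S' \<Longrightarrow> c0 \<le> p x - 1" and c2: "\<And>x. x \<in> S' \<Longrightarrow> 1 + \<bar>p x - 2\<bar> \<le> c2"
    and \<kappa>: "0 < \<kappa>" "\<kappa> \<le> 1" and \<omega>: "0 \<le> \<omega>"
    and R: "\<And>x k. x \<in> S' \<Longrightarrow> k \<in> Basis \<Longrightarrow> norm ((1 / t) *\<^sub>R (flux (x + t *\<^sub>R k) - flux x) - plap_lin (p x) (dq t x) (dV t k x))
         \<le> \<omega> * norm (dV t k x) + \<beta> x"
    and low: "integrable lborel low" "\<And>x. x \<notin> S' \<Longrightarrow> low x \<le> 0"
      "\<And>x H c n v G E. x \<in> S' \<Longrightarrow> H = norm (dq t x) \<Longrightarrow> c = H powr (p x - 2) \<Longrightarrow> n = real DIM('a) \<Longrightarrow>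
         v = sqrt (\<Sum>k\<in>Basis. (norm (dV t k x))\<^sup>2) \<Longrightarrow> G = Gf (dsq t x) \<Longrightarrow>
         E = 2 * dsq t x * Gf' (dsq t x) + (1 - \<kappa>) * Gf (dsq t x) \<Longrightarrow>
         low x \<le> c * c0 * \<kappa> / 2 * (\<zeta> x)\<^sup>2 * G * v\<^sup>2
      - (4 * c * c2\<^sup>2 * G * H\<^sup>2 * (norm (D\<zeta> x))\<^sup>2 / (c0 * \<kappa>) + 16 * n\<^sup>2 * (\<zeta> x)\<^sup>2 * G * (\<beta> x)\<^sup>2 / (c * c0 * \<kappa>)
         + n\<^sup>2 * (\<zeta> x)\<^sup>2 * E * (\<beta> x)\<^sup>2 / (c * c0) + 4 * n * \<beta> x * \<zeta> x * G * H * norm (D\<zeta> x))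
      - n * \<omega> * v * ((\<zeta> x)\<^sup>2 * (2 * G + E) * v + 2 * \<zeta> x * G * H * norm (D\<zeta> x))"
  shows "(\<integral>x. low x \<partial>lborel) \<le> 0"
proof -
  note Z = C1_suppD[OF \<zeta>(1)]
  let ?W = "\<lambda>x. \<Sum>k\<in>Basis. (dq t x \<bullet> k) *\<^sub>R dV t k x"
  have GC: "C1_grad (shiftdom t) (\<lambda>x. Gf (dsq t x)) (\<lambda>x. Gf' (dsq t x) *\<^sub>R (2 *\<^sub>R ?W x))"
    by (rule C1_grad_chain[OF dsq_C1 G(1)]) (rule continuous_on_subset[OF G(2)], auto)
  have Z2: "C1_supp S (\<lambda>x. \<zeta> x * \<zeta> x) (\<lambda>x. \<zeta> x *\<^sub>R D\<zeta> x + \<zeta> x *\<^sub>R D\<zeta> x)"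
    by (rule C1_supp_mult[OF open_UNIV Z(7) \<zeta>(1)]) auto
  define F where "F k x = (Gf (dsq t x) * (dq t x \<bullet> k)) * (\<zeta> x * \<zeta> x)" for k x
  define DF where "DF k x = (\<zeta> x * \<zeta> x) *\<^sub>R ((dq t x \<bullet> k) *\<^sub>R (Gf' (dsq t x) *\<^sub>R (2 *\<^sub>R ?W x)) + Gf (dsq t x) *\<^sub>R dV t k x)
      + (Gf (dsq t x) * (dq t x \<bullet> k)) *\<^sub>R (\<zeta> x *\<^sub>R D\<zeta> x + \<zeta> x *\<^sub>R D\<zeta> x)" for k x
  have F: "C1_supp S' (F k) (DF k)" if k: "k \<in> Basis" for k
  proof (rule C1_supp_restrict[OF _ S'(1)])
    show "C1_supp S (F k) (DF k)"
      unfolding F_def DF_def by (rule C1_supp_mult[OF open_shiftdom C1_grad_mult[OF GC dq_C1[OF k]] Z2 Sd])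
    show "F k x = 0" if "x \<notin> S'" for x
      using that S'(4)[of x] Z(5)[of x] by (cases "x \<in> S") (auto simp: F_def)
  qed
  define X where "X x = (\<Sum>k\<in>Basis. ((1 / t) *\<^sub>R (flux (x + t *\<^sub>R k) - flux x)) \<bullet> DF k x) - \<beta> x * (\<Sum>k\<in>Basis. norm (DF k x))" for x
  have EX: "integrable lborel X" "(\<integral>x. X x \<partial>lborel) \<le> 0"
    using energy_le[OF t F S'(1,3) St N \<beta> \<beta>m] unfolding X_def by auto
  have "low x \<le> X x" for x
  proof (cases "x \<in> S'")
    case False
    then have "X x = 0" using C1_suppD(6)[OF F] by (simp add: X_def)
    then show ?thesis using low(2)[OF False] by simp
  next
    case True
    define Gx where "Gx = Gf (dsq t x)"
    define Ex where "Ex = 2 * dsq t x * Gf' (dsq t x) + (1 - \<kappa>) * Gf (dsq t x)"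
    have dpos: "dsq t x > 0" using dq0[OF True] by (simp add: dsq_def)
    \<comment> \<open>With this \<open>Ex\<close> the coefficient \<open>g\<close> of
      \<open>energy_pointwise\<close> equals twice \<open>Gf'\<close>, the factor that the chain
      rule produces in \<open>DF\<close>.\<close>
    have g: "(Ex - (1 - \<kappa>) * Gx) / (norm (dq t x))\<^sup>2 = 2 * Gf' (dsq t x)"
      using dpos by (simp add: Ex_def Gx_def dsq_norm[symmetric])
    have DFx: "DF k x = (\<zeta> x)\<^sup>2 *\<^sub>R (Gx *\<^sub>R dV t k x + ((Ex - (1 - \<kappa>) * Gx) / (norm (dq t x))\<^sup>2 * (dq t x \<bullet> k)) *\<^sub>R ?W x)
       + (2 * \<zeta> x * Gx * (dq t x \<bullet> k)) *\<^sub>R D\<zeta> x" for k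
      unfolding g unfolding DF_def Gx_def by (simp add: power2_eq_square algebra_simps flip: scaleR_2)
    define Rk where "Rk k = (1 / t) *\<^sub>R (flux (x + t *\<^sub>R k) - flux x) - plap_lin (p x) (dq t x) (dV t k x)" for k
    have fl: "(1 / t) *\<^sub>R (flux (x + t *\<^sub>R k) - flux x) = plap_lin (p x) (dq t x) (dV t k x) + Rk k" for k by (simp add: Rk_def)
    have \<beta>0: "0 \<le> \<beta> x" using order_trans[OF abs_ge_zero \<beta>[OF True SOME_Basis, of 0]] by simp
    have Ex0: "0 \<le> Ex" unfolding Ex_def by (rule G(4)[OF dpos])
    have Gx0: "0 \<le> Gx" unfolding Gx_def by (rule G(3))
    have "X x = (\<Sum>k\<in>Basis. (plap_lin (p x) (dq t x) (dV t k x) + Rk k) \<bullet> DF k x) - \<beta> x * (\<Sum>k\<in>Basis. norm (DF k x))"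
      unfolding X_def fl ..
    moreover note energy_pointwise[where V = "\<lambda>k. dV t k x" and R = Rk and z = "D\<zeta> x" and s = "\<zeta> x",
        OF dq0[OF True] c0(1,2) c0(3)[OF True] c2[OF True] \<kappa> Gx0 Ex0 \<beta>0 \<omega> \<zeta>(2) R[OF True, folded Rk_def], folded DFx]
    moreover note low(3)[OF True refl refl refl refl Gx_def Ex_def]
    ultimately show ?thesis by simp
  qed
  then have "(\<integral>x. low x \<partial>lborel) \<le> (\<integral>x. X x \<partial>lborel)" by (intro integral_mono low(1) EX(1))
  then show ?thesis using EX(2) by simp
qed

end

section \<open>Uniform control of the discrete errors\<close>

text \<open>Bookkeeping for a total loss of \<kappa> in the exponent: one half goes to the
  logarithm, the other half to replacing \<open>q'\<close> by the nearby \<open>q\<close>. Comparing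
  \<open>h\<close> with \<open>2 * H\<close> costs the power of 2.\<close>

lemma ln_weight_bound:
  fixes h H M q q' \<kappa> p2 :: real
  assumes h: "0 < h" "h \<le> 2 * H" "h \<le> M" and M: "1 \<le> M" and \<kappa>: "0 < \<kappa>" and q: "\<bar>q' - q\<bar> \<le> \<kappa> / 2" "0 \<le> q - 1 - \<kappa>" "q \<le> p2"
  shows "h powr (q' - 1) * \<bar>ln h\<bar> \<le> (2 / \<kappa> + M powr (\<kappa> / 2 + 1)) * M powr \<kappa> * 2 powr p2 * H powr (q - 1 - \<kappa>)"
proof -
  let ?c = "2 / \<kappa> + M powr (\<kappa> / 2 + 1)"
  have H: "H > 0" using h by linarith
  have c: "?c \<ge> 0" using \<kappa> by simp
  have "h powr (q' - 1) * \<bar>ln h\<bar> \<le> h powr (q' - 1) * (?c * h powr (- (\<kappa> / 2)))"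
    using abs_ln_le_powr[OF h(1,3) M, of "\<kappa> / 2"] \<kappa> by (intro mult_left_mono) auto
  also have "\<dots> = ?c * (h powr (q' - 1) * h powr (- (\<kappa> / 2)))" by simp
  also have "h powr (q' - 1) * h powr (- (\<kappa> / 2)) = h powr (q' - q + \<kappa> / 2) * h powr (q - 1 - \<kappa>)"
    unfolding powr_add[symmetric] by (simp add: field_simps)
  also have "?c * (h powr (q' - q + \<kappa> / 2) * h powr (q - 1 - \<kappa>)) \<le> ?c * (M powr \<kappa> * (2 powr p2 * H powr (q - 1 - \<kappa>)))"
  proof (intro mult_left_mono mult_mono)
    have "- (\<kappa> / 2) \<le> q' - q" "q' - q \<le> \<kappa> / 2" using q(1) by linarith+
    then have "0 \<le> q' - q + \<kappa> / 2" "q' - q + \<kappa> / 2 \<le> \<kappa>" by linarith+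
    then show "h powr (q' - q + \<kappa> / 2) \<le> M powr \<kappa>" using h M by (intro powr_le_bound) auto
    have "h powr (q - 1 - \<kappa>) \<le> (2 * H) powr (q - 1 - \<kappa>)" using h q by (intro powr_mono2) auto
    also have "\<dots> = 2 powr (q - 1 - \<kappa>) * H powr (q - 1 - \<kappa>)" using H by (simp add: powr_mult)
    also have "\<dots> \<le> 2 powr p2 * H powr (q - 1 - \<kappa>)" using q \<kappa> by (intro mult_right_mono powr_mono) auto
    finally show "h powr (q - 1 - \<kappa>) \<le> 2 powr p2 * H powr (q - 1 - \<kappa>)" .
  qed (use c in auto)
  finally show ?thesis by (simp add: mult.assoc)
qed

text \<open>The mean value theorem in the exponent. It brings in a logarithm, so the variation of
  \<open>p\<close> inside the flux costs the same as the drift.\<close>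

lemma powr_exponent_diff:
  fixes h a b :: real
  assumes h: "0 < h"
  shows "\<exists>c. \<bar>c - a\<bar> \<le> \<bar>b - a\<bar> \<and> \<bar>h powr b - h powr a\<bar> \<le> \<bar>b - a\<bar> * (h powr c * \<bar>ln h\<bar>)"
proof (cases a b rule: linorder_cases)
  case equal then show ?thesis by auto
next
  have d: "((\<lambda>s. h powr s) has_real_derivative h powr s * ln h) (at s)" for s
    using h by (auto intro!: derivative_eq_intros)
  case less
  obtain z where "a < z" "z < b" "h powr b - h powr a = (b - a) * (h powr z * ln h)"
    using MVT2[OF less, of "\<lambda>s. h powr s" "\<lambda>s. h powr s * ln h"] d by blast
  then show ?thesis by (intro exI[of _ z]) (auto simp: abs_mult)
next
  have d: "((\<lambda>s. h powr s) has_real_derivative h powr s * ln h) (at s)" for s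
    using h by (auto intro!: derivative_eq_intros)
  case greater
  obtain z where "b < z" "z < a" "h powr a - h powr b = (a - b) * (h powr z * ln h)"
    using MVT2[OF greater, of "\<lambda>s. h powr s" "\<lambda>s. h powr s * ln h"] d by blast
  then show ?thesis by (intro exI[of _ z]) (auto simp: abs_mult abs_minus_commute)
qed

context plap_setting
begin

text \<open>\<open>L\<close> accounts for the variation of the exponent in the flux,
  \<open>L'\<close> for the drift; the remaining factor is the constant of
  \<open>ln_weight_bound\<close>.\<close>

definition "drift_const \<kappa> M p2 = (L + L') * ((2 / \<kappa> + M powr (\<kappa> / 2 + 1)) * M powr \<kappa> * 2 powr p2)"

lemma drift_const_nonneg: "\<kappa> > 0 \<Longrightarrow> 0 \<le> drift_const \<kappa> M p2"
  using L_nonneg L'_nonneg by (auto simp: drift_const_def)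

text \<open>Everything the energy estimates require of a step length, collected so that it can be
  made small once. Where |d| \<ge> \<delta> the linearisation error has two sources:
  \<open>\<omega>\<close> times the discrete Hessian from the nonlinearity in the gradient, and the
  power p - 1 - \<kappa> of |d| from the variation of the exponent, with a constant that does not
  see \<open>\<delta>\<close>.\<close>

definition good_step :: "'a set \<Rightarrow> 'a set \<Rightarrow> real \<Rightarrow> real \<Rightarrow> real \<Rightarrow> real \<Rightarrow> real \<Rightarrow> real \<Rightarrow> bool" where
  "good_step S N M \<kappa> \<delta> \<omega> Cb t \<longleftrightarrow> S \<subseteq> shiftdom t \<and> (\<forall>x\<in>S. norm (dq t x - D x) \<le> \<delta> / 4 \<and> norm (dq t x) \<le> M \<and>
     (\<forall>k\<in>Basis. \<forall>\<tau>. 0 \<le> \<tau> \<and> \<tau> \<le> 1 \<longrightarrow> x + (\<tau> * t) *\<^sub>R k \<in> N) \<and>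
     (\<delta> \<le> norm (dq t x) \<longrightarrow> \<delta> / 2 \<le> norm (D x) \<and> norm (D x) \<le> 2 * norm (dq t x) \<and>
       (\<forall>k\<in>Basis. (\<forall>\<tau>. 0 \<le> \<tau> \<and> \<tau> \<le> 1 \<longrightarrow> x + (\<tau> * t) *\<^sub>R k \<in> regular \<and> \<bar>drift (x + (\<tau> * t) *\<^sub>R k)\<bar> \<le> Cb * norm (dq t x) powr (p x - 1 - \<kappa>)) \<and>
         norm ((1 / t) *\<^sub>R (flux (x + t *\<^sub>R k) - flux x) - plap_lin (p x) (dq t x) (dV t k x))
           \<le> \<omega> * norm (dV t k x) + Cb * norm (dq t x) powr (p x - 1 - \<kappa>))))"

lemma good_stepD:
  assumes "good_step S N M \<kappa> \<delta> \<omega> Cb t"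
  shows "S \<subseteq> shiftdom t"
    "x \<in> S \<Longrightarrow> norm (dq t x - D x) \<le> \<delta> / 4" "x \<in> S \<Longrightarrow> norm (dq t x) \<le> M"
    "x \<in> S \<Longrightarrow> k \<in> Basis \<Longrightarrow> 0 \<le> \<tau> \<Longrightarrow> \<tau> \<le> 1 \<Longrightarrow> x + (\<tau> * t) *\<^sub>R k \<in> N"
    "x \<in> S \<Longrightarrow> \<delta> \<le> norm (dq t x) \<Longrightarrow> k \<in> Basis \<Longrightarrow> 0 \<le> \<tau> \<Longrightarrow> \<tau> \<le> 1 \<Longrightarrow>
        x + (\<tau> * t) *\<^sub>R k \<in> regular \<and> \<bar>drift (x + (\<tau> * t) *\<^sub>R k)\<bar> \<le> Cb * norm (dq t x) powr (p x - 1 - \<kappa>)"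
    "x \<in> S \<Longrightarrow> \<delta> \<le> norm (dq t x) \<Longrightarrow> k \<in> Basis \<Longrightarrow>
        norm ((1 / t) *\<^sub>R (flux (x + t *\<^sub>R k) - flux x) - plap_lin (p x) (dq t x) (dV t k x))
           \<le> \<omega> * norm (dV t k x) + Cb * norm (dq t x) powr (p x - 1 - \<kappa>)"
    "x \<in> S \<Longrightarrow> \<delta> \<le> norm (dq t x) \<Longrightarrow> \<delta> / 2 \<le> norm (D x)"
    "x \<in> S \<Longrightarrow> \<delta> \<le> norm (dq t x) \<Longrightarrow> norm (D x) \<le> 2 * norm (dq t x)"
  using assms unfolding good_step_def by blast+

lemma discrete_estimates:
  assumes S: "S \<subseteq> \<Omega>" and N: "compact N" "N \<subseteq> \<Omega>" and e: "e > 0" "\<And>x. x \<in> S \<Longrightarrow> cball x e \<subseteq> N"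
    and M: "M \<ge> 2" "\<And>y. y \<in> N \<Longrightarrow> norm (D y) \<le> M - 1" and pN: "\<And>y. y \<in> N \<Longrightarrow> p1 \<le> p y \<and> p y \<le> p2"
    and \<kappa>: "0 < \<kappa>" "\<kappa> \<le> p1 - 1" and \<delta>: "0 < \<delta>" "\<delta> \<le> 1" and \<omega>: "0 < \<omega>"
  defines "Cb \<equiv> drift_const \<kappa> M p2"
  shows "\<exists>t0>0. \<forall>t. 0 < t \<and> t < t0 \<longrightarrow> good_step S N M \<kappa> \<delta> \<omega> Cb t"
proof -
  obtain r where r: "r > 0" and lin: "\<And>q (d::'a) \<xi> \<xi>'. p1 \<le> q \<Longrightarrow> q \<le> p2 \<Longrightarrow> \<delta> \<le> norm d \<Longrightarrow> norm d \<le> M \<Longrightarrow>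
     norm (\<xi> - d) \<le> r \<Longrightarrow> norm (\<xi>' - d) \<le> r \<Longrightarrow>
     norm (plap_flux q \<xi>' - plap_flux q \<xi> - plap_lin q d (\<xi>' - \<xi>)) \<le> \<omega> * norm (\<xi>' - \<xi>)"
    using flux_linearization[OF \<delta>(1) \<omega>, of p1 p2 M, where ?'a = 'a] by blast
  \<comment> \<open>Both \<open>D x\<close> and the shifted gradient are within
    \<open>2 * r'\<close> of \<open>dq\<close>, hence inside the linearisation radius;
    \<open>\<delta> / 4\<close> makes their lengths comparable to |d| once |d| \<ge>
    \<delta>.\<close>
  define r' where "r' = min (r / 2) (\<delta> / 4)"
  have r': "r' > 0" "2 * r' \<le> r" "r' \<le> \<delta> / 4" using r \<delta> by (auto simp: r'_def)
  obtain t1 where t1: "t1 > 0" "t1 \<le> e" and U: "\<And>t x. 0 < t \<Longrightarrow> t < t1 \<Longrightarrow> x \<in> S \<Longrightarrow> x \<in> shiftdom t"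
    "\<And>t x. 0 < t \<Longrightarrow> t < t1 \<Longrightarrow> x \<in> S \<Longrightarrow> norm (dq t x - D x) \<le> r'"
    "\<And>t x k \<tau>. 0 < t \<Longrightarrow> t < t1 \<Longrightarrow> x \<in> S \<Longrightarrow> k \<in> Basis \<Longrightarrow> 0 \<le> \<tau> \<Longrightarrow> \<tau> \<le> 1 \<Longrightarrow> x + (\<tau> * t) *\<^sub>R k \<in> N"
    "\<And>t x k \<tau>. 0 < t \<Longrightarrow> t < t1 \<Longrightarrow> x \<in> S \<Longrightarrow> k \<in> Basis \<Longrightarrow> 0 \<le> \<tau> \<Longrightarrow> \<tau> \<le> 1 \<Longrightarrow> norm (D (x + (\<tau> * t) *\<^sub>R k) - D x) \<le> r'"
    using dq_uniform[OF S N e r'(1)] by blast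
  \<comment> \<open>Forces \<open>L * t \<le> \<kappa> / 2\<close>, the tolerance that
    \<open>ln_weight_bound\<close> grants to the exponent; \<open>L + 1\<close> avoids a zero
    denominator.\<close>
  define t0 where "t0 = min t1 (\<kappa> / (2 * (L + 1)))"
  have t0: "t0 > 0" using t1 \<kappa> L_nonneg by (auto simp: t0_def)
  define K where "K = (2 / \<kappa> + M powr (\<kappa> / 2 + 1)) * M powr \<kappa> * 2 powr p2"
  have K: "K \<ge> 0" using \<kappa> by (simp add: K_def)
  have Cb: "Cb = (L + L') * K" by (simp add: Cb_def drift_const_def K_def)
  have main: "good_step S N M \<kappa> \<delta> \<omega> Cb t"
    if tt: "0 < t \<and> t < t0" for t
    unfolding good_step_def
  proof (intro conjI ballI allI impI)
    have t: "0 < t" "t < t1" "t < \<kappa> / (2 * (L + 1))" using tt by (auto simp: t0_def)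
    have Lt: "L * t \<le> \<kappa> / 2"
    proof -
      have "(L + 1) * t \<le> (L + 1) * (\<kappa> / (2 * (L + 1)))" using t L_nonneg by (intro mult_left_mono) auto
      also have "\<dots> = \<kappa> / 2" using L_nonneg by (simp add: field_simps)
      finally show ?thesis using t L_nonneg by (simp add: distrib_right)
    qed
    show "S \<subseteq> shiftdom t" using U(1) t by auto
    fix x assume x: "x \<in> S"
    let ?H = "norm (dq t x)"
    have xN: "x \<in> N" using e x by force
    have dD: "norm (dq t x - D x) \<le> r'" using U(2) t x by auto
    show "norm (dq t x - D x) \<le> \<delta> / 4" using dD r' by linarith
    show HM: "?H \<le> M" using M(2)[OF xN] dD r' \<delta> norm_triangle_ineq[of "dq t x - D x" "D x"] by simp
    show "x + (\<tau> * t) *\<^sub>R k \<in> N" if "k \<in> Basis" "0 \<le> \<tau> \<and> \<tau> \<le> 1" for k \<tau> using U(3) t x that by auto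
    assume H: "\<delta> \<le> ?H"
    have Dd: "norm (D x - dq t x) \<le> r'" using dD by (simp add: norm_minus_commute)
    show "\<delta> / 2 \<le> norm (D x)" using H dD r' norm_triangle_ineq2[of "dq t x" "D x"] by linarith
    show "norm (D x) \<le> 2 * ?H" using H Dd r' \<delta> norm_triangle_ineq2[of "D x" "dq t x"] by linarith
    have Dy: "x + (\<tau> * t) *\<^sub>R k \<in> N \<and> norm (D (x + (\<tau> * t) *\<^sub>R k) - dq t x) \<le> r \<and> \<delta> / 4 \<le> norm (D (x + (\<tau> * t) *\<^sub>R k))
        \<and> norm (D (x + (\<tau> * t) *\<^sub>R k)) \<le> 2 * ?H \<and> \<bar>p (x + (\<tau> * t) *\<^sub>R k) - p x\<bar> \<le> L * t"
      if k: "k \<in> Basis" and \<tau>: "0 \<le> \<tau>" "\<tau> \<le> 1" for k \<tau>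
    proof -
      let ?y = "x + (\<tau> * t) *\<^sub>R k"
      have yN: "?y \<in> N" using U(3)[OF t(1,2) x k \<tau>] .
      have "norm (D ?y - D x) \<le> r'" using U(4)[OF t(1,2) x k \<tau>] .
      then have 1: "norm (D ?y - dq t x) \<le> 2 * r'"
        using norm_triangle_ineq[of "D ?y - D x" "D x - dq t x"] Dd by simp
      have "norm (dq t x - D ?y) \<le> 2 * r'" using 1 by (simp add: norm_minus_commute)
      then have 2: "\<delta> / 4 \<le> norm (D ?y)" using H r' \<delta> norm_triangle_ineq2[of "dq t x" "D ?y"] by linarith
      have 3: "norm (D ?y) \<le> 2 * ?H" using 1 H r' \<delta> norm_triangle_ineq2[of "D ?y" "dq t x"] by linarith
      have "dist (p ?y) (p x) \<le> L * dist ?y x" using lipschitz_onD[OF p_lip] yN N(2) x S by auto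
      also have "\<dots> \<le> L * t" using k \<tau> t L_nonneg by (intro mult_left_mono) (auto simp: dist_norm abs_mult mult_left_le_one_le)
      finally have 4: "\<bar>p ?y - p x\<bar> \<le> L * t" by (simp add: dist_real_def)
      show ?thesis using yN 1 2 3 4 r' by auto
    qed
    fix k :: 'a assume k: "k \<in> Basis"
    have px: "p1 \<le> p x" "p x \<le> p2" using pN[OF xN] by auto
    have wb: "h powr (q' - 1) * \<bar>ln h\<bar> \<le> K * ?H powr (p x - 1 - \<kappa>)"
      if "0 < h" "h \<le> 2 * ?H" "h \<le> M" "\<bar>q' - p x\<bar> \<le> L * t" for h q'
      unfolding K_def by (rule ln_weight_bound) (use that M \<kappa> px Lt in auto)
    show "x + (\<tau> * t) *\<^sub>R k \<in> regular" if \<tau>: "0 \<le> \<tau> \<and> \<tau> \<le> 1" for \<tau>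
      using Dy[OF k, of \<tau>] \<tau> \<delta> N(2) by (auto simp: regular_def)
    show "\<bar>drift (x + (\<tau> * t) *\<^sub>R k)\<bar> \<le> Cb * ?H powr (p x - 1 - \<kappa>)" if \<tau>: "0 \<le> \<tau> \<and> \<tau> \<le> 1" for \<tau>
    proof -
      let ?y = "x + (\<tau> * t) *\<^sub>R k" and ?h = "norm (D (x + (\<tau> * t) *\<^sub>R k))"
      have y: "?y \<in> N" "\<delta> / 4 \<le> ?h" "?h \<le> 2 * ?H" "\<bar>p ?y - p x\<bar> \<le> L * t" using Dy[OF k, of \<tau>] \<tau> by auto
      have h: "?h > 0" using y(2) \<delta> by linarith
      have hM: "?h \<le> M" using M(2)[OF y(1)] by linarith
      have "\<bar>drift ?y\<bar> \<le> ?h powr (p ?y - 2) * \<bar>ln ?h\<bar> * (?h * L')"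
        unfolding drift_def abs_mult
        using Cauchy_Schwarz_ineq2[of "D ?y" "P ?y"] P_bound[of ?y] mult_left_mono[of "norm (P ?y)" L' ?h]
        by (intro mult_mono) auto
      also have "\<dots> = L' * ((?h powr (p ?y - 2) * ?h powr 1) * \<bar>ln ?h\<bar>)" using h by simp
      also have "?h powr (p ?y - 2) * ?h powr 1 = ?h powr (p ?y - 1)" unfolding powr_add[symmetric] by simp
      also have "L' * (?h powr (p ?y - 1) * \<bar>ln ?h\<bar>) \<le> L' * (K * ?H powr (p x - 1 - \<kappa>))"
        by (intro mult_left_mono wb h y hM L'_nonneg)
      also have "\<dots> \<le> (L + L') * (K * ?H powr (p x - 1 - \<kappa>))" using L_nonneg K by (intro mult_right_mono) auto
      finally show ?thesis by (simp add: Cb mult.assoc)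
    qed
    let ?y = "x + t *\<^sub>R k"
    let ?h = "norm (D ?y)"
    have y: "?y \<in> N" "norm (D ?y - dq t x) \<le> r" "\<delta> / 4 \<le> ?h" "?h \<le> 2 * ?H" "\<bar>p ?y - p x\<bar> \<le> L * t" using Dy[OF k, of 1] by auto
    have h: "?h > 0" using y(3) \<delta> by linarith
    have hM: "?h \<le> M" using M(2)[OF y(1)] by linarith
    \<comment> \<open>The increment of the flux is split by freezing the exponent at
      \<open>p x\<close>. Here only the exponent moves; the Lipschitz bound gives a factor
      \<open>t\<close> that cancels the division by \<open>t\<close>.\<close>
    have A1: "norm (plap_flux (p ?y) (D ?y) - plap_flux (p x) (D ?y)) \<le> (L * t) * (K * ?H powr (p x - 1 - \<kappa>))"
    proof -
      obtain c where c: "\<bar>c - (p x - 2)\<bar> \<le> \<bar>(p ?y - 2) - (p x - 2)\<bar>"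
        "\<bar>?h powr (p ?y - 2) - ?h powr (p x - 2)\<bar> \<le> \<bar>(p ?y - 2) - (p x - 2)\<bar> * (?h powr c * \<bar>ln ?h\<bar>)"
        using powr_exponent_diff[OF h, of "p x - 2" "p ?y - 2"] by blast
      have "norm (plap_flux (p ?y) (D ?y) - plap_flux (p x) (D ?y)) = \<bar>?h powr (p ?y - 2) - ?h powr (p x - 2)\<bar> * ?h"
        unfolding plap_flux_def scaleR_diff_left[symmetric] by simp
      also have "\<dots> \<le> (\<bar>(p ?y - 2) - (p x - 2)\<bar> * (?h powr c * \<bar>ln ?h\<bar>)) * ?h" by (rule mult_right_mono[OF c(2)]) simp
      also have "\<dots> = \<bar>p ?y - p x\<bar> * ((?h powr c * ?h powr 1) * \<bar>ln ?h\<bar>)" using h by simp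
      also have "?h powr c * ?h powr 1 = ?h powr ((c + 2) - 1)" unfolding powr_add[symmetric] by (simp add: add.commute)
      also have "\<bar>p ?y - p x\<bar> * (?h powr ((c + 2) - 1) * \<bar>ln ?h\<bar>) \<le> (L * t) * (K * ?H powr (p x - 1 - \<kappa>))"
        by (intro mult_mono wb h y hM) (use c(1) y(5) L_nonneg t in auto)
      finally show ?thesis .
    qed
    have A2: "norm (plap_flux (p x) (D ?y) - plap_flux (p x) (D x) - plap_lin (p x) (dq t x) (D ?y - D x)) \<le> \<omega> * norm (D ?y - D x)"
      by (rule lin[OF px H HM]) (use y Dd r' in auto)
    have sc: "plap_lin (p x) (dq t x) (dV t k x) = (1 / t) *\<^sub>R plap_lin (p x) (dq t x) (D ?y - D x)"
      unfolding dV_def by (rule linear_scale[OF bounded_linear.linear[OF plap_lin_bounded_linear]])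
    have "(1 / t) *\<^sub>R (flux ?y - flux x) - plap_lin (p x) (dq t x) (dV t k x)
       = (1 / t) *\<^sub>R (plap_flux (p ?y) (D ?y) - plap_flux (p x) (D ?y))
       + (1 / t) *\<^sub>R (plap_flux (p x) (D ?y) - plap_flux (p x) (D x) - plap_lin (p x) (dq t x) (D ?y - D x))"
      unfolding sc flux_def by (simp add: scaleR_diff_right)
    also have "norm \<dots> \<le> (1 / t) * ((L * t) * (K * ?H powr (p x - 1 - \<kappa>))) + (1 / t) * (\<omega> * norm (D ?y - D x))"
      by (rule norm_triangle_mono) (use mult_left_mono[OF A1, of "1 / t"] mult_left_mono[OF A2, of "1 / t"] t in simp_all)
    also have "\<dots> = L * (K * ?H powr (p x - 1 - \<kappa>)) + \<omega> * norm (dV t k x)" using t by (simp add: dV_def)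
    also have "\<dots> \<le> \<omega> * norm (dV t k x) + Cb * ?H powr (p x - 1 - \<kappa>)"
    proof -
      have "L * (K * ?H powr (p x - 1 - \<kappa>)) \<le> (L + L') * (K * ?H powr (p x - 1 - \<kappa>))" using L'_nonneg K by (intro mult_right_mono) auto
      then show ?thesis by (simp add: Cb mult.assoc)
    qed
    finally show "norm ((1 / t) *\<^sub>R (flux ?y - flux x) - plap_lin (p x) (dq t x) (dV t k x))
       \<le> \<omega> * norm (dV t k x) + Cb * ?H powr (p x - 1 - \<kappa>)" .
  qed
  show ?thesis using t0 main by blast
qed

definition "dV_sq t x = (\<Sum>k\<in>Basis. (norm (dV t k x))\<^sup>2)"

lemma dV_sq_nonneg: "0 \<le> dV_sq t x" by (simp add: dV_sq_def sum_nonneg)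

lemma dV_sq_borel: "dV_sq t \<in> borel_measurable borel"
proof -
  note [measurable] = dV_borel
  show ?thesis unfolding dV_sq_def by measurable
qed

text \<open>The gradient is bounded by \<open>M - 1\<close> so that \<open>dq\<close>, which differs
  from it by less than 1, is bounded by \<open>M\<close>. The condition on \<kappa> makes p - 1 - 3
  \<kappa> nonnegative, the exponent left over in \<open>cutoff_estimate\<close>.\<close>

lemma local_bounds:
  assumes S: "compact S" "S \<subseteq> \<Omega>"
  obtains N e M p1 p2 \<kappa> where "compact N" "N \<subseteq> \<Omega>" "e > 0" "\<And>x. x \<in> S \<Longrightarrow> cball x e \<subseteq> N"
    "M \<ge> (2::real)" "\<And>y. y \<in> N \<Longrightarrow> norm (D y) \<le> M - 1" "\<And>y. y \<in> N \<Longrightarrow> p1 \<le> p y \<and> p y \<le> p2"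
    "0 < \<kappa>" "\<kappa> \<le> 1" "3 * \<kappa> \<le> p1 - 1" "1 < p1" "p1 \<le> p2"
proof -
  obtain e where e: "e > 0" "(\<Union>x\<in>S. cball x e) \<subseteq> \<Omega>"
    using compact_subset_open_imp_cball_epsilon_subset[OF S(1) open_\<Omega> S(2)] by blast
  define N where "N = {x + y |x y. x \<in> S \<and> y \<in> cball (0::'a) e}"
  have N: "compact N" unfolding N_def by (rule compact_cball_sum[OF S(1)])
  have sub: "cball x e \<subseteq> N" if "x \<in> S" for x
  proof
    fix y assume "y \<in> cball x e"
    then have "y - x \<in> cball 0 e" by (simp add: dist_norm norm_minus_commute)
    then have "x + (y - x) \<in> N" unfolding N_def using that by blast
    then show "y \<in> N" by simp
  qed
  have N\<Omega>: "N \<subseteq> \<Omega>"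
  proof
    fix z assume "z \<in> N"
    then obtain a b where "z = a + b" "a \<in> S" "norm b \<le> e" unfolding N_def by auto
    then have "z \<in> cball a e" by (simp add: dist_norm)
    then show "z \<in> \<Omega>" using e(2) \<open>a \<in> S\<close> by blast
  qed
  obtain M p1 p2 where b: "M \<ge> 1" "1 < p1" "p1 \<le> p2"
    "\<And>x. x \<in> N \<Longrightarrow> norm (D x) \<le> M" "\<And>x. x \<in> N \<Longrightarrow> p1 \<le> p x \<and> p x \<le> p2"
    using compact_bounds[OF N N\<Omega>] by blast
  show ?thesis
    by (rule that[OF N N\<Omega> e(1) sub, of "M + 1" p1 p2 "min 1 ((p1 - 1) / 3)"]) (use b in \<open>auto simp: min_def\<close>)
qed

text \<open>The bound degenerates as \<open>t\<close> tends to 0; it only guarantees that the energy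
  integrals exist, so that they can be estimated.\<close>

lemma dV_sq_integrable:
  assumes S: "compact S" and N: "\<And>x k. x \<in> S \<Longrightarrow> k \<in> Basis \<Longrightarrow> norm (D x) \<le> M \<and> norm (D (x + t *\<^sub>R k)) \<le> M"
    and w: "w \<in> borel_measurable borel" "\<And>x. x \<in> S \<Longrightarrow> \<bar>w x\<bar> \<le> Cw" "\<And>x. x \<notin> S \<Longrightarrow> w x = 0" and t: "t > 0"
  shows "integrable lborel (\<lambda>x. w x * dV_sq t x)"
proof (rule integrable_compact_bounded[OF _ S])
  show "(\<lambda>x. w x * dV_sq t x) \<in> borel_measurable borel" using w(1) dV_sq_borel by auto
  fix x assume x: "x \<in> S"
  have "dV_sq t x \<le> (\<Sum>k\<in>(Basis::'a set). (2 * M / t)\<^sup>2)"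
    unfolding dV_sq_def
  proof (rule sum_mono)
    fix k :: 'a assume k: "k \<in> Basis"
    have "norm (D (x + t *\<^sub>R k) - D x) \<le> 2 * M" using N[OF x k] norm_triangle_ineq4[of "D (x + t *\<^sub>R k)" "D x"] by linarith
    then have "norm (dV t k x) \<le> 2 * M / t" using t by (simp add: dV_def divide_right_mono)
    then show "(norm (dV t k x))\<^sup>2 \<le> (2 * M / t)\<^sup>2" by (rule power_mono) simp
  qed
  then have "\<bar>w x\<bar> * dV_sq t x \<le> Cw * (\<Sum>k\<in>(Basis::'a set). (2 * M / t)\<^sup>2)"
    using w(2)[OF x] dV_sq_nonneg by (intro mult_mono) auto
  then show "norm (w x * dV_sq t x) \<le> Cw * (\<Sum>k\<in>(Basis::'a set). (2 * M / t)\<^sup>2)"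
    using dV_sq_nonneg[of t x] by (simp add: abs_mult)
qed (use w(3) in auto)

end

section \<open>Energy bounds for the discrete Hessian\<close>

context plap_solution
begin

text \<open>The crude bound, with constant weight G = 1: uniform in \<open>t\<close>, but with a
  constant that depends on the least value of |D| on \<open>S\<close>. Its purpose is to pay for the
  linearisation error in \<open>weighted_energy_bound\<close>.\<close>

lemma gradient_quotient_bound_on_regular:
  assumes \<zeta>: "C1_supp S \<zeta> D\<zeta>" "\<And>x. 0 \<le> \<zeta> x" and S: "S \<subseteq> regular"
  shows "\<exists>C\<ge>0. \<exists>t0>0. \<forall>t. 0 < t \<and> t < t0 \<longrightarrow> integrable lborel (\<lambda>x. (\<zeta> x)\<^sup>2 * dV_sq t x) \<and> (\<integral>x. (\<zeta> x)\<^sup>2 * dV_sq t x \<partial>lborel) \<le> C"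
proof -
  note Z = C1_suppD[OF \<zeta>(1)]
  have S\<Omega>: "S \<subseteq> \<Omega>" using S regular_sub by auto
  obtain B where B: "B \<ge> 0" "\<And>x. \<bar>\<zeta> x\<bar> \<le> B" "\<And>x. norm (D\<zeta> x) \<le> B" using C1_supp_bound[OF \<zeta>(1)] by metis
  obtain N e M p1 p2 \<kappa> where N: "compact N" "N \<subseteq> \<Omega>" "e > 0" "\<And>x. x \<in> S \<Longrightarrow> cball x e \<subseteq> N"
    and M: "M \<ge> (2::real)" "\<And>y. y \<in> N \<Longrightarrow> norm (D y) \<le> M - 1" and pN: "\<And>y. y \<in> N \<Longrightarrow> p1 \<le> p y \<and> p y \<le> p2"
    and \<kappa>: "0 < \<kappa>" "\<kappa> \<le> 1" "3 * \<kappa> \<le> p1 - 1" and p12: "1 < p1" "p1 \<le> p2"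
    using local_bounds[OF Z(1) S\<Omega>] by metis
  have SN: "S \<subseteq> N" using N(3,4) by force
  \<comment> \<open>Twice \<open>\<delta>\<close>, so that the discrete gradient, within
    \<open>\<delta> / 4\<close> of \<open>D\<close>, still has length at least
    \<open>\<delta>\<close>.\<close>
  obtain \<delta> where \<delta>: "0 < \<delta>" "\<delta> \<le> 1" "\<And>x. x \<in> S \<Longrightarrow> 2 * \<delta> \<le> norm (D x)"
  proof (cases "S = {}")
    case True then show ?thesis using that[of 1] by auto
  next
    case False
    have "continuous_on S (\<lambda>x. norm (D x))" using continuous_on_subset[OF D_cont S\<Omega>] by (intro continuous_intros)
    from continuous_attains_inf[OF Z(1) False this] obtain x0 where x0: "x0 \<in> S" "\<And>y. y \<in> S \<Longrightarrow> norm (D x0) \<le> norm (D y)" by blast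
    have "norm (D x0) > 0" using x0(1) S by (auto simp: regular_def)
    then show ?thesis using that[of "min 1 (norm (D x0) / 2)"] x0(2) by force
  qed
  define n where "n = real DIM('a)"
  have n: "n > 0" by (simp add: n_def)
  define c0 where "c0 = min 1 (p1 - 1)"
  have c0: "0 < c0" "c0 \<le> 1" using p12 by (auto simp: c0_def)
  define c2 where "c2 = p2 + 3"
  define cmin where "cmin = \<delta> powr p2 / M\<^sup>2"
  define cmax where "cmax = M powr p2 / \<delta>\<^sup>2"
  have cmin: "cmin > 0" using \<delta> M by (auto simp: cmin_def)
  \<comment> \<open>The linearisation error is at most 4 n \<omega> \<zeta>^2 v^2 plus a constant.
    This choice makes 4 n \<omega> equal to the \<open>a\<close> defined below, which is half of the
    available coercivity \<open>2 * a\<close>.\<close>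
  define \<omega> where "\<omega> = cmin * c0 * \<kappa> / (16 * n)"
  have \<omega>: "\<omega> > 0" unfolding \<omega>_def using cmin c0 \<kappa> n by auto
  define Cb where "Cb = drift_const \<kappa> M p2"
  define b where "b = Cb * M powr p2"
  have Cb: "0 \<le> Cb" unfolding Cb_def by (rule drift_const_nonneg[OF \<kappa>(1)])
  have b0: "0 \<le> b" using Cb by (simp add: b_def)
  obtain t0 where t0: "t0 > 0" and gs: "\<And>t. 0 < t \<Longrightarrow> t < t0 \<Longrightarrow> good_step S N M \<kappa> \<delta> \<omega> Cb t"
    using discrete_estimates[OF S\<Omega> N M pN \<kappa>(1) _ \<delta>(1,2) \<omega>, folded Cb_def] \<kappa> by auto
  note T = good_stepD[OF gs]
  define a where "a = cmin * c0 * \<kappa> / 4"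
  have a: "a > 0" unfolding a_def using cmin c0 \<kappa> by auto
  define K where "K = 4 * cmax * c2\<^sup>2 * M\<^sup>2 * B\<^sup>2 / (c0 * \<kappa>) + 16 * n\<^sup>2 * B\<^sup>2 * b\<^sup>2 / (cmin * c0 * \<kappa>)
      + n\<^sup>2 * B\<^sup>2 * b\<^sup>2 / (cmin * c0) + 4 * n * b * B * M * B + n * \<omega> * (M\<^sup>2 * B\<^sup>2)"
  have K0: "0 \<le> K" unfolding K_def using cmin c0 \<kappa> n b0 B M \<omega> by (intro add_nonneg_nonneg) (auto simp: cmax_def)
  define m where "m = measure lborel S"
  have main: "integrable lborel (\<lambda>x. (\<zeta> x)\<^sup>2 * dV_sq t x)" "(\<integral>x. (\<zeta> x)\<^sup>2 * dV_sq t x \<partial>lborel) \<le> K * m / a" if t: "0 < t" "t < t0" for t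
  proof -
    have dqx: "\<delta> \<le> norm (dq t x)" if "x \<in> S" for x
      using T(2)[OF t that] \<delta>(1) \<delta>(3)[OF that] norm_triangle_ineq2[of "D x" "dq t x"] by (simp add: norm_minus_commute)
    have zm: "\<zeta> \<in> borel_measurable borel" using Z(4) by (rule borel_measurable_continuous_onI)
    show I: "integrable lborel (\<lambda>x. (\<zeta> x)\<^sup>2 * dV_sq t x)"
    proof (rule dV_sq_integrable[OF Z(1) _ _ _ _ t(1)])
      show "norm (D x) \<le> M \<and> norm (D (x + t *\<^sub>R k)) \<le> M" if "x \<in> S" "k \<in> Basis" for x k
        using M(2)[of x] M(2)[of "x + t *\<^sub>R k"] T(4)[OF t that, of 1] SN that by force
      show "\<bar>(\<zeta> x)\<^sup>2\<bar> \<le> B\<^sup>2" for x using power_mono[OF B(2)[of x], of 2] by simp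
    qed (use zm Z(5) in auto)
    define low where "low x = a * ((\<zeta> x)\<^sup>2 * dV_sq t x) - K * indicator S x" for x
    have il: "integrable lborel low" unfolding low_def using I integrable_indicator_compact[OF Z(1)] by auto
    have "(\<integral>x. low x \<partial>lborel) \<le> 0"
    proof (rule energy_estimate[where Gf = "\<lambda>_. 1" and Gf' = "\<lambda>_. 0" and \<beta> = "\<lambda>x. Cb * norm (dq t x) powr (p x - 1 - \<kappa>)" and C\<beta> = b
          and \<kappa> = \<kappa> and ?c0.0 = c0 and ?c2.0 = c2 and \<omega> = \<omega>, OF t(1) \<zeta> T(1)[OF t] Z(1) order_refl S _ _ N(1,2)])
      have px: "p1 \<le> p x" "p x \<le> p2" if "x \<in> S" for x using pN SN that by auto
      show "x + t *\<^sub>R k \<in> regular" if "x \<in> S" "k \<in> Basis" for x k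
        using T(5)[OF t that(1) dqx[OF that(1)] that(2), of 1] by simp
      show "x + (\<tau> * t) *\<^sub>R k \<in> N" if "x \<in> S" "k \<in> Basis" "0 \<le> \<tau>" "\<tau> \<le> 1" for x k \<tau> by (rule T(4)[OF t that])
      show "\<bar>drift (x + (\<tau> * t) *\<^sub>R k)\<bar> \<le> Cb * norm (dq t x) powr (p x - 1 - \<kappa>)" if "x \<in> S" "k \<in> Basis" "0 \<le> \<tau>" "\<tau> \<le> 1" for x k \<tau>
        using T(5)[OF t that(1) dqx[OF that(1)] that(2-4)] by simp
      show "(\<lambda>x. Cb * norm (dq t x) powr (p x - 1 - \<kappa>)) \<in> borel_measurable borel" using dq_borel p_borel by measurable
      have Hp: "norm (dq t x) powr (p x - 1 - \<kappa>) \<le> M powr p2" if "x \<in> S" for x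
        by (rule powr_le_bound) (use T(3)[OF t that] M px[OF that] \<kappa> p12 in auto)
      show \<beta>b: "\<bar>Cb * norm (dq t x) powr (p x - 1 - \<kappa>)\<bar> \<le> b" if "x \<in> S" for x
        unfolding b_def using mult_left_mono[OF Hp[OF that] Cb] Cb by (simp add: abs_mult)
      show "c0 \<le> p x - 1" if "x \<in> S" for x using px[OF that] by (auto simp: c0_def)
      show "1 + \<bar>p x - 2\<bar> \<le> c2" if "x \<in> S" for x using px[OF that] p12 by (auto simp: c2_def)
      show "norm ((1 / t) *\<^sub>R (flux (x + t *\<^sub>R k) - flux x) - plap_lin (p x) (dq t x) (dV t k x))
           \<le> \<omega> * norm (dV t k x) + Cb * norm (dq t x) powr (p x - 1 - \<kappa>)" if "x \<in> S" "k \<in> Basis" for x k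
        by (rule T(6)[OF t that(1) dqx[OF that(1)] that(2)])
      show "dq t x \<noteq> 0" if "x \<in> S" for x using dqx[OF that] \<delta>(1) by auto
      show "low x \<le> 0" if "x \<notin> S" for x using Z(5)[OF that] that by (simp add: low_def)
      fix x and H c n' v G E :: real
      assume x: "x \<in> S" and H: "H = norm (dq t x)" and c: "c = H powr (p x - 2)" and n': "n' = real DIM('a)"
        and v: "v = sqrt (\<Sum>k\<in>Basis. (norm (dV t k x))\<^sup>2)" and G: "G = 1" and E: "E = 2 * dsq t x * 0 + (1 - \<kappa>) * 1"
      let ?b = "Cb * norm (dq t x) powr (p x - 1 - \<kappa>)" and ?z = "\<zeta> x" and ?w = "norm (D\<zeta> x)"
      have HM: "\<delta> \<le> H" "H \<le> M" using dqx[OF x] T(3)[OF t x] H by auto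
      have H0: "H > 0" using HM \<delta> by linarith
      have vv: "v\<^sup>2 = dV_sq t x" "v \<ge> 0" using v dV_sq_nonneg[of t x] by (auto simp: dV_sq_def)
      have cc: "c = H powr (p x) / H\<^sup>2" using H0 by (simp add: c powr_diff)
      have cge: "cmin \<le> c"
      proof -
        have "\<delta> powr p2 \<le> \<delta> powr (p x)" using \<delta> px[OF x] by (intro powr_mono') auto
        also have "\<dots> \<le> H powr (p x)" using HM \<delta> px[OF x] p12 by (intro powr_mono2) auto
        finally have "\<delta> powr p2 \<le> H powr (p x)" .
        moreover have "H\<^sup>2 \<le> M\<^sup>2" using HM H0 by (intro power_mono) auto
        ultimately show ?thesis unfolding cc cmin_def using H0 by (intro frac_le) auto
      qed
      have cle: "c \<le> cmax"
      proof -
        have "H powr (p x) \<le> M powr p2" by (rule powr_le_bound) (use HM H0 M px[OF x] p12 in auto)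
        moreover have "\<delta>\<^sup>2 \<le> H\<^sup>2" using HM \<delta> by (intro power_mono) auto
        ultimately show ?thesis unfolding cc cmax_def using \<delta> by (intro frac_le) auto
      qed
      have cpos: "c > 0" using cge cmin by linarith
      have bb: "0 \<le> ?b" "?b \<le> b" using Cb \<beta>b[OF x] by auto
      have b2: "?b\<^sup>2 \<le> b\<^sup>2" using bb by (intro power_mono) auto
      have zB: "0 \<le> ?z" "?z \<le> B" "?w \<le> B" using \<zeta>(2)[of x] B(2,3)[of x] by auto
      have z2: "?z\<^sup>2 \<le> B\<^sup>2" "?w\<^sup>2 \<le> B\<^sup>2" "H\<^sup>2 \<le> M\<^sup>2" using zB HM H0 by (auto intro!: power_mono)
      have E1: "0 \<le> E" "E \<le> 1" using \<kappa> E by auto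
      have T1: "4 * c * c2\<^sup>2 * G * H\<^sup>2 * ?w\<^sup>2 / (c0 * \<kappa>) \<le> 4 * cmax * c2\<^sup>2 * M\<^sup>2 * B\<^sup>2 / (c0 * \<kappa>)"
        unfolding G using cle cpos z2 c0 \<kappa> by (intro divide_right_mono) (auto intro!: mult_mono)
      have T2: "16 * n'\<^sup>2 * ?z\<^sup>2 * G * ?b\<^sup>2 / (c * c0 * \<kappa>) \<le> 16 * n\<^sup>2 * B\<^sup>2 * b\<^sup>2 / (cmin * c0 * \<kappa>)"
        unfolding G n' n_def[symmetric]
        by (rule frac_le) (use cge cmin z2 b2 c0 \<kappa> in \<open>auto intro!: mult_mono mult_right_mono\<close>)
      have T3: "n'\<^sup>2 * ?z\<^sup>2 * E * ?b\<^sup>2 / (c * c0) \<le> n\<^sup>2 * B\<^sup>2 * b\<^sup>2 / (cmin * c0)"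
      proof (rule frac_le)
        have "n'\<^sup>2 * ?z\<^sup>2 * E * ?b\<^sup>2 \<le> n\<^sup>2 * B\<^sup>2 * 1 * b\<^sup>2"
          unfolding n' n_def[symmetric] using z2 b2 E1 by (intro mult_mono) auto
        then show "n'\<^sup>2 * ?z\<^sup>2 * E * ?b\<^sup>2 \<le> n\<^sup>2 * B\<^sup>2 * b\<^sup>2" by simp
      qed (use cge cmin c0 in auto)
      have T4: "4 * n' * ?b * ?z * G * H * ?w \<le> 4 * n * b * B * M * B"
      proof -
        have "4 * n * y * z * 1 * h * w \<le> 4 * n * b * B * M * B"
          if "0 \<le> y" "y \<le> b" "0 \<le> z" "z \<le> B" "0 \<le> h" "h \<le> M" "0 \<le> w" "w \<le> B" for y z h w :: real
          unfolding mult_1_right using that n B(1) b0 M(1) by (intro mult_mono mult_nonneg_nonneg) auto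
        from this[OF bb zB(1,2) _ HM(2) _ zB(3)] H0 show ?thesis unfolding G n' n_def[symmetric] by simp
      qed
      have T5: "n' * \<omega> * v * (?z\<^sup>2 * (2 * G + E) * v + 2 * ?z * G * H * ?w) \<le> a * (?z\<^sup>2 * v\<^sup>2) + n * \<omega> * (M\<^sup>2 * B\<^sup>2)"
      proof -
        have "v * (?z\<^sup>2 * (2 * G + E) * v + 2 * ?z * G * H * ?w) = (2 + E) * (?z\<^sup>2 * v\<^sup>2) + 2 * (?z * v) * (H * ?w)"
          unfolding G by (simp add: algebra_simps power2_eq_square)
        also have "\<dots> \<le> 3 * (?z\<^sup>2 * v\<^sup>2) + ((?z * v)\<^sup>2 + (H * ?w)\<^sup>2)"
          using E1 sum_squares_bound[of "?z * v" "H * ?w"] by (intro add_mono mult_right_mono) auto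
        also have "\<dots> \<le> 4 * (?z\<^sup>2 * v\<^sup>2) + M\<^sup>2 * B\<^sup>2"
          using mult_mono[OF z2(3) z2(2)] by (simp add: power_mult_distrib)
        finally have "n * \<omega> * (v * (?z\<^sup>2 * (2 * G + E) * v + 2 * ?z * G * H * ?w)) \<le> n * \<omega> * (4 * (?z\<^sup>2 * v\<^sup>2) + M\<^sup>2 * B\<^sup>2)"
          using n \<omega> by (intro mult_left_mono) auto
        also have "\<dots> = a * (?z\<^sup>2 * v\<^sup>2) + n * \<omega> * (M\<^sup>2 * B\<^sup>2)"
          using n by (simp add: a_def \<omega>_def distrib_left)
        finally show ?thesis unfolding n' n_def[symmetric] by (simp add: mult.assoc)
      qed
      have T0: "2 * a * (?z\<^sup>2 * v\<^sup>2) \<le> c * c0 * \<kappa> / 2 * ?z\<^sup>2 * G * v\<^sup>2"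
      proof -
        have "cmin * (c0 * \<kappa> / 2 * (?z\<^sup>2 * v\<^sup>2)) \<le> c * (c0 * \<kappa> / 2 * (?z\<^sup>2 * v\<^sup>2))"
          using cge c0 \<kappa> by (intro mult_right_mono) auto
        then show ?thesis unfolding G a_def by (simp add: mult_ac)
      qed
      have "low x = 2 * a * (?z\<^sup>2 * v\<^sup>2) - a * (?z\<^sup>2 * v\<^sup>2) - K" using x vv by (simp add: low_def)
      then show "low x \<le> c * c0 * \<kappa> / 2 * ?z\<^sup>2 * G * v\<^sup>2
      - (4 * c * c2\<^sup>2 * G * H\<^sup>2 * ?w\<^sup>2 / (c0 * \<kappa>) + 16 * n'\<^sup>2 * ?z\<^sup>2 * G * ?b\<^sup>2 / (c * c0 * \<kappa>)
         + n'\<^sup>2 * ?z\<^sup>2 * E * ?b\<^sup>2 / (c * c0) + 4 * n' * ?b * ?z * G * H * ?w)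
      - n' * \<omega> * v * (?z\<^sup>2 * (2 * G + E) * v + 2 * ?z * G * H * ?w)"
        using T0 T1 T2 T3 T4 T5 unfolding K_def by linarith
    qed (use c0 \<kappa> \<omega> il in auto)
    moreover have "(\<integral>x. low x \<partial>lborel) = a * (\<integral>x. (\<zeta> x)\<^sup>2 * dV_sq t x \<partial>lborel) - K * m"
      unfolding low_def m_def using I integrable_indicator_compact[OF Z(1)] Z(1) by (simp add: borel_compact)
    ultimately show "(\<integral>x. (\<zeta> x)\<^sup>2 * dV_sq t x \<partial>lborel) \<le> K * m / a" using a by (simp add: field_simps)
  qed
  have "0 \<le> K * m / a" using K0 a by (simp add: m_def)
  then show ?thesis using main t0 by (intro exI[of _ "K * m / a"] conjI exI[of _ t0] allI impI) auto
qed

end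

section \<open>The weighted energy bound\<close>

text \<open>The weight of the test function as a function of Q = |d|^2: the power |d|^(\<kappa>-1),
  switched off for |d| \<le> \<delta>.\<close>

definition wcut :: "real \<Rightarrow> real \<Rightarrow> real \<Rightarrow> real" where
  "wcut \<delta> \<kappa> Q = Q powr ((\<kappa> - 1) / 2) * cut \<delta> \<kappa> Q"

definition wcut' :: "real \<Rightarrow> real \<Rightarrow> real \<Rightarrow> real" where
  "wcut' \<delta> \<kappa> Q = (\<kappa> - 1) / 2 * Q powr ((\<kappa> - 1) / 2 - 1) * cut \<delta> \<kappa> Q + Q powr ((\<kappa> - 1) / 2) * cut' \<delta> \<kappa> Q"

lemma wcut_deriv:
  assumes \<delta>: "\<delta> > 0" and \<kappa>: "\<kappa> > 0"
  shows "(wcut \<delta> \<kappa> has_real_derivative wcut' \<delta> \<kappa> Q) (at Q)"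
proof (cases "Q < \<delta>\<^sup>2")
  case True
  have "(wcut \<delta> \<kappa> has_real_derivative 0) (at Q)"
    by (rule has_field_derivative_transform_within_open[of "\<lambda>_. 0" _ _ "{..<\<delta>\<^sup>2}"])
       (use True cut_zero[OF \<delta> \<kappa>] in \<open>auto simp: wcut_def\<close>)
  moreover have "wcut' \<delta> \<kappa> Q = 0" using cut_zero[OF \<delta> \<kappa>, of Q] True by (simp add: wcut'_def)
  ultimately show ?thesis by simp
next
  case False
  have "\<delta>\<^sup>2 > 0" using \<delta> by simp
  then have Q: "Q > 0" using False by linarith
  have "((\<lambda>Q. Q powr ((\<kappa> - 1) / 2)) has_real_derivative (\<kappa> - 1) / 2 * Q powr ((\<kappa> - 1) / 2 - 1)) (at Q)"
    by (rule has_real_derivative_powr[OF Q])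
  from DERIV_mult[OF this cut_deriv[OF \<delta> \<kappa>, of Q]] show ?thesis
    unfolding wcut_def wcut'_def by (simp add: mult_ac)
qed

lemma wcut'_cont:
  assumes \<delta>: "\<delta> > 0" and \<kappa>: "\<kappa> > 0"
  shows "continuous_on UNIV (wcut' \<delta> \<kappa>)"
proof -
  have 1: "continuous_on {..<\<delta>\<^sup>2} (wcut' \<delta> \<kappa>)"
    by (rule continuous_on_eq[of _ "\<lambda>_. 0"]) (use cut_zero[OF \<delta> \<kappa>] in \<open>auto simp: wcut'_def\<close>)
  have c: "continuous_on X (cut \<delta> \<kappa>)" for X
    using cut_deriv[OF \<delta> \<kappa>] by (meson DERIV_isCont continuous_at_imp_continuous_on)
  have 2: "continuous_on {0<..} (wcut' \<delta> \<kappa>)"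
    unfolding wcut'_def by (intro continuous_intros c cut'_cont \<delta> \<kappa>) auto
  have "continuous_on ({..<\<delta>\<^sup>2} \<union> {0<..}) (wcut' \<delta> \<kappa>)" by (rule continuous_on_open_Un) (use 1 2 in auto)
  moreover have "{..<\<delta>\<^sup>2} \<union> {0<..} = UNIV"
  proof -
    have "\<delta>\<^sup>2 > 0" using \<delta> by simp
    then have "x < \<delta>\<^sup>2 \<or> 0 < x" for x by linarith
    then show ?thesis by blast
  qed
  ultimately show ?thesis by simp
qed

lemma sq_powr_half: "H \<ge> 0 \<Longrightarrow> (H\<^sup>2) powr (a / 2) = H powr (a::real)"
  by (cases "H = 0") (simp_all add: powr_powr flip: powr_numeral)

text \<open>The pure power satisfies 2 Q G' = (\<kappa> - 1) G, so in the fourth claim it cancels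
  and only the derivative of the cutoff remains, which is nonnegative. The fifth claim bounds that
  remainder uniformly in \<open>\<delta>\<close>.\<close>

lemma wcut_props:
  assumes \<delta>: "\<delta> > 0" and \<kappa>: "\<kappa> > 0" and H: "H > 0"
  shows "wcut \<delta> \<kappa> (H\<^sup>2) = H powr (\<kappa> - 1) * cut \<delta> \<kappa> (H\<^sup>2)"
    "0 \<le> wcut \<delta> \<kappa> Q" "wcut \<delta> \<kappa> (H\<^sup>2) \<le> H powr (\<kappa> - 1)"
    "2 * Q * wcut' \<delta> \<kappa> Q + (1 - \<kappa>) * wcut \<delta> \<kappa> Q = 2 * Q * (Q powr ((\<kappa> - 1) / 2) * cut' \<delta> \<kappa> Q)"
    "2 * H\<^sup>2 * wcut' \<delta> \<kappa> (H\<^sup>2) + (1 - \<kappa>) * wcut \<delta> \<kappa> (H\<^sup>2) \<le> 2 * \<kappa> * H powr (\<kappa> - 1)"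
proof -
  show 1: "wcut \<delta> \<kappa> (H\<^sup>2) = H powr (\<kappa> - 1) * cut \<delta> \<kappa> (H\<^sup>2)"
    using sq_powr_half[of H "\<kappa> - 1"] H by (simp add: wcut_def)
  show "0 \<le> wcut \<delta> \<kappa> Q" using cut_bounds(1)[OF \<delta> \<kappa>] by (simp add: wcut_def)
  show "wcut \<delta> \<kappa> (H\<^sup>2) \<le> H powr (\<kappa> - 1)"
    unfolding 1 using cut_bounds(2)[OF \<delta> \<kappa>, of "H\<^sup>2"] mult_left_mono[of "cut \<delta> \<kappa> (H\<^sup>2)" 1 "H powr (\<kappa> - 1)"] by simp
  show 4: "2 * Q * wcut' \<delta> \<kappa> Q + (1 - \<kappa>) * wcut \<delta> \<kappa> Q = 2 * Q * (Q powr ((\<kappa> - 1) / 2) * cut' \<delta> \<kappa> Q)" for Q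
  proof (cases "Q > 0")
    case True
    have e: "Q * Q powr ((\<kappa> - 1) / 2 - 1) = Q powr ((\<kappa> - 1) / 2)"
      using True by (simp add: powr_diff)
    have "2 * Q * ((\<kappa> - 1) / 2 * Q powr ((\<kappa> - 1) / 2 - 1) * cut \<delta> \<kappa> Q) = (\<kappa> - 1) * (Q * Q powr ((\<kappa> - 1) / 2 - 1)) * cut \<delta> \<kappa> Q"
      by simp
    then show ?thesis unfolding wcut_def wcut'_def distrib_left e by (simp add: algebra_simps)
  next
    case False
    then show ?thesis by (simp add: wcut_def wcut'_def cut_def cut'_def)
  qed
  have "cut' \<delta> \<kappa> (H\<^sup>2) \<le> \<kappa> / H\<^sup>2" using cut_bounds(4)[OF \<delta> \<kappa>] H by simp
  then have "2 * H\<^sup>2 * (H powr (\<kappa> - 1) * cut' \<delta> \<kappa> (H\<^sup>2)) \<le> 2 * H\<^sup>2 * (H powr (\<kappa> - 1) * (\<kappa> / H\<^sup>2))"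
    by (intro mult_left_mono) auto
  also have "\<dots> = 2 * \<kappa> * H powr (\<kappa> - 1)" using H by simp
  finally show "2 * H\<^sup>2 * wcut' \<delta> \<kappa> (H\<^sup>2) + (1 - \<kappa>) * wcut \<delta> \<kappa> (H\<^sup>2) \<le> 2 * \<kappa> * H powr (\<kappa> - 1)"
    unfolding 4 using sq_powr_half[of H "\<kappa> - 1"] H by simp
qed

context plap_setting
begin

lemma dq_cont: "continuous_on (shiftdom t) (dq t)"
  by (subst continuous_on_componentwise) (use C1_gradD(3)[OF dq_C1] in blast)

lemma large_gradient_compact:
  assumes "compact S" "S \<subseteq> shiftdom t"
  shows "compact {x \<in> S. \<delta> \<le> norm (dq t x)}"
proof -
  have "closed (S \<inter> (\<lambda>x. norm (dq t x)) -` {\<delta>..})"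
    by (rule continuous_closed_preimage)
       (use continuous_on_subset[OF dq_cont assms(2)] compact_imp_closed[OF assms(1)] in \<open>auto intro!: continuous_intros\<close>)
  moreover have "S \<inter> (\<lambda>x. norm (dq t x)) -` {\<delta>..} = {x \<in> S. \<delta> \<le> norm (dq t x)}" by auto
  ultimately have "compact (S \<inter> {x \<in> S. \<delta> \<le> norm (dq t x)})" using assms(1) compact_Int_closed by metis
  moreover have "S \<inter> {x \<in> S. \<delta> \<le> norm (dq t x)} = {x \<in> S. \<delta> \<le> norm (dq t x)}" by auto
  ultimately show ?thesis by simp
qed

end

context plap_solution
begin

text \<open>The order of choices is the point: \<open>C\<close> precedes \<open>\<delta>\<close>;
  given \<open>\<delta>\<close>, the crude bound on {|D| \<ge> \<delta>/2} yields \<open>C1\<close>,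
  then \<open>\<omega>\<close> is chosen, and only then the range of \<open>t\<close>. The errors
  not multiplied by \<open>\<omega>\<close> carry nonnegative powers of |d|, so they are bounded
  independently of \<open>\<delta>\<close>.\<close>

lemma weighted_energy_bound:
  assumes \<zeta>: "C1_supp S \<zeta> D\<zeta>" "\<And>x. 0 \<le> \<zeta> x" and S: "S \<subseteq> \<Omega>"
    and N: "compact N" "N \<subseteq> \<Omega>" "e > 0" "\<And>x. x \<in> S \<Longrightarrow> cball x e \<subseteq> N"
    and M: "M \<ge> (2::real)" "\<And>y. y \<in> N \<Longrightarrow> norm (D y) \<le> M - 1" and pN: "\<And>y. y \<in> N \<Longrightarrow> p1 \<le> p y \<and> p y \<le> p2"
    and \<kappa>: "0 < \<kappa>" "\<kappa> \<le> 1" "3 * \<kappa> \<le> p1 - 1" and p12: "1 < p1" "p1 \<le> p2"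
  shows "\<exists>C\<ge>0. \<forall>\<delta>. 0 < \<delta> \<and> \<delta> \<le> 1 \<longrightarrow> (\<exists>t0>0. \<forall>t. 0 < t \<and> t < t0 \<longrightarrow> (\<exists>\<omega> Cb. good_step S N M \<kappa> \<delta> \<omega> Cb t) \<and>
     integrable lborel (\<lambda>x. (\<zeta> x)\<^sup>2 * (wcut \<delta> \<kappa> (dsq t x) * norm (dq t x) powr (p x - 2)) * dV_sq t x) \<and>
     (\<integral>x. (\<zeta> x)\<^sup>2 * (wcut \<delta> \<kappa> (dsq t x) * norm (dq t x) powr (p x - 2)) * dV_sq t x \<partial>lborel) \<le> C)"
proof -
  note Z = C1_suppD[OF \<zeta>(1)]
  obtain B where B: "B \<ge> 0" "\<And>x. \<bar>\<zeta> x\<bar> \<le> B" "\<And>x. norm (D\<zeta> x) \<le> B" using C1_supp_bound[OF \<zeta>(1)] by metis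
  have zm: "\<zeta> \<in> borel_measurable borel" using Z(4) by (rule borel_measurable_continuous_onI)
  have SN: "S \<subseteq> N" using N(3,4) by force
  define n where "n = real DIM('a)"
  have n: "n > 0" by (simp add: n_def)
  define c0 where "c0 = min 1 (p1 - 1)"
  have c0: "0 < c0" "c0 \<le> 1" using p12 by (auto simp: c0_def)
  define c2 where "c2 = p2 + 3"
  define Cb where "Cb = drift_const \<kappa> M p2"
  have Cb: "0 \<le> Cb" unfolding Cb_def by (rule drift_const_nonneg[OF \<kappa>(1)])
  define Mp where "Mp = M powr (p2 + 1)"
  have Mp: "Mp > 0" using M by (simp add: Mp_def)
  define K where "K = 4 * c2\<^sup>2 * Mp * B\<^sup>2 / (c0 * \<kappa>) + 16 * n\<^sup>2 * B\<^sup>2 * (Cb\<^sup>2 * Mp) / (c0 * \<kappa>)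
      + n\<^sup>2 * B\<^sup>2 * (2 * (Cb\<^sup>2 * Mp)) / c0 + 4 * n * B * B * (Cb * Mp)"
  have K0: "0 \<le> K" unfolding K_def using c0 \<kappa> n Cb B Mp by (intro add_nonneg_nonneg) auto
  define m where "m = measure lborel S"
  have m0: "m \<ge> 0" by (simp add: m_def)
  define a where "a = c0 * \<kappa> / 2"
  have a: "a > 0" using c0 \<kappa> by (simp add: a_def)
  \<comment> \<open>\<open>K * m\<close> pays for the cutoff and drift terms, and
    \<open>m + 1\<close> for the two halves of the linearisation error.\<close>
  define C where "C = (K * m + m + 1) / a"
  have C0: "C \<ge> 0" unfolding C_def using K0 m0 a by auto
  show ?thesis
  proof (rule exI[of _ C], intro conjI allI impI C0)
    fix \<delta> :: real assume "0 < \<delta> \<and> \<delta> \<le> 1"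
    then have \<delta>: "0 < \<delta>" "\<delta> \<le> 1" by auto
    \<comment> \<open>For a good step |d| \<ge> \<delta> implies |D| \<ge> \<delta>/2, so this set
      contains the support of the weight for all small \<open>t\<close>, while being independent of
      \<open>t\<close>.\<close>
    define Sd where "Sd = {x \<in> S. \<delta> / 2 \<le> norm (D x)}"
    have Sd: "compact Sd" "Sd \<subseteq> regular"
    proof -
      have "closed (S \<inter> (\<lambda>x. norm (D x)) -` {\<delta> / 2..})"
        by (rule continuous_closed_preimage)
           (use continuous_on_subset[OF D_cont S] compact_imp_closed[OF Z(1)] in \<open>auto intro!: continuous_intros\<close>)
      then have "compact (S \<inter> (S \<inter> (\<lambda>x. norm (D x)) -` {\<delta> / 2..}))" using Z(1) compact_Int_closed by blast
      moreover have "S \<inter> (S \<inter> (\<lambda>x. norm (D x)) -` {\<delta> / 2..}) = Sd" by (auto simp: Sd_def)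
      ultimately show "compact Sd" by simp
      show "Sd \<subseteq> regular" using S \<delta> by (auto simp: Sd_def regular_def)
    qed
    obtain S1 \<zeta>1 D\<zeta>1 where \<zeta>1: "C1_supp S1 \<zeta>1 D\<zeta>1" "S1 \<subseteq> regular" "\<And>x. \<zeta>1 x \<ge> 0" "\<And>x. x \<in> Sd \<Longrightarrow> \<zeta>1 x \<ge> 1"
      using C1_cutoff[OF Sd(1) open_regular Sd(2)] by blast
    obtain C1 t1 where C1: "C1 \<ge> 0" "t1 > 0"
      "\<And>t. 0 < t \<Longrightarrow> t < t1 \<Longrightarrow> integrable lborel (\<lambda>x. (\<zeta>1 x)\<^sup>2 * dV_sq t x)"
      "\<And>t. 0 < t \<Longrightarrow> t < t1 \<Longrightarrow> (\<integral>x. (\<zeta>1 x)\<^sup>2 * dV_sq t x \<partial>lborel) \<le> C1"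
      using gradient_quotient_bound_on_regular[OF \<zeta>1(1,3,2)] by blast
    define C\<delta> where "C\<delta> = n * (4 * B\<^sup>2 / \<delta> + B\<^sup>2 * M / \<delta>)"
    have C\<delta>: "C\<delta> \<ge> 0" unfolding C\<delta>_def using n \<delta> M by auto
    \<comment> \<open>Makes both \<open>\<omega> * C\<delta>\<close> and
      \<open>\<omega> * C\<delta> * C1\<close> at most 1, so the linearisation error costs an amount
      free of \<open>\<delta>\<close>.\<close>
    define \<omega> where "\<omega> = 1 / (C\<delta> * (C1 + 1) + 1)"
    have den: "C\<delta> * (C1 + 1) + 1 > 0" using C\<delta> C1(1) by (auto intro: add_nonneg_pos)
    have \<omega>: "\<omega> > 0" using den by (simp add: \<omega>_def)
    have \<omega>1: "\<omega> * C\<delta> * (C1 + 1) \<le> 1"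
    proof -
      have "C\<delta> * (C1 + 1) / (C\<delta> * (C1 + 1) + 1) \<le> 1" using den by (simp add: divide_le_eq)
      then show ?thesis by (simp add: \<omega>_def mult.assoc)
    qed
    have \<omega>C: "\<omega> * C\<delta> \<le> 1" "\<omega> * C\<delta> * C1 \<le> 1" "0 \<le> \<omega> * C\<delta>"
    proof -
      show 0: "0 \<le> \<omega> * C\<delta>" using \<omega> C\<delta> by simp
      have "\<omega> * C\<delta> * (C1 + 1) = \<omega> * C\<delta> * C1 + \<omega> * C\<delta>" by (simp add: distrib_left)
      moreover have "0 \<le> \<omega> * C\<delta> * C1" using 0 C1(1) by simp
      ultimately show "\<omega> * C\<delta> \<le> 1" "\<omega> * C\<delta> * C1 \<le> 1" using \<omega>1 0 by linarith+
    qed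
    obtain t0 where t0: "t0 > 0" and gs: "\<And>t. 0 < t \<Longrightarrow> t < t0 \<Longrightarrow> good_step S N M \<kappa> \<delta> \<omega> Cb t"
      using discrete_estimates[OF S N M pN \<kappa>(1) _ \<delta>(1,2) \<omega>, folded Cb_def] \<kappa> by auto
    note T = good_stepD[OF gs]
    have main: "(\<exists>\<omega> Cb. good_step S N M \<kappa> \<delta> \<omega> Cb t) \<and>
     integrable lborel (\<lambda>x. (\<zeta> x)\<^sup>2 * (wcut \<delta> \<kappa> (dsq t x) * norm (dq t x) powr (p x - 2)) * dV_sq t x) \<and>
     (\<integral>x. (\<zeta> x)\<^sup>2 * (wcut \<delta> \<kappa> (dsq t x) * norm (dq t x) powr (p x - 2)) * dV_sq t x \<partial>lborel) \<le> C" if tt: "0 < t \<and> t < min t0 t1" for t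
    proof -
      have t: "0 < t" "t < t0" and t1: "t < t1" using tt by auto
      define S' where "S' = {x \<in> S. \<delta> \<le> norm (dq t x)}"
      have S': "compact S'" "S' \<subseteq> S" unfolding S'_def using large_gradient_compact[OF Z(1) T(1)[OF t]] by auto
      have px: "p1 \<le> p x" "p x \<le> p2" if "x \<in> S" for x using pN SN that by auto
      have off: "wcut \<delta> \<kappa> (dsq t x) = 0" if "x \<in> S" "x \<notin> S'" for x
      proof -
        have "norm (dq t x) < \<delta>" using that by (auto simp: S'_def)
        then have "dsq t x \<le> \<delta>\<^sup>2" unfolding dsq_norm by (intro power_mono) auto
        then show ?thesis using cut_zero(1)[OF \<delta>(1) \<kappa>(1)] by (simp add: wcut_def)
      qed
      have Gle: "wcut \<delta> \<kappa> (dsq t x) \<le> 1 / \<delta> \<and> norm (dq t x) powr (\<kappa> - 1) \<le> 1 / \<delta>" if "x \<in> S'" for x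
      proof
        have H: "\<delta> \<le> norm (dq t x)" "0 < norm (dq t x)" using that \<delta> by (auto simp: S'_def intro: less_le_trans)
        have "norm (dq t x) powr (\<kappa> - 1) \<le> \<delta> powr (\<kappa> - 1)" using H \<delta> \<kappa> by (intro powr_mono2') auto
        also have "\<dots> \<le> \<delta> powr (- 1)" using \<delta> \<kappa> by (intro powr_mono') auto
        also have "\<dots> = 1 / \<delta>" using \<delta> by (simp add: powr_minus_divide)
        finally show 1: "norm (dq t x) powr (\<kappa> - 1) \<le> 1 / \<delta>" .
        show "wcut \<delta> \<kappa> (dsq t x) \<le> 1 / \<delta>"
          using wcut_props(3)[OF \<delta>(1) \<kappa>(1) H(2)] 1 unfolding dsq_norm by linarith
      qed
      define w where "w x = (\<zeta> x)\<^sup>2 * (wcut \<delta> \<kappa> (dsq t x) * norm (dq t x) powr (p x - 2))" for x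
      have cutm: "wcut \<delta> \<kappa> \<in> borel_measurable borel"
      proof -
        have "continuous_on UNIV (wcut \<delta> \<kappa>)" using wcut_deriv[OF \<delta>(1) \<kappa>(1)] by (meson DERIV_isCont continuous_at_imp_continuous_on)
        then show ?thesis by (rule borel_measurable_continuous_onI)
      qed
      have wm: "w \<in> borel_measurable borel"
      proof -
        note [measurable] = zm dq_borel p_borel dsq_borel cutm
        show ?thesis unfolding w_def by measurable
      qed
      have I: "integrable lborel (\<lambda>x. w x * dV_sq t x)"
      proof (rule dV_sq_integrable[OF Z(1) _ wm _ _ t(1)])
        show "norm (D x) \<le> M \<and> norm (D (x + t *\<^sub>R k)) \<le> M" if "x \<in> S" "k \<in> Basis" for x k
          using M(2)[of x] M(2)[of "x + t *\<^sub>R k"] T(4)[OF t that, of 1] SN that by force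
        show "w x = 0" if "x \<notin> S" for x using Z(5)[OF that] by (simp add: w_def)
        show "\<bar>w x\<bar> \<le> B\<^sup>2 * (1 / \<delta> * (M powr p2 / \<delta>\<^sup>2))" if x: "x \<in> S" for x
        proof (cases "x \<in> S'")
          case False then show ?thesis using off[OF x False] \<delta> by (simp add: w_def)
        next
          case True
          have H: "\<delta> \<le> norm (dq t x)" "0 < norm (dq t x)" using True \<delta> by (auto simp: S'_def intro: less_le_trans)
          have "norm (dq t x) powr (p x - 2) = norm (dq t x) powr p x / (norm (dq t x))\<^sup>2" using H by (simp add: powr_diff)
          also have "\<dots> \<le> M powr p2 / \<delta>\<^sup>2"
            by (intro frac_le powr_le_bound power_mono) (use H \<delta> T(3)[OF t x] M px[OF x] p12 in auto)
          finally have 1: "norm (dq t x) powr (p x - 2) \<le> M powr p2 / \<delta>\<^sup>2" .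
          have 2: "0 \<le> wcut \<delta> \<kappa> (dsq t x)" by (rule wcut_props(2)[OF \<delta>(1) \<kappa>(1) \<delta>(1)])
          have 3: "(\<zeta> x)\<^sup>2 \<le> B\<^sup>2" using power_mono[OF B(2)[of x], of 2] by simp
          have "w x \<le> B\<^sup>2 * (1 / \<delta> * (M powr p2 / \<delta>\<^sup>2))" unfolding w_def
            by (intro mult_mono 1 3) (use Gle[OF True] 2 \<delta> in auto)
          moreover have "0 \<le> w x" unfolding w_def using 2 by auto
          ultimately show ?thesis by simp
        qed
      qed
      \<comment> \<open>The term with \<open>\<zeta>1\<close> is the linearisation error; it cannot
        be absorbed by the weighted energy, whose weight vanishes near |d| = \<delta>, and is paid
        for by the crude bound instead.\<close>
      define low where "low x = a * (w x * dV_sq t x) - K * indicator S x - (\<omega> * C\<delta>) * ((\<zeta>1 x)\<^sup>2 * dV_sq t x) - (\<omega> * C\<delta>) * indicator S x" for x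
      have iS: "integrable lborel (indicat_real S)" by (rule integrable_indicator_compact[OF Z(1)])
      note i1 = C1(3)[OF t(1) t1]
      have il: "integrable lborel low" unfolding low_def using I i1 iS by auto
      have "(\<integral>x. low x \<partial>lborel) \<le> 0"
      proof (rule energy_estimate[where Gf = "wcut \<delta> \<kappa>" and Gf' = "wcut' \<delta> \<kappa>" and \<beta> = "\<lambda>x. Cb * norm (dq t x) powr (p x - 1 - \<kappa>)"
          and C\<beta> = "Cb * M powr p2" and \<kappa> = \<kappa> and ?c0.0 = c0 and ?c2.0 = c2 and \<omega> = \<omega>, OF t(1) \<zeta> T(1)[OF t] S' _ off _ N(1,2)])
        have d': "\<delta> \<le> norm (dq t x)" "x \<in> S" if "x \<in> S'" for x using that by (auto simp: S'_def)
        show "S' \<subseteq> regular"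
        proof
          fix x assume "x \<in> S'"
          then show "x \<in> regular" using T(7)[OF t, of x] d'[of x] \<delta> S by (auto simp: regular_def)
        qed
        show "x + t *\<^sub>R k \<in> regular" if "x \<in> S'" "k \<in> Basis" for x k
          using T(5)[OF t d'(2)[OF that(1)] d'(1)[OF that(1)] that(2), of 1] by simp
        show "x + (\<tau> * t) *\<^sub>R k \<in> N" if "x \<in> S'" "k \<in> Basis" "0 \<le> \<tau>" "\<tau> \<le> 1" for x k \<tau>
          by (rule T(4)[OF t d'(2)[OF that(1)] that(2-4)])
        show "\<bar>drift (x + (\<tau> * t) *\<^sub>R k)\<bar> \<le> Cb * norm (dq t x) powr (p x - 1 - \<kappa>)" if "x \<in> S'" "k \<in> Basis" "0 \<le> \<tau>" "\<tau> \<le> 1" for x k \<tau>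
          using T(5)[OF t d'(2)[OF that(1)] d'(1)[OF that(1)] that(2-4)] by simp
        show "(\<lambda>x. Cb * norm (dq t x) powr (p x - 1 - \<kappa>)) \<in> borel_measurable borel" using dq_borel p_borel by measurable
        have Hp: "norm (dq t x) powr (p x - 1 - \<kappa>) \<le> M powr p2" if "x \<in> S" for x
          by (rule powr_le_bound) (use T(3)[OF t that] M px[OF that] \<kappa> p12 in auto)
        show "\<bar>Cb * norm (dq t x) powr (p x - 1 - \<kappa>)\<bar> \<le> Cb * M powr p2" if "x \<in> S'" for x
          using mult_left_mono[OF Hp[OF d'(2)[OF that]] Cb] Cb by (simp add: abs_mult)
        show "c0 \<le> p x - 1" if "x \<in> S'" for x using px[OF d'(2)[OF that]] by (auto simp: c0_def)
        show "1 + \<bar>p x - 2\<bar> \<le> c2" if "x \<in> S'" for x using px[OF d'(2)[OF that]] p12 by (auto simp: c2_def)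
        show "norm ((1 / t) *\<^sub>R (flux (x + t *\<^sub>R k) - flux x) - plap_lin (p x) (dq t x) (dV t k x))
           \<le> \<omega> * norm (dV t k x) + Cb * norm (dq t x) powr (p x - 1 - \<kappa>)" if "x \<in> S'" "k \<in> Basis" for x k
          by (rule T(6)[OF t d'(2)[OF that(1)] d'(1)[OF that(1)] that(2)])
        show "dq t x \<noteq> 0" if "x \<in> S'" for x using d'(1)[OF that] \<delta>(1) by auto
        show "(wcut \<delta> \<kappa> has_real_derivative wcut' \<delta> \<kappa> Q) (at Q)" for Q by (rule wcut_deriv[OF \<delta>(1) \<kappa>(1)])
        show "continuous_on UNIV (wcut' \<delta> \<kappa>)" by (rule wcut'_cont[OF \<delta>(1) \<kappa>(1)])
        show "0 \<le> wcut \<delta> \<kappa> Q" for Q by (rule wcut_props(2)[OF \<delta>(1) \<kappa>(1) \<delta>(1)])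
        show "0 \<le> 2 * Q * wcut' \<delta> \<kappa> Q + (1 - \<kappa>) * wcut \<delta> \<kappa> Q" if "0 < Q" for Q
          unfolding wcut_props(4)[OF \<delta>(1) \<kappa>(1) \<delta>(1)] using cut_bounds(3)[OF \<delta>(1) \<kappa>(1), of Q] that by simp
        show "low x \<le> 0" if "x \<notin> S'" for x
        proof -
          have "w x = 0" using off[of x] that Z(5)[of x] by (cases "x \<in> S") (auto simp: w_def)
          moreover have "0 \<le> (\<omega> * C\<delta>) * ((\<zeta>1 x)\<^sup>2 * dV_sq t x)" using \<omega>C(3) dV_sq_nonneg by simp
          moreover have "0 \<le> K * indicator S x" "0 \<le> (\<omega> * C\<delta>) * indicator S x" using K0 \<omega>C(3) by auto
          ultimately show ?thesis by (simp add: low_def)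
        qed
        fix x and H c n' v G E :: real
        assume x: "x \<in> S'" and H: "H = norm (dq t x)" and c: "c = H powr (p x - 2)" and n': "n' = real DIM('a)"
          and v: "v = sqrt (\<Sum>k\<in>Basis. (norm (dV t k x))\<^sup>2)" and G: "G = wcut \<delta> \<kappa> (dsq t x)"
          and E: "E = 2 * dsq t x * wcut' \<delta> \<kappa> (dsq t x) + (1 - \<kappa>) * wcut \<delta> \<kappa> (dsq t x)"
        let ?b = "Cb * norm (dq t x) powr (p x - 1 - \<kappa>)" and ?z = "\<zeta> x" and ?w = "norm (D\<zeta> x)"
        have xS: "x \<in> S" using d'(2)[OF x] .
        have HM: "\<delta> \<le> H" "H \<le> M" using d'(1)[OF x] T(3)[OF t xS] H by auto
        have H0: "H > 0" using HM \<delta> by linarith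
        have vv: "v\<^sup>2 = dV_sq t x" "v \<ge> 0" using v dV_sq_nonneg[of t x] by (auto simp: dV_sq_def)
        have cpos: "c > 0" using H0 by (simp add: c)
        have dsqH: "dsq t x = H\<^sup>2" by (simp add: H dsq_norm)
        have G0: "0 \<le> G" unfolding G by (rule wcut_props(2)[OF \<delta>(1) \<kappa>(1) \<delta>(1)])
        have GH: "G \<le> H powr (\<kappa> - 1)" unfolding G dsqH by (rule wcut_props(3)[OF \<delta>(1) \<kappa>(1) H0])
        have E0: "0 \<le> E" unfolding E wcut_props(4)[OF \<delta>(1) \<kappa>(1) \<delta>(1)]
          using cut_bounds(3)[OF \<delta>(1) \<kappa>(1), of "dsq t x"] by (simp add: dsqH)
        have EH: "E \<le> 2 * H powr (\<kappa> - 1)"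
        proof -
          have "E \<le> 2 * \<kappa> * H powr (\<kappa> - 1)" unfolding E dsqH by (rule wcut_props(5)[OF \<delta>(1) \<kappa>(1) H0])
          also have "\<dots> \<le> 2 * 1 * H powr (\<kappa> - 1)" using \<kappa> by (intro mult_right_mono mult_left_mono) auto
          finally show ?thesis by simp
        qed
        have b: "?b = Cb * H powr (p x - 1 - \<kappa>)" by (simp add: H)
        have Hmp: "H powr e \<le> Mp" if "0 \<le> e" "e \<le> p2 + 1" for e
          unfolding Mp_def by (rule powr_le_bound) (use HM H0 M that in auto)
        \<comment> \<open>In this and the next two bounds the powers of \<open>H\<close> combine to
          the exponents p - 1 + \<kappa>, p - 1 - \<kappa> and p - 1. None is negative, so the bound
          \<open>M\<close> for \<open>H\<close> suffices.\<close>
        have pw1: "c * H powr (\<kappa> - 1) * H\<^sup>2 \<le> Mp"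
        proof -
          have "c * H powr (\<kappa> - 1) * H\<^sup>2 = H powr (p x - 2) * H powr (\<kappa> - 1) * H powr 2" using H0 by (simp add: c)
          also have "\<dots> = H powr (p x + \<kappa> - 1)" unfolding powr_add[symmetric] by simp
          also have "\<dots> \<le> Mp" by (rule Hmp) (use px[OF xS] p12 \<kappa> in auto)
          finally show ?thesis .
        qed
        have pw2: "H powr (\<kappa> - 1) * ?b\<^sup>2 / c \<le> Cb\<^sup>2 * Mp"
        proof -
          have "?b\<^sup>2 = Cb\<^sup>2 * (H powr (p x - 1 - \<kappa>) * H powr (p x - 1 - \<kappa>))" unfolding b by (simp add: power2_eq_square)
          moreover have "X / c = X * H powr (- (p x - 2))" for X unfolding c powr_minus_divide by simp
          ultimately have "H powr (\<kappa> - 1) * ?b\<^sup>2 / c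
            = Cb\<^sup>2 * (H powr (\<kappa> - 1) * (H powr (p x - 1 - \<kappa>) * H powr (p x - 1 - \<kappa>)) * H powr (- (p x - 2)))"
            by (simp only: mult_ac)
          also have "H powr (\<kappa> - 1) * (H powr (p x - 1 - \<kappa>) * H powr (p x - 1 - \<kappa>)) * H powr (- (p x - 2)) = H powr (p x - 1 - \<kappa>)"
            unfolding powr_add[symmetric] by (simp add: algebra_simps)
          also have "Cb\<^sup>2 * H powr (p x - 1 - \<kappa>) \<le> Cb\<^sup>2 * Mp"
            by (intro mult_left_mono Hmp) (use px[OF xS] p12 \<kappa> in auto)
          finally show ?thesis .
        qed
        have pw3: "?b * (H powr (\<kappa> - 1) * H) \<le> Cb * Mp"
        proof -
          have "?b * (H powr (\<kappa> - 1) * H) = Cb * (H powr (p x - 1 - \<kappa>) * (H powr (\<kappa> - 1) * H powr 1))" unfolding b using H0 by simp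
          also have "H powr (p x - 1 - \<kappa>) * (H powr (\<kappa> - 1) * H powr 1) = H powr (p x - 1)"
            unfolding powr_add[symmetric] by simp
          also have "Cb * H powr (p x - 1) \<le> Cb * Mp" by (intro mult_left_mono Hmp Cb) (use px[OF xS] p12 in auto)
          finally show ?thesis .
        qed
        have b0: "0 \<le> ?b" using Cb by simp
        have zB: "0 \<le> ?z" "?z \<le> B" "?w \<le> B" using \<zeta>(2)[of x] B(2,3)[of x] by auto
        have z2: "?z\<^sup>2 \<le> B\<^sup>2" "?w\<^sup>2 \<le> B\<^sup>2" using zB by (auto intro!: power_mono)
        have T1: "4 * c * c2\<^sup>2 * G * H\<^sup>2 * ?w\<^sup>2 / (c0 * \<kappa>) \<le> 4 * c2\<^sup>2 * Mp * B\<^sup>2 / (c0 * \<kappa>)"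
        proof (rule divide_right_mono)
          have "c * G * H\<^sup>2 \<le> c * H powr (\<kappa> - 1) * H\<^sup>2" using GH cpos by (intro mult_right_mono mult_left_mono) auto
          then have "c * G * H\<^sup>2 \<le> Mp" using pw1 by linarith
          then have "4 * c2\<^sup>2 * (c * G * H\<^sup>2) * ?w\<^sup>2 \<le> 4 * c2\<^sup>2 * Mp * B\<^sup>2"
            using z2 Mp by (intro mult_mono mult_left_mono) auto
          then show "4 * c * c2\<^sup>2 * G * H\<^sup>2 * ?w\<^sup>2 \<le> 4 * c2\<^sup>2 * Mp * B\<^sup>2" by (simp add: mult_ac)
        qed (use c0 \<kappa> in auto)
        have T2: "16 * n'\<^sup>2 * ?z\<^sup>2 * G * ?b\<^sup>2 / (c * c0 * \<kappa>) \<le> 16 * n\<^sup>2 * B\<^sup>2 * (Cb\<^sup>2 * Mp) / (c0 * \<kappa>)"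
        proof -
          have "G * ?b\<^sup>2 / c \<le> H powr (\<kappa> - 1) * ?b\<^sup>2 / c" using GH cpos by (intro divide_right_mono mult_right_mono) auto
          then have g: "G * ?b\<^sup>2 / c \<le> Cb\<^sup>2 * Mp" using pw2 by linarith
          have "16 * n\<^sup>2 * ?z\<^sup>2 * (G * ?b\<^sup>2 / c) \<le> 16 * n\<^sup>2 * B\<^sup>2 * (Cb\<^sup>2 * Mp)"
            using g z2 G0 cpos by (intro mult_mono mult_left_mono) auto
          then have "16 * n\<^sup>2 * ?z\<^sup>2 * (G * ?b\<^sup>2 / c) / (c0 * \<kappa>) \<le> 16 * n\<^sup>2 * B\<^sup>2 * (Cb\<^sup>2 * Mp) / (c0 * \<kappa>)"
            using c0 \<kappa> by (intro divide_right_mono) auto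
          then show ?thesis unfolding n' n_def[symmetric] by (simp add: mult_ac)
        qed
        have T3: "n'\<^sup>2 * ?z\<^sup>2 * E * ?b\<^sup>2 / (c * c0) \<le> n\<^sup>2 * B\<^sup>2 * (2 * (Cb\<^sup>2 * Mp)) / c0"
        proof -
          have "E * ?b\<^sup>2 / c \<le> 2 * H powr (\<kappa> - 1) * ?b\<^sup>2 / c" using EH cpos by (intro divide_right_mono mult_right_mono) auto
          then have g: "E * ?b\<^sup>2 / c \<le> 2 * (Cb\<^sup>2 * Mp)" using pw2 by (simp add: mult.assoc)
          have "n\<^sup>2 * ?z\<^sup>2 * (E * ?b\<^sup>2 / c) \<le> n\<^sup>2 * B\<^sup>2 * (2 * (Cb\<^sup>2 * Mp))"
            using g z2 E0 cpos by (intro mult_mono mult_left_mono) auto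
          then have "n\<^sup>2 * ?z\<^sup>2 * (E * ?b\<^sup>2 / c) / c0 \<le> n\<^sup>2 * B\<^sup>2 * (2 * (Cb\<^sup>2 * Mp)) / c0"
            using c0 by (intro divide_right_mono) auto
          then show ?thesis unfolding n' n_def[symmetric] by (simp add: mult_ac)
        qed
        have T4: "4 * n' * ?b * ?z * G * H * ?w \<le> 4 * n * B * B * (Cb * Mp)"
        proof -
          have "?b * (G * H) \<le> ?b * (H powr (\<kappa> - 1) * H)" using GH H0 b0 by (intro mult_right_mono mult_left_mono) auto
          then have g: "?b * (G * H) \<le> Cb * Mp" using pw3 by linarith
          have g0: "0 \<le> ?b * (G * H)" using b0 G0 H0 by simp
          have "4 * n * ?z * ?w * (?b * (G * H)) \<le> 4 * n * B * B * (Cb * Mp)"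
          proof (rule mult_mono[OF _ g _ g0])
            show "4 * n * ?z * ?w \<le> 4 * n * B * B" using zB n B(1) by (intro mult_mono) auto
          qed (use n B(1) in auto)
          then show ?thesis unfolding n' n_def[symmetric] by (simp add: mult_ac)
        qed
        \<comment> \<open>The only estimate in which 1/\<delta> enters. It is multiplied by
          \<open>\<omega>\<close>, and on the support of the weight \<open>\<zeta>1\<close> is at
          least 1.\<close>
        have T5: "n' * \<omega> * v * (?z\<^sup>2 * (2 * G + E) * v + 2 * ?z * G * H * ?w) \<le> \<omega> * C\<delta> * ((\<zeta>1 x)\<^sup>2 * dV_sq t x) + \<omega> * C\<delta>"
        proof -
          have Gd: "G \<le> 1 / \<delta>" "H powr (\<kappa> - 1) \<le> 1 / \<delta>" using Gle[OF x] by (auto simp: G H)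
          have Ed: "E \<le> 2 / \<delta>" using EH Gd(2) by (simp add: field_simps)
          have s1: "?z\<^sup>2 * (2 * G + E) * v\<^sup>2 \<le> B\<^sup>2 * (4 / \<delta>) * v\<^sup>2"
            using z2(1) Gd(1) Ed G0 E0 by (intro mult_right_mono mult_mono) auto
          have s2: "2 * ?z * G * H * ?w * v \<le> B\<^sup>2 * M / \<delta> * (v\<^sup>2 + 1)"
          proof -
            have "?z * ?w \<le> B * B" using zB B(1) by (intro mult_mono) auto
            moreover have "G * H \<le> 1 / \<delta> * M" using Gd(1) HM H0 G0 \<delta> by (intro mult_mono) auto
            ultimately have "(?z * ?w) * (G * H) \<le> (B * B) * (1 / \<delta> * M)"
              by (rule mult_mono) (use G0 H0 B(1) in auto)
            then have "((?z * ?w) * (G * H)) * (2 * v) \<le> ((B * B) * (1 / \<delta> * M)) * (v\<^sup>2 + 1)"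
              by (rule mult_mono) (use sum_squares_bound[of v 1] vv(2) \<delta> M B(1) in auto)
            then show ?thesis by (simp add: power2_eq_square mult_ac)
          qed
          have "v * (?z\<^sup>2 * (2 * G + E) * v + 2 * ?z * G * H * ?w) = ?z\<^sup>2 * (2 * G + E) * v\<^sup>2 + 2 * ?z * G * H * ?w * v"
            by (simp add: algebra_simps power2_eq_square)
          also have "\<dots> \<le> B\<^sup>2 * (4 / \<delta>) * v\<^sup>2 + B\<^sup>2 * M / \<delta> * (v\<^sup>2 + 1)" using s1 s2 by linarith
          also have "\<dots> \<le> (4 * B\<^sup>2 / \<delta> + B\<^sup>2 * M / \<delta>) * v\<^sup>2 + (4 * B\<^sup>2 / \<delta> + B\<^sup>2 * M / \<delta>)"
          proof -
            have "0 \<le> 4 * B\<^sup>2 / \<delta>" using \<delta> by simp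
            then show ?thesis by (simp add: algebra_simps add_divide_distrib)
          qed
          finally have "n * \<omega> * (v * (?z\<^sup>2 * (2 * G + E) * v + 2 * ?z * G * H * ?w)) \<le>
             n * \<omega> * ((4 * B\<^sup>2 / \<delta> + B\<^sup>2 * M / \<delta>) * v\<^sup>2 + (4 * B\<^sup>2 / \<delta> + B\<^sup>2 * M / \<delta>))"
            using n \<omega> by (intro mult_left_mono) auto
          also have "\<dots> = \<omega> * C\<delta> * v\<^sup>2 + \<omega> * C\<delta>" by (simp add: C\<delta>_def algebra_simps)
          also have "\<dots> \<le> \<omega> * C\<delta> * ((\<zeta>1 x)\<^sup>2 * dV_sq t x) + \<omega> * C\<delta>"
          proof -
            have "x \<in> Sd" using T(7)[OF t xS d'(1)[OF x]] xS by (simp add: Sd_def)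
            then have "1 \<le> (\<zeta>1 x)\<^sup>2" using \<zeta>1(4) by (simp add: one_le_power)
            then have "1 * dV_sq t x \<le> (\<zeta>1 x)\<^sup>2 * dV_sq t x" using dV_sq_nonneg by (intro mult_right_mono) auto
            then show ?thesis using \<omega>C(3) vv by (simp add: mult_left_mono)
          qed
          finally show ?thesis unfolding n' n_def[symmetric] by (simp add: mult.assoc)
        qed
        have T0: "a * (w x * dV_sq t x) = c * c0 * \<kappa> / 2 * ?z\<^sup>2 * G * v\<^sup>2"
          unfolding a_def w_def vv(1) G c H by (simp add: mult_ac)
        have "low x = a * (w x * dV_sq t x) - K - \<omega> * C\<delta> * ((\<zeta>1 x)\<^sup>2 * dV_sq t x) - \<omega> * C\<delta>" using xS by (simp add: low_def)
        then show "low x \<le> c * c0 * \<kappa> / 2 * ?z\<^sup>2 * G * v\<^sup>2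
      - (4 * c * c2\<^sup>2 * G * H\<^sup>2 * ?w\<^sup>2 / (c0 * \<kappa>) + 16 * n'\<^sup>2 * ?z\<^sup>2 * G * ?b\<^sup>2 / (c * c0 * \<kappa>)
         + n'\<^sup>2 * ?z\<^sup>2 * E * ?b\<^sup>2 / (c * c0) + 4 * n' * ?b * ?z * G * H * ?w)
      - n' * \<omega> * v * (?z\<^sup>2 * (2 * G + E) * v + 2 * ?z * G * H * ?w)"
          using T0 T1 T2 T3 T4 T5 unfolding K_def by linarith
      qed (use c0 \<kappa> \<omega> il in auto)
      moreover have "(\<integral>x. low x \<partial>lborel) = a * (\<integral>x. w x * dV_sq t x \<partial>lborel) - K * m - \<omega> * C\<delta> * (\<integral>x. (\<zeta>1 x)\<^sup>2 * dV_sq t x \<partial>lborel) - \<omega> * C\<delta> * m"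
        unfolding low_def m_def using I i1 iS Z(1) by (simp add: borel_compact)
      moreover have "\<omega> * C\<delta> * (\<integral>x. (\<zeta>1 x)\<^sup>2 * dV_sq t x \<partial>lborel) \<le> 1"
        using mult_left_mono[OF C1(4)[OF t(1) t1] \<omega>C(3)] \<omega>C(2) by linarith
      moreover have "\<omega> * C\<delta> * m \<le> m" using mult_right_mono[OF \<omega>C(1) m0] by simp
      ultimately have "a * (\<integral>x. w x * dV_sq t x \<partial>lborel) \<le> K * m + m + 1" by linarith
      then have "(\<integral>x. w x * dV_sq t x \<partial>lborel) \<le> C" unfolding C_def using a by (simp add: le_divide_eq mult.commute)
      then show ?thesis using I gs[OF t] unfolding w_def by blast
    qed
    show "\<exists>t0>0. \<forall>t. 0 < t \<and> t < t0 \<longrightarrow> (\<exists>\<omega> Cb. good_step S N M \<kappa> \<delta> \<omega> Cb t) \<and>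
     integrable lborel (\<lambda>x. (\<zeta> x)\<^sup>2 * (wcut \<delta> \<kappa> (dsq t x) * norm (dq t x) powr (p x - 2)) * dV_sq t x) \<and>
     (\<integral>x. (\<zeta> x)\<^sup>2 * (wcut \<delta> \<kappa> (dsq t x) * norm (dq t x) powr (p x - 2)) * dV_sq t x \<partial>lborel) \<le> C"
    proof -
      have "min t0 t1 > 0" using t0 C1(2) by simp
      then show ?thesis using main by blast
    qed
  qed
qed

section \<open>The equation across the critical set\<close>

text \<open>\<open>\<phi>\<close> times the cutoff is supported off the critical set, so the
  equation holds for it, and the integral equals, up to sign, the term in which the derivative falls
  on the cutoff. That term is the discrete Hessian times \<delta>^\<kappa> and a power of |d|,
  controlled by the weighted energy. \<open>C\<close> does not depend on \<open>\<delta>\<close>;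
  only the range of \<open>t\<close> does.\<close>

lemma cutoff_estimate:
  assumes \<phi>: "C1_supp S \<phi> D\<phi>" and S: "S \<subseteq> \<Omega>"
  shows "\<exists>\<kappa> C. 0 < \<kappa> \<and> (\<forall>\<delta>. 0 < \<delta> \<and> \<delta> \<le> 1 \<longrightarrow> (\<exists>t0>0. \<forall>t. 0 < t \<and> t < t0 \<longrightarrow>
     \<bar>\<integral>x. cut \<delta> \<kappa> (dsq t x) * (flux x \<bullet> D\<phi> x + drift x * \<phi> x) \<partial>lborel\<bar> \<le> C * \<delta> powr \<kappa>))"
proof -
  note F = C1_suppD[OF \<phi>]
  obtain S1 \<zeta> D\<zeta> where \<zeta>: "C1_supp S1 \<zeta> D\<zeta>" "S1 \<subseteq> \<Omega>" "\<And>x. \<zeta> x \<ge> 0" "\<And>x. x \<in> S \<Longrightarrow> \<zeta> x \<ge> 1"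
    using C1_cutoff[OF F(1) open_\<Omega> S] by blast
  note Z = C1_suppD[OF \<zeta>(1)]
  have SS1: "S \<subseteq> S1"
  proof
    fix x assume "x \<in> S"
    then show "x \<in> S1" using \<zeta>(4)[of x] Z(5)[of x] by fastforce
  qed
  obtain N e M p1 p2 \<kappa> where N: "compact N" "N \<subseteq> \<Omega>" "e > 0" "\<And>x. x \<in> S1 \<Longrightarrow> cball x e \<subseteq> N"
    and M: "M \<ge> (2::real)" "\<And>y. y \<in> N \<Longrightarrow> norm (D y) \<le> M - 1" and pN: "\<And>y. y \<in> N \<Longrightarrow> p1 \<le> p y \<and> p y \<le> p2"
    and \<kappa>: "0 < \<kappa>" "\<kappa> \<le> 1" "3 * \<kappa> \<le> p1 - 1" and p12: "1 < p1" "p1 \<le> p2"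
    using local_bounds[OF Z(1) \<zeta>(2)] by metis
  have SN: "S1 \<subseteq> N" using N(3,4) by force
  obtain C where C: "C \<ge> 0" and WB: "\<And>\<delta>. 0 < \<delta> \<Longrightarrow> \<delta> \<le> 1 \<Longrightarrow> (\<exists>t0>0. \<forall>t. 0 < t \<and> t < t0 \<longrightarrow> (\<exists>\<omega> Cb. good_step S1 N M \<kappa> \<delta> \<omega> Cb t) \<and>
     integrable lborel (\<lambda>x. (\<zeta> x)\<^sup>2 * (wcut \<delta> \<kappa> (dsq t x) * norm (dq t x) powr (p x - 2)) * dV_sq t x) \<and>
     (\<integral>x. (\<zeta> x)\<^sup>2 * (wcut \<delta> \<kappa> (dsq t x) * norm (dq t x) powr (p x - 2)) * dV_sq t x \<partial>lborel) \<le> C)"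
    using weighted_energy_bound[OF \<zeta>(1,3,2) N M pN \<kappa> p12] by auto
  obtain B where B: "B \<ge> 0" "\<And>x. \<bar>\<phi> x\<bar> \<le> B" "\<And>x. norm (D\<phi> x) \<le> B" using C1_supp_bound[OF \<phi>] by metis
  define m where "m = measure lborel S"
  define Mp where "Mp = M powr p2"
  define K where "K = B * 2 powr p2 * 2"
  have K: "K \<ge> 0" using B by (simp add: K_def)
  have "\<exists>t0>0. \<forall>t. 0 < t \<and> t < t0 \<longrightarrow>
     \<bar>\<integral>x. cut \<delta> \<kappa> (dsq t x) * (flux x \<bullet> D\<phi> x + drift x * \<phi> x) \<partial>lborel\<bar> \<le> (K * (C + Mp * m)) * \<delta> powr \<kappa>"
    if \<delta>: "0 < \<delta>" "\<delta> \<le> 1" for \<delta>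
  proof -
    obtain t0 where t0: "t0 > 0" and W0: "\<forall>t. 0 < t \<and> t < t0 \<longrightarrow> (\<exists>\<omega> Cb. good_step S1 N M \<kappa> \<delta> \<omega> Cb t) \<and>
     integrable lborel (\<lambda>x. (\<zeta> x)\<^sup>2 * (wcut \<delta> \<kappa> (dsq t x) * norm (dq t x) powr (p x - 2)) * dV_sq t x) \<and>
     (\<integral>x. (\<zeta> x)\<^sup>2 * (wcut \<delta> \<kappa> (dsq t x) * norm (dq t x) powr (p x - 2)) * dV_sq t x \<partial>lborel) \<le> C"
      using WB[OF \<delta>] by blast
    have "\<bar>\<integral>x. cut \<delta> \<kappa> (dsq t x) * (flux x \<bullet> D\<phi> x + drift x * \<phi> x) \<partial>lborel\<bar> \<le> (K * (C + Mp * m)) * \<delta> powr \<kappa>"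
      if t: "0 < t" "t < t0" for t
    proof -
      obtain \<omega> Cb where gs: "good_step S1 N M \<kappa> \<delta> \<omega> Cb t" using W0 t by blast
      define w where "w x = (\<zeta> x)\<^sup>2 * (wcut \<delta> \<kappa> (dsq t x) * norm (dq t x) powr (p x - 2)) * dV_sq t x" for x
      have wi: "integrable lborel w" "(\<integral>x. w x \<partial>lborel) \<le> C" using W0 t unfolding w_def by auto
      note T = good_stepD[OF gs]
      let ?W = "\<lambda>x. \<Sum>k\<in>Basis. (dq t x \<bullet> k) *\<^sub>R dV t k x"
      have cg: "C1_grad (shiftdom t) (\<lambda>x. cut \<delta> \<kappa> (dsq t x)) (\<lambda>x. cut' \<delta> \<kappa> (dsq t x) *\<^sub>R (2 *\<^sub>R ?W x))"
        by (rule C1_grad_chain[OF dsq_C1 cut_deriv[OF \<delta>(1) \<kappa>(1)] cut'_cont[OF \<delta>(1) \<kappa>(1)]])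
      have Ssd: "S \<subseteq> shiftdom t" using SS1 T(1) by auto
      define S' where "S' = {x \<in> S. \<delta> \<le> norm (dq t x)}"
      have S': "compact S'" unfolding S'_def by (rule large_gradient_compact[OF F(1) Ssd])
      have S'r: "S' \<subseteq> regular"
      proof
        fix x assume "x \<in> S'"
        then have x: "x \<in> S1" "\<delta> \<le> norm (dq t x)" using SS1 by (auto simp: S'_def)
        then show "x \<in> regular" using T(7)[OF x] \<delta> \<zeta>(2) by (auto simp: regular_def)
      qed
      have coff: "cut \<delta> \<kappa> (dsq t x) = 0 \<and> cut' \<delta> \<kappa> (dsq t x) = 0" if "x \<in> S" "x \<notin> S'" for x
      proof -
        have "norm (dq t x) < \<delta>" using that by (auto simp: S'_def)
        then have "dsq t x \<le> \<delta>\<^sup>2" unfolding dsq_norm by (intro power_mono) auto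
        then show ?thesis using cut_zero[OF \<delta>(1) \<kappa>(1)] by auto
      qed
      let ?f = "\<lambda>x. cut \<delta> \<kappa> (dsq t x) * \<phi> x" and ?D = "\<lambda>x. \<phi> x *\<^sub>R (cut' \<delta> \<kappa> (dsq t x) *\<^sub>R (2 *\<^sub>R ?W x)) + cut \<delta> \<kappa> (dsq t x) *\<^sub>R D\<phi> x"
      have f0: "C1_supp S ?f ?D" by (rule C1_supp_mult[OF open_shiftdom cg \<phi> Ssd])
      have f: "C1_supp S' ?f ?D"
        by (rule C1_supp_restrict[OF f0 S']) (metis coff F(5) mult_eq_0_iff)
      define R where "R x = \<phi> x * cut' \<delta> \<kappa> (dsq t x) * 2 * (flux x \<bullet> ?W x)" for x
      define f1 where "f1 x = flux x \<bullet> D\<phi> x + drift x * \<phi> x" for x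
      have S'\<Omega>: "S' \<subseteq> \<Omega>" using S'r regular_sub by auto
      have "(\<integral>x. flux x \<bullet> ?D x + drift x * ?f x \<partial>lborel) = 0" using wform_eq_0_on_regular[OF f S'r] unfolding wform_def .
      moreover have eqx: "flux x \<bullet> ?D x + drift x * ?f x = R x + cut \<delta> \<kappa> (dsq t x) * f1 x" for x
        by (simp add: R_def f1_def inner_add_right algebra_simps)
      ultimately have eq0: "(\<integral>x. R x + cut \<delta> \<kappa> (dsq t x) * f1 x \<partial>lborel) = 0" by simp
      have cutm: "(\<lambda>x. cut \<delta> \<kappa> (dsq t x)) \<in> borel_measurable borel"
      proof -
        have "continuous_on UNIV (cut \<delta> \<kappa>)" using cut_deriv[OF \<delta>(1) \<kappa>(1)] by (meson DERIV_isCont continuous_at_imp_continuous_on)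
        then have "cut \<delta> \<kappa> \<in> borel_measurable borel" by (rule borel_measurable_continuous_onI)
        then show ?thesis using dsq_borel measurable_compose by blast
      qed
      have f1i: "integrable lborel f1" unfolding f1_def by (rule wform_integrable(3)[OF \<phi> S])
      have ci: "integrable lborel (\<lambda>x. cut \<delta> \<kappa> (dsq t x) * f1 x)"
      proof (rule Bochner_Integration.integrable_bound[OF f1i])
        show "(\<lambda>x. cut \<delta> \<kappa> (dsq t x) * f1 x) \<in> borel_measurable lborel" using cutm f1i by auto
        show "AE x in lborel. norm (cut \<delta> \<kappa> (dsq t x) * f1 x) \<le> norm (f1 x)"
          using cut_bounds(1,2)[OF \<delta>(1) \<kappa>(1)] by (intro AE_I2) (auto simp: abs_mult intro!: mult_left_le_one_le)
      qed
      have Ri: "integrable lborel R"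
      proof -
        have "integrable lborel (\<lambda>x. R x + cut \<delta> \<kappa> (dsq t x) * f1 x)"
          using wform_integrable(3)[OF f S'\<Omega>] unfolding eqx .
        from Bochner_Integration.integrable_diff[OF this ci] show ?thesis by simp
      qed
      have "(\<integral>x. cut \<delta> \<kappa> (dsq t x) * f1 x \<partial>lborel) = - (\<integral>x. R x \<partial>lborel)" using eq0 Ri ci by simp
      then have "\<bar>\<integral>x. cut \<delta> \<kappa> (dsq t x) * f1 x \<partial>lborel\<bar> = \<bar>\<integral>x. R x \<partial>lborel\<bar>" by simp
      also have "\<dots> \<le> (\<integral>x. \<bar>R x\<bar> \<partial>lborel)" by (rule integral_abs_bound)
      also have "\<dots> \<le> (\<integral>x. (K * \<delta> powr \<kappa>) * (w x + Mp * indicator S x) \<partial>lborel)"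
      proof (rule integral_mono)
        show "integrable lborel (\<lambda>x. (K * \<delta> powr \<kappa>) * (w x + Mp * indicator S x))"
          using wi(1) integrable_indicator_compact[OF F(1)] by auto
        fix x
        have w0: "0 \<le> w x" unfolding w_def using wcut_props(2)[OF \<delta>(1) \<kappa>(1) \<delta>(1)] dV_sq_nonneg by (intro mult_nonneg_nonneg) auto
        have Mp0: "0 \<le> Mp" by (simp add: Mp_def)
        show "\<bar>R x\<bar> \<le> (K * \<delta> powr \<kappa>) * (w x + Mp * indicator S x)"
        proof (cases "x \<in> S'")
          case False
          then have "R x = 0" using coff[of x] F(5)[of x] by (cases "x \<in> S") (auto simp: R_def)
          then show ?thesis using w0 Mp0 K by simp
        next
          case True
          then have xS: "x \<in> S" "x \<in> S1" and Hd: "\<delta> \<le> norm (dq t x)" using SS1 by (auto simp: S'_def)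
          define H where "H = norm (dq t x)"
          have H: "H > 0" "H \<le> M" using Hd \<delta> T(3)[OF xS(2)] by (auto simp: H_def intro: less_le_trans)
          have px: "p1 \<le> p x" "p x \<le> p2" using pN SN xS by auto
          define v where "v = sqrt (dV_sq t x)"
          have v: "v \<ge> 0" "v\<^sup>2 = dV_sq t x" using dV_sq_nonneg[of t x] by (auto simp: v_def)
          have Wn: "norm (?W x) \<le> H * v"
          proof (rule power2_le_imp_le)
            show "(norm (?W x))\<^sup>2 \<le> (H * v)\<^sup>2"
              unfolding power_mult_distrib v(2) dV_sq_def H_def by (rule weighted_sum_square_le)
          qed (use H v in auto)
          have fl: "norm (flux x) \<le> 2 powr p2 * H powr (p x - 1)"
          proof -
            have "norm (flux x) \<le> (2 * H) powr (p x - 1)"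
              unfolding flux_def norm_plap_flux using T(8)[OF xS(2) Hd] px p12 by (intro powr_mono2) (auto simp: H_def)
            also have "\<dots> = 2 powr (p x - 1) * H powr (p x - 1)" using H by (simp add: powr_mult)
            also have "\<dots> \<le> 2 powr p2 * H powr (p x - 1)" using px by (intro mult_right_mono powr_mono) auto
            finally show ?thesis .
          qed
          define q where "q = sqrt (cut \<delta> \<kappa> (H\<^sup>2))"
          have q: "q \<ge> 0" "q\<^sup>2 = cut \<delta> \<kappa> (H\<^sup>2)" using cut_bounds(1)[OF \<delta>(1) \<kappa>(1)] by (auto simp: q_def)
          \<comment> \<open>The bound that keeps q = sqrt(cut): a bound without it could not be
            compared with the energy, whose weight also vanishes at |d| = \<delta>.\<close>
          have c': "cut' \<delta> \<kappa> (H\<^sup>2) \<le> q * (\<delta> powr \<kappa> * H powr (- \<kappa>)) / H\<^sup>2"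
          proof -
            have r: "(\<delta>\<^sup>2 / H\<^sup>2) powr (\<kappa> / 2) = \<delta> powr \<kappa> * H powr (- \<kappa>)"
            proof -
              have "(\<delta>\<^sup>2 / H\<^sup>2) powr (\<kappa> / 2) = (\<delta>\<^sup>2) powr (\<kappa> / 2) / (H\<^sup>2) powr (\<kappa> / 2)" by (rule powr_divide)
              also have "\<dots> = \<delta> powr \<kappa> / H powr \<kappa>" using sq_powr_half[of \<delta> \<kappa>] sq_powr_half[of H \<kappa>] \<delta> H by simp
              finally show ?thesis by (simp add: powr_minus_divide)
            qed
            have "cut' \<delta> \<kappa> (H\<^sup>2) \<le> \<kappa> * (q * (\<delta> powr \<kappa> * H powr (- \<kappa>))) / H\<^sup>2"
              using cut_bounds(5)[OF \<delta>(1) \<kappa>(1), of "H\<^sup>2"] H unfolding r q_def by simp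
            also have "\<dots> \<le> 1 * (q * (\<delta> powr \<kappa> * H powr (- \<kappa>))) / H\<^sup>2"
              using \<kappa>(2) q(1) by (intro divide_right_mono mult_right_mono) auto
            finally show ?thesis by simp
          qed
          have c'0: "0 \<le> cut' \<delta> \<kappa> (H\<^sup>2)" by (rule cut_bounds(3)[OF \<delta>(1) \<kappa>(1)])
          have fw: "\<bar>flux x \<bullet> ?W x\<bar> \<le> (2 powr p2 * H powr (p x - 1)) * (H * v)"
          proof -
            have "\<bar>flux x \<bullet> ?W x\<bar> \<le> norm (flux x) * norm (?W x)" by (rule Cauchy_Schwarz_ineq2)
            also have "\<dots> \<le> (2 powr p2 * H powr (p x - 1)) * (H * v)" using fl Wn by (intro mult_mono) auto
            finally show ?thesis .
          qed
          have "\<bar>R x\<bar> = \<bar>\<phi> x\<bar> * cut' \<delta> \<kappa> (H\<^sup>2) * 2 * \<bar>flux x \<bullet> ?W x\<bar>"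
            using c'0 by (simp add: R_def abs_mult dsq_norm H_def)
          also have "\<dots> \<le> B * (q * (\<delta> powr \<kappa> * H powr (- \<kappa>)) / H\<^sup>2) * 2 * ((2 powr p2 * H powr (p x - 1)) * (H * v))"
            using B(1) B(2)[of x] c' c'0 fw q(1)
            by (intro mult_mono[of "\<bar>\<phi> x\<bar> * cut' \<delta> \<kappa> (H\<^sup>2) * 2"] mult_right_mono mult_mono[of "\<bar>\<phi> x\<bar>"]) auto
          also have "\<dots> = K * \<delta> powr \<kappa> * (q * v * (H powr (- \<kappa>) * H powr (p x - 1) * H / H\<^sup>2))"
            unfolding K_def by (simp add: field_simps)
          also have "H powr (- \<kappa>) * H powr (p x - 1) * H / H\<^sup>2 = H powr (p x - 2 - \<kappa>)"
          proof -
            have "H / H\<^sup>2 = H powr (- 1)" using H by (simp add: powr_minus_divide power2_eq_square)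
            then have "H powr (- \<kappa>) * H powr (p x - 1) * H / H\<^sup>2 = H powr (- \<kappa>) * H powr (p x - 1) * H powr (- 1)"
              by (simp only: times_divide_eq_right[symmetric])
            also have "\<dots> = H powr (p x - 2 - \<kappa>)" unfolding powr_add[symmetric] by (simp add: algebra_simps)
            finally show ?thesis .
          qed
          also have "K * \<delta> powr \<kappa> * (q * v * H powr (p x - 2 - \<kappa>)) \<le> K * \<delta> powr \<kappa> * (w x + Mp * indicator S x)"
          proof (rule mult_left_mono)
            \<comment> \<open>Splits the exponent: p - 2 - \<kappa> is the mean of p - 3 + \<kappa>,
              the exponent of the energy weight, and p - 1 - 3 \<kappa>, which is nonnegative. The
              factor \<open>q\<close> goes into \<open>A\<close>, so that its square carries the
              full cutoff.\<close>
            define A where "A = q * v * H powr ((p x - 3 + \<kappa>) / 2)"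
            define A2 where "A2 = H powr ((p x - 1 - 3 * \<kappa>) / 2)"
            have AA: "A * A2 = q * v * H powr (p x - 2 - \<kappa>)"
            proof -
              have "A * A2 = q * v * (H powr ((p x - 3 + \<kappa>) / 2) * H powr ((p x - 1 - 3 * \<kappa>) / 2))" by (simp add: A_def A2_def)
              also have "H powr ((p x - 3 + \<kappa>) / 2) * H powr ((p x - 1 - 3 * \<kappa>) / 2) = H powr (p x - 2 - \<kappa>)"
                unfolding powr_add[symmetric] by (rule arg_cong[of _ _ "(powr) H"]) (simp add: field_simps)
              finally show ?thesis .
            qed
            have pw2: "(H powr (s / 2))\<^sup>2 = H powr s" for s :: real
              unfolding power2_eq_square powr_add[symmetric] by simp
            have A2s: "A2\<^sup>2 \<le> Mp"
              unfolding A2_def pw2 Mp_def by (rule powr_le_bound) (use H M px \<kappa> in auto)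
            have As: "A\<^sup>2 \<le> w x"
            proof -
              have "A\<^sup>2 = cut \<delta> \<kappa> (H\<^sup>2) * dV_sq t x * H powr (p x - 3 + \<kappa>)" by (simp add: A_def power_mult_distrib q(2) v(2) pw2)
              also have "H powr (p x - 3 + \<kappa>) = H powr (\<kappa> - 1) * H powr (p x - 2)" unfolding powr_add[symmetric] by (simp add: algebra_simps)
              also have "cut \<delta> \<kappa> (H\<^sup>2) * dV_sq t x * (H powr (\<kappa> - 1) * H powr (p x - 2)) = 1 * (wcut \<delta> \<kappa> (H\<^sup>2) * H powr (p x - 2) * dV_sq t x)"
                unfolding wcut_props(1)[OF \<delta>(1) \<kappa>(1) H(1)] by simp
              also have "\<dots> \<le> (\<zeta> x)\<^sup>2 * (wcut \<delta> \<kappa> (H\<^sup>2) * H powr (p x - 2) * dV_sq t x)"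
                using \<zeta>(4)[OF xS(1)] wcut_props(2)[OF \<delta>(1) \<kappa>(1) \<delta>(1)] dV_sq_nonneg
                by (intro mult_right_mono) (auto simp: one_le_power)
              finally show ?thesis by (simp add: w_def H_def dsq_norm mult.assoc)
            qed
            have A0: "0 \<le> A" "0 \<le> A2" using q v by (auto simp: A_def A2_def)
            have "2 * A * A2 \<le> A\<^sup>2 + A2\<^sup>2" by (rule sum_squares_bound)
            moreover have "0 \<le> A * A2" using A0 by simp
            ultimately have "A * A2 \<le> w x + Mp" using As A2s by linarith
            then show "q * v * H powr (p x - 2 - \<kappa>) \<le> w x + Mp * indicator S x" unfolding AA using xS by simp
          qed (use K in auto)
          finally show ?thesis .
        qed
      qed (use Ri in auto)
      also have "\<dots> = (K * \<delta> powr \<kappa>) * ((\<integral>x. w x \<partial>lborel) + Mp * m)"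
        using wi(1) integrable_indicator_compact[OF F(1)] F(1) by (simp add: m_def borel_compact)
      also have "\<dots> \<le> (K * \<delta> powr \<kappa>) * (C + Mp * m)" using wi(2) K by (intro mult_left_mono) auto
      finally show ?thesis by (simp add: f1_def mult_ac)
    qed
    then show ?thesis using t0 by blast
  qed
  then show ?thesis using \<kappa>(1) by blast
qed

text \<open>Two limits in this order: \<open>t\<close> to 0 for fixed \<open>\<delta>\<close>, where
  the discrete gradient converges to \<open>D\<close>, and then \<open>\<delta>\<close> to 0, where
  the right side \<delta>^\<kappa> disappears and the cutoff tends to 1 off the critical
  set.\<close>

lemma wform_eq_0:
  assumes \<phi>: "C1_supp S \<phi> D\<phi>" and S: "S \<subseteq> \<Omega>"
  shows "wform \<phi> D\<phi> = 0"
proof -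
  note F = C1_suppD[OF \<phi>]
  define f where "f x = flux x \<bullet> D\<phi> x + drift x * \<phi> x" for x
  have fi: "integrable lborel f" unfolding f_def by (rule wform_integrable(3)[OF \<phi> S])
  \<comment> \<open>Flux and drift vanish with \<open>D\<close>, so the critical set contributes
    nothing to the weak form even if it has positive measure.\<close>
  have fz: "x \<in> S \<and> D x \<noteq> 0" if "f x \<noteq> 0" for x
    using that F(5,6)[of x] by (cases "x \<in> S") (auto simp: f_def flux_def plap_flux_def drift_def)
  obtain \<kappa> C where \<kappa>: "0 < \<kappa>" and est: "\<forall>\<delta>. 0 < \<delta> \<and> \<delta> \<le> 1 \<longrightarrow> (\<exists>t0>0. \<forall>t. 0 < t \<and> t < t0 \<longrightarrow>
     \<bar>\<integral>x. cut \<delta> \<kappa> (dsq t x) * f x \<partial>lborel\<bar> \<le> C * \<delta> powr \<kappa>)"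
    using cutoff_estimate[OF \<phi> S] unfolding f_def by blast
  \<comment> \<open>The scale \<open>T\<close> is free so that, for each \<open>\<delta>\<close>,
    the whole sequence of steps can be kept below the threshold of
    \<open>cutoff_estimate\<close>.\<close>
  have dqlim: "((\<lambda>n. dq (T / real (Suc n)) x) \<longlonglongrightarrow> D x)" if x: "x \<in> \<Omega>" and T: "T > 0" for x T
  proof -
    obtain e where e: "e > 0" "cball x e \<subseteq> \<Omega>" using open_\<Omega> x open_contains_cball by blast
    show ?thesis
    proof (rule LIMSEQ_I)
      fix r :: real assume r: "r > 0"
      obtain t0 where t0: "t0 > 0" "\<And>t. 0 < t \<Longrightarrow> t < t0 \<Longrightarrow> norm (dq t x - D x) \<le> r / 2"
        using dq_uniform[of "{x}" "cball x e" e "r / 2"] e x r by (auto simp: Ball_def)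
      obtain n0 :: nat where n0: "T / t0 < real n0" using reals_Archimedean2 by blast
      show "\<exists>no. \<forall>n\<ge>no. norm (dq (T / real (Suc n)) x - D x) < r"
      proof (intro exI[of _ n0] allI impI)
        fix n assume "n \<ge> n0"
        then have "T / t0 < real (Suc n)" using n0 by linarith
        then have "T / real (Suc n) < t0" using t0(1) by (simp add: divide_less_eq mult.commute)
        then have "norm (dq (T / real (Suc n)) x - D x) \<le> r / 2" using t0(2) T by simp
        then show "norm (dq (T / real (Suc n)) x - D x) < r" using r by linarith
      qed
    qed
  qed
  have cutc: "isCont (cut \<delta> \<kappa>) Q" if "\<delta> > 0" for \<delta> Q using cut_deriv[OF that \<kappa>] DERIV_isCont by blast
  have cutm: "cut \<delta> \<kappa> \<in> borel_measurable borel" if "\<delta> > 0" for \<delta>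
    using cutc[OF that] by (intro borel_measurable_continuous_onI continuous_at_imp_continuous_on) auto
  have step: "\<bar>\<integral>x. cut \<delta> \<kappa> (D x \<bullet> D x) * f x \<partial>lborel\<bar> \<le> C * \<delta> powr \<kappa>" if \<delta>: "0 < \<delta>" "\<delta> \<le> 1" for \<delta>
  proof -
    obtain t0 where t0: "t0 > 0" "\<And>t. 0 < t \<Longrightarrow> t < t0 \<Longrightarrow> \<bar>\<integral>x. cut \<delta> \<kappa> (dsq t x) * f x \<partial>lborel\<bar> \<le> C * \<delta> powr \<kappa>"
      using est \<delta> by blast
    define T where "T = t0 / 2"
    have T: "T > 0" "T < t0" using t0(1) by (auto simp: T_def)
    have "(\<lambda>n. \<integral>x. cut \<delta> \<kappa> (dsq (T / real (Suc n)) x) * f x \<partial>lborel) \<longlonglongrightarrow> (\<integral>x. cut \<delta> \<kappa> (D x \<bullet> D x) * f x \<partial>lborel)"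
    proof (rule integral_dominated_convergence[where w = "\<lambda>x. \<bar>f x\<bar>"])
      show "(\<lambda>x. cut \<delta> \<kappa> (D x \<bullet> D x) * f x) \<in> borel_measurable lborel"
      proof -
        have "(\<lambda>x. D x \<bullet> D x) \<in> borel_measurable borel" using D_borel by auto
        then have "(\<lambda>x. cut \<delta> \<kappa> (D x \<bullet> D x)) \<in> borel_measurable borel" using cutm[OF \<delta>(1)] measurable_compose by blast
        then show ?thesis using fi by auto
      qed
      show "(\<lambda>x. cut \<delta> \<kappa> (dsq (T / real (Suc n)) x) * f x) \<in> borel_measurable lborel" for n
      proof -
        have "(\<lambda>x. cut \<delta> \<kappa> (dsq (T / real (Suc n)) x)) \<in> borel_measurable borel" using cutm[OF \<delta>(1)] dsq_borel measurable_compose by blast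
        then show ?thesis using fi by auto
      qed
      show "AE x in lborel. (\<lambda>n. cut \<delta> \<kappa> (dsq (T / real (Suc n)) x) * f x) \<longlonglongrightarrow> cut \<delta> \<kappa> (D x \<bullet> D x) * f x"
      proof (intro AE_I2)
        fix x
        show "(\<lambda>n. cut \<delta> \<kappa> (dsq (T / real (Suc n)) x) * f x) \<longlonglongrightarrow> cut \<delta> \<kappa> (D x \<bullet> D x) * f x"
        proof (cases "f x = 0")
          case False
          then have "x \<in> \<Omega>" using fz S by auto
          from dqlim[OF this T(1)] have "(\<lambda>n. dsq (T / real (Suc n)) x) \<longlonglongrightarrow> D x \<bullet> D x"
            unfolding dsq_def by (intro tendsto_inner)
          then have "(\<lambda>n. cut \<delta> \<kappa> (dsq (T / real (Suc n)) x)) \<longlonglongrightarrow> cut \<delta> \<kappa> (D x \<bullet> D x)"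
            by (rule isCont_tendsto_compose[OF cutc[OF \<delta>(1)]])
          then show ?thesis by (intro tendsto_intros)
        qed simp
      qed
      show "AE x in lborel. norm (cut \<delta> \<kappa> (dsq (T / real (Suc n)) x) * f x) \<le> \<bar>f x\<bar>" for n
        using cut_bounds(1,2)[OF \<delta>(1) \<kappa>] by (intro AE_I2) (auto simp: abs_mult intro!: mult_left_le_one_le)
    qed (use fi in auto)
    from tendsto_rabs[OF this] show ?thesis
    proof (rule LIMSEQ_le_const2)
      show "\<exists>N. \<forall>n\<ge>N. \<bar>\<integral>x. cut \<delta> \<kappa> (dsq (T / real (Suc n)) x) * f x \<partial>lborel\<bar> \<le> C * \<delta> powr \<kappa>"
      proof (intro exI[of _ 0] allI impI t0(2))
        fix n
        show "0 < T / real (Suc n)" using T by simp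
        have "T / real (Suc n) \<le> T" using T by (simp add: divide_le_eq mult_le_cancel_left1)
        then show "T / real (Suc n) < t0" using T by linarith
      qed
    qed
  qed
  let ?d = "\<lambda>n. 1 / real (Suc n)"
  have "(\<lambda>n. \<integral>x. cut (?d n) \<kappa> (D x \<bullet> D x) * f x \<partial>lborel) \<longlonglongrightarrow> (\<integral>x. f x \<partial>lborel)"
  proof (rule integral_factor_tendsto[OF fi])
    show "(\<lambda>x. cut (?d n) \<kappa> (D x \<bullet> D x)) \<in> borel_measurable borel" for n
    proof -
      have "(\<lambda>x. D x \<bullet> D x) \<in> borel_measurable borel" using D_borel by auto
      then show ?thesis using cutm[of "?d n"] measurable_compose by fastforce
    qed
    show "\<bar>cut (?d n) \<kappa> (D x \<bullet> D x)\<bar> \<le> 1" for n x using cut_bounds(1,2)[of "?d n" \<kappa>] \<kappa> by simp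
    have "(\<lambda>n. cut (?d n) \<kappa> Q) \<longlonglongrightarrow> 1" if Q: "Q > 0" for Q
    proof -
      have "(\<lambda>n. 1 / real (Suc n)) \<longlonglongrightarrow> 0" using LIMSEQ_inverse_real_of_nat by (simp add: inverse_eq_divide)
      then have "(\<lambda>n. (?d n)\<^sup>2 / Q) \<longlonglongrightarrow> 0\<^sup>2 / Q" using Q by (intro tendsto_intros) auto
      then have "(\<lambda>n. ((?d n)\<^sup>2 / Q) powr (\<kappa> / 2)) \<longlonglongrightarrow> (0\<^sup>2 / Q) powr (\<kappa> / 2)"
        using Q \<kappa> by (intro tendsto_powr') (auto simp: eventually_sequentially)
      then have "(\<lambda>n. (max 0 (1 - ((?d n)\<^sup>2 / Q) powr (\<kappa> / 2)))\<^sup>2) \<longlonglongrightarrow> (max 0 (1 - (0\<^sup>2 / Q) powr (\<kappa> / 2)))\<^sup>2"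
        by (intro tendsto_power tendsto_max tendsto_diff tendsto_const)
      then show ?thesis using Q by (simp add: cut_def)
    qed
    then show "AE x in lborel. f x \<noteq> 0 \<longrightarrow> (\<lambda>n. cut (?d n) \<kappa> (D x \<bullet> D x)) \<longlonglongrightarrow> 1"
      using fz by (intro AE_I2) auto
  qed
  from tendsto_rabs[OF this] have l1: "(\<lambda>n. \<bar>\<integral>x. cut (?d n) \<kappa> (D x \<bullet> D x) * f x \<partial>lborel\<bar>) \<longlonglongrightarrow> \<bar>\<integral>x. f x \<partial>lborel\<bar>" .
  have l2: "(\<lambda>n. C * (?d n) powr \<kappa>) \<longlonglongrightarrow> C * 0"
  proof (intro tendsto_mult tendsto_const)
    have "(\<lambda>n. 1 / real (Suc n)) \<longlonglongrightarrow> 0" using LIMSEQ_inverse_real_of_nat by (simp add: inverse_eq_divide)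
    then have "(\<lambda>n. (?d n) powr \<kappa>) \<longlonglongrightarrow> 0 powr \<kappa>" using \<kappa> by (intro tendsto_powr') (auto simp: eventually_sequentially)
    then show "(\<lambda>n. (?d n) powr \<kappa>) \<longlonglongrightarrow> 0" by simp
  qed
  have "\<bar>\<integral>x. f x \<partial>lborel\<bar> \<le> C * 0"
    by (rule LIMSEQ_le[OF l1 l2]) (use step in auto)
  then show ?thesis by (simp add: wform_def f_def)
qed

end

section \<open>Sobolev test functions\<close>

lemma set_integral_AE_lborel:
  fixes f :: "'a::euclidean_space \<Rightarrow> real"
  assumes g: "integrable lborel g" and ae: "AE x in lebesgue. g x = indicator U x * f x"
  shows "set_integrable lebesgue U f" "(LINT x:U|lebesgue. f x) = (\<integral>x. g x \<partial>lborel)"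
proof -
  have gm: "g \<in> borel_measurable lborel" using g by auto
  then have gl: "g \<in> borel_measurable lebesgue" by (rule measurable_completion)
  have fm: "(\<lambda>x. indicator U x * f x) \<in> borel_measurable lebesgue" by (rule borel_measurable_AE[OF gl ae])
  have gi: "integrable lebesgue g" using integrable_completion[OF gm] g by simp
  show "set_integrable lebesgue U f"
    unfolding set_integrable_def using integrable_cong_AE_imp[OF gi, of "\<lambda>x. indicator U x * f x"] fm ae by (simp add: eq_commute)
  have "(\<integral>x. g x \<partial>lborel) = (\<integral>x. g x \<partial>lebesgue)" using integral_completion[OF gm] by simp
  also have "\<dots> = (\<integral>x. indicator U x * f x \<partial>lebesgue)" by (rule integral_cong_AE[OF gl fm ae])
  finally show "(LINT x:U|lebesgue. f x) = (\<integral>x. g x \<partial>lborel)" by (simp add: set_lebesgue_integral_def)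
qed

lemma C1_W1var_loc:
  fixes u p :: "'a::euclidean_space \<Rightarrow> real"
  assumes U: "open U" and u: "C1_grad U u D" and p: "continuous_on U p" "\<And>x. x \<in> U \<Longrightarrow> 0 \<le> p x"
  shows "W1var_loc p U u"
  unfolding W1var_loc_def W1var_def W1var_grad_def
proof (intro allI impI exI[of _ D] conjI)
  fix V assume V: "open V \<and> compactly_in V U"
  then have K: "compact (closure V)" "closure V \<subseteq> U" by (auto simp: compactly_in_def)
  have VU: "V \<subseteq> U" using K closure_subset by blast
  have Vl: "V \<in> sets lebesgue" using V by auto
  have bnd: "bounded (f ` closure V)" if "continuous_on U f" for f :: "'a \<Rightarrow> 'c::real_normed_vector"
    using compact_imp_bounded[OF compact_continuous_image[OF continuous_on_subset[OF that K(2)] K(1)]] .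
  obtain c where c: "\<And>x. x \<in> closure V \<Longrightarrow> p x \<le> c" using bnd[OF p(1)] by (auto simp: bounded_iff abs_le_iff)
  obtain a where a: "\<And>x. x \<in> closure V \<Longrightarrow> norm (u x) \<le> a" using bnd[OF C1_gradD(3)[OF u]] by (auto simp: bounded_iff)
  obtain b where b: "\<And>x. x \<in> closure V \<Longrightarrow> norm (D x) \<le> b" using bnd[OF C1_gradD(2)[OF u]] by (auto simp: bounded_iff)
  have pb: "0 \<le> p x \<and> p x \<le> c" if "x \<in> closure V" for x using c[OF that] p(2) K(2) that by auto
  have "u \<in> borel_measurable (lebesgue_on V)" "D \<in> borel_measurable (lebesgue_on V)"
    using continuous_imp_measurable_on_sets_lebesgue[OF _ Vl] continuous_on_subset[OF C1_gradD(3)[OF u] VU]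
      continuous_on_subset[OF C1_gradD(2)[OF u] VU] by auto
  then show "Lvar p V u" "Lvar p V D"
    using Lvar_bounded[OF _ K(1), of u V a p c] Lvar_bounded[OF _ K(1), of D V b p c] a b pb closure_subset[of V] by auto
  show "weak_gradient V u D" using C1_weak_gradient[OF _ C1_grad_subset[OF u VU]] V by auto
qed

context plap_setting
begin

lemma wform_add:
  assumes "C1_supp S \<phi> D\<phi>" "C1_supp S \<psi> D\<psi>" "S \<subseteq> \<Omega>"
  shows "wform (\<lambda>x. \<phi> x + \<psi> x) (\<lambda>x. D\<phi> x + D\<psi> x) = wform \<phi> D\<phi> + wform \<psi> D\<psi>"
proof -
  have "wform (\<lambda>x. \<phi> x + \<psi> x) (\<lambda>x. D\<phi> x + D\<psi> x) = (\<integral>x. (flux x \<bullet> D\<phi> x + drift x * \<phi> x) + (flux x \<bullet> D\<psi> x + drift x * \<psi> x) \<partial>lborel)"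
    unfolding wform_def by (intro Bochner_Integration.integral_cong) (auto simp: inner_add_right algebra_simps)
  also have "\<dots> = wform \<phi> D\<phi> + wform \<psi> D\<psi>"
    unfolding wform_def by (rule Bochner_Integration.integral_add[OF wform_integrable(3)[OF assms(1,3)] wform_integrable(3)[OF assms(2,3)]])
  finally show ?thesis .
qed

text \<open>The integrand is odd in the gradient: the logarithm and the powers see only its length.
  This gives the sign in the second claim, used for the subsolution inequality.\<close>

lemma strong_integrand_eq:
  assumes "q x = p x"
  shows "strong_plap_integrand q P D \<phi> D\<phi> x = flux x \<bullet> D\<phi> x + drift x * \<phi> x"
    "strong_plap_integrand q P (\<lambda>x. - D x) \<phi> D\<phi> x = - (flux x \<bullet> D\<phi> x + drift x * \<phi> x)"
  using assms by (simp_all add: strong_plap_integrand_def flux_def plap_flux_def drift_def)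

end

lemma strong_plap_integrand_cong:
  "Dp x = Dp' x \<Longrightarrow> Du x = Du' x \<Longrightarrow> D\<phi> x = D\<phi>' x \<Longrightarrow> \<phi> x = \<phi>' x \<Longrightarrow>
    strong_plap_integrand p Dp Du \<phi> D\<phi> x = strong_plap_integrand p Dp' Du' \<phi>' D\<phi>' x"
  by (simp add: strong_plap_integrand_def)

text \<open>Translates between the weak formulation and the locales. The final extension to Sobolev
  test functions needs only L1 convergence of the mollified functions and gradients, since flux and
  drift are bounded on compact sets.\<close>

lemma weak_supersolution_across_level_set:
  fixes \<Omega> :: "'a::euclidean_space set" and p u :: "'a \<Rightarrow> real"
  assumes \<Omega>: "open \<Omega>" "bounded \<Omega>" and p1: "\<forall>x\<in>\<Omega>. 1 < p x" and pl: "L-lipschitz_on \<Omega> p"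
    and u: "C1_on \<Omega> u" and sol: "weak_solution p {x\<in>\<Omega>. u x \<noteq> 0} u"
  shows "weak_supersolution p \<Omega> u"
proof -
  obtain Df where Df: "\<forall>x\<in>\<Omega>. has_gradient u (Df x) x" "continuous_on \<Omega> Df"
    using u unfolding C1_on_def by blast
  define D where "D x = (if x \<in> \<Omega> then Df x else 0)" for x
  \<comment> \<open>The values of \<open>u\<close> and \<open>p\<close> outside the domain are
    arbitrary; the extensions by zero are Borel on the whole space and agree with them where it
    matters.\<close>
  define u0 where "u0 x = indicator \<Omega> x *\<^sub>R u x" for x
  define p0 where "p0 x = indicator \<Omega> x *\<^sub>R p x" for x
  have Dc: "continuous_on \<Omega> D" by (rule continuous_on_eq[OF Df(2)]) (simp add: D_def)
  have uD: "C1_grad \<Omega> u D" using Df(1) Dc by (simp add: C1_grad_def D_def)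
  have u0D: "C1_grad \<Omega> u0 D" unfolding C1_grad_def
  proof (intro conjI ballI Dc)
    fix x assume x: "x \<in> \<Omega>"
    show "has_gradient u0 (D x) x"
      by (rule has_derivative_transform_within_open[OF C1_gradD(1)[OF uD x] \<Omega>(1) x]) (simp add: u0_def)
  qed
  have pc: "continuous_on \<Omega> p" using pl by (rule lipschitz_on_continuous_on)
  have p0l: "L-lipschitz_on \<Omega> p0"
    using pl by (auto simp: lipschitz_on_def p0_def)
  obtain P where P: "P \<in> borel_measurable borel" "\<And>x. norm (P x) \<le> real DIM('a) * L" "weak_gradient \<Omega> p P"
    using lipschitz_weak_gradient[OF \<Omega> pl] by blast
  interpret plap_setting \<Omega> p0 u0 D P L "real DIM('a) * L"
  proof
    show "u0 \<in> borel_measurable borel" "p0 \<in> borel_measurable borel"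
      unfolding u0_def p0_def using \<Omega>(1) C1_gradD(3)[OF uD] pc
      by (intro borel_measurable_continuous_on_indicator; simp)+
  qed (use \<Omega> u0D p0l P p1 in \<open>auto simp: D_def p0_def\<close>)
  define U where "U = {x \<in> \<Omega>. u x \<noteq> 0}"
  have U: "open U" "U \<subseteq> \<Omega>"
  proof -
    have "open (\<Omega> \<inter> u -` (- {0}))" by (rule continuous_open_preimage[OF C1_gradD(3)[OF uD] \<Omega>(1)]) auto
    moreover have "U = \<Omega> \<inter> u -` (- {0})" by (auto simp: U_def)
    ultimately show "open U" by simp
  qed (auto simp: U_def)
  have gP: "weak_gradient \<Omega> u D" by (rule C1_weak_gradient[OF \<Omega>(1) uD])
  have "C1_grad \<Omega> (\<lambda>x. - 1 * u x) (\<lambda>x. - 1 *\<^sub>R D x)" by (rule C1_grad_cmult[OF uD])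
  then have gM: "weak_gradient \<Omega> (\<lambda>x. - u x) (\<lambda>x. - D x)" using C1_weak_gradient[OF \<Omega>(1)] by simp
  obtain Du1 Dp1 where s1: "weak_gradient U u Du1" "weak_gradient U p Dp1"
    "\<And>\<phi> D\<phi>. W1var_grad p U \<phi> D\<phi> \<Longrightarrow> (\<And>x. x \<in> U \<Longrightarrow> 0 \<le> \<phi> x) \<Longrightarrow> compact_support_in U \<phi> \<Longrightarrow>
       0 \<le> (LINT x:U|lebesgue. strong_plap_integrand p Dp1 Du1 \<phi> D\<phi> x)"
    using sol unfolding weak_solution_def weak_supersolution_def U_def[symmetric] by blast
  obtain Du2 Dp2 where s2: "weak_gradient U (\<lambda>x. - u x) Du2" "weak_gradient U p Dp2"
    "\<And>\<phi> D\<phi>. W1var_grad p U \<phi> D\<phi> \<Longrightarrow> (\<And>x. x \<in> U \<Longrightarrow> 0 \<le> \<phi> x) \<Longrightarrow> compact_support_in U \<phi> \<Longrightarrow>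
       0 \<le> (LINT x:U|lebesgue. strong_plap_integrand p Dp2 Du2 \<phi> D\<phi> x)"
    using sol unfolding weak_solution_def weak_subsolution_def weak_supersolution_def U_def[symmetric] by blast
  \<comment> \<open>The hypothesis only asserts that some weak gradients exist on \<open>U\<close>,
    possibly different for the two inequalities. Uniqueness identifies them almost everywhere with
    \<open>D\<close> or its negative, and with \<open>P\<close>.\<close>
  note ae1 = weak_gradient_unique[OF U(1,2) s1(1) gP refl] weak_gradient_unique[OF U(1,2) s1(2) P(3) refl]
  note ae2 = weak_gradient_unique[OF U(1,2) s2(1) gM refl] weak_gradient_unique[OF U(1,2) s2(2) P(3) refl]
  \<comment> \<open>The supersolution and subsolution inequalities together give equality, for
    nonnegative test functions.\<close>
  have pos: "wform \<phi> D\<phi> = 0" if \<phi>: "C1_supp S \<phi> D\<phi>" and S: "S \<subseteq> U" and nn: "\<And>x. 0 \<le> \<phi> x" for S \<phi> D\<phi>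
  proof -
    note F = C1_suppD[OF \<phi>]
    have S\<Omega>: "S \<subseteq> \<Omega>" using S U by auto
    have W: "W1var_grad p U \<phi> D\<phi>"
      by (rule C1_supp_W1var_grad[OF U(1) \<phi> S]) (use pc U(2) p1 continuous_on_subset in \<open>auto intro: less_imp_le less_trans[OF zero_less_one]\<close>)
    have c: "compact_support_in U \<phi>" by (rule compact_support_in_subset[OF F(1) S F(5)])
    define g where "g x = flux x \<bullet> D\<phi> x + drift x * \<phi> x" for x
    have gi: "integrable lborel g" unfolding g_def by (rule wform_integrable(3)[OF \<phi> S\<Omega>])
    have gz: "g x = 0" if "x \<notin> U" for x 
    proof -
      have "x \<notin> S" using S that by auto
      then show ?thesis using F(5,6) by (simp add: g_def)
    qed
    have pp: "p x = p0 x" if "x \<in> U" for x using that U(2) by (auto simp: p0_def)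
    have "AE x in lebesgue. g x = indicator U x * strong_plap_integrand p Dp1 Du1 \<phi> D\<phi> x"
      using ae1
    proof eventually_elim
      case (elim x)
      show ?case
      proof (cases "x \<in> U")
        case True
        have "strong_plap_integrand p Dp1 Du1 \<phi> D\<phi> x = strong_plap_integrand p P D \<phi> D\<phi> x"
          by (rule strong_plap_integrand_cong) (use elim True in auto)
        then show ?thesis using strong_integrand_eq(1)[of p x, OF pp[OF True]] True by (simp add: g_def)
      qed (use gz in auto)
    qed
    from set_integral_AE_lborel(2)[OF gi this] s1(3)[OF W nn c] have 1: "0 \<le> (\<integral>x. g x \<partial>lborel)" by simp
    have gi': "integrable lborel (\<lambda>x. - g x)" using gi by auto
    have "AE x in lebesgue. - g x = indicator U x * strong_plap_integrand p Dp2 Du2 \<phi> D\<phi> x"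
      using ae2
    proof eventually_elim
      case (elim x)
      show ?case
      proof (cases "x \<in> U")
        case True
        have "strong_plap_integrand p Dp2 Du2 \<phi> D\<phi> x = strong_plap_integrand p P (\<lambda>x. - D x) \<phi> D\<phi> x"
          by (rule strong_plap_integrand_cong) (use elim True in auto)
        then show ?thesis using strong_integrand_eq(2)[of p x, OF pp[OF True]] True by (simp add: g_def)
      qed (use gz in auto)
    qed
    from set_integral_AE_lborel(2)[OF gi' this] s2(3)[OF W nn c] have 2: "0 \<le> - (\<integral>x. g x \<partial>lborel)" by simp
    from 1 2 show ?thesis by (simp add: wform_def g_def)
  qed
  \<comment> \<open>A test function of either sign is the difference of the nonnegative functions
    \<open>\<phi> x + B * \<zeta> x\<close> and \<open>B * \<zeta> x\<close>, because
    \<open>\<zeta>\<close> is at least 1 on the support of \<open>\<phi>\<close>.\<close>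
  interpret plap_solution \<Omega> p0 u0 D P L "real DIM('a) * L"
  proof
    fix S \<phi> D\<phi> assume \<phi>: "C1_supp S \<phi> D\<phi>" and S0: "S \<subseteq> {x \<in> \<Omega>. u0 x \<noteq> 0}"
    have S: "S \<subseteq> U" using S0 by (auto simp: U_def u0_def)
    note F = C1_suppD[OF \<phi>]
    obtain S1 \<zeta> D\<zeta> where \<zeta>: "C1_supp S1 \<zeta> D\<zeta>" "S1 \<subseteq> U" "\<And>x. \<zeta> x \<ge> 0" "\<And>x. x \<in> S \<Longrightarrow> \<zeta> x \<ge> 1"
      using C1_cutoff[OF F(1) U(1) S] by blast
    obtain B where B: "B \<ge> 0" "\<And>x. \<bar>\<phi> x\<bar> \<le> B" using C1_supp_bound[OF \<phi>] by metis
    define S2 where "S2 = S \<union> S1"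
    have S2: "compact S2" "S2 \<subseteq> U" "S2 \<subseteq> \<Omega>" using F(1) C1_suppD(1)[OF \<zeta>(1)] S \<zeta>(2) U(2) by (auto simp: S2_def)
    have \<phi>2: "C1_supp S2 \<phi> D\<phi>" by (rule C1_supp_restrict[OF \<phi> S2(1)]) (use F(5) in \<open>auto simp: S2_def\<close>)
    have \<zeta>2: "C1_supp S2 (\<lambda>x. B * \<zeta> x) (\<lambda>x. B *\<^sub>R D\<zeta> x)"
      by (rule C1_supp_restrict[OF C1_supp_cmult[OF \<zeta>(1)] S2(1)]) (use C1_suppD(5)[OF \<zeta>(1)] in \<open>auto simp: S2_def\<close>)
    have n1: "0 \<le> B * \<zeta> x" for x using B(1) \<zeta>(3) by simp
    have n2: "0 \<le> \<phi> x + B * \<zeta> x" for x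
    proof (cases "x \<in> S")
      case True
      have "B * 1 \<le> B * \<zeta> x" using \<zeta>(4)[OF True] B(1) by (intro mult_left_mono) auto
      then show ?thesis using B(2)[of x] by linarith
    qed (use F(5) n1 in auto)
    have "wform (\<lambda>x. \<phi> x + B * \<zeta> x) (\<lambda>x. D\<phi> x + B *\<^sub>R D\<zeta> x) = 0" by (rule pos[OF C1_supp_add[OF \<phi>2 \<zeta>2] S2(2) n2])
    moreover have "wform (\<lambda>x. B * \<zeta> x) (\<lambda>x. B *\<^sub>R D\<zeta> x) = 0" by (rule pos[OF \<zeta>2 S2(2) n1])
    ultimately show "wform \<phi> D\<phi> = 0" using wform_add[OF \<phi>2 \<zeta>2 S2(3)] by simp
  qed
  have full: "set_integrable lebesgue \<Omega> (strong_plap_integrand p P D \<phi> D\<phi>) \<and> 0 \<le> (LINT x:\<Omega>|lebesgue. strong_plap_integrand p P D \<phi> D\<phi> x)"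
    if \<phi>: "W1var_grad p \<Omega> \<phi> D\<phi>" and c: "compact_support_in \<Omega> \<phi>" for \<phi> D\<phi>
  proof -
    define S where "S = closure {x \<in> \<Omega>. \<phi> x \<noteq> 0}"
    have S: "compact S" "S \<subseteq> \<Omega>" using c by (auto simp: S_def compact_support_in_def)
    have z: "\<phi> x = 0" if "x \<in> \<Omega>" "x \<notin> S" for x
      using that closure_subset[of "{x \<in> \<Omega>. \<phi> x \<noteq> 0}"] by (auto simp: S_def)
    have wg: "weak_gradient \<Omega> \<phi> D\<phi>" using \<phi> by (simp add: W1var_grad_def)
    obtain S' \<phi>' G' where A: "compact S'" "S' \<subseteq> \<Omega>" "integrable lborel \<phi>'" "\<And>i. i \<in> Basis \<Longrightarrow> integrable lborel (\<lambda>x. G' x \<bullet> i)"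
      "AE x in lebesgue. \<phi>' x = indicator \<Omega> x * \<phi> x" "AE x in lebesgue. G' x = indicator \<Omega> x *\<^sub>R D\<phi> x"
      "\<And>x. x \<notin> S' \<Longrightarrow> \<phi>' x = 0"  "\<And>x. x \<notin> S' \<Longrightarrow> G' x = 0"
      "\<And>e. e > 0 \<Longrightarrow> \<exists>\<psi> D\<psi>. C1_supp S' \<psi> D\<psi> \<and> (\<integral>x. \<bar>\<psi> x - \<phi>' x\<bar> \<partial>lborel) < e \<and>
       (\<forall>i\<in>Basis. (\<integral>x. \<bar>D\<psi> x \<bullet> i - G' x \<bullet> i\<bar> \<partial>lborel) < e)"
      by (rule weak_gradient_approx[OF \<Omega>(1) wg S], erule (1) z) (rule that; (assumption | blast))
    obtain C where C: "C \<ge> 0" "\<And>x. x \<in> S' \<Longrightarrow> norm (flux x) \<le> C" "\<And>x. x \<in> S' \<Longrightarrow> \<bar>drift x\<bar> \<le> C"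
      using flux_drift_bounded[OF A(1,2)] by blast
    have S'b: "S' \<in> sets borel" using A(1) by (simp add: borel_compact)
    have mul: "integrable lborel (\<lambda>x. a x * h x)" "\<bar>\<integral>x. a x * h x \<partial>lborel\<bar> \<le> C * (\<integral>x. \<bar>h x\<bar> \<partial>lborel)"
      if a: "a \<in> borel_measurable borel" "\<And>x. x \<in> S' \<Longrightarrow> \<bar>a x\<bar> \<le> C" and h: "integrable lborel h" "\<And>x. x \<notin> S' \<Longrightarrow> h x = 0" for a h :: "'a \<Rightarrow> real"
    proof -
      have pw: "\<bar>a x * h x\<bar> \<le> C * \<bar>h x\<bar>" for x
        using mult_right_mono[OF a(2)[of x], of "\<bar>h x\<bar>"] h(2)[of x] by (cases "x \<in> S'") (auto simp: abs_mult)
      show I: "integrable lborel (\<lambda>x. a x * h x)"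
      proof (rule Bochner_Integration.integrable_bound)
        show "integrable lborel (\<lambda>x. C * h x)" using h by auto
        show "AE x in lborel. norm (a x * h x) \<le> norm (C * h x)"
          using pw C(1) by (intro AE_I2) (simp add: abs_mult)
      qed (use a h in auto)
      have "\<bar>\<integral>x. a x * h x \<partial>lborel\<bar> \<le> (\<integral>x. \<bar>a x * h x\<bar> \<partial>lborel)" by (rule integral_abs_bound)
      also have "\<dots> \<le> (\<integral>x. C * \<bar>h x\<bar> \<partial>lborel)" by (rule integral_mono) (use I h pw in auto)
      finally show "\<bar>\<integral>x. a x * h x \<partial>lborel\<bar> \<le> C * (\<integral>x. \<bar>h x\<bar> \<partial>lborel)" by simp
    qed
    have fi: "(\<lambda>x. flux x \<bullet> i) \<in> borel_measurable borel" for i using flux_borel by auto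
    have fb: "\<bar>flux x \<bullet> i\<bar> \<le> C" if "x \<in> S'" "i \<in> Basis" for x i
      using Basis_le_norm[OF that(2), of "flux x"] C(2)[OF that(1)] by linarith
    define g where "g x = flux x \<bullet> G' x + drift x * \<phi>' x" for x
    have gs: "g x = (\<Sum>i\<in>Basis. (flux x \<bullet> i) * (G' x \<bullet> i)) + drift x * \<phi>' x" for x
      unfolding g_def by (subst euclidean_inner) (rule refl)
    have i1: "integrable lborel (\<lambda>x. (flux x \<bullet> i) * (G' x \<bullet> i))" if "i \<in> Basis" for i
    proof (rule mul(1)[OF fi _ A(4)[OF that]])
      show "\<bar>flux x \<bullet> i\<bar> \<le> C" if "x \<in> S'" for x by (rule fb[OF that \<open>i \<in> Basis\<close>])
      show "G' x \<bullet> i = 0" if "x \<notin> S'" for x using A(8)[OF that] by simp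
    qed
    have i2: "integrable lborel (\<lambda>x. drift x * \<phi>' x)"
      by (rule mul(1)[OF drift_borel C(3) A(3,7)])
    have gi: "integrable lborel g"
      unfolding gs using i1 i2 by auto
    have ae: "AE x in lebesgue. g x = indicator \<Omega> x * strong_plap_integrand p P D \<phi> D\<phi> x"
      using A(5,6)
    proof eventually_elim
      case (elim x)
      show ?case
      proof (cases "x \<in> \<Omega>")
        case True
        have "p x = p0 x" using True by (simp add: p0_def)
        from strong_integrand_eq(1)[of p x \<phi> D\<phi>, OF this] show ?thesis using elim True by (simp add: g_def)
      qed (use elim in \<open>simp add: g_def\<close>)
    qed
    \<comment> \<open>The approximant has weak form 0, so only the errors remain: one for each
      component of the gradient and one for the function itself, each at most
      \<open>C * e\<close>.\<close>
    have "\<bar>\<integral>x. g x \<partial>lborel\<bar> \<le> C * (real DIM('a) + 1) * e" if e: "e > 0" for e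
    proof -
      obtain \<psi> D\<psi> where \<psi>: "C1_supp S' \<psi> D\<psi>" "(\<integral>x. \<bar>\<psi> x - \<phi>' x\<bar> \<partial>lborel) < e"
        "\<And>i. i \<in> Basis \<Longrightarrow> (\<integral>x. \<bar>D\<psi> x \<bullet> i - G' x \<bullet> i\<bar> \<partial>lborel) < e" using A(9)[OF e] by blast
      note Q = C1_suppD[OF \<psi>(1)]
      have \<psi>i: "integrable lborel \<psi>" by (rule integrable_continuous_compact_supp[OF Q(4,1,5)])
      have D\<psi>i: "integrable lborel (\<lambda>x. D\<psi> x \<bullet> i)" for i
        by (rule integrable_continuous_compact_supp[OF _ Q(1)]) (use Q(3,6) in \<open>auto intro!: continuous_intros\<close>)
      have w0: "(\<integral>x. flux x \<bullet> D\<psi> x + drift x * \<psi> x \<partial>lborel) = 0" using wform_eq_0[OF \<psi>(1) A(2)] by (simp add: wform_def)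
      have h1: "integrable lborel (\<lambda>x. (flux x \<bullet> i) * (D\<psi> x \<bullet> i - G' x \<bullet> i))"
        "\<bar>\<integral>x. (flux x \<bullet> i) * (D\<psi> x \<bullet> i - G' x \<bullet> i) \<partial>lborel\<bar> \<le> C * e" if i: "i \<in> Basis" for i
      proof -
        have d: "integrable lborel (\<lambda>x. D\<psi> x \<bullet> i - G' x \<bullet> i)" using D\<psi>i A(4)[OF i] by auto
        have dz: "D\<psi> x \<bullet> i - G' x \<bullet> i = 0" if "x \<notin> S'" for x using Q(6)[OF that] A(8)[OF that] by simp
        note m = mul[OF fi[of i] fb[OF _ i] d dz]
        show "integrable lborel (\<lambda>x. (flux x \<bullet> i) * (D\<psi> x \<bullet> i - G' x \<bullet> i))" by (rule m(1))
        show "\<bar>\<integral>x. (flux x \<bullet> i) * (D\<psi> x \<bullet> i - G' x \<bullet> i) \<partial>lborel\<bar> \<le> C * e"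
          using m(2) mult_left_mono[OF less_imp_le[OF \<psi>(3)[OF i]] C(1)] by linarith
      qed
      have d2: "integrable lborel (\<lambda>x. \<psi> x - \<phi>' x)" using \<psi>i A(3) by auto
      have d2z: "\<psi> x - \<phi>' x = 0" if "x \<notin> S'" for x using Q(5)[OF that] A(7)[OF that] by simp
      note m2 = mul[OF drift_borel C(3) d2 d2z]
      have h2: "\<bar>\<integral>x. drift x * (\<psi> x - \<phi>' x) \<partial>lborel\<bar> \<le> C * e"
        using m2(2) mult_left_mono[OF less_imp_le[OF \<psi>(2)] C(1)] by linarith
      have "(\<integral>x. g x \<partial>lborel) = (\<integral>x. g x \<partial>lborel) - (\<integral>x. flux x \<bullet> D\<psi> x + drift x * \<psi> x \<partial>lborel)" using w0 by simp
      also have "\<dots> = (\<integral>x. g x - (flux x \<bullet> D\<psi> x + drift x * \<psi> x) \<partial>lborel)"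
        by (rule Bochner_Integration.integral_diff[symmetric, OF gi wform_integrable(3)[OF \<psi>(1) A(2)]])
      also have "\<dots> = (\<integral>x. - ((\<Sum>i\<in>Basis. (flux x \<bullet> i) * (D\<psi> x \<bullet> i - G' x \<bullet> i)) + drift x * (\<psi> x - \<phi>' x)) \<partial>lborel)"
      proof (rule Bochner_Integration.integral_cong[OF refl])
        fix x
        have "flux x \<bullet> D\<psi> x = (\<Sum>i\<in>Basis. (flux x \<bullet> i) * (D\<psi> x \<bullet> i))" by (rule euclidean_inner)
        then show "g x - (flux x \<bullet> D\<psi> x + drift x * \<psi> x) = - ((\<Sum>i\<in>Basis. (flux x \<bullet> i) * (D\<psi> x \<bullet> i - G' x \<bullet> i)) + drift x * (\<psi> x - \<phi>' x))"
          unfolding gs by (simp add: right_diff_distrib sum_subtractf)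
      qed
      also have "\<dots> = - ((\<Sum>i\<in>Basis. \<integral>x. (flux x \<bullet> i) * (D\<psi> x \<bullet> i - G' x \<bullet> i) \<partial>lborel) + (\<integral>x. drift x * (\<psi> x - \<phi>' x) \<partial>lborel))"
      proof -
        have "integrable lborel (\<lambda>x. \<Sum>i\<in>Basis. (flux x \<bullet> i) * (D\<psi> x \<bullet> i - G' x \<bullet> i))" using h1(1) by (rule Bochner_Integration.integrable_sum)
        moreover have "(\<integral>x. (\<Sum>i\<in>Basis. (flux x \<bullet> i) * (D\<psi> x \<bullet> i - G' x \<bullet> i)) \<partial>lborel) = (\<Sum>i\<in>Basis. \<integral>x. (flux x \<bullet> i) * (D\<psi> x \<bullet> i - G' x \<bullet> i) \<partial>lborel)"
          by (rule Bochner_Integration.integral_sum) (rule h1(1))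
        ultimately show ?thesis using m2(1) by simp
      qed
      finally have eqg: "(\<integral>x. g x \<partial>lborel) = - ((\<Sum>i\<in>Basis. \<integral>x. (flux x \<bullet> i) * (D\<psi> x \<bullet> i - G' x \<bullet> i) \<partial>lborel) + (\<integral>x. drift x * (\<psi> x - \<phi>' x) \<partial>lborel))" .
      have "\<bar>\<Sum>i\<in>Basis. \<integral>x. (flux x \<bullet> i) * (D\<psi> x \<bullet> i - G' x \<bullet> i) \<partial>lborel\<bar> \<le> (\<Sum>i\<in>(Basis::'a set). C * e)"
        by (rule order_trans[OF sum_abs sum_mono]) (rule h1(2))
      then have "\<bar>\<Sum>i\<in>Basis. \<integral>x. (flux x \<bullet> i) * (D\<psi> x \<bullet> i - G' x \<bullet> i) \<partial>lborel\<bar> \<le> real DIM('a) * (C * e)" by simp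
      then have "\<bar>\<integral>x. g x \<partial>lborel\<bar> \<le> real DIM('a) * (C * e) + C * e" unfolding eqg using h2 by linarith
      then show ?thesis by (simp add: algebra_simps)
    qed
    moreover define R where "R = C * (real DIM('a) + 1) + 1"
    ultimately have le: "\<bar>\<integral>x. g x \<partial>lborel\<bar> \<le> R * e" if "e > 0" for e
      using that by (smt (verit) mult_right_mono)
    have R: "R > 0" using C(1) by (auto simp: R_def intro: add_nonneg_pos)
    have "\<bar>\<integral>x. g x \<partial>lborel\<bar> \<le> 0"
    proof (rule field_le_epsilon)
      fix e :: real assume "e > 0"
      then show "\<bar>\<integral>x. g x \<partial>lborel\<bar> \<le> 0 + e" using le[of "e / R"] R by simp
    qed
    then show ?thesis using set_integral_AE_lborel[OF gi ae] by simp
  qed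
  have "W1var_loc p \<Omega> u"
    by (rule C1_W1var_loc[OF \<Omega>(1) uD pc]) (use p1 in \<open>auto intro: less_imp_le less_trans[OF zero_less_one]\<close>)
  then show ?thesis
    unfolding weak_supersolution_def using gP P(3) full by blast
qed

theorem theorem6p3:
  fixes \<Omega> :: "'a::euclidean_space set"
    and p u :: "'a \<Rightarrow> real"
  assumes "open \<Omega>" and "bounded \<Omega>"
    and "\<forall>x\<in>\<Omega>. 1 < p x"
    and "\<exists>L. L-lipschitz_on \<Omega> p"
    and "1 < ess_inf (lebesgue_on \<Omega>) p"
    and "C1_on \<Omega> u"
    and "weak_solution p {x\<in>\<Omega>. u x \<noteq> 0} u"
  shows "weak_solution p \<Omega> u"
proof -
  obtain L where L: "L-lipschitz_on \<Omega> p" using assms(4) by blast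
  obtain Df where Df: "\<forall>x\<in>\<Omega>. has_gradient u (Df x) x" "continuous_on \<Omega> Df"
    using assms(6) unfolding C1_on_def by blast
  \<comment> \<open>Being a solution is invariant under changing the sign of \<open>u\<close>, and
    so is the zero set; the subsolution half is therefore the same lemma for the negative of
    \<open>u\<close>.\<close>
  have "C1_on \<Omega> (\<lambda>x. - u x)" unfolding C1_on_def
  proof (intro exI[of _ "\<lambda>x. - Df x"] conjI ballI)
    fix x assume "x \<in> \<Omega>"
    then show "has_gradient (\<lambda>x. - u x) (- Df x) x" using has_derivative_minus[of u "\<lambda>h. Df x \<bullet> h" "at x"] Df(1) by simp
  qed (use Df(2) in \<open>auto intro: continuous_intros\<close>)
  moreover have "weak_solution p {x\<in>\<Omega>. - u x \<noteq> 0} (\<lambda>x. - u x)"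
    using assms(7) by (simp add: weak_solution_def weak_subsolution_def)
  ultimately have "weak_supersolution p \<Omega> (\<lambda>x. - u x)"
    by (rule weak_supersolution_across_level_set[OF assms(1-3) L])
  then show ?thesis
    using weak_supersolution_across_level_set[OF assms(1-3) L assms(6,7)]
    by (simp add: weak_solution_def weak_subsolution_def)
qed

end
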